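(* Let $X$ be a real algebraic variety of dimension $n$ and let $D$ be a real very ample divisor of $X$. Then there exist $c>0$ and $m_0\in\mathbf{N}$ such that, for any integer $m\geq m_0$, there exists $Z\in|mD|$ with $b_i\left(Z(\mathbf{R})\right)\geq c\,m^{n}$ for every $i\in\{0,\dots,n-1\}$.
   Context: A real algebraic variety $X$ is an algebraic variety defined over $\mathbf{R}$; it is assumed throughout that $X$ is smooth and projective and that its real locus $X(\mathbf{R})$ is non-empty. $X(\mathbf{R})$ and $X(\mathbf{C})$ denote the real and complex loci. For a real divisor $D$ and $m>0$, the linear system $|mD|$ is the set of real effective divisors (real algebraic hypersurfaces of $X$) linearly equivalent to $mD$; $Z(\mathbf{R})$ is the real locus of $Z\in|mD|$. $b_i(\cdot)$ denotes the $i$-th Betti number with $\mathbf{Z}/2$ coefficients, i.e. $b_i(S)=\dim_{\mathbf{Z}/2} H_i(S;\mathbf{Z}/2)$. *)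

theory Defs
  imports "HOL-Homology.Homology" "HOL-Library.Poly_Mapping" "HOL-Library.Z2" "HOL-Library.Function_Algebras"
begin

section \<open>Complex projective space\<close>

text \<open>A point of projective space is the set of all its homogeneous coordinate vectors.
  All spaces \<open>P\<^sup>N\<close> live in one type, since a very ample divisor embeds \<open>X\<close> into a projective
  space whose dimension is existentially quantified.\<close>

type_synonym point = "(nat \<Rightarrow> complex) set"

definition coord_vectors :: "nat \<Rightarrow> (nat \<Rightarrow> complex) set" where
  "coord_vectors N = {x. (\<forall>i>N. x i = 0) \<and> (\<exists>i. x i \<noteq> 0)}"

definition proj_point :: "(nat \<Rightarrow> complex) \<Rightarrow> point" where
  "proj_point x = {\<lambda>i. t * x i |t. t \<noteq> 0}"

definition proj_space :: "nat \<Rightarrow> point set" where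
  "proj_space N = proj_point ` coord_vectors N"

text \<open>The quotient topology: since points are sets of coordinate vectors, the preimage of \<open>U\<close>
  in the space of nonzero vectors is \<open>\<Union>U\<close>.\<close>

definition proj_topology :: "nat \<Rightarrow> point topology" where
  "proj_topology N =
    topology (\<lambda>U. U \<subseteq> proj_space N \<and> openin (top_of_set (coord_vectors N)) (\<Union>U))"

lemma proj_point_eqI:
  assumes "y \<in> proj_point x"
  shows "proj_point y = proj_point x"
proof -
  obtain t where t: "t \<noteq> 0" and y: "y = (\<lambda>i. t * x i)"
    using assms by (auto simp: proj_point_def)
  show ?thesis
  proof (intro equalityI subsetI)
    fix z assume "z \<in> proj_point y"
    then obtain s where "s \<noteq> 0" "z = (\<lambda>i. s * y i)" by (auto simp: proj_point_def)
    then show "z \<in> proj_point x"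
      unfolding proj_point_def y using t by (auto intro!: exI[of _ "s * t"])
  next
    fix z assume "z \<in> proj_point x"
    then obtain s where "s \<noteq> 0" "z = (\<lambda>i. s * x i)" by (auto simp: proj_point_def)
    then show "z \<in> proj_point y"
      unfolding proj_point_def y using t by (auto intro!: exI[of _ "s / t"])
  qed
qed

lemma openin_proj_topology:
  "openin (proj_topology N) U \<longleftrightarrow>
    U \<subseteq> proj_space N \<and> openin (top_of_set (coord_vectors N)) (\<Union>U)"
proof -
  have disj: "P = Q" if "P \<in> proj_space N" "Q \<in> proj_space N" "x \<in> P" "x \<in> Q" for P Q x
    using that proj_point_eqI unfolding proj_space_def by blast
  have "istopology (\<lambda>U. U \<subseteq> proj_space N \<and> openin (top_of_set (coord_vectors N)) (\<Union>U))"
    unfolding istopology_def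
  proof (intro conjI allI impI)
    fix S T
    assume S: "S \<subseteq> proj_space N \<and> openin (top_of_set (coord_vectors N)) (\<Union>S)"
      and T: "T \<subseteq> proj_space N \<and> openin (top_of_set (coord_vectors N)) (\<Union>T)"
    have "\<Union>(S \<inter> T) = \<Union>S \<inter> \<Union>T"
      using S T disj by blast
    then show "openin (top_of_set (coord_vectors N)) (\<Union>(S \<inter> T))"
      using S T by (simp add: openin_Int)
    show "S \<inter> T \<subseteq> proj_space N" using S by blast
  next
    fix K
    assume K: "\<forall>S\<in>K. S \<subseteq> proj_space N \<and> openin (top_of_set (coord_vectors N)) (\<Union>S)"
    have eq: "\<Union>(\<Union>K) = \<Union>((\<lambda>S. \<Union>S) ` K)" by blast
    show "openin (top_of_set (coord_vectors N)) (\<Union>(\<Union>K))"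
      unfolding eq using K by (intro openin_Union) blast
    show "\<Union>K \<subseteq> proj_space N" using K by blast
  qed
  then show ?thesis
    by (simp add: proj_topology_def topology_inverse')
qed

section \<open>Polynomials with real coefficients\<close>

type_synonym rpoly = "(nat \<Rightarrow>\<^sub>0 nat) \<Rightarrow>\<^sub>0 real"

definition peval :: "rpoly \<Rightarrow> (nat \<Rightarrow> complex) \<Rightarrow> complex" where
  "peval F x = (\<Sum>m\<in>Poly_Mapping.keys F. complex_of_real (Poly_Mapping.lookup F m) *
     (\<Prod>i\<in>Poly_Mapping.keys m. x i ^ Poly_Mapping.lookup m i))"

definition pdiff :: "nat \<Rightarrow> rpoly \<Rightarrow> rpoly" where
  "pdiff i F = (\<Sum>m\<in>Poly_Mapping.keys F. Poly_Mapping.single (m - Poly_Mapping.single i 1)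
     (real (Poly_Mapping.lookup m i) * Poly_Mapping.lookup F m))"

definition forms :: "nat \<Rightarrow> nat \<Rightarrow> rpoly set" where
  "forms N d = {F. \<forall>m\<in>Poly_Mapping.keys F. Poly_Mapping.keys m \<subseteq> {..N} \<and>
     (\<Sum>i\<in>Poly_Mapping.keys m. Poly_Mapping.lookup m i) = d}"

definition vanishes_at :: "rpoly \<Rightarrow> point \<Rightarrow> bool" where
  "vanishes_at F P \<longleftrightarrow> (\<forall>x\<in>P. peval F x = 0)"

definition vanishes_on :: "rpoly \<Rightarrow> point set \<Rightarrow> bool" where
  "vanishes_on F X \<longleftrightarrow> (\<forall>P\<in>X. vanishes_at F P)"

section \<open>Real projective varieties\<close>

text \<open>A reduced closed subscheme of projective space over the reals is represented by its set of
  complex points, which is the zero set of real forms.\<close>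

definition real_closed :: "nat \<Rightarrow> point set \<Rightarrow> bool" where
  "real_closed N X \<longleftrightarrow>
    (\<exists>S \<subseteq> (\<Union>d. forms N d). X = {P \<in> proj_space N. \<forall>F\<in>S. vanishes_at F P})"

definition real_irreducible :: "nat \<Rightarrow> point set \<Rightarrow> bool" where
  "real_irreducible N X \<longleftrightarrow> real_closed N X \<and> X \<noteq> {} \<and>
    (\<forall>A B. real_closed N A \<and> real_closed N B \<and> X = A \<union> B \<longrightarrow> X = A \<or> X = B)"

text \<open>Krull dimension.\<close>

definition variety_dim :: "nat \<Rightarrow> point set \<Rightarrow> nat" where
  "variety_dim N X = (GREATEST k. \<exists>W :: nat \<Rightarrow> point set.
     (\<forall>i\<le>k. real_irreducible N (W i) \<and> W i \<subseteq> X) \<and> (\<forall>i<k. W i \<subset> W (Suc i)))"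

global_interpretation cvec: vector_space "\<lambda>(a::complex) (v::nat \<Rightarrow> complex) i. a * v i"
  by unfold_locales (auto simp: fun_eq_iff plus_fun_def algebra_simps)

text \<open>The Jacobian criterion: the Jacobian matrix of the homogeneous ideal of \<open>X\<close> has rank
  \<open>N - dim X\<close> at every complex point.\<close>

definition smooth :: "nat \<Rightarrow> point set \<Rightarrow> bool" where
  "smooth N X \<longleftrightarrow> (\<forall>P\<in>X. \<forall>x\<in>P.
     cvec.dim {\<lambda>i. peval (pdiff i F) x |F. F \<in> (\<Union>d. forms N d) \<and> vanishes_on F X}
       = N - variety_dim N X)"

definition real_locus :: "point set \<Rightarrow> point set" where
  "real_locus X = {P \<in> X. \<exists>x\<in>P. \<forall>i. x i \<in> \<real>}"

definition real_variety :: "nat \<Rightarrow> point set \<Rightarrow> bool" where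
  "real_variety N X \<longleftrightarrow> real_irreducible N X \<and> smooth N X \<and> real_locus X \<noteq> {}"

section \<open>Nonzero rational functions defined over the reals\<close>

text \<open>A pair \<open>(F, G)\<close> stands for the rational function \<open>F / G\<close>; \<open>rat_eq\<close> is equality in the
  function field.\<close>

type_synonym ratfun = "rpoly \<times> rpoly"

definition nonzero_rat :: "nat \<Rightarrow> point set \<Rightarrow> ratfun \<Rightarrow> bool" where
  "nonzero_rat N X f \<longleftrightarrow> (\<exists>d. fst f \<in> forms N d \<and> snd f \<in> forms N d) \<and>
     \<not> vanishes_on (fst f) X \<and> \<not> vanishes_on (snd f) X"

definition rat_eq :: "point set \<Rightarrow> ratfun \<Rightarrow> ratfun \<Rightarrow> bool" where
  "rat_eq X f g \<longleftrightarrow> vanishes_on (fst f * snd g - fst g * snd f) X"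

definition rat_mult :: "ratfun \<Rightarrow> ratfun \<Rightarrow> ratfun" where
  "rat_mult f g = (fst f * fst g, snd f * snd g)"

definition rat_div :: "ratfun \<Rightarrow> ratfun \<Rightarrow> ratfun" where
  "rat_div f g = (fst f * snd g, snd f * fst g)"

definition rat_power :: "ratfun \<Rightarrow> nat \<Rightarrow> ratfun" where
  "rat_power f m = (fst f ^ m, snd f ^ m)"

definition regular_at :: "nat \<Rightarrow> point set \<Rightarrow> point \<Rightarrow> ratfun \<Rightarrow> bool" where
  "regular_at N X P f \<longleftrightarrow>
    (\<exists>g. nonzero_rat N X g \<and> rat_eq X f g \<and> \<not> vanishes_at (snd g) P)"

definition unit_at :: "nat \<Rightarrow> point set \<Rightarrow> point \<Rightarrow> ratfun \<Rightarrow> bool" where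
  "unit_at N X P f \<longleftrightarrow>
    (\<exists>g. nonzero_rat N X g \<and> rat_eq X f g \<and> \<not> vanishes_at (fst g) P \<and> \<not> vanishes_at (snd g) P)"

section \<open>Real divisors\<close>

text \<open>A real divisor is a Cartier divisor defined over the reals (\<open>X\<close> being smooth, these are the
  same as Weil divisors).  It is given by local equations: \<open>D P\<close> is a rational function
  representing \<open>D\<close> near \<open>P\<close>, and near every \<open>P\<close> the local equations at nearby points agree
  with \<open>D P\<close> up to units.  So \<open>D\<close> is a representative of a global section of \<open>K\<^sup>*/O\<^sup>*\<close>.\<close>

type_synonym divisor = "point \<Rightarrow> ratfun"

definition real_divisor :: "nat \<Rightarrow> point set \<Rightarrow> divisor \<Rightarrow> bool" where
  "real_divisor N X D \<longleftrightarrow> (\<forall>P\<in>X. nonzero_rat N X (D P) \<and>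
     (\<exists>H \<in> (\<Union>d. forms N d). \<not> vanishes_at H P \<and>
       (\<forall>Q\<in>X. \<not> vanishes_at H Q \<longrightarrow> unit_at N X Q (rat_div (D Q) (D P)))))"

definition effective :: "nat \<Rightarrow> point set \<Rightarrow> divisor \<Rightarrow> bool" where
  "effective N X D \<longleftrightarrow> (\<forall>P\<in>X. regular_at N X P (D P))"

definition support :: "nat \<Rightarrow> point set \<Rightarrow> divisor \<Rightarrow> point set" where
  "support N X D = {P \<in> X. \<not> unit_at N X P (D P)}"

definition lin_equiv :: "nat \<Rightarrow> point set \<Rightarrow> divisor \<Rightarrow> divisor \<Rightarrow> bool" where
  "lin_equiv N X D E \<longleftrightarrow> (\<exists>h. nonzero_rat N X h \<and>
     (\<forall>P\<in>X. unit_at N X P (rat_div (D P) (rat_mult h (E P)))))"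

definition multiple :: "nat \<Rightarrow> divisor \<Rightarrow> divisor" where
  "multiple m D = (\<lambda>P. rat_power (D P) m)"

definition linear_system :: "nat \<Rightarrow> point set \<Rightarrow> divisor \<Rightarrow> divisor set" where
  "linear_system N X D = {Z. real_divisor N X Z \<and> effective N X Z \<and> lin_equiv N X Z D}"

section \<open>Very ample divisors\<close>

text \<open>\<open>local_rep N X r \<phi> F\<close>: on the open subset of \<open>X\<close> where some \<open>F j\<close> does not vanish, the
  map \<open>\<phi>\<close> to \<open>P\<^sup>r\<close> is \<open>[F 0 : ... : F r]\<close>.\<close>

definition local_rep :: "nat \<Rightarrow> point set \<Rightarrow> nat \<Rightarrow> (point \<Rightarrow> point) \<Rightarrow> (nat \<Rightarrow> rpoly) \<Rightarrow> bool" where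
  "local_rep N X r \<phi> F \<longleftrightarrow> (\<exists>d. \<forall>j\<le>r. F j \<in> forms N d) \<and>
     (\<forall>P\<in>X. \<forall>x\<in>P. (\<exists>j\<le>r. peval (F j) x \<noteq> 0) \<longrightarrow>
        \<phi> P = proj_point (\<lambda>j. if j \<le> r then peval (F j) x else 0))"

definition real_morphism :: "nat \<Rightarrow> point set \<Rightarrow> nat \<Rightarrow> (point \<Rightarrow> point) \<Rightarrow> bool" where
  "real_morphism N X r \<phi> \<longleftrightarrow>
     (\<forall>P\<in>X. \<exists>F. local_rep N X r \<phi> F \<and> (\<exists>j\<le>r. \<not> vanishes_at (F j) P))"

text \<open>Closed immersions: isomorphisms onto a closed subvariety.\<close>

definition real_embedding :: "nat \<Rightarrow> point set \<Rightarrow> nat \<Rightarrow> (point \<Rightarrow> point) \<Rightarrow> bool" where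
  "real_embedding N X r \<phi> \<longleftrightarrow> real_morphism N X r \<phi> \<and> real_closed r (\<phi> ` X) \<and>
     (\<exists>\<psi>. real_morphism r (\<phi> ` X) N \<psi> \<and> (\<forall>P\<in>X. \<psi> (\<phi> P) = P))"

text \<open>\<open>E\<close> is the pullback along \<open>\<phi>\<close> of the hyperplane \<open>L = 0\<close>, where \<open>L\<close> is a linear form not
  vanishing identically on \<open>\<phi> ` X\<close>: where the coordinate \<open>y\<^sub>j\<close> does not vanish the hyperplane has
  local equation \<open>L / y\<^sub>j\<close>.  The coefficients of \<open>L\<close> are \<open>a\<close>, so its pullback under
  \<open>[F 0 : ... : F r]\<close> is \<open>\<Sum>i\<le>r. a i F i\<close>.\<close>

definition hyperplane_pullback ::
  "nat \<Rightarrow> point set \<Rightarrow> nat \<Rightarrow> (point \<Rightarrow> point) \<Rightarrow> (nat \<Rightarrow> real) \<Rightarrow> divisor \<Rightarrow> bool" where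
  "hyperplane_pullback N X r \<phi> a E \<longleftrightarrow>
     (\<exists>P\<in>X. \<exists>y\<in>\<phi> P. (\<Sum>i\<le>r. complex_of_real (a i) * y i) \<noteq> 0) \<and>
     real_divisor N X E \<and>
     (\<forall>P\<in>X. \<forall>F. \<forall>j\<le>r. local_rep N X r \<phi> F \<and> \<not> vanishes_at (F j) P \<longrightarrow>
        unit_at N X P (rat_div (E P) (\<Sum>i\<le>r. Poly_Mapping.single 0 (a i) * F i, F j)))"

text \<open>\<open>D\<close> is very ample if \<open>O(D)\<close> is the pullback of \<open>O(1)\<close> along a closed immersion.\<close>

definition very_ample :: "nat \<Rightarrow> point set \<Rightarrow> divisor \<Rightarrow> bool" where
  "very_ample N X D \<longleftrightarrow> (\<exists>r \<phi> a E. real_embedding N X r \<phi> \<and>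
     hyperplane_pullback N X r \<phi> a E \<and> lin_equiv N X D E)"

section \<open>Singular homology with coefficients in the field with two elements\<close>

type_synonym 'a chain2 = "((nat \<Rightarrow> real) \<Rightarrow> 'a) \<Rightarrow>\<^sub>0 bit"

definition chains2 :: "nat \<Rightarrow> 'a topology \<Rightarrow> 'a chain2 set" where
  "chains2 p T = {c. Poly_Mapping.keys c \<subseteq> singular_simplex_set p T}"

definition boundary2 :: "nat \<Rightarrow> 'a chain2 \<Rightarrow> 'a chain2" where
  "boundary2 p c = (if p = 0 then 0 else
     (\<Sum>s\<in>Poly_Mapping.keys c. \<Sum>k\<le>p. Poly_Mapping.single (singular_face p k s) 1))"

definition cycles2 :: "nat \<Rightarrow> 'a topology \<Rightarrow> 'a chain2 set" where
  "cycles2 p T = {c \<in> chains2 p T. boundary2 p c = 0}"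

definition boundaries2 :: "nat \<Rightarrow> 'a topology \<Rightarrow> 'a chain2 set" where
  "boundaries2 p T = boundary2 (Suc p) ` chains2 (Suc p) T"

global_interpretation chain2: vector_space "\<lambda>(a::bit) (c::'a \<Rightarrow>\<^sub>0 bit). Poly_Mapping.map ((*) a) c"
proof unfold_locales
  fix a b :: bit and x y :: "'a \<Rightarrow>\<^sub>0 bit"
  have lm: "Poly_Mapping.lookup (Poly_Mapping.map ((*) a) x) k = a * Poly_Mapping.lookup x k"
    for a and x :: "'a \<Rightarrow>\<^sub>0 bit" and k
    by (simp add: Poly_Mapping.map.rep_eq when_def)
  show "Poly_Mapping.map ((*) a) (x + y) = Poly_Mapping.map ((*) a) x + Poly_Mapping.map ((*) a) y"
    by (rule poly_mapping_eqI) (simp only: lm lookup_add distrib_left)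
  show "Poly_Mapping.map ((*) (a + b)) x = Poly_Mapping.map ((*) a) x + Poly_Mapping.map ((*) b) x"
    by (rule poly_mapping_eqI) (simp only: lm lookup_add distrib_right)
  show "Poly_Mapping.map ((*) a) (Poly_Mapping.map ((*) b) x) = Poly_Mapping.map ((*) (a * b)) x"
    by (rule poly_mapping_eqI) (simp only: lm mult.assoc)
  show "Poly_Mapping.map ((*) 1) x = x"
    by (rule poly_mapping_eqI) (simp only: lm mult_1)
qed

text \<open>The classes of \<open>B\<close> (pairwise distinct) form a basis of the quotient space \<open>V / W\<close>.\<close>

definition quotient_basis :: "('a \<Rightarrow>\<^sub>0 bit) set \<Rightarrow> ('a \<Rightarrow>\<^sub>0 bit) set \<Rightarrow> ('a \<Rightarrow>\<^sub>0 bit) set \<Rightarrow> bool" where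
  "quotient_basis V W B \<longleftrightarrow> B \<subseteq> V \<and> V \<subseteq> chain2.span (B \<union> W) \<and>
     (\<forall>b\<in>B. b \<notin> chain2.span ((B - {b}) \<union> W))"

text \<open>As for \<open>dim\<close> in the library, the value is \<open>0\<close> if the homology is infinite-dimensional; this
  does not occur for real algebraic sets.\<close>

definition betti2 :: "nat \<Rightarrow> 'a topology \<Rightarrow> nat" where
  "betti2 p T = card (SOME B. quotient_basis (cycles2 p T) (boundaries2 p T) B)"

end

theory Submission
 imports Defs "HOL-Analysis.Analysis" "Jordan_Normal_Form.Determinant"
begin

text \<open>Replace X by its image Y in P^r under the embedding given by D; forms of degree m on P^r then cut
divisors of |mD|. Over a small cube of dimension n, near a real point q of Y, the real locus of Y
contains two disjoint sheets, each with polynomial coordinates t in [-1,1]^n. Composing each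
coordinate with the Chebyshev polynomial T_k folds the cube k^n times onto itself, so the pull-back
under (T_k(t_0), ..., T_k(t_{n-1})) of a fixed hypersurface inside the open cube consists, in each
sheet, of k^n copies of it, while the degree grows only linearly in k. The fixed hypersurface is
the disjoint union of round spheres of every dimension i < n (a point for i = 0), a sphere of
dimension i < n - 1 being made a zero set by a sum of squares. This gives a form G of degree 16nk on P^r whose real zero set
on Y is exactly the union of the 2k^n copies of each sphere. For general m = 16nk + d one takes
L^d G, where L is a linear form.

The Betti number is a lower bound only if it is finite: betti2 is the cardinality of a basis, hence
0 for an infinite one. Therefore L is chosen by a Bertini argument so that its real zero set on Y is
a compact manifold, which has finite homology, and L does not vanish on the sheets. The real locus
of the divisor is then a finite disjoint union of compact pieces with finite homology, of which
2k^n are spheres of dimension i, and k^n is at least (m / 32n)^n.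

The parts of the argument are: \<open>betti2_ge_pieces\<close> (Betti numbers of disjoint unions),
\<open>locally_Euclidean_finq\<close> (finiteness for compact manifolds), \<open>frame_exists\<close> and
\<open>local_manifold\<close> (the Jacobian criterion makes the real locus a manifold), \<open>linear_system_form\<close>
(forms give divisors of |mD|), \<open>smooth_image\<close> (Y satisfies the Jacobian criterion),
\<open>real_locus_homeomorphic\<close> (a model of the real locus in a vector space),
\<open>exists_regular_section\<close> (the form L) and \<open>sphere_hypersurface\<close> (the form G).\<close>

section \<open>Notation\<close>

type_synonym rvec = "nat => real"
type_synonym cvector = "nat => complex"
abbreviation "lookup == Poly_Mapping.lookup"
abbreviation "keys == Poly_Mapping.keys"
abbreviation "single == Poly_Mapping.single"
abbreviation "subtop == subtopology"
abbreviation "scycle p T == singular_relcycle p T {}"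
lemmas vanishes_defs = vanishes_on_def vanishes_at_def

text \<open>The local analysis takes place in the first N + 1 coordinates of functions on the naturals, so that
one type serves every dimension; these are the open and closed boxes for the maximum norm.\<close>

abbreviation near :: "nat => rvec => real => rvec => bool" where
 "near N x0 r x == ALL i<=N. abs (x i - x0 i) < r"

abbreviation inbox :: "nat => real => rvec => bool" where
 "inbox N R x == ALL i<=N. abs (x i) <= R"

section \<open>Chains modulo 2\<close>

lemma chain2_double [simp]: "c + c = (0::'a \<Rightarrow>\<^sub>0 bit)"
proof (rule poly_mapping_eqI)
 fix k show "lookup (c + c) k = lookup 0 k"
  by (cases "lookup c k") (simp_all add: lookup_add)
qed

lemma chain2_diff: "a - b = a + (b::'a \<Rightarrow>\<^sub>0 bit)"
 by (simp add: diff_eq_eq add.assoc)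

lemma chain2_cancel: "a + (a + b) = (b::'a \<Rightarrow>\<^sub>0 bit)"
 by (simp flip: add.assoc)

lemma chain2_eq_iff: "a + b = 0 \<longleftrightarrow> a = (b::'a \<Rightarrow>\<^sub>0 bit)"
 by (simp flip: chain2_diff)

text \<open>The linear extension of a map given on simplices.\<close>

definition ext2 :: "('a => 'b \<Rightarrow>\<^sub>0 bit) => ('a \<Rightarrow>\<^sub>0 bit) => ('b \<Rightarrow>\<^sub>0 bit)" where
 "ext2 h c = (SUM s:keys c. h s)"

lemma ext2_0 [simp]: "ext2 h 0 = 0"
 by (simp add: ext2_def)

lemma ext2_single [simp]: "ext2 h (single s 1) = h s"
 by (simp add: ext2_def)

lemma ext2_superset:
 assumes "finite S" "keys c <= S"
 shows "ext2 h c = (SUM s:S. if lookup c s = 1 then h s else 0)"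
proof -
 have "(SUM s:S. if lookup c s = 1 then h s else 0)
  = (SUM s:keys c. if lookup c s = 1 then h s else 0)"
  by (rule sum.mono_neutral_right) (use assms in \<open>auto simp: in_keys_iff\<close>)
 also have "... = ext2 h c"
  unfolding ext2_def by (rule sum.cong) (auto simp: in_keys_iff)
 finally show ?thesis by simp
qed

lemma ext2_add: "ext2 h (a + b) = ext2 h a + ext2 h b"
proof -
 let ?S = "keys a Un keys b"
 have S: "finite ?S" by simp
 have "ext2 h (a + b) = (SUM s:?S. if lookup (a + b) s = 1 then h s else 0)"
  by (rule ext2_superset [OF S]) (rule Poly_Mapping.keys_add)
 also have "... = (SUM s:?S. (if lookup a s = 1 then h s else 0)
  + (if lookup b s = 1 then h s else 0))"
 proof (rule sum.cong)
  fix s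
  show "(if lookup (a + b) s = 1 then h s else 0) =
  (if lookup a s = 1 then h s else 0) + (if lookup b s = 1 then h s else 0)"
  by (cases "lookup a s"; cases "lookup b s") (auto simp: lookup_add)
 qed simp
 also have "... = ext2 h a + ext2 h b"
  by (simp add: sum.distrib ext2_superset [OF S, of a] ext2_superset [OF S, of b])
 finally show ?thesis .
qed

lemma ext2_sum: "ext2 h (sum f I) = (SUM i:I. ext2 h (f i))"
 by (induction I rule: infinite_finite_induct) (auto simp: ext2_add)

lemma ext2_cong: "(!!s. s : keys c ==> g s = h s) ==> ext2 g c = ext2 h c"
 by (simp add: ext2_def)

lemma ext2_fun_add: "ext2 (%s. g s + h s) c = ext2 g c + ext2 h c"
 by (simp add: ext2_def sum.distrib)

lemma ext2_of: "ext2 (%s. single s 1) c = c"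
proof (rule poly_mapping_eqI)
 fix k
 have "lookup (ext2 (%s. single s 1) c) k
  = (SUM s:keys c. if s = k then 1 else 0)"
  by (simp add: ext2_def lookup_sum lookup_single when_def)
 also have "... = lookup c k"
  by (auto simp: in_keys_iff)
 finally show "lookup (ext2 (%s. single s 1) c) k = lookup c k" .
qed

lemma keys_ext2: "keys (ext2 h c) <= (UN s:keys c. keys (h s))"
 unfolding ext2_def by (rule Poly_Mapping.keys_sum)

text \<open>Reduction of integral chains modulo 2, the link to the integral homology of the library.\<close>

definition red :: "('a \<Rightarrow>\<^sub>0 int) => ('a \<Rightarrow>\<^sub>0 bit)" where
 "red c = Poly_Mapping.map of_int c"

lemma lookup_red [simp]: "lookup (red c) k = of_int (lookup c k)"
 by (simp add: red_def Poly_Mapping.map.rep_eq when_def)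

lemma red_0 [simp]: "red 0 = 0"
 by (rule poly_mapping_eqI) simp

lemma red_add: "red (a + b) = red a + red b"
 by (rule poly_mapping_eqI) (simp only: lookup_red lookup_add of_int_add)

lemma red_diff: "red (a - b) = red a + red b"
 unfolding chain2_diff [symmetric]
 by (rule poly_mapping_eqI) (simp only: lookup_red lookup_minus of_int_diff)

lemma red_sum: "red (sum f I) = (SUM i:I. red (f i))"
 by (induction I rule: infinite_finite_induct) (auto simp: red_add)

lemma red_cmul: "red (frag_cmul k c) = (if even k then 0 else red c)"
proof (rule poly_mapping_eqI)
 fix s
 have "(of_int k :: bit) = (if even k then 0 else 1)"
  by (metis bit_not_one_iff even_of_int_iff even_zero odd_one bit_not_zero_iff)
 thus "lookup (red (frag_cmul k c)) s = lookup (if even k then 0 else red c) s"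
  by (simp del: mult_bit_eq_and add_bit_eq_xor)
qed

lemma red_frag_of [simp]: "red (frag_of s) = single s 1"
 by (rule poly_mapping_eqI) (simp add: lookup_single when_def)

lemma keys_red: "keys (red c) <= keys c"
 by (auto simp: in_keys_iff)

lemma red_extend: "red (frag_extend h c) = ext2 (%s. red (h s)) (red c)"
proof -
 have "keys c <= UNIV" by simp
 thus ?thesis
  by (induction c rule: frag_induction)
  (auto simp: frag_extend_diff red_diff ext2_add)
qed

lemma red_lift: "EX c'. red c' = c & keys c' = keys c"
proof -
 define c' :: "'a \<Rightarrow>\<^sub>0 int" where "c' = Poly_Mapping.map (%b. if b = 0 then 0 else 1) c"
 have l: "lookup c' k = (if lookup c k = 0 then 0 else 1)" for k
  by (simp add: c'_def Poly_Mapping.map.rep_eq when_def)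
 have "red c' = c"
 proof (rule poly_mapping_eqI)
  fix k show "lookup (red c') k = lookup c k"
  by (cases "lookup c k") (auto simp: l)
 qed
 moreover have "keys c' = keys c"
  by (auto simp: in_keys_iff l split: if_splits)
 ultimately show ?thesis by blast
qed

lemma red_eq_0:
 assumes "red c = 0"
 obtains e where "c = frag_cmul 2 e" "keys e <= keys c"
proof
 define e where "e = Poly_Mapping.map (%z. z div 2) c"
 have l: "lookup e k = lookup c k div 2" for k
  by (simp add: e_def Poly_Mapping.map.rep_eq when_def)
 have ev: "even (lookup c k)" for k
  by (metis assms lookup_red lookup_zero even_of_int_iff even_zero)
 show "c = frag_cmul 2 e"
  by (rule poly_mapping_eqI) (use ev in \<open>simp add: l\<close>)
 show "keys e <= keys c"
  by (auto simp: in_keys_iff l)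
qed

lemma frag_cmul_2_eq_0: "frag_cmul 2 c = 0 ==> c = 0"
proof (rule poly_mapping_eqI)
 fix k assume "frag_cmul 2 c = 0"
 hence "lookup (frag_cmul 2 c) k = 0" by simp
 thus "lookup c k = lookup 0 k" by simp
qed

definition face2 :: "nat => (rvec => 'a) => 'a chain2" where
 "face2 p s = (if p = 0 then 0 else (SUM k<=p. single (singular_face p k s) 1))"

lemma boundary2_ext2: "boundary2 p c = ext2 (face2 p) c"
 by (simp add: boundary2_def ext2_def face2_def)

lemma boundary2_red: "boundary2 p (red c) = red (chain_boundary p c)"
proof (cases "p = 0")
 case True
 thus ?thesis by (simp add: boundary2_def chain_boundary_def)
next
 case False
 have "red (SUM k<=p. frag_cmul ((-1) ^ k) (frag_of (singular_face p k f))) = face2 p f" for f :: "rvec => 'a"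
  unfolding red_sum face2_def using False by (auto simp: red_cmul intro!: sum.cong)
 thus ?thesis using False by (simp add: boundary2_ext2 chain_boundary_def red_extend)
qed

lemma boundary2_add: "boundary2 p (a + b) = boundary2 p a + boundary2 p b"
 by (simp add: boundary2_ext2 ext2_add)

lemma boundary2_0 [simp]: "boundary2 p 0 = 0"
 by (simp add: boundary2_ext2)

lemma chains2_red: "chains2 p T = red ` {c. singular_chain p T c}"
proof (intro equalityI subsetI)
 fix c assume c: "c : chains2 p T"
 obtain c' where c': "red c' = c" "keys c' = keys c" using red_lift by metis
 have "singular_chain p T c'"
  using c unfolding chains2_def singular_chain_def c'(2) by simp
 thus "c : red ` {c. singular_chain p T c}"
  using c'(1) by blast
next
 fix c assume "c : red ` {c. singular_chain p T c}"
 then obtain c' where c': "c = red c'" "singular_chain p T c'" by blast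
 show "c : chains2 p T"
  using keys_red [of c'] c'(2) unfolding chains2_def singular_chain_def c'(1) by simp
qed

lemma chains2_0 [simp]: "0 : chains2 p T"
 by (simp add: chains2_def)

lemma chains2_add: "a : chains2 p T ==> b : chains2 p T ==> a + b : chains2 p T"
 unfolding chains2_def using Poly_Mapping.keys_add [of a b] by blast

lemma chains2E:
 assumes "c : chains2 p T"
 obtains c' where "singular_chain p T c'" "c = red c'"
 using assms unfolding chains2_red by blast

lemma red_chains2: "singular_chain p T c ==> red c : chains2 p T"
 unfolding chains2_red by blast

lemma boundary2_chains2: "c : chains2 p T ==> boundary2 p c : chains2 (p - Suc 0) T"
 by (elim chains2E) (simp add: boundary2_red red_chains2 singular_chain_boundary)

lemma boundary2_boundary2: "c : chains2 (Suc p) T ==> boundary2 p (boundary2 (Suc p) c) = 0"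
 using chain_boundary_boundary [of "Suc p" T] by (elim chains2E) (simp add: boundary2_red)

lemma cycles2_0 [simp]: "0 : cycles2 p T"
 by (simp add: cycles2_def)

lemma cycles2_add: "a : cycles2 p T ==> b : cycles2 p T ==> a + b : cycles2 p T"
 unfolding cycles2_def by (simp add: chains2_add boundary2_add)

lemma boundaries2_0 [simp]: "0 : boundaries2 p T"
 unfolding boundaries2_def by (rule image_eqI [of _ _ 0]) auto

lemma boundaries2_add:
 assumes "a : boundaries2 p T" "b : boundaries2 p T"
 shows "a + b : boundaries2 p T"
proof -
 obtain c d where "c : chains2 (Suc p) T" "a = boundary2 (Suc p) c"
  "d : chains2 (Suc p) T" "b = boundary2 (Suc p) d"
  using assms unfolding boundaries2_def by blast
 thus ?thesis
  unfolding boundaries2_def by (intro image_eqI [of _ _ "c + d"]) (simp_all add: boundary2_add chains2_add)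
qed

lemma boundaries2_sum: "(!!i. i : I ==> f i : boundaries2 p T) ==> sum f I : boundaries2 p T"
 by (induction I rule: infinite_finite_induct) (auto simp: boundaries2_add)

lemma cycles2_sum: "(!!i. i : I ==> f i : cycles2 p T) ==> sum f I : cycles2 p T"
 by (induction I rule: infinite_finite_induct) (auto simp: cycles2_add)

lemma boundaries2_cycles2: "boundaries2 p T <= cycles2 p T"
proof
 fix c assume "c : boundaries2 p T"
 then obtain d where d: "d : chains2 (Suc p) T" "c = boundary2 (Suc p) d"
  unfolding boundaries2_def by blast
 thus "c : cycles2 p T"
  using boundary2_chains2 [OF d(1)] boundary2_boundary2 [OF d(1)] by (simp add: cycles2_def)
qed

lemma chains2_mono: "S <= S' ==> chains2 p (subtop T S) <= chains2 p (subtop T S')"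
 unfolding chains2_def singular_simplex_subtopology by blast

lemma cycles2_mono: "S <= S' ==> cycles2 p (subtop T S) <= cycles2 p (subtop T S')"
 unfolding cycles2_def using chains2_mono by blast

lemma boundaries2_mono: "S <= S' ==> boundaries2 p (subtop T S) <= boundaries2 p (subtop T S')"
 unfolding boundaries2_def using chains2_mono by blast

lemma cycles2_lift:
 assumes "z : cycles2 p T"
 obtains c e where "singular_chain p T c" "red c = z" "chain_boundary p c = frag_cmul 2 e"
  "singular_chain (p - Suc 0) T e"
proof -
 have z: "z : chains2 p T" "boundary2 p z = 0" using assms by (auto simp: cycles2_def)
 obtain c where c: "singular_chain p T c" "red c = z"
  using z(1) by (blast elim: chains2E)
 have "red (chain_boundary p c) = 0"
  using z(2) unfolding c(2) [symmetric] boundary2_red .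
 then obtain e where "chain_boundary p c = frag_cmul 2 e" "keys e <= keys (chain_boundary p c)"
  by (rule red_eq_0)
 moreover from this have "singular_chain (p - Suc 0) T e"
  using singular_chain_boundary [OF c(1)] unfolding singular_chain_def by blast
 ultimately show thesis using that c by blast
qed

lemma red_relcycle: "scycle p T c ==> red c : cycles2 p T"
 by (simp add: singular_cycle cycles2_def red_chains2 boundary2_red)

lemma red_relboundary: "singular_relboundary p T {} c ==> red c : boundaries2 p T"
 unfolding singular_boundary boundaries2_def by (auto simp flip: boundary2_red intro!: imageI red_chains2)

section \<open>Spaces whose integral homology is trivial or infinite cyclic\<close>

text \<open>In this case the homology has no 2-torsion and its rank is at most one, so that mod-2 homology can be
read off without a universal coefficient theorem.\<close>

definition hom01 :: "int => 'a topology => bool" where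
 "hom01 p T \<longleftrightarrow> trivial_group (homology_group p T) | homology_group p T \<cong> integer_group"

lemma homology_class_add:
 assumes "scycle p T a" "scycle p T b"
 shows "homologous_rel_set p T {} a \<otimes>\<^bsub>homology_group (int p) T\<^esub> homologous_rel_set p T {} b
  = homologous_rel_set p T {} (a + b)"
proof -
 have "x : {r + s |r s. homologous_rel p T {} a r & homologous_rel p T {} b s}"
  if "homologous_rel p T {} (a + b) x" for x
 proof -
  have "homologous_rel p T {} b (x - a)"
  using that by (simp add: homologous_rel_def algebra_simps)
  moreover have "x = a + (x - a)" by simp
  ultimately show ?thesis using homologous_rel_refl by blast
 qed
 note this [unfolded mem_Collect_eq]
 thus ?thesis
  unfolding mult_relative_homology_group by (blast intro: homologous_rel_add)
qed

lemma hom01_function: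
 assumes "hom01 (int p) T"
 obtains F :: "'a chain => int" where
  "ALL a b. scycle p T a --> scycle p T b --> F (a + b) = F a + F b"
  "ALL a. scycle p T a --> (F a = 0 \<longleftrightarrow> singular_relboundary p T {} a)"
  "(ALL a. scycle p T a --> F a = 0) & trivial_group (homology_group (int p) T)
  | (EX g. scycle p T g & F g = 1)"
proof -
 let ?H = "homology_group (int p) T"
 consider "trivial_group ?H" | "?H \<cong> integer_group" using assms by (auto simp: hom01_def)
 thus thesis
 proof cases
  case 1
  have b: "singular_relboundary p T {} a" if "scycle p T a" for a
  proof -
  have "homologous_rel_set p T {} a : carrier ?H"
  using that by (auto simp: carrier_relative_homology_group)
  hence "homologous_rel_set p T {} a = singular_relboundary_set p T {}"
  using 1 by (auto simp: trivial_group_def)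
  thus ?thesis by (simp add: homologous_rel_set_eq_relboundary)
  qed
  show ?thesis
  by (rule that [of "%_. 0"]) (use 1 b in simp_all)
 next
  case 2
  then obtain f where f: "f : iso ?H integer_group" by (auto simp: is_iso_def)
  interpret f: group_hom ?H integer_group f
  using f by (simp add: group_hom_def group_hom_axioms_def iso_def)
  define F where "F a = f (homologous_rel_set p T {} a)" for a
  have car: "homologous_rel_set p T {} a : carrier ?H" if "scycle p T a" for a
  using that by (auto simp: carrier_relative_homology_group)
  show ?thesis
  proof (rule that [of F])
  have "F (a + b) = F a + F b" if "scycle p T a" "scycle p T b" for a b
  using f.hom_mult [OF car [OF that(1)] car [OF that(2)]]
  by (simp add: F_def homology_class_add that)
  thus "ALL a b. scycle p T a --> scycle p T b --> F (a + b) = F a + F b"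
  by blast
  have "F a = 0 \<longleftrightarrow> singular_relboundary p T {} a" if "scycle p T a" for a
  proof -
  have inj: "inj_on f (carrier ?H)" using f by (simp add: iso_def bij_betw_def)
  have "F a = 0 \<longleftrightarrow> homologous_rel_set p T {} a = \<one>\<^bsub>?H\<^esub>"
  using inj_on_eq_iff [OF inj car [OF that] f.G.one_closed] f.hom_one by (simp add: F_def)
  thus ?thesis by (simp add: homologous_rel_set_eq_relboundary)
  qed
  thus "ALL a. scycle p T a --> (F a = 0 \<longleftrightarrow> singular_relboundary p T {} a)"
  by blast
  have "1 : f ` carrier ?H" using f by (simp add: iso_def bij_betw_def)
  thus "(ALL a. scycle p T a --> F a = 0) & trivial_group ?H
  | (EX g. scycle p T g & F g = 1)"
  unfolding carrier_relative_homology_group F_def by fastforce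
  qed
 qed
qed

lemma additive_cmul:
 fixes F :: "'a chain => int"
 assumes add: "!!a b. scycle p T a ==> scycle p T b ==> F (a + b) = F a + F b"
  and a: "scycle p T a"
 shows "F (frag_cmul k a) = k * F a"
proof -
 have cyc: "scycle p T (frag_cmul j a)" for j
  using a by (rule singular_relcycle_cmul)
 have step: "F (frag_cmul (i + j) a) = F (frag_cmul i a) + F (frag_cmul j a)" for i j
  unfolding frag_cmul_distrib by (rule add [OF cyc cyc])
 have F0: "F (frag_cmul 0 a) = 0" using step [of 0 0] by (simp only: add_0_left add_cancel_left_left)
 have n: "F (frag_cmul (int n) a) = int n * F a" for n
 proof (induction n)
  case (Suc n)
  have "F (frag_cmul (int (Suc n)) a) = F (frag_cmul (int n + 1) a)" by (simp add: add.commute)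
  also have "... = int n * F a + F a" unfolding step Suc by simp
  finally show ?case by (simp add: distrib_right)
 qed (use F0 in simp)
 show ?thesis
 proof (cases "k >= 0")
  case True
  thus ?thesis using n [of "nat k"] by simp
 next
  case False
  have "F (frag_cmul k a) = - F (frag_cmul (-k) a)"
  using step [of k "-k"] F0 by (simp only: add.right_inverse)
  also have "... = k * F a"
  using n [of "nat (-k)"] False by simp
  finally show ?thesis .
 qed
qed

lemma hom01_torsion_free:
 assumes "hom01 (int p) T" "scycle p T e" "singular_relboundary p T {} (frag_cmul 2 e)"
 shows "singular_relboundary p T {} e"
proof -
 from assms(1) obtain F :: "'a chain => int" where
  FF: "ALL a b. scycle p T a --> scycle p T b --> F (a + b) = F a + F b"
  "ALL a. scycle p T a --> (F a = 0 \<longleftrightarrow> singular_relboundary p T {} a)"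
  "(ALL a. scycle p T a --> F a = 0) & trivial_group (homology_group (int p) T)
  | (EX g. scycle p T g & F g = 1)"
  by (rule hom01_function)
 note F = FF(1) [rule_format] FF(2) [rule_format] FF(3)
 have "2 * F e = 0"
  using F(2) [OF singular_relcycle_cmul [OF assms(2)], of 2] additive_cmul [of p T F e 2, OF F(1) assms(2)] assms(3)
  by linarith
 thus ?thesis using F(2) assms(2) by simp
qed

text \<open>Lift z to an integral chain c. Its boundary is twice a chain b, and b is a cycle. Homology in degree
p - 1 is torsion free, so b bounds a chain f, and c - 2f is a cycle with the same reduction.\<close>

lemma hom01_lift_cycle:
 assumes z: "z : cycles2 p T" and p: "p = 0 | hom01 (int (p - 1)) T"
 obtains c where "scycle p T c" "red c = z"
proof -
 obtain c e where c: "singular_chain p T c" "red c = z" "chain_boundary p c = frag_cmul 2 e"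
  "singular_chain (p - Suc 0) T e" using z by (rule cycles2_lift)
 show thesis
 proof (cases "p = 0")
  case True
  hence "scycle p T c" using c(1) by (simp add: singular_cycle chain_boundary_def)
  thus ?thesis using c(2) by (rule that)
 next
  case False
  then obtain q where q: "p = Suc q" by (cases p) auto
  have "frag_cmul 2 (chain_boundary q e) = 0"
  using chain_boundary_boundary [OF c(1)] unfolding c(3) by (simp add: chain_boundary_cmul q)
  hence "chain_boundary q e = 0"
  by (rule frag_cmul_2_eq_0)
  hence e: "scycle q T e" using c(4) by (simp add: singular_cycle q)
  have "singular_relboundary q T {} (frag_cmul 2 e)"
  unfolding singular_boundary using c q by auto
  moreover have "hom01 (int q) T" using p q by simp
  ultimately have "singular_relboundary q T {} e"
  using hom01_torsion_free e by blast
  then obtain f where f: "singular_chain p T f" "chain_boundary p f = e"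
  using q by (auto simp: singular_boundary)
  have "scycle p T (c - frag_cmul 2 f)"
  using c(1,3) f by (simp add: singular_cycle singular_chain_diff singular_chain_cmul chain_boundary_diff chain_boundary_cmul)
  moreover have "red (c - frag_cmul 2 f) = z" using c(2) by (simp add: red_diff red_cmul)
  ultimately show ?thesis by (rule that)
 qed
qed

text \<open>Lift to integral cycles; these are multiples of a generator up to boundaries, and only the parity
of the multiple survives modulo 2.\<close>

lemma hom01_two_classes:
 assumes "hom01 (int p) T" "p = 0 | hom01 (int (p - 1)) T"
 shows "EX g:cycles2 p T. ALL z:cycles2 p T. z : boundaries2 p T | z + g : boundaries2 p T"
proof -
 from assms(1) obtain F :: "'a chain => int" where
  FF: "ALL a b. scycle p T a --> scycle p T b --> F (a + b) = F a + F b"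
  "ALL a. scycle p T a --> (F a = 0 \<longleftrightarrow> singular_relboundary p T {} a)"
  "(ALL a. scycle p T a --> F a = 0) & trivial_group (homology_group (int p) T)
  | (EX g. scycle p T g & F g = 1)"
  by (rule hom01_function)
 note F = FF(1) [rule_format] FF(2) [rule_format] FF(3)
 obtain g where g: "scycle p T g" "!!c. scycle p T c ==> F c = F c * F g"
 proof (cases "EX g. scycle p T g & F g = 1")
  case True
  then obtain g where g: "scycle p T g" "F g = 1" by blast
  show thesis by (rule that [OF g(1)]) (simp add: g(2))
 next
  case False
  hence 0: "F c = 0" if "scycle p T c" for c using F(3) that by blast
  show thesis by (rule that [OF singular_relcycle_0]) (simp add: 0)
 qed
 have "z : boundaries2 p T | z + red g : boundaries2 p T" if z: "z : cycles2 p T" for z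
 proof -
  obtain c where c: "scycle p T c" "red c = z"
  using hom01_lift_cycle [OF z assms(2)] .
  define k where "k = F c"
  have gk: "scycle p T (frag_cmul (-k) g)" using g by (simp only: singular_relcycle_cmul)
  have "F (c + frag_cmul (-k) g) = F c + (-k) * F g"
  unfolding F(1) [OF c(1) gk] using additive_cmul [of p T F g "-k", OF F(1) g(1)] by simp
  also have "... = 0" using g(2) [OF c(1)] unfolding k_def by linarith
  finally have "F (c + frag_cmul (-k) g) = 0" .
  hence "red (c + frag_cmul (-k) g) : boundaries2 p T"
  using F(2) singular_relcycle_add [OF c(1) gk] red_relboundary by blast
  moreover have "red (c + frag_cmul (-k) g) = (if even k then z else z + red g)"
  unfolding red_add red_cmul c(2) by simp
  ultimately show ?thesis by (cases "even k") simp_all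
 qed
 thus ?thesis using red_relcycle [OF g(1)] by (intro bexI [of _ "red g"]) simp_all
qed

text \<open>If a generator bounded modulo 2, it would be homologous to twice an integral chain, necessarily a
cycle, contradicting that it is not divisible by 2.\<close>

lemma integer_homology_nonbounding:
 assumes "homology_group (int p) T \<cong> integer_group"
 shows "EX g:cycles2 p T. g ~: boundaries2 p T"
proof -
 have nt: "~ trivial_group (homology_group (int p) T)"
  using isomorphic_group_triviality [OF assms group_relative_homology_group group_integer_group]
  nontrivial_integer_group by simp
 have "hom01 (int p) T" using assms by (simp add: hom01_def)
 then obtain F :: "'a chain => int" where
  FF: "ALL a b. scycle p T a --> scycle p T b --> F (a + b) = F a + F b"
  "ALL a. scycle p T a --> (F a = 0 \<longleftrightarrow> singular_relboundary p T {} a)"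
  "(ALL a. scycle p T a --> F a = 0) & trivial_group (homology_group (int p) T)
  | (EX g. scycle p T g & F g = 1)"
  by (rule hom01_function)
 note F = FF(1) [rule_format] FF(2) [rule_format] FF(3)
 obtain g where g: "scycle p T g" "F g = 1"
  using F(3) nt by blast
 have "red g ~: boundaries2 p T"
 proof
  assume "red g : boundaries2 p T"
  then obtain d where d: "singular_chain (Suc p) T d" "red g = red (chain_boundary (Suc p) d)"
  unfolding boundaries2_def by (auto simp: boundary2_red elim!: chains2E)
  let ?b = "chain_boundary (Suc p) d"
  have b: "singular_relboundary p T {} ?b" using d by (auto simp: singular_boundary)
  have bc: "scycle p T ?b" using b by (rule singular_relboundary_imp_relcycle)
  have "red (g - ?b) = 0" using d by (simp add: red_diff)
  then obtain e where e: "g - ?b = frag_cmul 2 e" "keys e <= keys (g - ?b)"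
  by (rule red_eq_0)
  have gb: "scycle p T (g - ?b)" using g(1) bc by (rule singular_relcycle_diff)
  have "frag_cmul 2 (chain_boundary p e) = 0"
  using gb e(1) by (simp add: singular_cycle chain_boundary_cmul)
  hence "chain_boundary p e = 0"
  by (rule frag_cmul_2_eq_0)
  hence ec: "scycle p T e"
  using gb e(2) by (auto simp: singular_cycle singular_chain_def)
  have "F g = F (frag_cmul 2 e + ?b)" using e(1) by (metis diff_add_cancel)
  also have "... = 2 * F e"
  using F(1) [OF singular_relcycle_cmul [OF ec] bc, of 2] additive_cmul [of p T F e 2, OF F(1) ec] F(2) [OF bc] b by linarith
  finally show False using g by presburger
 qed
 thus ?thesis using red_relcycle [OF g(1)] by blast
qed

section \<open>Restriction and push-forward of chains\<close>

definition restr :: "('a => bool) => ('a \<Rightarrow>\<^sub>0 bit) => ('a \<Rightarrow>\<^sub>0 bit)" where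
 "restr P = ext2 (%s. if P s then single s 1 else 0)"

lemma restr_add: "restr P (a + b) = restr P a + restr P b"
 by (simp add: restr_def ext2_add)

lemma restr_split: "restr P c + restr (%s. ~ P s) c = c"
proof -
 have "restr P c + restr (%s. ~ P s) c = ext2 (%s. single s 1) c"
  unfolding restr_def ext2_fun_add [symmetric] by (rule ext2_cong) simp
 thus ?thesis by (simp add: ext2_of)
qed

lemma keys_restr: "keys (restr P c) <= {s : keys c. P s}"
proof
 fix s assume "s : keys (restr P c)"
 hence "s : (UN t:keys c. keys (if P t then single t (1::bit) else 0))"
  unfolding restr_def by (rule subsetD [OF keys_ext2])
 thus "s : {s : keys c. P s}" by (auto split: if_splits)
qed

lemma restr_all: "(!!s. s : keys c ==> P s) ==> restr P c = c"
 unfolding restr_def using ext2_cong [of c "%s. if P s then single s 1 else 0" "%s. single s 1"]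
 by (simp add: ext2_of)

lemma restr_none: "(!!s. s : keys c ==> ~ P s) ==> restr P c = 0"
 unfolding restr_def ext2_def by simp

definition push2 :: "nat => ('a => 'b) => 'a chain2 => 'b chain2" where
 "push2 p f = ext2 (%s. single (simplex_map p f s) 1)"

lemma push2_red: "push2 p f (red c) = red (chain_map p f c)"
 by (simp add: push2_def chain_map_def red_extend)

lemma push2_add: "push2 p f (a + b) = push2 p f a + push2 p f b"
 by (simp add: push2_def ext2_add)

lemma push2_cycles2:
 assumes f: "continuous_map X Y f" and z: "z : cycles2 p X"
 shows "push2 p f z : cycles2 p Y"
proof -
 have z': "z : chains2 p X" "boundary2 p z = 0" using z by (auto simp: cycles2_def)
 obtain c where c: "singular_chain p X c" "z = red c" using z'(1) by (rule chains2E)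
 have "boundary2 p (push2 p f z) = push2 (p - Suc 0) f (boundary2 p z)"
  unfolding c(2) push2_red boundary2_red chain_boundary_chain_map [OF c(1)] ..
 also have "... = 0" using z'(2) by (simp add: push2_def)
 finally show ?thesis
  using singular_chain_chain_map [OF c(1) f] by (simp add: cycles2_def c(2) push2_red red_chains2)
qed

lemma push2_boundaries2:
 assumes f: "continuous_map X Y f" and z: "z : boundaries2 p X"
 shows "push2 p f z : boundaries2 p Y"
proof -
 obtain d where "d : chains2 (Suc p) X" "z = boundary2 (Suc p) d"
  using z unfolding boundaries2_def by blast
 then obtain c where c: "singular_chain (Suc p) X c" "z = red (chain_boundary (Suc p) c)"
  by (metis boundary2_red chains2E)
 have "push2 p f z = boundary2 (Suc p) (red (chain_map (Suc p) f c))"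
  unfolding c(2) push2_red boundary2_red chain_boundary_chain_map [OF c(1)] by simp
 thus ?thesis
  unfolding boundaries2_def using singular_chain_chain_map [OF c(1) f] by (simp add: red_chains2)
qed

lemma push2_inverse:
 assumes "z : chains2 p X" "!!x. x : topspace X ==> g (h x) = x"
 shows "push2 p g (push2 p h z) = z"
proof -
 obtain c where c: "singular_chain p X c" "z = red c" using assms(1) by (rule chains2E)
 have "chain_map p g (chain_map p h c) = chain_map p (g \<circ> h) c"
  by (simp add: chain_map_compose)
 also have "... = c" using c(1) by (rule chain_map_id_gen) (use assms(2) in simp)
 finally show ?thesis by (simp add: c(2) push2_red)
qed

section \<open>Inclusions with finite image in homology\<close>

text \<open>The image of the mod-2 homology of S in that of S' is finite. Unlike finiteness of the homology of S
itself, this passes through Mayer-Vietoris for overlapping sets that are not known to be nice.\<close>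

definition finq :: "nat => 'a topology => 'a set => 'a set => bool" where
 "finq p T S S' \<longleftrightarrow> (EX C. finite C & (ALL z:cycles2 p (subtop T S). EX c:C.
  z + c : boundaries2 p (subtop T S')))"

lemma finq_mono: "finq p T S S' ==> S1 <= S ==> S' <= S2 ==> finq p T S1 S2"
 unfolding finq_def using cycles2_mono [of S1 S p T] boundaries2_mono [of S' S2 p T] by (meson subsetD)

lemma chains2_empty:
 assumes "topspace X = {}" "c : chains2 p X" shows "c = 0"
proof -
 have "keys c <= {}"
  using assms(2) singular_simplex_empty [OF assms(1)] unfolding chains2_def by blast
 thus ?thesis by simp
qed

lemma finq_empty: "finq p T {} S"
proof -
 have "z + 0 : boundaries2 p (subtop T S)" if "z : cycles2 p (subtop T {})" for z
 proof -
  have "z : chains2 p (subtop T {})" using that by (simp add: cycles2_def)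
  hence "z = 0" using chains2_empty by (metis topspace_subtopology inf_bot_right)
  thus ?thesis by simp
 qed
 thus ?thesis unfolding finq_def by (intro exI [of _ "{0}"]) auto
qed

lemma finq_transport:
 assumes fin: "finq p E W W2" and h: "continuous_map (subtop T S) (subtop E W) h"
  and g: "continuous_map (subtop E W2) (subtop T S2) g"
  and gh: "!!x. x : topspace T ==> x : S ==> g (h x) = x"
 shows "finq p T S S2"
proof -
 obtain C where C: "finite C" "!!z. z : cycles2 p (subtop E W) ==> EX c:C. z + c : boundaries2 p (subtop E W2)"
  using fin unfolding finq_def by blast
 have "EX c:push2 p g ` C. z + c : boundaries2 p (subtop T S2)" if z: "z : cycles2 p (subtop T S)" for z
 proof -
  obtain c where c: "c : C" "push2 p h z + c : boundaries2 p (subtop E W2)"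
  using C(2) [OF push2_cycles2 [OF h z]] by blast
  have "z : chains2 p (subtop T S)" using z by (simp add: cycles2_def)
  hence "push2 p g (push2 p h z) = z" by (rule push2_inverse) (use gh in auto)
  hence "push2 p g (push2 p h z + c) = z + push2 p g c" by (simp add: push2_add)
  thus ?thesis using push2_boundaries2 [OF g c(2)] c(1) by auto
 qed
 thus ?thesis unfolding finq_def using C(1) by (intro exI [of _ "push2 p g ` C"]) simp
qed

text \<open>Barycentric subdivision, imported from the integral theory of the library: every cycle is homologous
to a sum of chains that are small with respect to the open cover {A, B}.\<close>

lemma small_decomposition:
 assumes A: "openin T A" and B: "openin T B" and z: "z : cycles2 p (subtop T (A Un B))"
 obtains a b where "a : chains2 p (subtop T A)" "b : chains2 p (subtop T B)"
  "z + (a + b) : boundaries2 p (subtop T (A Un B))"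
proof -
 define X where "X = subtop T (A Un B)"
 obtain c e where c: "singular_chain p X c" "red c = z" "chain_boundary p c = frag_cmul 2 e"
  "singular_chain (p - Suc 0) X e"
  using z unfolding X_def by (rule cycles2_lift)
 have oAB: "openin X A" "openin X B"
  using A B unfolding X_def by (simp_all add: openin_open_subtopology openin_Un)
 obtain n where n: "!!m f. n <= m ==> f : keys ((singular_subdivision p ^^ m) c)
  ==> EX V : {A, B}. f : (standard_simplex p) \<rightarrow> V"
 proof (rule sufficient_iterated_singular_subdivision_exists [of "{A, B}" X p c])
  show "topspace X <= \<Union> {A, B}" unfolding X_def by auto
 qed (use oAB c(1) in auto)
 define sd where "sd = (singular_subdivision p ^^ n) c"
 have sdc: "singular_chain p X sd"
  unfolding sd_def by (induction n) (simp_all add: c(1) singular_chain_singular_subdivision)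
 have "EX h. (ALL p c1 c2. h p (c1 - c2) = h p c1 - h p c2)
  & (ALL p X c. singular_chain p X c --> singular_chain (Suc p) X (h p c))
  & (ALL p X c. singular_chain p X c --> chain_boundary (Suc p) (h p c) + h (p - Suc 0) (chain_boundary p c)
  = (singular_subdivision p ^^ n) c - (c :: 'a chain))"
  by (rule chain_homotopic_iterated_singular_subdivision [of n]) blast
 then obtain h where h: "!!p c1 c2. h p (c1 - c2) = h p c1 - h p c2"
  "!!p X c. singular_chain p X c ==> singular_chain (Suc p) X (h p c)"
  "!!p X c. singular_chain p X c ==> chain_boundary (Suc p) (h p c) + h (p - Suc 0) (chain_boundary p c)
  = (singular_subdivision p ^^ n) c - (c :: 'a chain)"
  by metis
 have h2: "h q (frag_cmul 2 e) = frag_cmul 2 (h q e)" for q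
 proof -
  have 0: "h q 0 = 0" using h(1) [of q 0 0] by simp
  have m: "h q (- e) = - h q e" using h(1) [of q 0 e] 0 by simp
  have t: "frag_cmul 2 x = x - (- x)" for x :: "'a chain"
  by (rule poly_mapping_eqI) (simp add: lookup_add)
  show ?thesis unfolding t h(1) m ..
 qed
 have "red (chain_boundary (Suc p) (h p c)) = red sd + z"
  using arg_cong [OF h(3) [OF c(1)], of red] unfolding c(3) h2 red_add red_diff sd_def [symmetric] c(2)
  by (simp add: red_cmul)
 hence bd: "z + red sd : boundaries2 p X"
  unfolding boundaries2_def using h(2) [OF c(1)]
  by (intro image_eqI [of _ _ "red (h p c)"]) (simp_all add: boundary2_red red_chains2 add.commute)
 let ?P = "%s. s : standard_simplex p \<rightarrow> A"
 define a where "a = restr ?P (red sd)"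
 define b where "b = restr (%s. ~ ?P s) (red sd)"
 have ab: "a + b = red sd" unfolding a_def b_def by (rule restr_split)
 have sing: "singular_simplex p T s" if "s : keys (red sd)" for s
 proof -
  have "s : keys sd" using that keys_red by (rule subsetD [rotated])
  hence "singular_simplex p X s" using sdc unfolding singular_chain_def by blast
  thus ?thesis unfolding X_def singular_simplex_subtopology by blast
 qed
 have "a : chains2 p (subtop T A)"
  using keys_restr [of ?P "red sd"] sing unfolding chains2_def a_def singular_simplex_subtopology by blast
 moreover have "b : chains2 p (subtop T B)"
 proof -
  have "s : standard_simplex p \<rightarrow> B" if "s : keys (red sd)" "~ ?P s" for s
  using n [of n s] that keys_red [of sd] unfolding sd_def [symmetric] by blast
  thus ?thesis
  using keys_restr [of "%s. ~ ?P s" "red sd"] sing unfolding chains2_def b_def singular_simplex_subtopology by blast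
 qed
 moreover have "z + (a + b) : boundaries2 p (subtop T (A Un B))"
  using bd unfolding ab X_def .
 ultimately show thesis by (rule that)
qed

text \<open>The Mayer-Vietoris sequence with finite images. Split a cycle as a + b; the class of the boundary of a
takes finitely many values in the intersection. Cycles with the same value differ by a cycle in A'
plus one in B', hence by finitely many classes.\<close>

lemma finq_Un:
 assumes A: "openin T A" "A <= A'" "finq p T A' U" "A' <= U"
  and B: "openin T B" "B <= B'" "finq p T B' U" "B' <= U"
  and D: "p = 0 | finq (p - 1) T (A Int B) (A' Int B')"
 shows "finq p T (A Un B) U"
proof -
 obtain CA where CA: "finite CA" "!!z. z : cycles2 p (subtop T A') ==> EX c:CA. z + c : boundaries2 p (subtop T U)"
  using A(3) unfolding finq_def by blast
 obtain CB where CB: "finite CB" "!!z. z : cycles2 p (subtop T B') ==> EX c:CB. z + c : boundaries2 p (subtop T U)"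
  using B(3) unfolding finq_def by blast
 define Z where "Z = {(z, a, b). z : cycles2 p (subtop T (A Un B)) & a : chains2 p (subtop T A)
  & b : chains2 p (subtop T B) & z + (a + b) : boundaries2 p (subtop T (A Un B))}"
 \<comment> \<open>Splittings are identified if the boundaries of their A-parts agree up to a boundary in the larger intersection.\<close>
 define eq where "eq a a' \<longleftrightarrow> (EX e:chains2 p (subtop T (A' Int B')). boundary2 p a + boundary2 p a' = boundary2 p e)"
  for a a' :: "'a chain2"
 have ab: "boundary2 p a = boundary2 p b" if "(z, a, b) : Z" for z a b
 proof -
  have zz: "boundary2 p z = 0" "boundary2 p (z + (a + b)) = 0"
  using that boundaries2_cycles2 [of p "subtop T (A Un B)"] unfolding Z_def cycles2_def by blast+
  thus ?thesis by (simp add: boundary2_add chain2_eq_iff)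
 qed
 have "EX R. finite R & R <= Z & (ALL t:Z. EX t':R. eq (fst (snd t)) (fst (snd t')))"
 proof (cases "p = 0")
  case True
  have "eq a a'" for a a' unfolding eq_def by (rule bexI [of _ 0]) (simp_all add: boundary2_def True)
  moreover have "(0, 0, 0) : Z" unfolding Z_def by simp
  ultimately show ?thesis by (intro exI [of _ "{(0, 0, 0)}"]) auto
 next
  case False
  then obtain C where C: "finite C" "!!y. y : cycles2 (p - 1) (subtop T (A Int B)) ==>
  EX c:C. y + c : boundaries2 (p - 1) (subtop T (A' Int B'))"
  using D unfolding finq_def by blast
  have hit: "EX c:C. boundary2 p a + c : boundaries2 (p - 1) (subtop T (A' Int B'))" if "(z, a, b) : Z" for z a b
  proof (rule C(2))
  have a: "a : chains2 p (subtop T A)" and b: "b : chains2 p (subtop T B)"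
  using that unfolding Z_def by blast+
  have "boundary2 p a : chains2 (p - 1) (subtop T A)" "boundary2 p a : chains2 (p - 1) (subtop T B)"
  using boundary2_chains2 [OF a] boundary2_chains2 [OF b] ab [OF that] by simp_all
  hence "boundary2 p a : chains2 (p - 1) (subtop T (A Int B))"
  unfolding chains2_def singular_simplex_subtopology by blast
  moreover have "boundary2 (p - 1) (boundary2 p a) = 0"
  using boundary2_boundary2 [of a "p - 1" "subtop T A"] a False by simp
  ultimately show "boundary2 p a : cycles2 (p - 1) (subtop T (A Int B))" by (simp add: cycles2_def)
  qed
  define rep where "rep c = (SOME t. t : Z & boundary2 p (fst (snd t)) + c : boundaries2 (p - 1) (subtop T (A' Int B')))" for c
  let ?R = "(rep ` C) Int Z"
  have "EX t:?R. eq a (fst (snd t))" if zab: "(z, a, b) : Z" for z a b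
  proof -
  obtain c where c: "c : C" "boundary2 p a + c : boundaries2 (p - 1) (subtop T (A' Int B'))"
  using hit [OF zab] by blast
  have "rep c : Z & boundary2 p (fst (snd (rep c))) + c : boundaries2 (p - 1) (subtop T (A' Int B'))"
  unfolding rep_def by (rule someI [of _ "(z, a, b)"]) (use zab c in simp)
  hence r: "rep c : Z" "boundary2 p (fst (snd (rep c))) + c : boundaries2 (p - 1) (subtop T (A' Int B'))" by blast+
  have "(boundary2 p a + c) + (boundary2 p (fst (snd (rep c))) + c) : boundaries2 (p - 1) (subtop T (A' Int B'))"
  using c(2) r(2) by (rule boundaries2_add)
  also have "(boundary2 p a + c) + (boundary2 p (fst (snd (rep c))) + c) = boundary2 p a + boundary2 p (fst (snd (rep c)))"
  by (simp only: ac_simps chain2_cancel)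
  finally have "eq a (fst (snd (rep c)))"
  unfolding eq_def boundaries2_def using False by auto
  thus ?thesis using r(1) c(1) by blast
  qed
  hence "ALL t:Z. EX t':?R. eq (fst (snd t)) (fst (snd t'))" by (metis prod.collapse)
  thus ?thesis using C(1) by (intro exI [of _ ?R]) simp
 qed
 then obtain R where R: "finite R" "R <= Z" "!!z a b. (z, a, b) : Z ==> EX z' a' b'. (z', a', b') : R & eq a a'"
  by (metis (no_types, lifting) fst_conv prod.collapse snd_conv)
 define C where "C = (%(t, c1, c2). fst t + (c1 + c2)) ` (R \<times> CA \<times> CB)"
 have "EX c:C. z + c : boundaries2 p (subtop T U)" if z: "z : cycles2 p (subtop T (A Un B))" for z
 proof -
  obtain a b where d: "a : chains2 p (subtop T A)" "b : chains2 p (subtop T B)"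
  "z + (a + b) : boundaries2 p (subtop T (A Un B))"
  using A(1) B(1) z by (rule small_decomposition)
  hence zab: "(z, a, b) : Z" using z unfolding Z_def by blast
  then obtain z' a' b' where R': "(z', a', b') : R" "eq a a'" using R(3) by blast
  hence zab': "(z', a', b') : Z" using R(2) by blast
  hence d': "a' : chains2 p (subtop T A)" "b' : chains2 p (subtop T B)"
  "z' + (a' + b') : boundaries2 p (subtop T (A Un B))" unfolding Z_def by blast+
  obtain e where e: "e : chains2 p (subtop T (A' Int B'))" "boundary2 p a + boundary2 p a' = boundary2 p e"
  using R'(2) unfolding eq_def by blast
  have eA: "e : chains2 p (subtop T A')" and eB: "e : chains2 p (subtop T B')"
  using e(1) chains2_mono [of "A' Int B'" A' p T] chains2_mono [of "A' Int B'" B' p T] by blast+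
  have aA: "a : chains2 p (subtop T A')" "a' : chains2 p (subtop T A')"
  using d(1) d'(1) chains2_mono [OF A(2), of p T] by blast+
  have bB: "b : chains2 p (subtop T B')" "b' : chains2 p (subtop T B')"
  using d(2) d'(2) chains2_mono [OF B(2), of p T] by blast+
  have "a + a' + e : cycles2 p (subtop T A')"
  unfolding cycles2_def using e(2) by (simp add: aA eA chains2_add boundary2_add)
  then obtain c1 where c1: "c1 : CA" "a + a' + e + c1 : boundaries2 p (subtop T U)" using CA(2) by blast
  have "b + b' + e : cycles2 p (subtop T B')"
  unfolding cycles2_def using e(2) ab [OF zab] ab [OF zab'] by (simp add: bB eB chains2_add boundary2_add)
  then obtain c2 where c2: "c2 : CB" "b + b' + e + c2 : boundaries2 p (subtop T U)" using CB(2) by blast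
  have U: "boundaries2 p (subtop T (A Un B)) <= boundaries2 p (subtop T U)"
  using A(2,4) B(2,4) by (intro boundaries2_mono) blast
  have "(z + (a + b)) + (z' + (a' + b')) + ((a + a' + e + c1) + (b + b' + e + c2)) : boundaries2 p (subtop T U)"
  by (rule boundaries2_add [OF boundaries2_add [OF subsetD [OF U d(3)] subsetD [OF U d'(3)]] boundaries2_add [OF c1(2) c2(2)]])
  also have "(z + (a + b)) + (z' + (a' + b')) + ((a + a' + e + c1) + (b + b' + e + c2))
  = (z + (z' + (c1 + c2))) + ((a + a) + (a' + a') + ((b + b) + (b' + b')) + (e + e))"
  by (simp only: ac_simps)
  also have "... = z + (z' + (c1 + c2))" by simp
  finally show ?thesis
  using R'(1) c1(1) c2(1) unfolding C_def by force
 qed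
 moreover have "finite C" unfolding C_def using R(1) CA(1) CB(1) by simp
 ultimately show ?thesis unfolding finq_def by blast
qed

section \<open>Finiteness for compact locally Euclidean spaces\<close>

text \<open>Every neighbourhood U of C contains a smaller one whose homology has finite image in that of U. The
condition concerns germs of neighbourhoods, so that C may be an arbitrary compact set.\<close>

definition tame :: "'a topology => 'a set => bool" where
 "tame T C \<longleftrightarrow> (ALL U. openin T U & C <= U -->
  (EX V. openin T V & C <= V & V <= U & (ALL p. finq p T V U)))"

lemma tame_empty: "tame T {}"
 unfolding tame_def by (intro allI impI exI [of _ "{}"]) (simp add: finq_empty)

lemma tame_Un:
 assumes H: "Hausdorff_space T" and C: "compactin T C1" "compactin T C2"
  and t: "tame T C1" "tame T C2" "tame T (C1 Int C2)"
 shows "tame T (C1 Un C2)"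
 unfolding tame_def
proof (intro allI impI)
 fix U assume U: "openin T U & C1 Un C2 <= U"
 obtain A' where A': "openin T A'" "C1 <= A'" "A' <= U" "!!p. finq p T A' U"
  using t(1) U unfolding tame_def by (meson le_sup_iff)
 obtain B' where B': "openin T B'" "C2 <= B'" "B' <= U" "!!p. finq p T B' U"
  using t(2) U unfolding tame_def by (meson le_sup_iff)
 have "openin T (A' Int B') & C1 Int C2 <= A' Int B'" using A' B' by blast
 then obtain D where D: "openin T D" "C1 Int C2 <= D" "D <= A' Int B'" "!!p. finq p T D (A' Int B')"
  using t(3) unfolding tame_def by meson
 have "compactin T (C1 - D)" "compactin T (C2 - D)"
  using C D(1) by (metis closedin_diff closedin_topspace Diff_Int_distrib2 compactin_subset_topspace inf.absorb_iff2 closed_Int_compactin openin_closedin_eq Int_Diff inf.commute)+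
 moreover have "disjnt (C1 - D) (C2 - D)" using D(2) unfolding disjnt_def by blast
 ultimately obtain N1 N2 where N: "openin T N1" "openin T N2" "C1 - D <= N1" "C2 - D <= N2" "disjnt N1 N2"
  by (rule Hausdorff_space_compact_separation [OF H])
 define A where "A = A' Int (N1 Un D)"
 define B where "B = B' Int (N2 Un D)"
 have AB: "A Int B <= D" using N(5) unfolding A_def B_def disjnt_def by blast
 have oA: "openin T A" "openin T B" unfolding A_def B_def using A' B' N D by blast+
 have "finq p T (A Un B) U" for p
 proof (rule finq_Un [of T A A' p U B B'])
  show "p = 0 | finq (p - 1) T (A Int B) (A' Int B')"
  using finq_mono [OF D(4) AB order_refl] by blast
 qed (use oA A' B' in \<open>auto simp: A_def B_def\<close>)
 moreover have "C1 Un C2 <= A Un B" using A' B' N unfolding A_def B_def by blast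
 moreover have "A Un B <= U" using A'(3) B'(3) unfolding A_def B_def by blast
 ultimately show "EX V. openin T V & C1 Un C2 <= V & V <= U & (ALL p. finq p T V U)"
  using oA by (intro exI [of _ "A Un B"]) blast
qed

lemma tame_Union:
 assumes H: "Hausdorff_space T" and "finite \<F>"
  and "!!C. C : \<F> ==> compactin T C" "!!C K. C : \<F> ==> compactin T K ==> K <= C ==> tame T K"
 shows "tame T (\<Union>\<F>)"
 using assms(2-)
proof (induction \<F> rule: finite_induct)
 case empty
 thus ?case by (simp add: tame_empty)
next
 case (insert C \<F>)
 have cU: "compactin T (\<Union>\<F>)" using insert by (intro compactin_Union) auto
 have cC: "compactin T C" using insert by simp
 have "compactin T (C Int \<Union>\<F>)"
  using compactin_imp_closedin [OF H cC] cU by (rule closed_Int_compactin)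
 hence "tame T (C Int \<Union>\<F>)" using insert.prems(2) [of C "C Int \<Union>\<F>"] by blast
 moreover have "tame T C" using insert.prems(2) [of C C] cC by blast
 moreover have "tame T (\<Union>\<F>)" using insert by blast
 ultimately have "tame T (C Un \<Union>\<F>)" using H cC cU by (intro tame_Un)
 thus ?case by simp
qed

abbreviation Ecar :: "nat => rvec set" where
 "Ecar q \<equiv> {x. ALL i>=q. x i = 0}"

lemma Euclidean_space_eq: "Euclidean_space q = top_of_set (Ecar q)"
 by (simp add: Euclidean_space_def euclidean_product_topology)

definition cbx :: "nat => rvec => rvec => rvec set" where
 "cbx q a b = {x : Ecar q. ALL i<q. a i <= x i & x i <= b i}"

definition obx :: "nat => rvec => rvec => rvec set" where
 "obx q a b = {x : Ecar q. ALL i<q. a i < x i & x i < b i}"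

lemma continuous_on_coord [continuous_intros]: "continuous_on S (%x::nat => 'a::topological_space. x i)"
 by (rule continuous_on_subset [OF continuous_on_product_coordinates]) simp

lemma compact_cbx: "compact (cbx q a b)"
proof -
 have "cbx q a b = (\<Pi>\<^sub>E i\<in>UNIV. if i < q then {a i..b i} else {0})"
 proof (rule Set.set_eqI)
  fix x
  have "x : cbx q a b \<longleftrightarrow> (ALL i. x i : (if i < q then {a i..b i} else {0}))"
  proof
  assume "ALL i. x i : (if i < q then {a i..b i} else {0})"
  hence H: "x i : (if i < q then {a i..b i} else {0})" for i by blast
  have "x i = 0" if "i >= q" for i using H [of i] that by simp
  moreover have "a i <= x i & x i <= b i" if "i < q" for i using H [of i] that by simp
  ultimately show "x : cbx q a b" unfolding cbx_def by simp
  qed (simp add: cbx_def)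
  thus "x : cbx q a b \<longleftrightarrow> x : (\<Pi>\<^sub>E i\<in>UNIV. if i < q then {a i..b i} else {0})"
  by (simp add: PiE_iff)
 qed
 moreover have "compactin (product_topology (%i. euclideanreal) UNIV) (\<Pi>\<^sub>E i\<in>UNIV. if i < q then {a i..b i} else {0})"
  unfolding compactin_PiE by simp
 ultimately show ?thesis by (simp add: euclidean_product_topology)
qed

lemma openin_obx: "openin (top_of_set (Ecar q)) (obx q a b)"
proof -
 have "open (INT i:{..<q}. {x::nat => real. a i < x i} Int {x. x i < b i})"
  by (intro open_INT ballI open_Int open_Collect_less continuous_intros) simp_all
 moreover have "obx q a b = Ecar q Int (INT i:{..<q}. {x. a i < x i} Int {x. x i < b i})"
  by (auto simp: obx_def)
 ultimately show ?thesis by auto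
qed

lemma cbx_enlarge:
 assumes U: "openin (top_of_set (Ecar q)) U" and ab: "cbx q a b <= U"
 obtains eps where "eps > 0" "cbx q (%i. a i - eps) (%i. b i + eps) <= U"
proof -
 obtain W where W: "open W" "U = Ecar q Int W" using U by (auto simp: openin_open)
 define K where "K = cbx q (%i. a i - 1) (%i. b i + 1) - W"
 have K: "compact K" unfolding K_def using compact_cbx W(1) by (rule compact_diff)
 define dl where "dl x = (SUM i<q. max 0 (a i - x i) + max 0 (x i - b i))" for x :: rvec
 have cont: "continuous_on K dl" unfolding dl_def by (intro continuous_intros)
 have sub: "cbx q (%i. a i - eps) (%i. b i + eps) <= U" if e: "0 < eps" "eps <= 1" and d: "!!x. x : K ==> dl x > 2 * real q * eps" for eps
 proof
  fix x assume x: "x : cbx q (%i. a i - eps) (%i. b i + eps)"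
  hence xb: "a i - eps <= x i" "x i <= b i + eps" if "i < q" for i using that by (auto simp: cbx_def)
  have x1: "x : cbx q (%i. a i - 1) (%i. b i + 1)"
  using x e(2) xb unfolding cbx_def by (force intro: order_trans)
  have "dl x <= (SUM i<q. 2 * eps)"
  unfolding dl_def using xb e by (intro sum_mono) (fastforce simp: max_def)
  also have "... = 2 * real q * eps" by simp
  finally have "x ~: K" using d by force
  thus "x : U" using x1 x unfolding K_def W(2) cbx_def by blast
 qed
 show thesis
 proof (cases "K = {}")
  case True
  thus ?thesis using sub [of 1] that [of 1] by simp
 next
  case False
  then obtain x0 where x0: "x0 : K" "!!x. x : K ==> dl x0 <= dl x"
  using continuous_attains_inf [OF K _ cont] by blast
  have "x0 ~: cbx q a b" using x0(1) ab W(2) unfolding K_def by blast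
  moreover have "x0 : Ecar q" using x0(1) unfolding K_def cbx_def by blast
  ultimately obtain j where j: "j < q" "x0 j < a j | b j < x0 j" unfolding cbx_def by force
  have "0 < max 0 (a j - x0 j) + max 0 (x0 j - b j)" using j(2) by (auto simp: max_def)
  also have "... <= dl x0" unfolding dl_def
  using j(1) by (intro member_le_sum [of j "{..<q}" "%i. max 0 (a i - x0 i) + max 0 (x0 i - b i)"]) auto
  finally have pos: "dl x0 > 0" .
  define eps where "eps = min 1 (dl x0 / (2 * real q + 1))"
  have e: "eps > 0" "eps <= 1" using pos by (auto simp: eps_def)
  have "2 * real q * eps < (2 * real q + 1) * eps" using e by simp
  also have "... <= (2 * real q + 1) * (dl x0 / (2 * real q + 1))" by (intro mult_left_mono) (auto simp: eps_def)
  also have "... = dl x0" by simp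
  finally have "dl x > 2 * real q * eps" if "x : K" for x using x0(2) [OF that] by linarith
  thus ?thesis using sub [OF e] that [OF e(1)] by blast
 qed
qed

lemma contractible_obx:
 assumes "c : obx q a b"
 shows "contractible_space (top_of_set (obx q a b))"
proof -
 let ?S = "obx q a b" and ?h = "%(t::real, x::nat => real) i. (1 - t) * x i + t * c i"
 have "continuous_on ({0..1} \<times> ?S) ?h"
  unfolding split_def
  by (intro continuous_on_coordinatewise_then_product continuous_intros
  continuous_on_product_then_coordinatewise [OF continuous_on_snd [OF continuous_on_id]])
 moreover have "?h : {0..1} \<times> ?S \<rightarrow> ?S"
 proof (intro funcsetI, clarify)
  fix t :: real and x assume t: "t : {0..1}" and x: "x : ?S"
  have "a i < (1 - t) * x i + t * c i & (1 - t) * x i + t * c i < b i" if "i < q" for i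
  using convex_bound_lt [of "x i" "b i" "c i" "1 - t" t] convex_bound_lt [of "- x i" "- a i" "- c i" "1 - t" t]
  t x assms that by (simp add: obx_def)
  thus "(%i. (1 - t) * x i + t * c i) : ?S"
  using x assms by (simp add: obx_def)
 qed
 ultimately have "homotopic_with_canon (%x. True) ?S ?S id (%x. c)"
  unfolding homotopic_with_def prod_topology_subtopology_eu
  by (intro exI [of _ ?h]) (auto simp: continuous_map_in_subtopology image_subset_iff_funcset)
 thus ?thesis unfolding contractible_space_def by blast
qed

lemma hom01_contractible:
 assumes "contractible_space X" "topspace X ~= {}"
 shows "hom01 p X"
proof (cases "p = 0")
 case True
 thus ?thesis unfolding hom01_def
  using isomorphic_integer_zeroth_homology_group contractible_imp_path_connected_space assms by blast
next
 case False
 thus ?thesis unfolding hom01_def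
  using trivial_reduced_homology_group_contractible_space [OF assms(1), of p] un_reduced_homology_group by metis
qed

lemma hom01_finq:
 assumes "!!p. hom01 p (subtop T S)" "S <= S'"
 shows "finq p T S S'"
proof -
 obtain g where g: "!!z. z : cycles2 p (subtop T S) ==> z : boundaries2 p (subtop T S) | z + g : boundaries2 p (subtop T S)"
  using hom01_two_classes [of p "subtop T S"] assms(1) by blast
 have "finq p T S S" unfolding finq_def
  by (intro exI [of _ "{0, g}"]) (use g in auto)
 thus ?thesis using assms(2) by (rule finq_mono [OF _ order_refl])
qed

lemma tame_cbx: "tame (Euclidean_space q) (cbx q a b)"
 unfolding tame_def Euclidean_space_eq
proof (intro allI impI)
 fix U assume U: "openin (top_of_set (Ecar q)) U & cbx q a b <= U"
 obtain eps where e: "eps > 0" "cbx q (%i. a i - eps) (%i. b i + eps) <= U"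
  using U cbx_enlarge by blast
 let ?V = "obx q (%i. a i - eps) (%i. b i + eps)"
 have V: "?V <= U" using e(2) unfolding obx_def cbx_def by fastforce
 have "cbx q a b <= ?V" using e(1) unfolding obx_def cbx_def by fastforce
 moreover have "finq p (top_of_set (Ecar q)) ?V U" for p
 proof (cases "?V = {}")
  case True
  thus ?thesis by (simp add: finq_empty)
 next
  case False
  then obtain c where "c : ?V" by blast
  hence "contractible_space (top_of_set ?V)" by (rule contractible_obx)
  moreover have "subtop (top_of_set (Ecar q)) ?V = top_of_set ?V"
  by (simp add: subtopology_subtopology) (metis (no_types, lifting) Int_absorb1 obx_def mem_Collect_eq subsetI)
  ultimately show ?thesis
  using V False by (intro hom01_finq hom01_contractible) simp_all
 qed
 ultimately show "EX V. openin (top_of_set (Ecar q)) V & cbx q a b <= V & V <= U & (ALL p. finq p (top_of_set (Ecar q)) V U)"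
  using openin_obx V by (intro exI [of _ ?V]) simp
qed

lemma Hausdorff_Euclidean_space: "Hausdorff_space (Euclidean_space q)"
 unfolding Euclidean_space_eq by (simp add: Hausdorff_space_subtopology)

lemma compactin_cbx: "compactin (Euclidean_space q) (cbx q a b)"
 unfolding Euclidean_space_eq compactin_subtopology using compact_cbx by (auto simp: cbx_def)

text \<open>Intersections of boxes are boxes, so the union can be built up by Mayer-Vietoris.\<close>

lemma tame_cbx_Union:
 fixes n :: nat
 shows "ALL j<n. EX a b. B j = cbx q a b ==> tame (Euclidean_space q) (UN j<n. B j)"
proof (induction n arbitrary: B)
 case 0
 thus ?case by (simp add: tame_empty)
next
 case (Suc n)
 obtain a b where ab: "B n = cbx q a b" using Suc.prems by blast
 have int: "ALL j<n. EX a' b'. B j Int B n = cbx q a' b'"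
 proof (intro allI impI)
  fix j assume "j < n"
  then obtain c d where "B j = cbx q c d" using Suc.prems less_SucI by blast
  hence "B j Int B n = cbx q (%i. max (c i) (a i)) (%i. min (d i) (b i))"
  unfolding ab cbx_def by auto
  thus "EX a' b'. B j Int B n = cbx q a' b'" by blast
 qed
 have c: "compactin (Euclidean_space q) (UN j<n. B j)"
 proof (rule compactin_Union)
  show "compactin (Euclidean_space q) S" if "S : B ` {..<n}" for S
  using that Suc.prems compactin_cbx less_SucI by (metis imageE lessThan_iff)
 qed simp
 have "tame (Euclidean_space q) ((UN j<n. B j) Un B n)"
 proof (rule tame_Un [OF Hausdorff_Euclidean_space c])
  show "tame (Euclidean_space q) (UN j<n. B j)" using Suc by simp
  have "(UN j<n. B j) Int B n = (UN j<n. B j Int B n)" by blast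
  thus "tame (Euclidean_space q) ((UN j<n. B j) Int B n)" using Suc.IH [OF int] by simp
 qed (simp_all add: ab compactin_cbx tame_cbx)
 moreover have "(UN j<Suc n. B j) = (UN j<n. B j) Un B n" by (auto simp: less_Suc_eq)
 ultimately show ?case by simp
qed

text \<open>Any neighbourhood of a compact set contains a finite union of boxes that is again a neighbourhood.\<close>

lemma tame_Euclidean_compact:
 assumes C: "compactin (Euclidean_space q) C"
 shows "tame (Euclidean_space q) C"
 unfolding tame_def
proof (intro allI impI)
 fix U assume U: "openin (Euclidean_space q) U & C <= U"
 have CE: "C <= Ecar q" using compactin_subset_topspace [OF C] by (simp add: topspace_Euclidean_space)
 have "EX eps>0. cbx q (%i. x i - eps) (%i. x i + eps) <= U" if x: "x : C" for x
 proof -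
  have "y = x" if "y : cbx q x x" for y
  proof
  fix i show "y i = x i" using that x CE unfolding cbx_def by (cases "i < q") (auto simp: not_less intro: antisym)
  qed
  hence "cbx q x x <= U" using U x by blast
  moreover have "openin (top_of_set (Ecar q)) U" using U by (simp add: Euclidean_space_eq)
  ultimately show ?thesis using cbx_enlarge [of q U x x] by blast
 qed
 then obtain eps where e: "!!x. x : C ==> eps x > 0" "!!x. x : C ==> cbx q (%i. x i - eps x) (%i. x i + eps x) <= U"
  by metis
 let ?O = "%x. obx q (%i. x i - eps x) (%i. x i + eps x)"
 have "EX \<F>. finite \<F> & \<F> <= ?O ` C & C <= \<Union>\<F>"
 proof (rule compactinD [OF C])
  show "openin (Euclidean_space q) V" if "V : ?O ` C" for V using that openin_obx by (auto simp: Euclidean_space_eq)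
  show "C <= \<Union> (?O ` C)"
  proof
  fix x assume "x : C"
  moreover from this have "x : ?O x" using CE e(1) unfolding obx_def by force
  ultimately show "x : \<Union> (?O ` C)" by blast
  qed
 qed
 then obtain \<F> where FF: "finite \<F>" "\<F> <= ?O ` C" "C <= \<Union>\<F>" by blast
 obtain F where F0: "F <= C" "finite F" "\<F> = ?O ` F" using finite_subset_image [OF FF(1,2)] by blast
 hence F: "finite F" "F <= C" "C <= (UN x:F. ?O x)" using FF(3) by simp_all
 obtain f where f: "bij_betw f {0..<card F} F" using ex_bij_betw_nat_finite [OF F(1)] by blast
 let ?B = "%j. cbx q (%i. f j i - eps (f j)) (%i. f j i + eps (f j))"
 have fF: "F = f ` {..<card F}" using f by (simp add: bij_betw_def lessThan_atLeast0)
 have ocbx: "obx q a b <= cbx q a b" for a b unfolding obx_def cbx_def by (auto simp: less_imp_le)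
 have CB: "C <= (UN j<card F. ?B j)"
 proof
  fix x assume "x : C"
  then obtain y where y: "y : F" "x : ?O y" using F(3) by blast
  then obtain j where "j < card F" "y = f j" using fF by blast
  thus "x : (UN j<card F. ?B j)" using subsetD [OF ocbx y(2)] by blast
 qed
 have BU: "?B j <= U" if "j < card F" for j
 proof (rule e(2))
  show "f j : C" using F(2) fF that by blast
 qed
 hence BU: "(UN j<card F. ?B j) <= U" by blast
 have "tame (Euclidean_space q) (UN j<card F. ?B j)" by (rule tame_cbx_Union) blast
 hence "EX V. openin (Euclidean_space q) V & (UN j<card F. ?B j) <= V & V <= U & (ALL p. finq p (Euclidean_space q) V U)"
  unfolding tame_def using U BU by simp
 then obtain V where V: "openin (Euclidean_space q) V" "(UN j<card F. ?B j) <= V" "V <= U" "ALL p. finq p (Euclidean_space q) V U"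
  by blast
 show "EX V. openin (Euclidean_space q) V & C <= V & V <= U & (ALL p. finq p (Euclidean_space q) V U)"
  by (intro exI [of _ V] conjI V(1,3,4) subset_trans [OF CB V(2)])
qed

definition chart_at :: "'a topology => 'a => 'a set => bool" where
 "chart_at T x S \<longleftrightarrow> openin T S & x : S & (EX q U h g. openin (Euclidean_space q) U &
  homeomorphic_maps (subtop T S) (subtop (Euclidean_space q) U) h g)"

lemma tame_in_chart:
 assumes ch: "chart_at T x S" and C: "compactin T C" "C <= S"
 shows "tame T C"
 unfolding tame_def
proof (intro allI impI)
 fix O1 assume O1: "openin T O1 & C <= O1"
 obtain q U h g where S: "openin T S" and U: "openin (Euclidean_space q) U"
  and hg: "homeomorphic_maps (subtop T S) (subtop (Euclidean_space q) U) h g"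
  using ch unfolding chart_at_def by blast
 let ?E = "Euclidean_space q"
 have SO: "S <= topspace T" using S by (rule openin_subset)
 have UO: "U <= topspace ?E" using U by (rule openin_subset)
 have tS: "topspace (subtop T S) = S" "topspace (subtop ?E U) = U"
  using SO UO by auto
 have h: "continuous_map (subtop T S) (subtop ?E U) h" and g: "continuous_map (subtop ?E U) (subtop T S) g"
  and gh: "!!x. x : S ==> g (h x) = x" and hg': "!!y. y : U ==> h (g y) = y"
  using hg unfolding homeomorphic_maps_def tS by blast+
 have hS: "h x : U" if "x : S" for x using continuous_map_funspace [OF h] that unfolding tS by blast
 have gU: "g y : S" if "y : U" for y using continuous_map_funspace [OF g] that unfolding tS by blast
 define O2 where "O2 = O1 Int S"
 have O2: "openin T O2" "C <= O2" "O2 <= S" using O1 S C(2) by (auto simp: O2_def)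
 have "compactin (subtop T S) C" using C by (simp add: compactin_subtopology)
 hence "compactin (subtop ?E U) (h ` C)" using h by (rule image_compactin)
 hence hC: "compactin ?E (h ` C)" by (simp add: compactin_subtopology)
 have "openin (subtop T S) O2" using O2 S by (simp add: openin_open_subtopology)
 hence "openin (subtop ?E U) {y : topspace (subtop ?E U). g y : O2}"
  using g by (intro openin_continuous_map_preimage)
 moreover have "{y : topspace (subtop ?E U). g y : O2} = h ` O2"
  unfolding tS using hS hg' gh O2(3) by force
 ultimately have hO2: "openin ?E (h ` O2)" using U by (simp add: openin_open_subtopology)
 have "h ` C <= h ` O2" using O2(2) by blast
 then obtain W where W: "openin ?E W" "h ` C <= W" "W <= h ` O2" "!!p. finq p ?E W (h ` O2)"
  using tame_Euclidean_compact [OF hC] hO2 unfolding tame_def by meson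
 define V where "V = {x : S. h x : W}"
 have WU: "W <= U" using W(3) hS O2(3) by blast
 have "openin (subtop ?E U) W" using W(1) U WU by (simp add: openin_open_subtopology)
 hence "openin (subtop T S) V"
  using openin_continuous_map_preimage [OF h] unfolding tS V_def by blast
 hence oV: "openin T V" using S by (simp add: openin_open_subtopology)
 have CV: "C <= V" using C(2) W(2) unfolding V_def by blast
 have VO: "V <= O2"
 proof
  fix x assume x: "x : V"
  then obtain y where y: "y : O2" "h x = h y" using W(3) unfolding V_def by blast
  have "x = g (h x)" "y = g (h y)" using gh x y(1) O2(3) unfolding V_def by auto
  thus "x : O2" using y by simp
 qed
 have "finq p T V O2" for p
 proof (rule finq_transport [OF W(4)])
  have "continuous_map (subtop (subtop T S) V) (subtop (subtop ?E U) W) h"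
  using continuous_map_from_subtopology [OF h, of V]
  by (rule continuous_map_into_subtopology) (auto simp: V_def)
  moreover have "S Int V = V" "U Int W = W" using WU unfolding V_def by blast+
  ultimately show "continuous_map (subtop T V) (subtop ?E W) h"
  by (simp add: subtopology_subtopology)
  have hO: "h ` O2 <= U" using hS O2(3) by blast
  have "continuous_map (subtop (subtop ?E U) (h ` O2)) (subtop (subtop T S) O2) g"
  using continuous_map_from_subtopology [OF g, of "h ` O2"]
  by (rule continuous_map_into_subtopology) (use gh O2(3) in auto)
  moreover have "S Int O2 = O2" "U Int h ` O2 = h ` O2" using O2(3) hO by blast+
  ultimately show "continuous_map (subtop ?E (h ` O2)) (subtop T O2) g"
  by (simp add: subtopology_subtopology)
  show "g (h x) = x" if "x : V" for x using that gh unfolding V_def by blast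
 qed
 thus "EX V. openin T V & C <= V & V <= O1 & (ALL p. finq p T V O1)"
  using oV CV VO finq_mono unfolding O2_def by (metis inf_le1 order_refl order_trans)
qed

text \<open>Compactness gives a finite cover by compact subsets of charts. Each compact subset of these is tame by
transport from Euclidean space, hence so is the union by Mayer-Vietoris. The only neighbourhood of
the whole space is the space itself.\<close>

theorem locally_Euclidean_finq:
 assumes K: "compact_space T" and H: "Hausdorff_space T"
  and ch: "!!x. x : topspace T ==> EX S. chart_at T x S"
 shows "finq p T (topspace T) (topspace T)"
proof -
 have "EX S V C. chart_at T x S & openin T V & closedin T C & x : V & V <= C & C <= S" if x: "x : topspace T" for x
 proof -
  obtain S where S: "chart_at T x S" using ch [OF x] by blast
  hence "openin T S & x : S" unfolding chart_at_def by blast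
  moreover have "neighbourhood_base_of (closedin T) T"
  using compact_Hausdorff_imp_regular_space [OF K H] by (simp add: neighbourhood_base_of_closedin)
  ultimately obtain V C where "openin T V" "closedin T C" "x : V" "V <= C" "C <= S"
  unfolding neighbourhood_base_of by meson
  thus ?thesis using S by blast
 qed
 hence "ALL x:topspace T. EX S V C. chart_at T x S & openin T V & closedin T C & x : V & V <= C & C <= S"
  by blast
 then obtain S V C where "ALL x:topspace T. chart_at T x (S x) & openin T (V x) & closedin T (C x)
  & x : V x & V x <= C x & C x <= S x"
  unfolding bchoice_iff by blast
 hence SVC: "!!x. x : topspace T ==> chart_at T x (S x)" "!!x. x : topspace T ==> openin T (V x)"
  "!!x. x : topspace T ==> closedin T (C x)" "!!x. x : topspace T ==> x : V x"
  "!!x. x : topspace T ==> V x <= C x" "!!x. x : topspace T ==> C x <= S x"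
  by simp_all
 have "EX \<F>. finite \<F> & \<F> <= V ` topspace T & topspace T <= \<Union>\<F>"
  using K unfolding compact_space_def
  by (rule compactinD) (use SVC(2,4) in blast)+
 then obtain \<F> where FF: "finite \<F>" "\<F> <= V ` topspace T" "topspace T <= \<Union>\<F>" by blast
 obtain F where "F <= topspace T" "finite F" "\<F> = V ` F" using finite_subset_image [OF FF(1,2)] by blast
 hence F: "finite F" "F <= topspace T" "topspace T <= (UN x:F. V x)" using FF(3) by simp_all
 have cC: "compactin T (C x)" if "x : F" for x
  using closedin_compact_space [OF K] SVC(3) F(2) that by blast
 have ty: "tame T L" if "x : F" "compactin T L" "L <= C x" for x L
 proof (rule tame_in_chart [of T x "S x"])
  have x: "x : topspace T" using F(2) that(1) by blast
  show "chart_at T x (S x)" using SVC(1) [OF x] .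
  show "L <= S x" using SVC(6) [OF x] that(3) by blast
 qed (rule that(2))
 have "tame T (\<Union> (C ` F))"
 proof (rule tame_Union [OF H])
  show "tame T L" if "D : C ` F" "compactin T L" "L <= D" for D L
  using that ty by blast
 qed (use F(1) cC in auto)
 moreover have "\<Union> (C ` F) = topspace T"
 proof
  show "\<Union> (C ` F) <= topspace T" using closedin_subset [OF SVC(3)] F(2) by blast
  show "topspace T <= \<Union> (C ` F)" using F(2,3) SVC(5) by blast
 qed
 ultimately have "tame T (topspace T)" by simp
 hence "EX W. openin T W & topspace T <= W & W <= topspace T & (ALL p. finq p T W (topspace T))"
  unfolding tame_def by simp
 then obtain W where W: "topspace T <= W" "W <= topspace T" "ALL p. finq p T W (topspace T)"
  by blast
 thus ?thesis by (simp add: subset_antisym)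
qed

section \<open>Finite disjoint unions and Betti numbers\<close>

lemma lookup_restr: "lookup (restr P z) s = (if P s then lookup z s else 0)"
proof (cases "P s")
 case True
 hence "s ~: keys (restr (%s. ~ P s) z)" using keys_restr [of "%s. ~ P s" z] by blast
 hence "lookup (restr (%s. ~ P s) z) s = 0" by (simp add: in_keys_iff)
 moreover have "lookup (restr P z) s + lookup (restr (%s. ~ P s) z) s = lookup z s"
  unfolding lookup_add [symmetric] restr_split ..
 ultimately show ?thesis using True by (simp only: add_0_right if_True)
next
 case False
 hence "s ~: keys (restr P z)" using keys_restr [of P z] by blast
 hence "lookup (restr P z) s = 0" by (simp add: in_keys_iff)
 thus ?thesis using False by (simp only: if_False)
qed

locale pieces =
 fixes T :: "'a topology" and I :: "'i set" and S :: "'i => 'a set"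
 assumes fin: "finite I" and closed: "!!i. i : I ==> closedin T (S i)"
  and disj: "!!i j. i : I ==> j : I ==> i ~= j ==> S i Int S j = {}"
  and cover: "topspace T = (UN i:I. S i)"
begin

lemma simplex_in_piece:
 assumes s: "singular_simplex p T s"
 shows "EX i:I. s : standard_simplex p \<rightarrow> S i"
proof -
 let ?P = "subtop (powertop_real UNIV) (standard_simplex p)"
 have sc: "continuous_map ?P T s" using s by (simp add: singular_simplex_def)
 have "connectedin ?P (standard_simplex p)"
  using connectedin_standard_simplex by (simp add: connectedin_subtopology)
 hence con: "connectedin T (s ` standard_simplex p)"
  using sc by (rule connectedin_continuous_map_image [rotated])
 obtain v where v: "v : standard_simplex p" using nonempty_standard_simplex by blast
 have "s v : topspace T" using connectedin_subset_topspace [OF con] v by blast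
 then obtain i where i: "i : I" "s v : S i" using cover by blast
 have "closedin T (UN j:I - {i}. S j)" using fin closed by (intro closedin_Union) auto
 moreover have "topspace T - (UN j:I - {i}. S j) = S i"
  unfolding cover using i(1) disj by blast
 ultimately have "openin T (S i)" by (metis closedin_def)
 hence "s ` standard_simplex p <= S i | disjnt (s ` standard_simplex p) (S i)"
  using connectedin_clopen_cases [OF con closed [OF i(1)]] by blast
 hence "s ` standard_simplex p <= S i" using v i(2) unfolding disjnt_def by blast
 thus ?thesis using i(1) by blast
qed

abbreviation part :: "nat => 'i => 'a chain2 => 'a chain2" where
 "part p i \<equiv> restr (%s. s : standard_simplex p \<rightarrow> S i)"

lemma part_chains2:
 assumes "z : chains2 p T" shows "part p i z : chains2 p (subtop T (S i))"
proof -
 have "keys (part p i z) <= {s : keys z. s : standard_simplex p \<rightarrow> S i}" by (rule keys_restr)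
 thus ?thesis using assms unfolding chains2_def singular_simplex_subtopology by blast
qed

lemma part_boundary2:
 assumes z: "z : chains2 (Suc p) T" and i: "i : I"
 shows "part p i (boundary2 (Suc p) z) = boundary2 (Suc p) (part (Suc p) i z)"
proof -
 let ?P = "%s. s : standard_simplex (Suc p) \<rightarrow> S i"
 let ?z' = "restr (%s. ~ ?P s) z"
 have "?z' : chains2 (Suc p) (subtop T (- S i))"
 proof -
  have "s : standard_simplex (Suc p) \<rightarrow> - S i" if s: "s : keys z" "~ ?P s" for s
  proof -
  obtain j where j: "j : I" "s : standard_simplex (Suc p) \<rightarrow> S j"
  using simplex_in_piece s(1) z unfolding chains2_def by blast
  hence "j ~= i" using s(2) by blast
  show ?thesis using disj [OF j(1) i `j ~= i`] j(2) by blast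
  qed
  thus ?thesis
  using keys_restr [of "%s. ~ ?P s" z] z unfolding chains2_def singular_simplex_subtopology by blast
 qed
 hence b: "boundary2 (Suc p) ?z' : chains2 p (subtop T (- S i))"
  using boundary2_chains2 by fastforce
 have b0: "part p i (boundary2 (Suc p) ?z') = 0"
 proof (rule restr_none)
  fix s assume "s : keys (boundary2 (Suc p) ?z')"
  hence "s : standard_simplex p \<rightarrow> - S i" using b unfolding chains2_def singular_simplex_subtopology by blast
  thus "s ~: standard_simplex p \<rightarrow> S i" using nonempty_standard_simplex [of p] by blast
 qed
 have "boundary2 (Suc p) (part (Suc p) i z) : chains2 p (subtop T (S i))"
  using boundary2_chains2 [OF part_chains2 [OF z]] by simp
 hence b1: "part p i (boundary2 (Suc p) (part (Suc p) i z)) = boundary2 (Suc p) (part (Suc p) i z)"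
  unfolding chains2_def singular_simplex_subtopology by (intro restr_all) blast
 have "part p i (boundary2 (Suc p) z) = part p i (boundary2 (Suc p) (part (Suc p) i z + ?z'))"
  by (simp only: restr_split)
 thus ?thesis by (simp only: boundary2_add restr_add b0 b1 add_0_right)
qed

lemma sum_parts:
 assumes z: "z : chains2 p T" shows "(SUM i:I. part p i z) = z"
proof (rule poly_mapping_eqI)
 fix s
 have "lookup (SUM i:I. part p i z) s = (SUM i:I. if s : standard_simplex p \<rightarrow> S i then lookup z s else 0)"
  by (simp add: lookup_sum lookup_restr)
 also have "... = lookup z s"
 proof (cases "s : keys z")
  case True
  then obtain i where i: "i : I" "s : standard_simplex p \<rightarrow> S i"
  using simplex_in_piece z unfolding chains2_def by blast
  have "(if s : standard_simplex p \<rightarrow> S j then lookup z s else 0) = (if j = i then lookup z s else 0)"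
  if j: "j : I" for j
  proof (cases "j = i")
  case False
  hence "s ~: standard_simplex p \<rightarrow> S j" using disj [OF j i(1)] i(2) nonempty_standard_simplex [of p] by blast
  thus ?thesis using False by simp
  qed (use i in simp)
  thus ?thesis using i(1) fin by (simp cong: sum.cong)
 next
  case False
  hence "lookup z s = 0" by (simp add: in_keys_iff)
  thus ?thesis by (simp only: if_cancel sum.neutral_const)
 qed
 finally show "lookup (SUM i:I. part p i z) s = lookup z s" .
qed

lemma part_cycles2:
 assumes z: "z : cycles2 p T" and i: "i : I" shows "part p i z : cycles2 p (subtop T (S i))"
proof -
 have z': "z : chains2 p T" "boundary2 p z = 0" using z by (auto simp: cycles2_def)
 have "boundary2 p (part p i z) = 0"
 proof (cases p)
  case (Suc q)
  thus ?thesis using part_boundary2 [OF _ i, of z q] z' by (simp add: restr_def)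
 qed (simp add: boundary2_def)
 thus ?thesis using part_chains2 [OF z'(1)] by (simp add: cycles2_def)
qed

lemma boundaries2_sub: "boundaries2 p (subtop T A) <= boundaries2 p T"
 unfolding boundaries2_def chains2_def singular_simplex_subtopology by blast

lemma cycles2_sub: "cycles2 p (subtop T A) <= cycles2 p T"
 unfolding cycles2_def chains2_def singular_simplex_subtopology by blast

lemma finite_classes:
 assumes f: "!!i. i : I ==> finq p T (S i) (S i)"
 obtains C where "finite C" "!!z. z : cycles2 p T ==> EX c:C. z + c : boundaries2 p T"
proof -
 have "ALL i:I. EX C. finite C & (ALL z:cycles2 p (subtop T (S i)). EX c:C. z + c : boundaries2 p (subtop T (S i)))"
  using f unfolding finq_def by blast
 then obtain C where C: "ALL i:I. finite (C i) & (ALL z:cycles2 p (subtop T (S i)). EX c:C i. z + c : boundaries2 p (subtop T (S i)))"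
  unfolding bchoice_iff by blast
 let ?C = "(%c. SUM i:I. c i) ` (PiE I C)"
 show thesis
 proof (rule that)
  show "finite ?C" using C fin by (intro finite_imageI finite_PiE) auto
  fix z assume z: "z : cycles2 p T"
  have "ALL i:I. EX c. c : C i & part p i z + c : boundaries2 p (subtop T (S i))"
  using C part_cycles2 [OF z] by blast
  then obtain c where c: "ALL i:I. c i : C i & part p i z + c i : boundaries2 p (subtop T (S i))"
  unfolding bchoice_iff by blast
  have "(SUM i:I. part p i z + c i) : boundaries2 p T"
  by (intro boundaries2_sum) (use c boundaries2_sub in blast)
  moreover have "(SUM i:I. part p i z + c i) = z + (SUM i:I. restrict c I i)"
  using sum_parts [of z p] z by (simp add: sum.distrib cycles2_def)
  moreover have "(SUM i:I. restrict c I i) : ?C" using c by (intro imageI) auto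
  ultimately show "EX c:?C. z + c : boundaries2 p T" by (intro bexI [of _ "SUM i:I. restrict c I i"]) simp_all
 qed
qed

text \<open>The component in a single piece of a chain bounding the sum would bound the given cycle there.\<close>

lemma independent_pieces:
 assumes Q: "Q <= I" and g: "!!i. i : Q ==> g i : cycles2 p (subtop T (S i))"
  "!!i. i : Q ==> g i ~: boundaries2 p (subtop T (S i))"
  and R: "R <= Q" "R ~= {}"
 shows "sum g R ~: boundaries2 p T"
proof
 assume "sum g R : boundaries2 p T"
 then obtain d where d: "d : chains2 (Suc p) T" "sum g R = boundary2 (Suc p) d"
  unfolding boundaries2_def by blast
 obtain i where i: "i : R" using R(2) by blast
 have gk: "keys (g j) <= {s. singular_simplex p T s & s : standard_simplex p \<rightarrow> S j}" if "j : R" for j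
  using g(1) [of j] that R(1) unfolding cycles2_def chains2_def singular_simplex_subtopology by blast
 have gi: "part p i (g j) = (if j = i then g i else 0)" if j: "j : R" for j
 proof (cases "j = i")
  case True
  thus ?thesis using gk [OF j] by (auto intro: restr_all)
 next
  case False
  have "part p i (g j) = 0"
  proof (rule restr_none)
  fix s assume "s : keys (g j)"
  hence "s : standard_simplex p \<rightarrow> S j" using gk [OF j] by blast
  thus "s ~: standard_simplex p \<rightarrow> S i"
  using disj [of j i] j i R Q False nonempty_standard_simplex [of p] by blast
  qed
  thus ?thesis using False by simp
 qed
 have "part p i (sum g R) = (SUM j:R. part p i (g j))"
  by (simp add: restr_def ext2_sum)
 also have "... = (SUM j:R. if j = i then g i else 0)" using gi by (rule sum.cong [OF refl])
 also have "... = g i" using i finite_subset [OF R(1) finite_subset [OF Q fin]] by simp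
 finally have "g i = boundary2 (Suc p) (part (Suc p) i d)"
  using part_boundary2 [OF d(1), of i] d(2) i R(1) Q by auto
 hence "g i : boundaries2 p (subtop T (S i))"
  unfolding boundaries2_def using part_chains2 [OF d(1)] by simp
 thus False using g(2) i R(1) by blast
qed

end

lemma sum_symdiff2:
 fixes f :: "'i => ('a \<Rightarrow>\<^sub>0 bit)"
 assumes "finite A" "finite B"
 shows "sum f ((A - B) Un (B - A)) = sum f A + sum f B"
proof -
 have "sum f A = sum f (A - B) + sum f (A Int B)"
  using sum.Int_Diff [OF assms(1), of f B] by (simp add: add.commute)
 moreover have "sum f B = sum f (B - A) + sum f (A Int B)"
  using sum.Int_Diff [OF assms(2), of f A] by (simp add: add.commute Int_commute)
 moreover have "sum f ((A - B) Un (B - A)) = sum f (A - B) + sum f (B - A)"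
  using assms by (intro sum.union_disjoint) auto
 ultimately have "sum f A + sum f B = sum f ((A - B) Un (B - A)) + (sum f (A Int B) + sum f (A Int B))"
  by (simp only: ac_simps)
 thus ?thesis by simp
qed

lemma subspace2I:
 assumes "0 : V" "!!a b. a : V ==> b : V ==> a + b : V"
 shows "chain2.subspace V"
proof (rule chain2.subspaceI)
 fix c :: bit and x assume "x : V"
 thus "Poly_Mapping.map ((*) c) x : V"
  using assms(1) chain2.scale_zero_left [of x] chain2.scale_one [of x] by (cases c) auto
qed (use assms in auto)

lemma quotient_basis_exists:
 assumes "W <= V" shows "EX B. quotient_basis V W B"
proof -
 obtain BW where BW: "BW <= W" "chain2.independent BW" "W <= chain2.span BW"
  using chain2.maximal_independent_subset [of W] by metis
 have BV: "BW <= V" using BW(1) assms by (rule subset_trans)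
 obtain B' where B': "BW <= B'" "B' <= V" "chain2.independent B'" "V <= chain2.span B'"
  using chain2.maximal_independent_subset_extend [OF BV BW(2)] by metis
 have "V <= chain2.span ((B' - BW) Un W)"
  using B'(4) chain2.span_mono [of B' "(B' - BW) Un W"] BW(1) by blast
 moreover have "b ~: chain2.span ((B' - BW - {b}) Un W)" if b: "b : B' - BW" for b
 proof
  assume bs: "b : chain2.span ((B' - BW - {b}) Un W)"
  have "W <= chain2.span (B' - {b})"
  using BW(3) chain2.span_mono [of BW "B' - {b}"] B'(1) b by blast
  moreover have "B' - BW - {b} <= chain2.span (B' - {b})" using chain2.span_superset [of "B' - {b}"] by blast
  ultimately have "chain2.span ((B' - BW - {b}) Un W) <= chain2.span (B' - {b})"
  by (intro chain2.span_minimal chain2.subspace_span) simp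
  thus False using bs B'(3) b unfolding chain2.dependent_def by blast
 qed
 ultimately show ?thesis using B'(2) unfolding quotient_basis_def by (intro exI [of _ "B' - BW"]) auto
qed

text \<open>Finitely many classes modulo boundaries force every basis of the homology to be finite, so that its
cardinality is the true dimension. Distinct subsets of Q give distinct classes and distinct subsets of
the basis represent all classes, so 2 ^ card Q <= 2 ^ card B.\<close>

lemma betti2_ge:
 assumes fin: "finite C" "!!z. z : cycles2 p T ==> EX c:C. z + c : boundaries2 p T"
  and Q: "finite Q" "!!i. i : Q ==> g i : cycles2 p T"
  "!!R. R <= Q ==> R ~= {} ==> sum g R ~: boundaries2 p T"
 shows "card Q <= betti2 p T"
proof -
 let ?V = "cycles2 p T" and ?W = "boundaries2 p T"
 define B where "B = (SOME B. quotient_basis ?V ?W B)"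
 have "quotient_basis ?V ?W B"
  unfolding B_def using quotient_basis_exists [OF boundaries2_cycles2 [of p T]] by (rule someI_ex)
 hence B: "B <= ?V" "?V <= chain2.span (B Un ?W)" "!!b. b : B ==> b ~: chain2.span ((B - {b}) Un ?W)"
  unfolding quotient_basis_def by blast+
 have "ALL b:B. EX c. c : C & b + c : ?W" using B(1) fin(2) by blast
 then obtain c where c: "ALL b:B. c b : C & b + c b : ?W" unfolding bchoice_iff by blast
 have "inj_on c B"
 proof (rule inj_onI, rule ccontr)
  fix b b' assume b: "b : B" "b' : B" "c b = c b'" "b ~= b'"
  have "(b + c b) + (b' + c b') : ?W" using c b boundaries2_add by blast
  also have "(b + c b) + (b' + c b') = b + b'" unfolding b(3) by (simp only: ac_simps chain2_cancel chain2_double add_0_right add_0_left)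
  finally have "(b + b') + b' : chain2.span ((B - {b}) Un ?W)"
  using b by (intro chain2.span_add chain2.span_base) auto
  also have "(b + b') + b' = b" by (simp only: ac_simps chain2_cancel)
  finally show False using B(3) b(1) by blast
 qed
 moreover have "finite (c ` B)" using c fin(1) by (meson finite_subset image_subsetI)
 ultimately have fB: "finite B" by (rule finite_imageD [rotated])
 \<comment> \<open>Over the field with two elements linear combinations are subset sums.\<close>
 define U where "U = {x. EX F. F <= B & x + \<Sum>F : ?W}"
 have "chain2.subspace U"
 proof (rule subspace2I)
  show "0 : U" unfolding U_def by (intro CollectI exI [of _ "{}"]) simp
  fix x y assume "x : U" "y : U"
  then obtain F G where FG: "F <= B" "x + \<Sum>F : ?W" "G <= B" "y + \<Sum>G : ?W" unfolding U_def by blast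
  have "(x + \<Sum>F) + (y + \<Sum>G) : ?W" using FG(2,4) by (rule boundaries2_add)
  also have "(x + \<Sum>F) + (y + \<Sum>G) = (x + y) + (\<Sum>F + \<Sum>G)" by (simp only: ac_simps)
  also have "\<Sum>F + \<Sum>G = \<Sum>((F - G) Un (G - F))"
  using sum_symdiff2 [of F G "%x. x"] finite_subset [OF FG(1) fB] finite_subset [OF FG(3) fB] by simp
  finally have "(x + y) + \<Sum>((F - G) Un (G - F)) : ?W" .
  moreover have "(F - G) Un (G - F) <= B" using FG(1,3) by blast
  ultimately show "x + y : U" unfolding U_def by blast
 qed
 moreover have "B Un ?W <= U"
 proof
  fix x assume "x : B Un ?W"
  thus "x : U"
  proof
  assume "x : B"
  thus ?thesis unfolding U_def by (intro CollectI exI [of _ "{x}"]) simp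
  next
  assume "x : ?W"
  thus ?thesis unfolding U_def by (intro CollectI exI [of _ "{}"]) simp
  qed
 qed
 ultimately have "?V <= U" using B(2) chain2.span_minimal by blast
 moreover have "sum g R : ?V" if "R : Pow Q" for R
  by (rule cycles2_sum) (use Q(2) that in blast)
 ultimately have "ALL R:Pow Q. EX F. F <= B & sum g R + \<Sum>F : ?W"
  unfolding U_def by blast
 then obtain F where F: "ALL R:Pow Q. F R <= B & sum g R + \<Sum>(F R) : ?W" unfolding bchoice_iff by blast
 have "inj_on F (Pow Q)"
 proof (rule inj_onI, rule ccontr)
  fix R R' assume R: "R : Pow Q" "R' : Pow Q" "F R = F R'" "R ~= R'"
  have "(sum g R + \<Sum>(F R)) + (sum g R' + \<Sum>(F R')) : ?W" using bspec [OF F R(1)] bspec [OF F R(2)] by (intro boundaries2_add [of "sum g R + \<Sum>(F R)"]) simp_all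
  also have "(sum g R + \<Sum>(F R)) + (sum g R' + \<Sum>(F R')) = sum g R + sum g R'"
  unfolding R(3) by (simp only: ac_simps chain2_cancel chain2_double add_0_right add_0_left)
  also have "... = sum g ((R - R') Un (R' - R))"
  using R(1,2) Q(1) by (intro sum_symdiff2 [symmetric]) (auto intro: finite_subset)
  finally have "sum g ((R - R') Un (R' - R)) : ?W" .
  thus False using Q(3) [of "(R - R') Un (R' - R)"] R by blast
 qed
 hence "card (Pow Q) <= card (Pow B)"
  using F fB by (intro card_inj_on_le [of F]) auto
 hence "(2::nat) ^ card Q <= 2 ^ card B" using Q(1) fB by (simp add: card_Pow)
 hence "card Q <= card B" by (rule power_le_imp_le_exp [rotated]) simp
 thus ?thesis unfolding betti2_def B_def .
qed

theorem (in pieces) betti2_ge_pieces: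
 assumes "!!i. i : I ==> finq p T (S i) (S i)" "Q <= I"
  and "!!i. i : Q ==> EX g:cycles2 p (subtop T (S i)). g ~: boundaries2 p (subtop T (S i))"
 shows "card Q <= betti2 p T"
proof -
 obtain C where C: "finite C" "!!z. z : cycles2 p T ==> EX c:C. z + c : boundaries2 p T"
  using assms(1) finite_classes by blast
 have "ALL i:Q. EX g. g : cycles2 p (subtop T (S i)) & g ~: boundaries2 p (subtop T (S i))"
  using assms(3) by blast
 then obtain g where g: "ALL i:Q. g i : cycles2 p (subtop T (S i)) & g i ~: boundaries2 p (subtop T (S i))"
  unfolding bchoice_iff by blast
 show ?thesis
 proof (rule betti2_ge [OF C, where g = g])
  show "finite Q" using assms(2) fin by (rule finite_subset)
  show "g i : cycles2 p T" if "i : Q" for i using g that cycles2_sub by blast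
  show "sum g R ~: boundaries2 p T" if "R <= Q" "R ~= {}" for R
  using independent_pieces [OF assms(2) _ _ that] g by blast
 qed
qed

section \<open>Evaluation of polynomials\<close>

definition mev :: "(nat \<Rightarrow>\<^sub>0 nat) => (nat => 'a::comm_semiring_1) => 'a" where
 "mev m x = (PROD i:keys m. x i ^ lookup m i)"

lemma mev_superset: "finite S ==> keys m <= S ==> mev m x = (PROD i:S. x i ^ lookup m i)"
 unfolding mev_def by (rule prod.mono_neutral_left) (auto simp: in_keys_iff)

lemma mev_0 [simp]: "mev 0 x = 1"
 by (simp add: mev_def)

lemma mev_single: "mev (single i k) x = x i ^ k"
 by (simp add: mev_superset [of "{i}"])

lemma mev_add: "mev (m + m') x = mev m x * mev m' x"
proof -
 let ?S = "keys m Un keys m'"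
 have "mev (m + m') x = (PROD i:?S. x i ^ lookup (m + m') i)"
  by (rule mev_superset) (simp_all add: Poly_Mapping.keys_add)
 also have "... = (PROD i:?S. x i ^ lookup m i) * (PROD i:?S. x i ^ lookup m' i)"
  by (simp add: lookup_add power_add prod.distrib)
 also have "... = mev m x * mev m' x"
  by (simp add: mev_superset [of ?S m] mev_superset [of ?S m'])
 finally show ?thesis .
qed

lemma peval_eq: "peval F x = (SUM m:keys F. complex_of_real (lookup F m) * mev m x)"
 by (simp add: peval_def mev_def)

lemma peval_superset: "finite S ==> keys F <= S ==>
  peval F x = (SUM m:S. complex_of_real (lookup F m) * mev m x)"
 unfolding peval_eq by (rule sum.mono_neutral_left) (auto simp: in_keys_iff)

lemma peval_0 [simp]: "peval 0 x = 0"
 by (simp add: peval_eq)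

lemma peval_single: "peval (single m c) x = complex_of_real c * mev m x"
 by (simp add: peval_superset [of "{m}"])

lemma peval_add: "peval (F + G) x = peval F x + peval G x"
proof -
 let ?S = "keys F Un keys G"
 have "peval (F + G) x = (SUM m:?S. complex_of_real (lookup (F + G) m) * mev m x)"
  by (rule peval_superset) (simp_all add: Poly_Mapping.keys_add)
 also have "... = peval F x + peval G x"
  by (simp add: peval_superset [of ?S F] peval_superset [of ?S G] lookup_add distrib_right sum.distrib)
 finally show ?thesis .
qed

lemma peval_sum: "peval (sum f I) x = (SUM i:I. peval (f i) x)"
 by (induction I rule: infinite_finite_induct) (auto simp: peval_add)

lemma peval_minus: "peval (- F) x = - peval F x"
 using peval_add [of F "- F" x] by (simp add: eq_neg_iff_add_eq_0 add.commute)

lemma peval_diff: "peval (F - G) x = peval F x - peval G x"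
 using peval_add [of F "- G" x] by (simp add: peval_minus)

lemma rpoly_expand: "(F::rpoly) = (SUM m:keys F. single m (lookup F m))"
proof (rule poly_mapping_eqI)
 fix k
 show "lookup F k = lookup (SUM m:keys F. single m (lookup F m)) k"
  by (auto simp: lookup_sum lookup_single when_def in_keys_iff)
qed

lemma rpoly_bilinear_expand:
 "(F::rpoly) * G = (SUM m:keys F. SUM m':keys G.
  single (m + m') (lookup F m * lookup G m'))"
proof -
 have "F * G = (SUM m:keys F. single m (lookup F m)) *
  (SUM m:keys G. single m (lookup G m))"
  using rpoly_expand [of F] rpoly_expand [of G] by simp
 thus ?thesis by (simp add: sum_product mult_single)
qed

lemma peval_mult: "peval (F * G) x = peval F x * peval G x"
 unfolding rpoly_bilinear_expand peval_sum peval_single mev_add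
 by (simp add: peval_eq sum_product mult_ac)

lemma peval_const: "peval (single 0 c) x = complex_of_real c"
 by (simp add: peval_single)

lemma peval_1 [simp]: "peval 1 x = 1"
 using peval_const [of 1 x] by simp

lemma peval_power: "peval (F ^ n) x = peval F x ^ n"
 by (induction n) (auto simp: peval_mult)

lemma peval_prod: "peval (prod f I) x = (PROD i:I. peval (f i) x)"
 by (induction I rule: infinite_finite_induct) (auto simp: peval_mult)

definition Xv :: "nat => rpoly" where
 "Xv i = single (single i 1) 1"

lemma peval_Xv [simp]: "peval (Xv i) x = x i"
 by (simp add: Xv_def peval_single mev_single)

definition psub :: "(nat => rpoly) => rpoly => rpoly" where
 "psub F G = (SUM m:keys G. single 0 (lookup G m) * mev m F)"

lemma peval_psub: "peval (psub F G) x = peval G (%i. peval (F i) x)"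
 unfolding psub_def peval_sum peval_mult peval_const
 by (simp add: mev_def peval_prod peval_power peval_eq [of G])

section \<open>Forms\<close>

definition mdeg :: "(nat \<Rightarrow>\<^sub>0 nat) => nat" where
 "mdeg m = (SUM i:keys m. lookup m i)"

lemma mdeg_superset: "finite S ==> keys m <= S ==> mdeg m = (SUM i:S. lookup m i)"
 unfolding mdeg_def by (rule sum.mono_neutral_left) (auto simp: in_keys_iff)

lemma mdeg_add: "mdeg (m + m') = mdeg m + mdeg m'"
proof -
 let ?S = "keys m Un keys m'"
 have "mdeg (m + m') = (SUM i:?S. lookup (m + m') i)"
  by (rule mdeg_superset) (simp_all add: Poly_Mapping.keys_add)
 thus ?thesis
  by (simp add: mdeg_superset [of ?S m] mdeg_superset [of ?S m'] lookup_add sum.distrib)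
qed

lemma forms_iff: "F : forms N d \<longleftrightarrow> (ALL m:keys F. keys m <= {..N} & mdeg m = d)"
 by (simp add: forms_def mdeg_def)

lemma forms_0 [simp]: "0 : forms N d"
 by (simp add: forms_iff)

lemma forms_single: "keys m <= {..N} ==> mdeg m = d ==> single m c : forms N d"
 by (simp add: forms_iff)

lemma forms_const: "single 0 c : forms N 0"
 by (rule forms_single) (simp_all add: mdeg_def)

lemma forms_1: "1 : forms N 0"
 using forms_const [of 1 N] by simp

lemma forms_Xv: "i <= N ==> Xv i : forms N 1"
 unfolding Xv_def by (rule forms_single) (simp_all add: mdeg_def)

lemma forms_add: "F : forms N d ==> G : forms N d ==> F + G : forms N d"
 unfolding forms_iff using Poly_Mapping.keys_add [of F G] by blast

lemma forms_minus: "F : forms N d ==> - F : forms N d"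
 by (simp add: forms_iff)

lemma forms_diff: "F : forms N d ==> G : forms N d ==> F - G : forms N d"
 using forms_add [of F N d "- G"] forms_minus by simp

lemma forms_sum: "(!!i. i : I ==> f i : forms N d) ==> sum f I : forms N d"
 by (induction I rule: infinite_finite_induct) (auto simp: forms_add)

lemma forms_mult: "F : forms N d ==> G : forms N e ==> F * G : forms N (d + e)"
 unfolding rpoly_bilinear_expand
proof (intro forms_sum forms_single)
 fix m m' assume *: "F : forms N d" "G : forms N e" "m : keys F" "m' : keys G"
 show "keys (m + m') <= {..N}"
  using * Poly_Mapping.keys_add [of m m'] unfolding forms_iff by blast
 show "mdeg (m + m') = d + e" using * by (simp add: forms_iff mdeg_add)
qed

lemma forms_power: "F : forms N d ==> F ^ k : forms N (k * d)"
 by (induction k) (auto simp: forms_1 forms_mult)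

lemma forms_prod: "(!!i. i : I ==> f i : forms N (e i)) ==> prod f I : forms N (sum e I)"
 by (induction I rule: infinite_finite_induct) (auto simp: forms_1 forms_mult)

lemma forms_scale: "F : forms N d ==> single 0 c * F : forms N d"
 using forms_mult [OF forms_const, of F N d c] by simp

lemma forms_psub:
 assumes G: "G : forms r m" and F: "!!i. i <= r ==> F i : forms N d"
 shows "psub F G : forms N (m * d)"
 unfolding psub_def
proof (intro forms_sum forms_scale)
 fix k assume k: "k : keys G"
 have kr: "keys k <= {..r}" "mdeg k = m" using G k by (auto simp: forms_iff)
 have "mev k F : forms N (SUM i:keys k. lookup k i * d)"
  unfolding mev_def using kr(1) by (intro forms_prod forms_power F) auto
 also have "(SUM i:keys k. lookup k i * d) = m * d"
  unfolding kr(2) [symmetric] mdeg_def sum_distrib_right ..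
 finally show "mev k F : forms N (m * d)" .
qed

lemma mev_scale: "mev m (%i. t * x i) = t ^ mdeg m * mev m x"
 by (simp add: mev_def mdeg_def power_mult_distrib prod.distrib power_sum)

lemma peval_scale: "F : forms N d ==> peval F (%i. t * x i) = t ^ d * peval F x"
 by (simp add: peval_eq mev_scale forms_iff sum_distrib_left mult_ac)

lemma mev_cong: "(!!i. i : keys m ==> x i = y i) ==> mev m x = mev m y"
 by (simp add: mev_def)

lemma peval_cong: "F : forms N d ==> (!!i. i <= N ==> x i = y i) ==> peval F x = peval F y"
 unfolding peval_eq forms_iff by (intro sum.cong refl arg_cong2 [where f = "(*)"] mev_cong) blast

section \<open>Partial derivatives\<close>

lemma pdiff_superset:
 assumes "finite S" "keys F <= S"
 shows "pdiff i F = (SUM m:S. single (m - single i 1)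
  (real (lookup m i) * lookup F m))"
 unfolding pdiff_def by (rule sum.mono_neutral_left) (use assms in \<open>auto simp: in_keys_iff\<close>)

lemma pdiff_add: "pdiff i (F + G) = pdiff i F + pdiff i G"
proof -
 let ?S = "keys F Un keys G"
 have "pdiff i (F + G) = (SUM m:?S. single (m - single i 1)
  (real (lookup m i) * lookup (F + G) m))"
  by (rule pdiff_superset) (simp_all add: Poly_Mapping.keys_add)
 thus ?thesis
  by (simp add: pdiff_superset [of ?S F] pdiff_superset [of ?S G] lookup_add distrib_left single_add sum.distrib)
qed

lemma pdiff_0 [simp]: "pdiff i 0 = 0"
 by (simp add: pdiff_def)

lemma pdiff_sum: "pdiff i (sum f I) = (SUM j:I. pdiff i (f j))"
 by (induction I rule: infinite_finite_induct) (auto simp: pdiff_add)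

lemma pdiff_single: "pdiff i (single m c) =
  single (m - single i 1) (real (lookup m i) * c)"
 by (simp add: pdiff_superset [of "{m}"])

lemma pdiff_const [simp]: "pdiff i (single 0 c) = 0"
 by (simp add: pdiff_single)

lemma pdiff_Xv: "pdiff i (Xv j) = (if i = j then 1 else 0)"
 by (auto simp: Xv_def pdiff_single lookup_single)

lemma single_minus_add:
 assumes "lookup m i ~= (0::nat)"
 shows "(m - single i 1) + m' = (m + m') - single i 1"
proof (rule poly_mapping_eqI)
 fix k
 show "lookup (m - single i 1 + m') k = lookup (m + m' - single i 1) k"
  using assms by (cases "k = i") (auto simp: lookup_add lookup_minus lookup_single)
qed

lemma pdiff_single_mult:
 "pdiff i (single m c * single m' c') =
  pdiff i (single m c) * single m' c' + single m c * pdiff i (single m' c')"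
proof -
 have 1: "pdiff i (single m c) * single m' c'
  = single (m + m' - single i 1) (real (lookup m i) * c * c')"
  by (cases "lookup m i = 0") (auto simp: pdiff_single mult_single single_minus_add [unfolded One_nat_def])
 have 2: "single m c * pdiff i (single m' c')
  = single (m + m' - single i 1) (real (lookup m' i) * c * c')"
  by (cases "lookup m' i = 0")
  (auto simp: pdiff_single mult_single single_minus_add [unfolded One_nat_def] add.commute [of m] mult_ac)
 show ?thesis unfolding 1 2 single_add [symmetric]
  by (simp add: mult_single pdiff_single lookup_add algebra_simps)
qed

lemma pdiff_mult: "pdiff i (F * G) = pdiff i F * G + F * pdiff i G"
proof -
 have "pdiff i (F * G) = pdiff i ((SUM m:keys F. single m (lookup F m)) *
  (SUM m:keys G. single m (lookup G m)))"
  using rpoly_expand [of F] rpoly_expand [of G] by simp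
 also have "... = (SUM m:keys F. pdiff i (single m (lookup F m))) *
  (SUM m:keys G. single m (lookup G m)) +
  (SUM m:keys F. single m (lookup F m)) *
  (SUM m:keys G. pdiff i (single m (lookup G m)))"
  by (simp add: sum_product pdiff_sum pdiff_single_mult sum.distrib)
 also have "... = pdiff i F * G + F * pdiff i G"
  unfolding pdiff_sum [symmetric] rpoly_expand [symmetric] ..
 finally show ?thesis .
qed

lemma pdiff_forms:
 assumes "F : forms N d" shows "pdiff i F : forms N (d - 1)"
 unfolding pdiff_def
proof (rule forms_sum)
 fix m assume m: "m : keys F"
 show "single (m - single i 1) (real (lookup m i) * lookup F m) : forms N (d - 1)"
 proof (cases "lookup m i = 0")
  case False
  let ?m' = "m - single i 1"
  have e: "?m' + single i 1 = m"
  using single_minus_add [OF False, of "single i 1"] by simp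
  have "mdeg ?m' + 1 = mdeg m"
  using mdeg_add [of ?m' "single i 1"] unfolding e by (simp add: mdeg_def)
  moreover have "keys ?m' <= keys m" by (auto simp: in_keys_iff lookup_minus)
  ultimately show ?thesis using assms m by (intro forms_single) (auto simp: forms_iff)
 qed simp
qed

text \<open>The radial derivative of a form is its degree times itself; this puts every point of X into the
kernel of its gradients.\<close>

lemma euler_forms:
 assumes F: "F : forms N d"
 shows "(SUM i<=N. Xv i * pdiff i F) = single 0 (real d) * F"
proof -
 have 1: "Xv i * pdiff i (single m c) = single m (real (lookup m i) * c)" for i m c
 proof (cases "lookup m i = 0")
  case False
  have "single i 1 + (m - single i 1) = m"
  using single_minus_add [OF False, of "single i 1"] by (simp add: add.commute)
  thus ?thesis by (simp add: Xv_def pdiff_single mult_single)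
 qed (simp add: pdiff_single)
 have ss: "(SUM i:I. single m (f i)) = single m (SUM i:I. f i)"
  for I :: "nat set" and m :: "nat \<Rightarrow>\<^sub>0 nat" and f :: rvec
  by (induction I rule: infinite_finite_induct) (auto simp: single_add)
 have "(SUM i<=N. Xv i * pdiff i F) = (SUM i<=N. SUM m:keys F. Xv i * pdiff i (single m (lookup F m)))"
  by (subst (1) rpoly_expand [of F]) (simp add: pdiff_sum sum_distrib_left)
 also have "... = (SUM m:keys F. SUM i<=N. single m (real (lookup m i) * lookup F m))"
  unfolding 1 by (rule sum.swap)
 also have "... = (SUM m:keys F. single 0 (real d) * single m (lookup F m))"
 proof (rule sum.cong [OF refl])
  fix m assume "m : keys F"
  hence "keys m <= {..N}" "mdeg m = d" using F by (auto simp: forms_iff)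
  hence "real d = (SUM i<=N. real (lookup m i))"
  unfolding of_nat_sum [symmetric] of_nat_eq_iff using mdeg_superset [of "{..N}" m] by simp
  thus "(SUM i<=N. single m (real (lookup m i) * lookup F m)) =
  single 0 (real d) * single m (lookup F m)"
  by (simp add: ss mult_single sum_distrib_right)
 qed
 also have "... = single 0 (real d) * F"
  unfolding sum_distrib_left [symmetric] rpoly_expand [symmetric] ..
 finally show ?thesis .
qed

section \<open>Real points\<close>

definition reval :: "rpoly => rvec => real" where
 "reval F x = (SUM m:keys F. lookup F m * mev m x)"

abbreviation cx :: "rvec => nat => complex" where
 "cx x \<equiv> %i. complex_of_real (x i)"

lemma peval_cx: "peval F (cx x) = complex_of_real (reval F x)"
 by (simp add: peval_eq reval_def mev_def)

lemma reval_add: "reval (F + G) x = reval F x + reval G x"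
 using peval_add [of F G "cx x"] unfolding peval_cx of_real_add [symmetric] of_real_eq_iff .

lemma reval_mult: "reval (F * G) x = reval F x * reval G x"
 using peval_mult [of F G "cx x"] unfolding peval_cx of_real_mult [symmetric] of_real_eq_iff .

lemma reval_diff: "reval (F - G) x = reval F x - reval G x"
 using peval_diff [of F G "cx x"] unfolding peval_cx of_real_diff [symmetric] of_real_eq_iff .

lemma reval_power: "reval (F ^ k) x = reval F x ^ k"
 using peval_power [of F k "cx x"] unfolding peval_cx of_real_power [symmetric] of_real_eq_iff .

lemma reval_const [simp]: "reval (single 0 c) x = c"
 using peval_const [of c "cx x"] unfolding peval_cx of_real_eq_iff .

lemma reval_0 [simp]: "reval 0 x = 0"
 by (simp add: reval_def)

lemma reval_1 [simp]: "reval 1 x = 1"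
 using reval_const [of 1 x] by simp

lemma reval_sum: "reval (sum f I) x = (SUM i:I. reval (f i) x)"
 by (induction I rule: infinite_finite_induct) (auto simp: reval_add)

lemma reval_prod: "reval (prod f I) x = (PROD i:I. reval (f i) x)"
 by (induction I rule: infinite_finite_induct) (auto simp: reval_mult)

lemma reval_Xv [simp]: "reval (Xv i) x = x i"
 using peval_Xv [of i "cx x"] unfolding peval_cx of_real_eq_iff .

lemma reval_scale: "F : forms N d ==> reval F (%i. t * x i) = t ^ d * reval F x"
 by (simp add: reval_def mev_scale forms_iff sum_distrib_left mult_ac)

lemma reval_cong: "F : forms N d ==> (!!i. i <= N ==> x i = y i) ==> reval F x = reval F y"
 unfolding reval_def forms_iff by (intro sum.cong refl arg_cong2 [where f = "(*)"] mev_cong) blast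

lemma continuous_on_reval: "continuous_on S (reval F)"
proof -
 have "continuous_on S (%x::nat => real. x i)" for i
  by (rule continuous_on_subset [OF continuous_on_product_coordinates]) simp
 thus ?thesis unfolding reval_def mev_def by (intro continuous_intros)
qed

lemma rpoly_induct [consumes 1, case_names const var add mult]:
 assumes F: "F : forms N d" and const: "!!c. P (single 0 c)" and var: "!!i. i <= N ==> P (Xv i)"
  and add: "!!F G. P F ==> P G ==> P (F + G)" and mult: "!!F G. P F ==> P G ==> P (F * G)"
 shows "P F"
proof -
 have 0: "P 0" and 1: "P 1" using const [of 0] const [of 1] by simp_all
 have pw: "P (Xv i ^ k)" if "i <= N" for i k
  by (induction k) (use var that 1 mult in auto)
 have mon: "P (PROD i:S. Xv i ^ f i)" if "finite S" "S <= {..N}" for S and f :: "nat => nat"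
  using that by (induction S rule: finite_induct) (use 1 mult pw in auto)
 have Xp: "Xv i ^ k = single (single i k) 1" for i k
  by (induction k) (simp_all add: Xv_def mult_single flip: single_add)
 have pm: "(PROD i:S. single (f i) (1::real)) = single (SUM i:S. f i) 1"
  for S :: "nat set" and f :: "nat => (nat \<Rightarrow>\<^sub>0 nat)"
  by (induction S rule: infinite_finite_induct) (simp_all add: mult_single)
 have me: "(SUM i:keys m. single i (lookup m i)) = m" for m :: "nat \<Rightarrow>\<^sub>0 nat"
  by (rule poly_mapping_eqI) (auto simp: lookup_sum lookup_single when_def in_keys_iff)
 have "P (single m (lookup F m))" if m: "m : keys F" for m
 proof -
  have "single m (lookup F m) =
  single 0 (lookup F m) * (PROD i:keys m. Xv i ^ lookup m i)"
  unfolding Xp pm me by (simp add: mult_single)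
  thus ?thesis using F m const mult mon by (simp add: forms_iff)
 qed
 hence "P (SUM m:S. single m (lookup F m))" if "S <= keys F" for S
  using that by (induction S rule: infinite_finite_induct) (use 0 add in auto)
 from this [OF order_refl] show ?thesis unfolding rpoly_expand [symmetric] .
qed

section \<open>Coefficient norm\<close>

text \<open>The norm is submultiplicative and bounds values on boxes; a derivative in degree d increases it at
most by the factor d. The Cauchy-type estimates along curves rest on this growth.\<close>

definition norm1 :: "rpoly => real" where
 "norm1 F = (SUM m:keys F. abs (lookup F m))"

lemma norm1_superset: "finite S ==> keys F <= S ==> norm1 F = (SUM m:S. abs (lookup F m))"
 unfolding norm1_def by (rule sum.mono_neutral_left) (auto simp: in_keys_iff)

lemma norm1_nonneg: "norm1 F >= 0"
 by (simp add: norm1_def sum_nonneg)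

lemma norm1_0 [simp]: "norm1 0 = 0"
 by (simp add: norm1_def)

lemma norm1_single [simp]: "norm1 (single m c) = abs c"
 by (simp add: norm1_superset [of "{m}"])

lemma norm1_add: "norm1 (F + G) <= norm1 F + norm1 G"
proof -
 let ?S = "keys F Un keys G"
 have "norm1 (F + G) = (SUM m:?S. abs (lookup (F + G) m))"
  by (rule norm1_superset) (simp_all add: Poly_Mapping.keys_add)
 also have "... <= (SUM m:?S. abs (lookup F m) + abs (lookup G m))"
  by (intro sum_mono) (simp add: lookup_add)
 also have "... = norm1 F + norm1 G"
  by (simp add: sum.distrib norm1_superset [of ?S F] norm1_superset [of ?S G])
 finally show ?thesis .
qed

lemma norm1_sum: "norm1 (sum f I) <= (SUM i:I. norm1 (f i))"
proof (induction I rule: infinite_finite_induct)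
 case (insert i I)
 thus ?case using norm1_add [of "f i" "sum f I"] by simp
qed auto

lemma norm1_mult: "norm1 (F * G) <= norm1 F * norm1 G"
proof -
 have "norm1 (F * G) <= (SUM m:keys F. SUM m':keys G.
  abs (lookup F m * lookup G m'))"
  unfolding rpoly_bilinear_expand
  by (intro order_trans [OF norm1_sum] sum_mono) simp
 also have "... = norm1 F * norm1 G" by (simp add: norm1_def sum_product abs_mult)
 finally show ?thesis .
qed

lemma norm1_pdiff:
 assumes "F : forms N d" shows "norm1 (pdiff i F) <= real d * norm1 F"
proof -
 have "lookup m i <= d" if "m : keys F" for m
 proof (cases "i : keys m")
  case True
  hence "lookup m i <= mdeg m" unfolding mdeg_def by (intro member_le_sum) auto
  thus ?thesis using assms that by (simp add: forms_iff)
 qed (simp add: in_keys_iff)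
 hence "(SUM m:keys F. norm1 (single (m - single i 1)
  (real (lookup m i) * lookup F m))) <= (SUM m:keys F. real d * abs (lookup F m))"
  by (intro sum_mono) (simp add: abs_mult mult_right_mono)
 thus ?thesis using norm1_sum unfolding pdiff_def norm1_def [of F] sum_distrib_left by (rule order_trans [rotated])
qed

lemma reval_bound:
 assumes F: "F : forms N d" and x: "!!i. i <= N ==> abs (x i) <= R"
 shows "abs (reval F x) <= norm1 F * R ^ d"
proof -
 have R: "R >= 0" using x [of 0] by simp
 have "abs (mev m x) <= R ^ d" if m: "m : keys F" for m
 proof -
  have mm: "keys m <= {..N}" "mdeg m = d" using F m by (auto simp: forms_iff)
  have "abs (mev m x) = (PROD i:keys m. abs (x i) ^ lookup m i)"
  by (simp add: mev_def abs_prod power_abs)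
  also have "... <= (PROD i:keys m. R ^ lookup m i)"
  using mm x by (intro prod_mono conjI power_mono) auto
  also have "... = R ^ d" unfolding mm(2) [symmetric] mdeg_def power_sum ..
  finally show ?thesis .
 qed
 hence "abs (reval F x) <= (SUM m:keys F. abs (lookup F m) * R ^ d)"
  unfolding reval_def by (intro order_trans [OF sum_abs] sum_mono) (simp add: abs_mult mult_left_mono)
 thus ?thesis by (simp add: norm1_def sum_distrib_right)
qed

section \<open>Irreducible sets and the bound on the Krull dimension\<close>

lemma proj_point_self: "x : proj_point x"
 unfolding proj_point_def by (intro CollectI exI [of _ 1]) simp

lemma vanishes_at_proj_point:
 assumes "F : forms N d" shows "vanishes_at F (proj_point x) \<longleftrightarrow> peval F x = 0"
proof
 assume "vanishes_at F (proj_point x)" thus "peval F x = 0"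
  unfolding vanishes_at_def using proj_point_self by blast
next
 assume "peval F x = 0" thus "vanishes_at F (proj_point x)"
  unfolding vanishes_at_def proj_point_def using peval_scale [OF assms] by auto
qed

lemma vanishes_at_rep:
 assumes "P : proj_space N" "x : P" "F : forms M d" shows "vanishes_at F P \<longleftrightarrow> peval F x = 0"
proof -
 obtain y where y: "P = proj_point y" using assms(1) unfolding proj_space_def by blast
 hence "P = proj_point x" using assms(2) proj_point_eqI by blast
 thus ?thesis using vanishes_at_proj_point [OF assms(3)] by simp
qed

lemma proj_space_rep:
 assumes "P : proj_space N" obtains x where "x : P" "P = proj_point x" "x : coord_vectors N"
 using assms proj_point_self unfolding proj_space_def by blast

lemma real_closed_subset: "real_closed N X ==> X <= proj_space N"
 unfolding real_closed_def by blast

lemma real_closed_Int_zero: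
 assumes X: "real_closed N X" and F: "F : forms N d"
 shows "real_closed N {P : X. vanishes_at F P}"
proof -
 obtain S where S: "S <= (UN d. forms N d)" "X = {P : proj_space N. ALL F:S. vanishes_at F P}"
  using X unfolding real_closed_def by blast
 show ?thesis unfolding real_closed_def
  by (rule exI [of _ "insert F S"]) (use S F in auto)
qed

text \<open>Otherwise the zero sets of F and G would decompose X.\<close>

lemma irreducible_prime:
 assumes X: "real_irreducible N X" and F: "F : forms N d" and G: "G : forms N e"
  and FG: "vanishes_on (F * G) X"
 shows "vanishes_on F X | vanishes_on G X"
proof -
 have Xc: "real_closed N X" using X by (simp add: real_irreducible_def)
 let ?A = "{P : X. vanishes_at F P}" and ?B = "{P : X. vanishes_at G P}"
 have "X = ?A Un ?B"
 proof (intro equalityI subsetI)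
  fix P assume P: "P : X"
  hence Pp: "P : proj_space N" using real_closed_subset [OF Xc] by blast
  then obtain x where x: "x : P" by (rule proj_space_rep)
  have "peval F x * peval G x = 0"
  using FG P x unfolding vanishes_defs peval_mult by blast
  thus "P : ?A Un ?B"
  using P vanishes_at_rep [OF Pp x F] vanishes_at_rep [OF Pp x G] by auto
 qed auto
 hence "X = ?A | X = ?B"
  using X real_closed_Int_zero [OF Xc F] real_closed_Int_zero [OF Xc G] unfolding real_irreducible_def by blast
 thus ?thesis unfolding vanishes_on_def by blast
qed

lemma power_not_vanishing:
 assumes "~ vanishes_on F X" shows "~ vanishes_on (F ^ s) X"
proof -
 obtain P x where "P : X" "x : P" "peval F x ~= 0"
  using assms unfolding vanishes_defs by blast
 thus ?thesis unfolding vanishes_defs by (metis peval_power power_not_zero)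
qed

lemma nontrivial_solution:
 fixes M :: "'b => 'a => real"
 assumes "finite B" "finite A" "card B < card A"
 shows "EX c. (EX a:A. c a ~= 0) & (ALL b:B. (SUM a:A. M b a * c a) = 0)"
 using assms
proof (induction B arbitrary: A M rule: finite_induct)
 case empty
 then obtain a where "a : A" by fastforce
 thus ?case by (intro exI [of _ "%_. 1"]) auto
next
 case (insert b0 B)
 show ?case
 proof (cases "ALL a:A. M b0 a = 0")
  case True
  obtain c where "EX a:A. c a ~= 0" "ALL b:B. (SUM a:A. M b a * c a) = 0"
  using insert.IH [of A M] insert.prems insert.hyps by auto
  moreover have "(SUM a:A. M b0 a * c a) = 0" using True by simp
  ultimately show ?thesis by auto
 next
  case False
  then obtain a0 where a0: "a0 : A" "M b0 a0 ~= 0" by blast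
  let ?A = "A - {a0}"
  have "card B < card ?A" using insert.prems insert.hyps a0 by simp
  then obtain c where c: "EX a:?A. c a ~= 0"
  "ALL b:B. (SUM a:?A. (M b a - M b a0 * M b0 a / M b0 a0) * c a) = 0"
  using insert.IH [of ?A "%b a. M b a - M b a0 * M b0 a / M b0 a0"] insert.prems by auto
  define t where "t = (SUM a:?A. M b0 a * c a)"
  define c' where "c' a = (if a = a0 then - t / M b0 a0 else c a)" for a
  have sp: "(SUM a:A. M b a * c' a) = M b a0 * (- t / M b0 a0) + (SUM a:?A. M b a * c a)" for b
  proof -
  have "(SUM a:A. M b a * c' a) = M b a0 * c' a0 + (SUM a:?A. M b a * c' a)"
  using a0(1) insert.prems(1) by (rule sum.remove [rotated])
  also have "(SUM a:?A. M b a * c' a) = (SUM a:?A. M b a * c a)"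
  by (rule sum.cong) (auto simp: c'_def)
  finally show ?thesis by (simp add: c'_def)
  qed
  have "(SUM a:A. M b a * c' a) = 0" if b: "b : insert b0 B" for b
  proof (cases "b = b0")
  case True
  thus ?thesis unfolding sp using a0(2) by (simp add: t_def)
  next
  case False
  hence "(SUM a:?A. (M b a - M b a0 * M b0 a / M b0 a0) * c a) = 0" using c(2) b by blast
  moreover have "(SUM a:?A. (M b a - M b a0 * M b0 a / M b0 a0) * c a)
  = (SUM a:?A. M b a * c a) - M b a0 / M b0 a0 * t"
  proof -
  have "(M b a - M b a0 * M b0 a / M b0 a0) * c a = M b a * c a - M b a0 / M b0 a0 * (M b0 a * c a)" for a
  by (simp add: algebra_simps)
  thus ?thesis by (simp add: t_def sum_subtractf sum_distrib_left)
  qed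
  ultimately show ?thesis unfolding sp by simp
  qed
  moreover have "EX a:A. c' a ~= 0" using c(1) unfolding c'_def by auto
  ultimately show ?thesis by blast
 qed
qed

definition hmon :: "(nat => rpoly) => nat => (nat => nat) => rpoly" where
 "hmon H j alp = (PROD i<=j. H i ^ alp i)"

lemma forms_hmon:
 assumes "!!i. i <= j ==> H i : forms N e" shows "hmon H j alp : forms N ((SUM i<=j. alp i) * e)"
 unfolding hmon_def sum_distrib_right by (intro forms_prod forms_power assms) simp

text \<open>Divide by the smallest occurring power of the last form, the ideal of an irreducible set being prime,
and restrict to the previous member of the chain, where that form vanishes: only the monomials with
the smallest exponent survive, and the induction hypothesis applies to them.\<close>

lemma chain_independent:
 assumes W: "!!i. i <= k ==> real_irreducible N (W i)" and sub: "!!i. i < k ==> W i <= W (Suc i)"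
  and H: "!!i. i <= k ==> H i : forms N e" and Hv: "!!i. i < k ==> vanishes_on (H (Suc i)) (W i)"
  and Hn: "!!i. i <= k ==> ~ vanishes_on (H i) (W i)"
 shows "j <= k ==> finite A ==> inj_on (%alp. restrict alp {..j}) A ==> (!!alp. alp : A ==> (SUM i<=j. alp i) = D) ==>
  vanishes_on (SUM alp:A. single 0 (c alp) * hmon H j alp) (W j) ==> alp : A ==> c alp = 0"
proof (induction j arbitrary: A D c alp)
 case 0
 have eq: "bet = alp" if "bet : A" for bet
 proof -
  have "restrict bet {..0} = restrict alp {..0}"
  using "0.prems"(4) [OF that] "0.prems"(4) [OF "0.prems"(6)] by (auto simp: restrict_def fun_eq_iff)
  thus ?thesis by (rule inj_onD [OF "0.prems"(3) _ that "0.prems"(6)])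
 qed
 hence A: "A = {alp}" using "0.prems"(6) by blast
 obtain P x where P: "P : W 0" "x : P" "peval (H 0 ^ alp 0) x ~= 0"
  using power_not_vanishing [OF Hn [of 0], of "alp 0"] unfolding vanishes_defs by blast
 have "peval (single 0 (c alp) * hmon H 0 alp) x = 0"
  using "0.prems"(5) P(1,2) unfolding A vanishes_defs by simp
 thus ?case using P(3) by (simp add: peval_mult peval_const hmon_def)
next
 case (Suc j)
 have jk: "j < k" "j <= k" "Suc j <= k" using Suc.prems(1) by simp_all
 show ?case
 proof (rule ccontr)
  assume ca: "c alp ~= 0"
  define A' where "A' = {bet : A. c bet ~= 0}"
  have fA': "finite A'" and aA': "alp : A'" using Suc.prems(2,6) ca by (auto simp: A'_def)
  define s where "s = Min ((%bet. bet (Suc j)) ` A')"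
  have smin: "s <= bet (Suc j)" if "bet : A'" for bet unfolding s_def using that fA' by (intro Min_le) auto
  have "s : (%bet. bet (Suc j)) ` A'" unfolding s_def using fA' aA' by (intro Min_in) auto
  then obtain bet0 where b0: "bet0 : A'" "bet0 (Suc j) = s" by blast
  define P1 where "P1 = (SUM bet:A'. single 0 (c bet) * (hmon H j bet * H (Suc j) ^ (bet (Suc j) - s)))"
  have deg: "(SUM i<=j. bet i) + bet (Suc j) = D" if "bet : A'" for bet
  using Suc.prems(4) [of bet] that by (simp add: A'_def)
  have P1f: "P1 : forms N ((D - s) * e)"
  unfolding P1_def
  proof (intro forms_sum forms_scale)
  fix bet assume b: "bet : A'"
  have "hmon H j bet * H (Suc j) ^ (bet (Suc j) - s) : forms N ((SUM i<=j. bet i) * e + (bet (Suc j) - s) * e)"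
  using H jk by (intro forms_mult forms_hmon forms_power) auto
  also have "(SUM i<=j. bet i) * e + (bet (Suc j) - s) * e = (D - s) * e"
  using deg [OF b] smin [OF b] by (simp flip: distrib_right)
  finally show "hmon H j bet * H (Suc j) ^ (bet (Suc j) - s) : forms N ((D - s) * e)" .
  qed
  have prod: "(SUM bet:A. single 0 (c bet) * hmon H (Suc j) bet) = H (Suc j) ^ s * P1"
  proof -
  have "(SUM bet:A. single 0 (c bet) * hmon H (Suc j) bet) = (SUM bet:A'. single 0 (c bet) * hmon H (Suc j) bet)"
  by (rule sum.mono_neutral_right) (use Suc.prems(2) in \<open>auto simp: A'_def\<close>)
  also have "... = (SUM bet:A'. H (Suc j) ^ s * (single 0 (c bet) * (hmon H j bet * H (Suc j) ^ (bet (Suc j) - s))))"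
  proof (rule sum.cong [OF refl])
  fix bet assume "bet : A'"
  hence "H (Suc j) ^ bet (Suc j) = H (Suc j) ^ s * H (Suc j) ^ (bet (Suc j) - s)"
  using smin by (simp flip: power_add)
  thus "single 0 (c bet) * hmon H (Suc j) bet =
  H (Suc j) ^ s * (single 0 (c bet) * (hmon H j bet * H (Suc j) ^ (bet (Suc j) - s)))"
  by (simp add: hmon_def mult_ac)
  qed
  finally show ?thesis by (simp add: P1_def sum_distrib_left)
  qed
  have "vanishes_on (H (Suc j) ^ s) (W (Suc j)) | vanishes_on P1 (W (Suc j))"
  using Suc.prems(5) unfolding prod
  by (rule irreducible_prime [OF W [OF jk(3)] forms_power [OF H [OF jk(3)]] P1f])
  hence P1v: "vanishes_on P1 (W (Suc j))" using power_not_vanishing [OF Hn [OF jk(3)]] by blast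
  define A0 where "A0 = {bet : A'. bet (Suc j) = s}"
  have "vanishes_on (SUM bet:A0. single 0 (c bet) * hmon H j bet) (W j)"
  unfolding vanishes_defs
  proof (intro ballI)
  fix P x assume P: "P : W j" "x : P"
  have h: "peval (H (Suc j)) x = 0" using Hv [OF jk(1)] P unfolding vanishes_defs by blast
  have "peval (SUM bet:A0. single 0 (c bet) * hmon H j bet) x = peval P1 x"
  unfolding P1_def peval_sum
  proof (rule sum.mono_neutral_cong_left)
  show "ALL bet:A' - A0. peval (single 0 (c bet) * (hmon H j bet * H (Suc j) ^ (bet (Suc j) - s))) x = 0"
  proof
  fix bet assume "bet : A' - A0"
  hence "bet (Suc j) - s > 0" using smin [of bet] by (auto simp: A0_def)
  thus "peval (single 0 (c bet) * (hmon H j bet * H (Suc j) ^ (bet (Suc j) - s))) x = 0"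
  by (simp add: peval_mult peval_power h)
  qed
  qed (use fA' in \<open>auto simp: A0_def\<close>)
  also have "... = 0" using P1v sub [OF jk(1)] P unfolding vanishes_defs by blast
  finally show "peval (SUM bet:A0. single 0 (c bet) * hmon H j bet) x = 0" .
  qed
  moreover have "inj_on (%bet. restrict bet {..j}) A0"
  proof (rule inj_onI)
  fix bet gam assume bg: "bet : A0" "gam : A0" "restrict bet {..j} = restrict gam {..j}"
  have "bet i = gam i" if "i <= Suc j" for i
  proof (cases "i = Suc j")
  case False
  thus ?thesis using fun_cong [OF bg(3), of i] that by simp
  qed (use bg in \<open>auto simp: A0_def\<close>)
  hence "restrict bet {..Suc j} = restrict gam {..Suc j}" by (auto simp: restrict_def fun_eq_iff)
  thus "bet = gam" by (rule inj_onD [OF Suc.prems(3)]) (use bg(1,2) in \<open>auto simp: A0_def A'_def\<close>)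
  qed
  moreover have "(SUM i<=j. bet i) = D - s" if "bet : A0" for bet
  using deg [of bet] that by (auto simp: A0_def)
  moreover have "finite A0" using fA' by (simp add: A0_def)
  moreover have "bet0 : A0" using b0 by (simp add: A0_def)
  ultimately have "c bet0 = 0" using Suc.IH [OF jk(2), of A0 "D - s" c bet0] by blast
  thus False using b0 by (simp add: A'_def)
 qed
qed

lemma card_monomials:
 "finite {m. keys m <= {..N} & mdeg m = D} & card {m. keys m <= {..N} & mdeg m = D} <= (D + 1) ^ N"
proof -
 let ?M = "{m. keys m <= {..N} & mdeg m = D}"
 let ?f = "%m. restrict (lookup m) {1..N}"
 have mem: "?f ` ?M <= (\<Pi>\<^sub>E i\<in>{1..N}. {..D})"
 proof clarsimp
  fix m i assume m: "keys m <= {..N}" "D = mdeg m" "Suc 0 <= i" "i <= N"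
  show "lookup m i <= mdeg m"
  unfolding mdeg_superset [OF finite_atMost m(1)] using m(4) by (intro member_le_sum) auto
 qed
 have inj: "inj_on ?f ?M"
 proof (rule inj_onI)
  fix m m' assume m: "m : ?M" "m' : ?M" "?f m = ?f m'"
  have e: "lookup m i = lookup m' i" if "1 <= i" "i <= N" for i
  using fun_cong [OF m(3), of i] that by simp
  have sp: "mdeg u = lookup u 0 + (SUM i=1..N. lookup u i)" if "u : ?M" for u
  proof -
  have "mdeg u = (SUM i<=N. lookup u i)" using that by (intro mdeg_superset) auto
  also have "{..N} = insert 0 {1..N}" by auto
  finally show ?thesis by simp
  qed
  have "(SUM i=1..N. lookup m i) = (SUM i=1..N. lookup m' i)"
  using e by (intro sum.cong) auto
  hence z: "lookup m 0 = lookup m' 0" using sp [OF m(1)] sp [OF m(2)] m(1,2) by simp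
  show "m = m'"
  proof (rule poly_mapping_eqI)
  fix i
  consider "i = 0" | "1 <= i" "i <= N" | "i > N" by linarith
  thus "lookup m i = lookup m' i"
  proof cases
  case 3
  hence "i ~: keys m" "i ~: keys m'" using m(1,2) by auto
  thus ?thesis by (simp add: in_keys_iff)
  qed (use z e in auto)
  qed
 qed
 have "finite (\<Pi>\<^sub>E i\<in>{1..N}. {..D})" by (intro finite_PiE) auto
 hence "finite ?M" "card ?M <= card (\<Pi>\<^sub>E i\<in>{1..N}. {..D})"
  using mem inj by (auto intro: finite_subset [THEN finite_imageD] card_inj_on_le)
 thus ?thesis by (simp add: card_PiE)
qed

text \<open>Take for each step a form vanishing on W i but not on W (i + 1), raised to powers of a common degree
e. The monomials of degree D in these k + 1 forms are independent, and there are about D^k of them;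
forms of degree eD in N + 1 variables span a space of dimension at most (eD + 1)^N. Hence k <= N.\<close>

lemma chain_length_le:
 assumes W: "!!i. i <= k ==> real_irreducible N (W i)" and sub: "!!i. i < k ==> W i \<subset> W (Suc i)"
 shows "k <= N"
proof (rule ccontr)
 assume kN: "~ k <= N"
 have Wc: "W i <= proj_space N" "W i ~= {}" if "i <= k" for i
 proof -
  have "real_closed N (W i)" "W i ~= {}" using W [OF that] by (simp_all add: real_irreducible_def)
  thus "W i <= proj_space N" "W i ~= {}" using real_closed_subset by simp_all
 qed
 have "EX G d. G : forms N d & d >= 1 & ~ vanishes_on G (W i) & (ALL i'. i = Suc i' --> vanishes_on G (W i'))" if i: "i <= k" for i
 proof (cases i)
  case 0
  obtain P where P: "P : W i" using Wc [OF i] by blast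
  hence "P : proj_space N" using Wc(1) [OF i] by blast
  then obtain x where x: "x : P" "x : coord_vectors N" by (rule proj_space_rep)
  then obtain b where b: "x b ~= 0" unfolding coord_vectors_def by blast
  have "~ b > N" using x(2) b unfolding coord_vectors_def by blast
  note b = b this [unfolded not_less]
  have "~ vanishes_on (Xv b) (W i)"
  proof
  assume "vanishes_on (Xv b) (W i)"
  hence "peval (Xv b) x = 0" using P x(1) unfolding vanishes_defs by blast
  thus False using b(1) by simp
  qed
  thus ?thesis using forms_Xv [OF b(2)] 0 by (intro exI [of _ "Xv b"] exI [of _ 1]) auto
 next
  case (Suc i')
  have i': "i' < k" "i' <= k" using i Suc by simp_all
  have "real_closed N (W i')" using W [OF i'(2)] by (simp add: real_irreducible_def)
  then obtain S where S: "S <= (UN d. forms N d)" "W i' = {P : proj_space N. ALL F:S. vanishes_at F P}"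
  unfolding real_closed_def by blast
  obtain P where P: "P : W i" "P ~: W i'" using sub [OF i'(1)] Suc by blast
  then obtain G where G: "G : S" "~ vanishes_at G P" using S(2) Wc(1) [OF i] by blast
  obtain d where d: "G : forms N d" using S(1) G(1) by blast
  have v: "vanishes_on G (W i')" unfolding vanishes_on_def using S(2) G(1) by blast
  have "d ~= 0"
  proof
  assume "d = 0"
  hence Gc: "peval G x = peval G y" for x y
  using d unfolding peval_eq forms_iff mdeg_def mev_def
  by (intro sum.cong refl arg_cong2 [where f = "(*)"] prod.cong) (auto simp: in_keys_iff)
  obtain Q where Q: "Q : W i'" using Wc(2) [OF i'(2)] by blast
  hence "Q : proj_space N" using Wc(1) [OF i'(2)] by blast
  then obtain y where "y : Q" by (rule proj_space_rep)
  hence "peval G y = 0" using v Q unfolding vanishes_defs by blast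
  thus False using G(2) Gc unfolding vanishes_at_def by metis
  qed
  thus ?thesis using d v G(2) P(1) Suc unfolding vanishes_on_def by (intro exI [of _ G] exI [of _ d]) auto
 qed
 hence "ALL i:{..k}. EX t. fst t : forms N (snd t) & snd t >= 1 & ~ vanishes_on (fst t) (W i) & (ALL i'. i = Suc i' --> vanishes_on (fst t) (W i'))"
  by simp
 then obtain t where t: "ALL i:{..k}. fst (t i) : forms N (snd (t i)) & snd (t i) >= 1 & ~ vanishes_on (fst (t i)) (W i) & (ALL i'. i = Suc i' --> vanishes_on (fst (t i)) (W i'))"
  unfolding bchoice_iff by blast
 define e where "e = (PROD i<=k. snd (t i))"
 have e1: "e >= 1" unfolding e_def using t by (intro prod_ge_1) auto
 define H where "H i = fst (t i) ^ (e div snd (t i))" for i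
 have ediv: "e div snd (t i) * snd (t i) = e" if "i <= k" for i
 proof -
  have "snd (t i) dvd e" unfolding e_def using that by (intro dvd_prodI) auto
  thus ?thesis by simp
 qed
 have epos: "e div snd (t i) > 0" if "i <= k" for i using ediv [OF that] e1 by (metis mult_0 not_gr_zero not_one_le_zero)
 have H: "H i : forms N e" if "i <= k" for i
  using forms_power [of "fst (t i)" N "snd (t i)" "e div snd (t i)"] t that ediv [OF that] by (simp add: H_def)
 have Hn: "~ vanishes_on (H i) (W i)" if "i <= k" for i
  unfolding H_def using t that by (intro power_not_vanishing) auto
 have Hv: "vanishes_on (H (Suc i)) (W i)" if "i < k" for i
 proof -
  have v: "vanishes_on (fst (t (Suc i))) (W i)" using t that by auto
  have "e div snd (t (Suc i)) > 0" using epos that by simp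
  thus ?thesis using v unfolding vanishes_defs H_def peval_power by simp
 qed
 define D where "D = (e * k) ^ N"
 let ?B = "\<Pi>\<^sub>E i\<in>{1..k}. {..D}"
 define alp where "alp bet = (%i. if i = 0 then k * D - (SUM i=1..k. bet i) else bet i)" for bet :: "nat => nat"
 have at: "{..k} = insert 0 {1..k}" by auto
 have asum: "(SUM i<=k. alp bet i) = k * D" if "bet : ?B" for bet
 proof -
  have "(SUM i=1..k. bet i) <= (SUM i=1..k. D)" using that by (intro sum_mono) auto
  thus ?thesis unfolding at by (simp add: alp_def)
 qed
 have ainj: "inj_on (%bet. restrict (alp bet) {..k}) ?B"
 proof (rule inj_onI)
  fix bet gam assume bg: "bet : ?B" "gam : ?B" "restrict (alp bet) {..k} = restrict (alp gam) {..k}"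
  show "bet = gam"
  proof (rule PiE_ext [OF bg(1,2)])
  fix i assume "i : {1..k}"
  thus "bet i = gam i" using fun_cong [OF bg(3), of i] by (simp add: alp_def)
  qed
 qed
 have ainj': "inj_on alp ?B" using ainj by (auto simp: inj_on_def)
 define A where "A = alp ` ?B"
 have fB: "finite ?B" by (intro finite_PiE) auto
 have cA: "finite A" "card A = (D + 1) ^ k" unfolding A_def using fB ainj' by (simp_all add: card_image card_PiE)
 let ?M = "{m. keys m <= {..N} & mdeg m = k * D * e}"
 have M: "finite ?M" "card ?M <= (k * D * e + 1) ^ N" using card_monomials [of N "k * D * e"] by blast+
 have ek: "e * k >= 1" using e1 kN by simp
 have "k * D * e + 1 <= (e * k) * (D + 1)" using ek by (simp add: algebra_simps)
 hence "card ?M <= ((e * k) * (D + 1)) ^ N" using M(2) by (meson le_trans power_mono zero_le)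
 also have "... = (e * k) ^ N * (D + 1) ^ N" by (rule power_mult_distrib)
 also have "... = D * (D + 1) ^ N" unfolding D_def ..
 also have "... < (D + 1) * (D + 1) ^ N" by simp
 also have "... <= (D + 1) ^ k" using power_increasing [of "Suc N" k "D + 1"] kN by simp
 finally have "card ?M < card A" using cA by simp
 then obtain c where c: "EX a:A. c a ~= 0" "ALL m:?M. (SUM a:A. lookup (hmon H k a) m * c a) = 0"
  using nontrivial_solution [OF M(1) cA(1), of "%m a. lookup (hmon H k a) m"] by blast
 have Hf: "hmon H k a : forms N (k * D * e)" if "a : A" for a
  using forms_hmon [of k H N e a] H asum that unfolding A_def by auto
 have sc: "lookup (single 0 u * F) m = u * lookup F m" for u :: real and F :: rpoly and m
 proof -
  have "single 0 u * F = (SUM m:keys F. single m (u * lookup F m))"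
  by (subst (1) rpoly_expand [of F]) (simp add: sum_distrib_left mult_single)
  thus ?thesis by (auto simp: lookup_sum lookup_single when_def in_keys_iff)
 qed
 have "(SUM a:A. single 0 (c a) * hmon H k a) = 0"
 proof (rule poly_mapping_eqI)
  fix m
  show "lookup (SUM a:A. single 0 (c a) * hmon H k a) m = lookup 0 m"
  proof (cases "m : ?M")
  case True
  hence "(SUM a:A. lookup (hmon H k a) m * c a) = 0" using c(2) by blast
  thus ?thesis by (simp add: lookup_sum sc mult.commute [of "c _"])
  next
  case False
  hence "lookup (hmon H k a) m = 0" if "a : A" for a
  using Hf [OF that] unfolding forms_iff by (auto simp: in_keys_iff)
  thus ?thesis by (simp add: lookup_sum sc)
  qed
 qed
 hence van: "vanishes_on (SUM a:A. single 0 (c a) * hmon H k a) (W k)"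
  by (simp add: vanishes_defs)
 have injA: "inj_on (%a. restrict a {..k}) A"
  using ainj unfolding A_def by (auto simp: inj_on_def)
 have sumA: "(SUM i<=k. a i) = k * D" if "a : A" for a using asum that unfolding A_def by auto
 have "c a = 0" if "a : A" for a
  using chain_independent [of k N W H e k A "k * D" c a, OF W _ H Hv Hn order_refl cA(1) injA sumA van that] sub
  by blast
 thus False using c(1) by blast
qed

text \<open>This makes N - dim X a genuine difference in the Jacobian criterion.\<close>

theorem variety_dim_le:
 assumes "real_irreducible N X" shows "variety_dim N X <= N"
proof -
 let ?Q = "%k. EX W :: nat => point set. (ALL i<=k. real_irreducible N (W i) & W i <= X) & (ALL i<k. W i \<subset> W (Suc i))"
 have b: "k <= N" if "?Q k" for k using that chain_length_le [of k N] by blast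
 have "?Q 0" by (rule exI [of _ "%_. X"]) (use assms in simp)
 hence "?Q (GREATEST k. ?Q k)" by (rule GreatestI_nat [where b = N]) (use b in blast)
 thus ?thesis unfolding variety_dim_def by (rule b)
qed

section \<open>Quadratic approximation of polynomials on boxes\<close>

definition nrm :: "nat => rvec => real" where
 "nrm N x = (SUM i<=N. abs (x i))"

abbreviation vdist :: "nat => rvec => rvec => real" where
 "vdist N x y == nrm N (%i. x i - y i)"

lemma nrm_nonneg [simp]: "nrm N x >= 0"
 by (simp add: nrm_def sum_nonneg)

lemma coord_le_nrm: "i <= N ==> abs (x i) <= nrm N x"
 unfolding nrm_def by (rule member_le_sum [of i "{..N}" "%i. abs (x i)"]) auto

lemma nrm_bound: "(!!i. i <= N ==> abs (x i) <= c) ==> nrm N x <= real (Suc N) * c"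
 using sum_mono [of "{..N}" "%i. abs (x i)" "%_. c"] by (simp add: nrm_def)

lemma lin_bound:
 assumes "!!l. l <= N ==> abs (g l) <= C"
 shows "abs (SUM l<=N. g l * v l) <= C * nrm N v"
proof -
 have "abs (SUM l<=N. g l * v l) <= (SUM l<=N. abs (g l * v l))" by (rule sum_abs)
 also have "... <= (SUM l<=N. C * abs (v l))"
  using assms by (intro sum_mono) (simp add: abs_mult mult_right_mono)
 finally show ?thesis by (simp add: nrm_def sum_distrib_left)
qed

lemma DERIV_reval:
 assumes F: "F : forms N d" and c: "!!i. i <= N ==> ((%s. c s i) has_field_derivative c' i) (at s0)"
 shows "((%s. reval F (c s)) has_field_derivative (SUM l<=N. reval (pdiff l F) (c s0) * c' l)) (at s0)"
 using F
proof (induction F rule: rpoly_induct)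
 case (var i)
 thus ?case using c [OF var] by (simp add: pdiff_Xv if_distrib [of "%F. reval F _ * _"] cong: if_cong)
next
 case (add F G)
 show ?case using DERIV_add [OF add] by (simp add: reval_add pdiff_add distrib_right sum.distrib)
next
 case (mult F G)
 have "(SUM l<=N. reval (pdiff l (F * G)) (c s0) * c' l) =
  (SUM l<=N. reval (pdiff l F) (c s0) * c' l) * reval G (c s0) + (SUM l<=N. reval (pdiff l G) (c s0) * c' l) * reval F (c s0)"
  by (simp add: pdiff_mult reval_add reval_mult distrib_right distrib_left sum.distrib sum_distrib_left sum_distrib_right mult_ac)
 thus ?case using DERIV_mult [OF mult] by (simp add: reval_mult)
qed simp

lemma mean_value:
 assumes F: "F : forms N d"
 obtains s where "0 <= s" "s <= 1"
  "reval F x - reval F y = (SUM l<=N. reval (pdiff l F) (%i. y i + s * (x i - y i)) * (x l - y l))"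
proof -
 define g where "g s = reval F (%i. y i + s * (x i - y i))" for s
 define g' where "g' s = (SUM l<=N. reval (pdiff l F) (%i. y i + s * (x i - y i)) * (x l - y l))" for s
 have "(g has_field_derivative g' s) (at s)" for s
  unfolding g_def g'_def
  by (rule DERIV_reval [OF F, of "%s i. y i + s * (x i - y i)"]) (auto intro!: derivative_eq_intros)
 then obtain s where "0 < s" "s < 1" "g 1 - g 0 = (1 - 0) * g' s" using MVT2 [of 0 1 g g'] by auto
 thus thesis by (intro that [of s]) (auto simp: g_def g'_def)
qed

lemma segment_abs_le:
 fixes a b :: real
 assumes "abs a <= R" "abs b <= R" "0 <= s" "s <= 1" shows "abs (a + s * (b - a)) <= R"
proof -
 have "abs ((1 - s) * a + s * b) <= (1 - s) * abs a + s * abs b"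
  using abs_triangle_ineq [of "(1 - s) * a" "s * b"] assms(3,4) by (simp add: abs_mult)
 also have "... <= (1 - s) * R + s * R" using assms by (intro add_mono mult_left_mono) auto
 finally show ?thesis by (simp add: algebra_simps)
qed

definition lipc :: "nat => nat => rpoly => real => real" where
 "lipc N d F R = (SUM l<=N. norm1 (pdiff l F) * abs R ^ (d - 1))"

lemma lipc_nonneg: "lipc N d F R >= 0"
 unfolding lipc_def by (intro sum_nonneg mult_nonneg_nonneg norm1_nonneg) auto

lemma reval_lipschitz:
 assumes F: "F : forms N d" and xy: "inbox N R x" "inbox N R y"
 shows "abs (reval F x - reval F y) <= lipc N d F R * vdist N x y"
proof -
 obtain s where s: "0 <= s" "s <= 1" and
  eq: "reval F x - reval F y = (SUM l<=N. reval (pdiff l F) (%i. y i + s * (x i - y i)) * (x l - y l))"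
  by (rule mean_value [OF F])
 show ?thesis unfolding eq
 proof (rule lin_bound)
  fix l assume l: "l <= N"
  have "abs (reval (pdiff l F) (%i. y i + s * (x i - y i))) <= norm1 (pdiff l F) * abs R ^ (d - 1)"
  proof (rule reval_bound [OF pdiff_forms [OF F]])
  fix i assume "i <= N"
  hence "abs (y i + s * (x i - y i)) <= R" using xy s by (intro segment_abs_le) auto
  thus "abs (y i + s * (x i - y i)) <= abs R" by linarith
  qed
  also have "... <= lipc N d F R" unfolding lipc_def
  using l by (intro member_le_sum [of l "{..N}" "%l. norm1 (pdiff l F) * abs R ^ (d - 1)"] mult_nonneg_nonneg norm1_nonneg) auto
  finally show "abs (reval (pdiff l F) (%i. y i + s * (x i - y i))) <= lipc N d F R" .
 qed
qed

lemma linear_approximation: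
 assumes F: "F : forms N d" and c: "!!l s. l <= N ==> 0 <= s ==> s <= 1 ==>
  abs (reval (pdiff l F) (%i. y i + s * (x i - y i)) - reval (pdiff l F) z) <= c"
 shows "abs (reval F x - reval F y - (SUM l<=N. reval (pdiff l F) z * (x l - y l))) <= c * vdist N x y"
proof -
 obtain s where s: "0 <= s" "s <= 1" and
  eq: "reval F x - reval F y = (SUM l<=N. reval (pdiff l F) (%i. y i + s * (x i - y i)) * (x l - y l))"
  by (rule mean_value [OF F])
 have "reval F x - reval F y - (SUM l<=N. reval (pdiff l F) z * (x l - y l)) =
  (SUM l<=N. (reval (pdiff l F) (%i. y i + s * (x i - y i)) - reval (pdiff l F) z) * (x l - y l))"
  unfolding eq by (simp add: left_diff_distrib sum_subtractf)
 thus ?thesis using lin_bound [of N _ c "%i. x i - y i"] c s by simp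
qed

lemma lipc_sum: "l <= N ==> lipc N (d - 1) (pdiff l F) R <= (SUM l<=N. lipc N (d - 1) (pdiff l F) R)"
 using lipc_nonneg by (intro member_le_sum) auto

theorem reval_estimates:
 assumes F: "F : forms N d"
 obtains C where "C >= 0" "!!x. inbox N R x ==> abs (reval F x) <= C"
  "!!x y. inbox N R x ==> inbox N R y ==>
  abs (reval F x - reval F y - (SUM l<=N. reval (pdiff l F) y * (x l - y l))) <= C * (vdist N x y)\<^sup>2"
  "!!x y. inbox N R x ==> inbox N R y ==> abs (reval F x - reval F y) <= C * vdist N x y"
proof -
 define Q where "Q = (SUM l<=N. lipc N (d - 1) (pdiff l F) R)"
 have Q: "Q >= 0" unfolding Q_def by (intro sum_nonneg lipc_nonneg)
 define C where "C = norm1 F * abs R ^ d + Q + lipc N d F R"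
 have b: "norm1 F * abs R ^ d >= 0" by (intro mult_nonneg_nonneg norm1_nonneg) auto
 have C: "norm1 F * abs R ^ d <= C" "Q <= C" "lipc N d F R <= C" "C >= 0"
  using b Q lipc_nonneg [of N d F R] unfolding C_def by linarith+
 show thesis
 proof (rule that [OF C(4)])
  fix x assume "inbox N R x"
  hence "abs (reval F x) <= norm1 F * abs R ^ d" by (intro reval_bound [OF F]) (meson abs_ge_self order_trans)
  thus "abs (reval F x) <= C" using C(1) by linarith
 next
  fix x y assume xy: "inbox N R x" "inbox N R y"
  let ?n = "vdist N x y"
  show "abs (reval F x - reval F y) <= C * ?n"
  using reval_lipschitz [OF F xy] mult_right_mono [OF C(3), of ?n] by simp
  have "abs (reval F x - reval F y - (SUM l<=N. reval (pdiff l F) y * (x l - y l))) <= (Q * ?n) * ?n"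
  proof (rule linear_approximation [OF F])
  fix l s assume l: "l <= N" and s: "0 <= s" "s <= (1::real)"
  let ?z = "%i. y i + s * (x i - y i)"
  have "abs (reval (pdiff l F) ?z - reval (pdiff l F) y) <= lipc N (d - 1) (pdiff l F) R * vdist N ?z y"
  by (rule reval_lipschitz [OF pdiff_forms [OF F]]) (use xy s segment_abs_le in auto)
  also have "... <= Q * ?n"
  using lipc_sum [OF l, of d F R] Q s unfolding Q_def nrm_def
  by (intro mult_mono sum_mono) (auto simp: abs_mult mult_left_le_one_le sum_nonneg)
  finally show "abs (reval (pdiff l F) ?z - reval (pdiff l F) y) <= Q * ?n" .
  qed
  also have "... <= C * ?n\<^sup>2" using mult_right_mono [OF C(2), of "?n\<^sup>2"] by (simp add: power2_eq_square mult.assoc)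
  finally show "abs (reval F x - reval F y - (SUM l<=N. reval (pdiff l F) y * (x l - y l))) <= C * ?n\<^sup>2" .
 qed
qed

lemma inbox_near:
 assumes "near N x0 s x" "s <= 1" shows "ALL i<=N. abs (x i) <= nrm N x0 + 1"
proof (intro allI impI)
 fix i assume i: "i <= N"
 hence "abs (x i - x0 i) < s" using assms(1) by blast
 thus "abs (x i) <= nrm N x0 + 1" using coord_le_nrm [OF i, of x0] assms(2) by linarith
qed

text \<open>Strict differentiability: the linear approximation is uniform in pairs of points, as is needed to
compare f at two arbitrary points near x0.\<close>

definition sdiff :: "nat => (rvec => real) => rvec => rvec => bool" where
 "sdiff N f g x0 \<longleftrightarrow> (ALL eps>0. EX rho>0. ALL x y. (ALL i<=N. abs (x i - x0 i) < rho & abs (y i - x0 i) < rho) -->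
  abs (f x - f y - (SUM l<=N. g l * (x l - y l))) <= eps * vdist N x y)"

lemma sdiff_reval:
 assumes F: "F : forms N d" shows "sdiff N (reval F) (%l. reval (pdiff l F) x0) x0"
 unfolding sdiff_def
proof (intro allI impI)
 fix eps :: real assume e: "eps > 0"
 define R where "R = nrm N x0 + 1"
 define Q where "Q = (SUM l<=N. lipc N (d - 1) (pdiff l F) R)"
 have Q: "Q >= 0" unfolding Q_def by (intro sum_nonneg lipc_nonneg)
 define rho where "rho = min 1 (eps / ((Q + 1) * real (Suc N)))"
 have p: "(Q + 1) * real (Suc N) > 0" using Q by simp
 hence r: "rho > 0" "rho <= 1" "rho * ((Q + 1) * real (Suc N)) <= eps"
  unfolding pos_le_divide_eq [OF p, symmetric] using e by (simp_all add: rho_def del: of_nat_Suc)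
 show "EX rho>0. ALL x y. (ALL i<=N. abs (x i - x0 i) < rho & abs (y i - x0 i) < rho) -->
  abs (reval F x - reval F y - (SUM l<=N. reval (pdiff l F) x0 * (x l - y l))) <= eps * vdist N x y"
 proof (intro exI [of _ rho] conjI allI impI linear_approximation [OF F])
  fix x y l s assume xy: "ALL i<=N. abs (x i - x0 i) < rho & abs (y i - x0 i) < rho" and l: "l <= N" and s: "0 <= s" "s <= (1::real)"
  let ?z = "%i. y i + s * (x i - y i)"
  have zr: "abs (?z i - x0 i) <= rho" if "i <= N" for i
  using segment_abs_le [of "y i - x0 i" rho "x i - x0 i" s] xy that s by (simp add: less_imp_le algebra_simps)
  have zR: "inbox N R ?z" and xR: "inbox N R x0"
  using zr r(2) coord_le_nrm [of _ N x0] unfolding R_def by (fastforce simp: abs_le_iff)+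
  have "abs (reval (pdiff l F) ?z - reval (pdiff l F) x0) <= lipc N (d - 1) (pdiff l F) R * vdist N ?z x0"
  by (rule reval_lipschitz [OF pdiff_forms [OF F] zR xR])
  also have "... <= (Q + 1) * (real (Suc N) * rho)"
  using lipc_sum [OF l, of d F R] Q unfolding Q_def [symmetric] by (intro mult_mono nrm_bound zr) auto
  also have "... <= eps" using r(3) by (simp add: mult_ac del: of_nat_Suc)
  finally show "abs (reval (pdiff l F) ?z - reval (pdiff l F) x0) <= eps" .
 qed (rule r(1))
qed

lemma sdiff_lipschitz:
 assumes "sdiff N f g x0"
 obtains rho L where "rho > 0" "L > 0" "!!x y. near N x0 rho x ==> near N x0 rho y ==>
  abs (f x - f y) <= L * vdist N x y"
proof -
 have "(0::real) < 1" by simp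
 then obtain rho where r: "rho > 0" "ALL x y. (ALL i<=N. abs (x i - x0 i) < rho & abs (y i - x0 i) < rho) -->
  abs (f x - f y - (SUM l<=N. g l * (x l - y l))) <= 1 * vdist N x y"
  using assms unfolding sdiff_def by blast
 show thesis
 proof (rule that [of rho "nrm N g + 1"])
  fix x y assume "near N x0 rho x" "near N x0 rho y"
  hence "abs (f x - f y - (SUM l<=N. g l * (x l - y l))) <= 1 * vdist N x y" using r(2) by blast
  moreover have "abs (SUM l<=N. g l * (x l - y l)) <= nrm N g * vdist N x y"
  by (rule lin_bound) (rule coord_le_nrm)
  ultimately show "abs (f x - f y) <= (nrm N g + 1) * vdist N x y" by (simp add: distrib_right)
 qed (use r(1) nrm_nonneg [of N g] in linarith)+
qed

lemma nonzero_near: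
 assumes f: "sdiff N f g x0" and f0: "f x0 ~= 0"
 obtains rho where "rho > 0" "!!x. near N x0 rho x ==> f x ~= 0"
  "!!x. near N x0 rho x ==> abs (f x0) <= 2 * abs (f x)"
proof -
 obtain rho1 L where L: "rho1 > 0" "L > 0" "!!x y. near N x0 rho1 x ==> near N x0 rho1 y ==>
  abs (f x - f y) <= L * vdist N x y"
  by (rule sdiff_lipschitz [OF f]) blast
 define rho where "rho = min rho1 (abs (f x0) / (2 * L * real (Suc N)))"
 have rho: "rho > 0" "rho <= rho1" and "rho <= abs (f x0) / (2 * L * real (Suc N))" using L(1,2) f0 by (auto simp: rho_def)
 hence "rho * (2 * L * real (Suc N)) <= abs (f x0)" using L(2) by (subst pos_le_divide_eq [symmetric]) auto
 hence r2: "L * (real (Suc N) * rho) <= abs (f x0) / 2" by (simp add: mult_ac del: of_nat_Suc)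
 have half: "abs (f x0) <= 2 * abs (f x)" if x: "near N x0 rho x" for x
 proof -
  have "abs (f x - f x0) <= L * vdist N x x0"
  proof (rule L(3))
  show "near N x0 rho1 x" using x rho(2) by (meson less_le_trans)
  qed (use L(1) in simp)
  also have "... <= L * (real (Suc N) * rho)" using L(2) x by (intro mult_left_mono nrm_bound) (auto intro: less_imp_le)
  finally show ?thesis using r2 by linarith
 qed
 have "f x ~= 0" if "near N x0 rho x" for x using half [OF that] f0 by auto
 thus thesis by (rule that [OF rho(1) _ half])
qed

lemma lipschitz_continuous_on:
 assumes "!!x y. x : S ==> y : S ==> abs (f x - f y) <= L * vdist N x y"
 shows "continuous_on S f"
 unfolding continuous_on_def
proof
 fix y assume y: "y : S"
 have "continuous_on UNIV (%x::nat => real. x i)" for i by (rule continuous_on_product_coordinates)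
 hence "continuous_on UNIV (%x. L * vdist N x y)" unfolding nrm_def by (intro continuous_intros)
 hence "((%x. L * vdist N x y) \<longlongrightarrow> L * vdist N y y) (at y within UNIV)"
  unfolding continuous_on_def by blast
 hence "((%x. L * vdist N x y) \<longlongrightarrow> 0) (at y within S)"
  by (auto simp: nrm_def intro: tendsto_within_subset)
 hence "((%x. f x - f y) \<longlongrightarrow> 0) (at y within S)"
  by (rule Lim_null_comparison [rotated]) (use assms y in \<open>auto simp: eventually_at_topological\<close>)
 thus "(f \<longlongrightarrow> f y) (at y within S)" by (simp add: LIM_zero_iff)
qed

text \<open>The residual sum of |z i - f i x| attains its minimum on a compact box. One Newton step with the fixed
inverse W of the derivative stays in the box and halves the residual, so the minimum is 0. The
constant eps is chosen to give the factor 1/2, which also yields the Lipschitz bound for the inverse.\<close>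

theorem inverse_function:
 fixes A W :: "nat => rvec"
 assumes f: "!!i. i <= N ==> sdiff N (f i) (A i) x0"
  and AW: "!!i j. i <= N ==> j <= N ==> (SUM l<=N. A i l * W l j) = (if i = j then 1 else 0)"
  and WA: "!!l k. l <= N ==> k <= N ==> (SUM i<=N. W l i * A i k) = (if l = k then 1 else 0)"
 obtains rho K where "rho > 0" "K > 0"
  "!!x y. near N x0 rho x ==> near N x0 rho y ==>
  vdist N x y <= K * (SUM i<=N. abs (f i x - f i y))"
  "!!r z. 0 < r ==> r <= rho ==> (SUM i<=N. abs (z i - f i x0)) <= r / (6 * K) ==>
  EX x. (near N x0 r x) & (ALL i>N. x i = x0 i) & (ALL i<=N. f i x = z i)"
proof -
 define w where "w = (SUM l<=N. SUM i<=N. abs (W l i)) + 1"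
 have w: "w > 0" unfolding w_def by (intro add_nonneg_pos sum_nonneg) auto
 have Wbound: "nrm N (%l. SUM i<=N. W l i * v i) <= w * (SUM i<=N. abs (v i))" for v
 proof -
  have "abs (SUM i<=N. W l i * v i) <= (SUM i<=N. abs (W l i)) * nrm N v" for l
  by (rule lin_bound) (rule member_le_sum [of _ "{..N}" "%i. abs (W l i)"], auto)
  hence "nrm N (%l. SUM i<=N. W l i * v i) <= (SUM l<=N. (SUM i<=N. abs (W l i)) * nrm N v)"
  unfolding nrm_def [of N "%l. SUM i<=N. W l i * v i"] by (rule sum_mono)
  also have "... <= w * nrm N v" unfolding w_def sum_distrib_right [symmetric] by (simp add: distrib_right)
  finally show ?thesis by (simp add: nrm_def)
 qed
 define eps where "eps = 1 / (2 * w * real (Suc N))"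
 have e: "eps > 0" "real (Suc N) * eps * w = 1 / 2" using w by (simp_all add: eps_def del: of_nat_Suc)
 have "ALL i:{..N}. EX rho. rho > 0 & (ALL x y. (ALL i<=N. abs (x i - x0 i) < rho & abs (y i - x0 i) < rho) -->
  abs (f i x - f i y - (SUM l<=N. A i l * (x l - y l))) <= eps * vdist N x y)"
  using f e(1) unfolding sdiff_def by simp
 then obtain R where R: "ALL i:{..N}. R i > 0 & (ALL x y. (ALL j<=N. abs (x j - x0 j) < R i & abs (y j - x0 j) < R i) -->
  abs (f i x - f i y - (SUM l<=N. A i l * (x l - y l))) <= eps * vdist N x y)"
  unfolding bchoice_iff by blast
 define rho where "rho = Min (R ` {..N})"
 have rho: "rho > 0" unfolding rho_def using R by (subst Min_gr_iff) auto
 have rhoR: "rho <= R i" if "i <= N" for i unfolding rho_def using that by (intro Min_le) auto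
 have err: "abs (f i x - f i y - (SUM l<=N. A i l * (x l - y l))) <= eps * vdist N x y"
  if i: "i <= N" and "near N x0 rho x" "near N x0 rho y" for i x y
 proof -
  have "ALL j<=N. abs (x j - x0 j) < R i & abs (y j - x0 j) < R i" using that rhoR [OF i] by (meson less_le_trans)
  moreover have "i : {..N}" using i by simp
  ultimately show ?thesis using R by blast
 qed
 let ?K = "2 * w"
 have lip: "vdist N x y <= ?K * (SUM i<=N. abs (f i x - f i y))"
  if xy: "near N x0 rho x" "near N x0 rho y" for x y
 proof -
  let ?v = "%i. SUM l<=N. A i l * (x l - y l)"
  let ?n = "vdist N x y"
  have "x l - y l = (SUM i<=N. W l i * ?v i)" if l: "l <= N" for l
  proof -
  have "(SUM i<=N. W l i * ?v i) = (SUM k<=N. (SUM i<=N. W l i * A i k) * (x k - y k))"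
  by (simp add: sum_distrib_left sum_distrib_right mult.assoc) (rule sum.swap)
  also have "... = (SUM k<=N. if k = l then x k - y k else 0)"
  by (rule sum.cong [OF refl]) (use WA l in auto)
  also have "... = x l - y l" using l by simp
  finally show ?thesis by simp
  qed
  hence "?n = nrm N (%l. SUM i<=N. W l i * ?v i)" unfolding nrm_def by (intro sum.cong) auto
  also have "... <= w * (SUM i<=N. abs (?v i))" by (rule Wbound)
  also have "(SUM i<=N. abs (?v i)) <= (SUM i<=N. abs (f i x - f i y) + eps * ?n)"
  proof (rule sum_mono)
  fix i assume "i : {..N}"
  hence "abs (f i x - f i y - ?v i) <= eps * ?n" using err xy by simp
  thus "abs (?v i) <= abs (f i x - f i y) + eps * ?n" by linarith
  qed
  also have "... = (SUM i<=N. abs (f i x - f i y)) + real (Suc N) * eps * ?n" by (simp add: sum.distrib)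
  finally have "?n <= w * ((SUM i<=N. abs (f i x - f i y)) + real (Suc N) * eps * ?n)" using w by simp
  also have "... = w * (SUM i<=N. abs (f i x - f i y)) + (real (Suc N) * eps * w) * ?n" by (simp add: algebra_simps)
  finally show ?thesis unfolding e(2) by linarith
 qed
 show thesis
 proof (rule that [OF rho _ lip])
  show "?K > 0" using w by simp
  fix r z assume r: "0 < r" "r <= rho" and z: "(SUM i<=N. abs (z i - f i x0)) <= r / (6 * ?K)"
  define B where "B = (\<Pi>\<^sub>E i\<in>UNIV. if i <= N then {x0 i - r / 2..x0 i + r / 2} else {x0 i})"
  have "compactin (product_topology (%i::nat. euclideanreal) UNIV) B"
  unfolding B_def compactin_PiE by simp
  hence B: "compact B" by (simp add: euclidean_product_topology)
  have Bi: "x : B \<longleftrightarrow> (ALL i<=N. abs (x i - x0 i) <= r / 2) & (ALL i>N. x i = x0 i)" for x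
  proof -
  have iv: "t : {a - c..a + c} \<longleftrightarrow> abs (t - a) <= c" for t a c :: real by (auto simp: abs_le_iff)
  have "x : B \<longleftrightarrow> (ALL i. x i : (if i <= N then {x0 i - r / 2..x0 i + r / 2} else {x0 i}))"
  by (simp add: B_def PiE_iff)
  also have "... \<longleftrightarrow> (ALL i. (i <= N --> abs (x i - x0 i) <= r / 2) & (~ i <= N --> x i = x0 i))"
  proof (intro all_cong1)
  fix i show "x i : (if i <= N then {x0 i - r / 2..x0 i + r / 2} else {x0 i}) \<longleftrightarrow>
  (i <= N --> abs (x i - x0 i) <= r / 2) & (~ i <= N --> x i = x0 i)"
  using iv [of "x i" "x0 i" "r / 2"] by (cases "i <= N") simp_all
  qed
  finally show ?thesis by (auto simp: not_le)
  qed
  have Br: "near N x0 rho x" if "x : B" for x using that r unfolding Bi by fastforce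
  have x0B: "x0 : B" unfolding Bi using r by simp
  define Q where "Q x = (SUM i<=N. abs (z i - f i x))" for x
  have "continuous_on B (f i)" if i: "i <= N" for i
  proof (rule lipschitz_continuous_on)
  fix x y assume "x : B" "y : B"
  hence "abs (f i x - f i y - (SUM l<=N. A i l * (x l - y l))) <= eps * vdist N x y"
  using err [OF i] Br by blast
  moreover have "abs (SUM l<=N. A i l * (x l - y l)) <= nrm N (A i) * vdist N x y"
  by (rule lin_bound) (rule coord_le_nrm)
  ultimately show "abs (f i x - f i y) <= (nrm N (A i) + eps) * vdist N x y" by (simp add: distrib_right)
  qed
  hence "continuous_on B Q" unfolding Q_def by (intro continuous_intros) auto
  then obtain x where x: "x : B" "!!y. y : B ==> Q x <= Q y"
  using continuous_attains_inf [OF B] x0B by blast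
  have Q0: "Q x0 <= r / (6 * ?K)" unfolding Q_def by (rule z)
  have Qx: "Q x <= Q x0" by (rule x(2) [OF x0B])
  have Qn: "Q y >= 0" for y unfolding Q_def by (simp add: sum_nonneg)
  \<comment> \<open>The Newton step at the minimiser x.\<close>
  define y where "y = (%l. if l <= N then x l + (SUM i<=N. W l i * (z i - f i x)) else x l)"
  let ?d = "vdist N y x"
  have d: "?d <= w * Q x"
  using Wbound [of "%i. z i - f i x"] unfolding Q_def y_def nrm_def by simp
  have "vdist N x x0 <= ?K * (SUM i<=N. abs (f i x - f i x0))" using lip Br x(1) x0B by blast
  also have "(SUM i<=N. abs (f i x - f i x0)) <= Q x + Q x0"
  unfolding Q_def sum.distrib [symmetric] by (rule sum_mono) linarith
  finally have "vdist N x x0 <= ?K * (Q x + Q x0)" using w by simp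
  hence "?d + vdist N x x0 <= w * Q x0 + ?K * (2 * Q x0)"
  using d Qx w by (smt (verit) mult_left_mono)
  also have "... <= 3 * ?K * Q x0" using w Qn [of x0] by (simp add: algebra_simps)
  also have "... <= 3 * ?K * (r / (6 * ?K))" using Q0 w by (intro mult_left_mono) auto
  also have "... = r / 2" using w by simp
  finally have tot: "?d + vdist N x x0 <= r / 2" .
  have yB: "y : B"
  unfolding Bi
  proof (intro conjI allI impI)
  fix i assume i: "i <= N"
  have "abs (y i - x i) <= ?d" "abs (x i - x0 i) <= vdist N x x0"
  using coord_le_nrm [OF i, of "%l. y l - x l"] coord_le_nrm [OF i, of "%i. x i - x0 i"] by simp_all
  thus "abs (y i - x0 i) <= r / 2" using tot by linarith
  next
  fix i assume "i > N" thus "y i = x0 i" using x(1) unfolding Bi y_def by simp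
  qed
  have "abs (z i - f i y) <= eps * (w * Q x)" if i: "i <= N" for i
  proof -
  have "(SUM l<=N. A i l * (y l - x l)) = (SUM l<=N. A i l * (SUM j<=N. W l j * (z j - f j x)))"
  by (rule sum.cong) (auto simp: y_def)
  also have "... = (SUM j<=N. (SUM l<=N. A i l * W l j) * (z j - f j x))"
  by (simp add: sum_distrib_left sum_distrib_right mult.assoc) (rule sum.swap)
  also have "... = (SUM j<=N. if j = i then z j - f j x else 0)"
  by (rule sum.cong [OF refl]) (use AW i in auto)
  also have "... = z i - f i x" using i by simp
  finally have "abs (f i y - f i x - (z i - f i x)) <= eps * ?d"
  using err [OF i Br [OF yB] Br [OF x(1)]] by simp
  also have "... <= eps * (w * Q x)" using d e(1) by simp
  finally show ?thesis by (simp add: abs_minus_commute)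
  qed
  hence "Q y <= (SUM i<=N. eps * (w * Q x))" unfolding Q_def [of y] by (intro sum_mono) simp
  also have "... = (real (Suc N) * eps * w) * Q x" by (simp add: algebra_simps)
  finally have "Q y <= Q x / 2" unfolding e(2) by simp
  hence "Q x = 0" using x(2) [OF yB] Qn [of x] by linarith
  hence "ALL i:{..N}. abs (z i - f i x) = 0" unfolding Q_def by (subst (asm) sum_nonneg_eq_0_iff) auto
  hence "ALL i<=N. f i x = z i" by simp
  moreover have "near N x0 r x" using x(1) r unfolding Bi by fastforce
  ultimately show "EX x. (near N x0 r x) & (ALL i>N. x i = x0 i) & (ALL i<=N. f i x = z i)"
  using x(1) unfolding Bi by blast
 qed
qed

section \<open>Frames: polynomial coordinate systems with their dual vector fields\<close>

lemma det_forms: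
 assumes M: "M : carrier_mat k k" and e: "!!i l. i < k ==> l < k ==> M $$ (i, l) : forms N (e i)"
 shows "Determinant.det M : forms N (SUM i<k. e i)"
 unfolding det_def' [OF M]
proof (rule forms_sum)
 fix p assume "p : {p. p permutes {0..<k}}"
 hence p: "p i < k" if "i < k" for i using permutes_in_image [of p "{0..<k}" i] that by simp
 have "(PROD i = 0..<k. M $$ (i, p i)) : forms N (\<Sum>i = 0..<k. e i)"
  using e p by (intro forms_prod) auto
 hence F: "(PROD i = 0..<k. M $$ (i, p i)) : forms N (SUM i<k. e i)" by (simp add: lessThan_atLeast0)
 show "signof p * (PROD i = 0..<k. M $$ (i, p i)) : forms N (SUM i<k. e i)"
  using F forms_minus [OF F] by (cases p rule: sign_cases) simp_all
qed

definition pmat :: "nat => (nat => rpoly) => rpoly mat" where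
 "pmat N f = Matrix.mat (Suc N) (Suc N) (%(i, l). pdiff l (f i))"

definition jac :: "nat => (nat => rpoly) => rpoly" where
 "jac N f = Determinant.det (pmat N f)"

text \<open>The adjugate matrix: up to the factor jac N f these are the coefficients of the vector fields dual
to the differentials of the frame. Keeping the denominator away makes them polynomial.\<close>

definition dual :: "nat => (nat => rpoly) => nat => nat => rpoly" where
 "dual N f j l = cofactor (pmat N f) j l"

lemma pmat_carrier [simp]: "pmat N f : carrier_mat (Suc N) (Suc N)"
 by (simp add: pmat_def)

lemma dual_right:
 assumes "i <= N" "j <= N"
 shows "(SUM l<=N. pdiff l (f i) * dual N f j l) = (if i = j then jac N f else 0)"
proof -
 have "(pmat N f * adj_mat (pmat N f)) $$ (i, j) = (jac N f \<cdot>\<^sub>m 1\<^sub>m (Suc N)) $$ (i, j)"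
  using adj_mat(2) [OF pmat_carrier [of N f]] by (simp add: jac_def)
 moreover have "(pmat N f * adj_mat (pmat N f)) $$ (i, j) = (SUM l<=N. pdiff l (f i) * dual N f j l)"
  using assms adj_mat(1) [OF pmat_carrier [of N f]]
  by (simp add: scalar_prod_def adj_mat_def dual_def pmat_def lessThan_Suc_atMost atLeast0LessThan del: sum.lessThan_Suc)
 ultimately show ?thesis using assms by simp
qed

lemma dual_left:
 assumes "l <= N" "k <= N"
 shows "(SUM i<=N. dual N f i l * pdiff k (f i)) = (if l = k then jac N f else 0)"
proof -
 have "(adj_mat (pmat N f) * pmat N f) $$ (l, k) = (jac N f \<cdot>\<^sub>m 1\<^sub>m (Suc N)) $$ (l, k)"
  using adj_mat(3) [OF pmat_carrier [of N f]] by (simp add: jac_def)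
 moreover have "(adj_mat (pmat N f) * pmat N f) $$ (l, k) = (SUM i<=N. dual N f i l * pdiff k (f i))"
  using assms adj_mat(1) [OF pmat_carrier [of N f]]
  by (simp add: scalar_prod_def adj_mat_def dual_def pmat_def lessThan_Suc_atMost atLeast0LessThan del: sum.lessThan_Suc)
 ultimately show ?thesis using assms by simp
qed

lemma jac_forms:
 assumes "!!i. i <= N ==> f i : forms N (d i)"
 shows "jac N f : forms N (SUM i<=N. d i - 1)"
proof -
 have "Determinant.det (pmat N f) : forms N (SUM i<Suc N. d i - 1)"
  by (rule det_forms [OF pmat_carrier]) (use assms pdiff_forms in \<open>simp add: pmat_def del: One_nat_def\<close>)
 thus ?thesis unfolding jac_def lessThan_Suc_atMost .
qed

lemma dual_forms:
 assumes "!!i. i <= N ==> f i : forms N (d i)" "j <= N" "l <= N"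
 shows "dual N f j l : forms N (SUM i<N. d (insert_index j i) - 1)"
proof -
 have c: "mat_delete (pmat N f) j l : carrier_mat N N"
  using mat_delete_carrier [OF pmat_carrier [of N f]] by simp
 have "Determinant.det (mat_delete (pmat N f) j l) : forms N (SUM i<N. d (insert_index j i) - 1)"
 proof (rule det_forms [OF c])
  fix i k assume ik: "i < N" "k < N"
  have "mat_delete (pmat N f) j l $$ (i, k) = pmat N f $$ (insert_index j i, insert_index l k)"
  using mat_delete_index [OF pmat_carrier [of N f], of j l i k] assms ik by simp
  also have "... = pdiff (insert_index l k) (f (insert_index j i))"
  using ik by (simp add: pmat_def insert_index_def)
  finally have eq: "mat_delete (pmat N f) j l $$ (i, k) = pdiff (insert_index l k) (f (insert_index j i))" .
  have "insert_index j i <= N" using ik by (simp add: insert_index_def)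
  thus "mat_delete (pmat N f) j l $$ (i, k) : forms N (d (insert_index j i) - 1)"
  unfolding eq by (intro pdiff_forms assms(1))
 qed
 thus ?thesis
  unfolding dual_def cofactor_def
  using forms_minus by (cases "even (j + l)") simp_all
qed

text \<open>Derivative of a polynomial along the \<open>j\<close>-th dual field.\<close>
definition dder :: "nat => (nat => rpoly) => nat => rpoly => rpoly" where
 "dder N f j G = (SUM l<=N. dual N f j l * pdiff l G)"

lemma dder_frame: "i <= N ==> j <= N ==> dder N f j (f i) = (if i = j then jac N f else 0)"
 using dual_right [of i N j f] by (simp add: dder_def mult.commute)

lemma dder_mult: "dder N f j (F * G) = dder N f j F * G + F * dder N f j G"
 by (simp add: dder_def pdiff_mult sum_distrib_left sum_distrib_right sum.distrib algebra_simps)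

lemma dder_add: "dder N f j (F + G) = dder N f j F + dder N f j G"
 by (simp add: dder_def pdiff_add sum.distrib algebra_simps)

lemma dder_const: "dder N f j (single 0 c) = 0"
 by (simp add: dder_def)

lemma dder_sum: "dder N f j (sum h I) = (SUM i:I. dder N f j (h i))"
proof (induction I rule: infinite_finite_induct)
 case (insert x I)
 thus ?case by (simp add: dder_add)
qed (simp_all add: dder_def)

lemma dder_forms:
 assumes "!!i. i <= N ==> f i : forms N (d i)" "j <= N" "G : forms N m"
 shows "dder N f j G : forms N ((SUM i<N. d (insert_index j i) - 1) + (m - 1))"
 unfolding dder_def using assms by (intro forms_sum forms_mult dual_forms pdiff_forms) auto

text \<open>Cramer's rule: expand in the basis of differentials of the frame.\<close>
lemma differential_expand:
 "reval (jac N f) x * (SUM l<=N. reval (pdiff l G) x * w l) =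
  (SUM i<=N. reval (dder N f i G) x * (SUM k<=N. reval (pdiff k (f i)) x * w k))"
proof -
 have L: "(SUM i<=N. reval (dual N f i l) x * reval (pdiff k (f i)) x) = (if l = k then reval (jac N f) x else 0)"
  if "l <= N" "k <= N" for l k
  using arg_cong [OF dual_left [OF that, of f], of "%F. reval F x"]
  by (cases "l = k") (simp_all add: reval_sum reval_mult)
 have "(SUM i<=N. reval (dder N f i G) x * (SUM k<=N. reval (pdiff k (f i)) x * w k))
  = (SUM i<=N. SUM k<=N. SUM l<=N. reval (dual N f i l) x * reval (pdiff k (f i)) x * (reval (pdiff l G) x * w k))"
 proof (rule sum.cong [OF refl])
  fix i
  have "reval (dder N f i G) x * (SUM k<=N. reval (pdiff k (f i)) x * w k)
  = (SUM l<=N. SUM k<=N. reval (dual N f i l) x * reval (pdiff l G) x * (reval (pdiff k (f i)) x * w k))"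
  unfolding dder_def by (simp only: reval_sum reval_mult sum_product)
  also have "... = (SUM k<=N. SUM l<=N. reval (dual N f i l) x * reval (pdiff l G) x * (reval (pdiff k (f i)) x * w k))"
  by (rule sum.swap)
  finally show "reval (dder N f i G) x * (SUM k<=N. reval (pdiff k (f i)) x * w k)
  = (SUM k<=N. SUM l<=N. reval (dual N f i l) x * reval (pdiff k (f i)) x * (reval (pdiff l G) x * w k))"
  by (simp only: mult_ac)
 qed
 also have "... = (SUM k<=N. SUM l<=N. SUM i<=N. reval (dual N f i l) x * reval (pdiff k (f i)) x * (reval (pdiff l G) x * w k))"
  by (subst sum.swap, rule sum.cong [OF refl], rule sum.swap)
 also have "... = (SUM k<=N. SUM l<=N. (if l = k then reval (jac N f) x else 0) * (reval (pdiff l G) x * w k))"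
  unfolding sum_distrib_right [symmetric] by (intro sum.cong refl) (use L in simp)
 also have "... = (SUM k<=N. reval (jac N f) x * (reval (pdiff k G) x * w k))"
  by (intro sum.cong refl) (simp add: if_distrib [of "%t. t * _"] cong: if_cong)
 finally show ?thesis by (simp add: sum_distrib_left)
qed

lemma peval_hom: "comm_ring_hom (%F. peval F x)"
 by unfold_locales (simp_all add: peval_add peval_mult)

lemma peval_jac: "peval (jac N f) x = Determinant.det (Matrix.mat (Suc N) (Suc N) (%(i, l). peval (pdiff l (f i)) x))"
proof -
 interpret h: comm_ring_hom "%F. peval F x" by (rule peval_hom)
 have "map_mat (%F. peval F x) (pmat N f) = Matrix.mat (Suc N) (Suc N) (%(i, l). peval (pdiff l (f i)) x)"
  by (rule eq_matI) (auto simp: pmat_def)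
 thus ?thesis unfolding jac_def using h.hom_det [of "pmat N f"] by simp
qed

lemma fsum_apply: "(SUM i:I. f i) x = (SUM i:I. f i x :: 'b::comm_monoid_add)"
 by (induction I rule: infinite_finite_induct) auto

section \<open>Frames adapted to a smooth variety\<close>

abbreviation unit :: "nat => nat => complex" where
 "unit l \<equiv> (%i. if i = l then 1 else 0)"

lemma in_span_units: "v : cvec.span (unit ` {..N}) \<longleftrightarrow> (ALL i>N. v i = 0)"
proof
 have "cvec.span (unit ` {..N}) <= {v. ALL i>N. v i = 0}"
  by (rule cvec.span_minimal) (auto intro!: cvec.subspaceI)
 thus "v : cvec.span (unit ` {..N}) ==> ALL i>N. v i = 0" by blast
 assume z: "ALL i>N. v i = 0"
 have "v = (SUM l<=N. (%i. v l * unit l i))"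
 proof
  fix i show "v i = (SUM l<=N. (%i. v l * unit l i)) i"
  using z by (cases "i <= N") (simp_all add: fsum_apply if_distrib [of "%t. _ * t"] cong: if_cong)
 qed
 also have "... : cvec.span (unit ` {..N})"
  by (intro cvec.span_sum cvec.span_scale cvec.span_base) simp
 finally show "v : cvec.span (unit ` {..N})" .
qed

definition grads :: "nat => point set => cvector => cvector set" where
 "grads N X x = {%i. peval (pdiff i F) x |F. F : (UN d. forms N d) & vanishes_on F X}"

lemma grads_span: "grads N X x <= cvec.span (unit ` {..N})"
proof
 fix v assume "v : grads N X x"
 then obtain F d where F: "v = (%i. peval (pdiff i F) x)" "F : forms N d" unfolding grads_def by blast
 have "v i = 0" if i: "i > N" for i
 proof -
  have "lookup m i = 0" if "m : keys F" for m
  using F(2) that i unfolding forms_iff by (metis atMost_iff in_keys_iff not_le subsetD)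
  hence "pdiff i F = 0" unfolding pdiff_def by simp
  thus "v i = 0" using F by simp
 qed
 thus "v : cvec.span (unit ` {..N})" unfolding in_span_units by blast
qed

definition dotp :: "nat => cvector => cvector => complex" where
 "dotp N a v = (SUM i<=N. a i * v i)"

lemma dotp_span:
 assumes "!!b. b : B ==> dotp N a b = 0" "v : cvec.span B" shows "dotp N a v = 0"
proof -
 have "cvec.subspace {v. dotp N a v = 0}"
  by (rule cvec.subspaceI) (auto simp: dotp_def distrib_left sum.distrib mult.left_commute simp flip: sum_distrib_left)
 hence "cvec.span B <= {v. dotp N a v = 0}" using assms(1) by (intro cvec.span_minimal) auto
 thus ?thesis using assms(2) by blast
qed

lemma dotp_unit [simp]: "i <= N ==> dotp N (unit i) v = v i" "i <= N ==> dotp N v (unit i) = v i"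
 by (simp_all add: dotp_def if_distrib [of "%t. _ * t"] if_distrib [of "%t. t * _"] cong: if_cong)

lemma independent_units: "cvec.independent (unit ` {..N})" and card_units: "card (unit ` {..N}) = Suc N"
proof -
 have inj: "inj unit" by (rule injI) (metis one_neq_zero)
 thus "card (unit ` {..N}) = Suc N" by (simp add: card_image inj_on_subset [OF inj])
 show "cvec.independent (unit ` {..N})"
 proof
  assume "cvec.dependent (unit ` {..N})"
  then obtain l where l: "l <= N" "unit l : cvec.span (unit ` {..N} - {unit l})" unfolding cvec.dependent_def by blast
  have "dotp N (unit l) (unit l) = 0"
  proof (rule dotp_span [OF _ l(2)])
  fix b assume "b : unit ` {..N} - {unit l}"
  then obtain k where "k <= N" "b = unit k" "k ~= l" by blast
  thus "dotp N (unit l) b = 0" using l(1) by simp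
  qed
  thus False using l(1) by simp
 qed
qed

definition real_cone :: "nat => point set => rvec => bool" where
 "real_cone N X x \<longleftrightarrow> cx x : coord_vectors N & proj_point (cx x) : X"

text \<open>The rank condition on the Jacobian matrix, in a form that passes to the image under a closed
immersion; codim below is N - n.\<close>

locale smooth_variety =
 fixes N n :: nat and X :: "point set"
 assumes Xclosed: "real_closed N X" and n_le: "n <= N"
  and dim_N: "!!P x. P : X ==> x : P ==> cvec.dim (grads N X x) = N - n"
begin

definition "codim = N - n"

lemma Xsub: "X <= proj_space N"
 using Xclosed by (rule real_closed_subset)

lemma codim_n: "codim + n = N"
 using n_le by (simp add: codim_def)

abbreviation ideal :: "nat => rpoly set" where
 "ideal d \<equiv> {F : forms N d. vanishes_on F X}"

lemma dim_grads: "P : X ==> x : P ==> cvec.dim (grads N X x) = codim"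
 using dim_N unfolding codim_def by blast

lemma independent_grads_span:
 assumes P: "P : X" "x : P" and F: "!!i. i < codim ==> F i : ideal (d i)"
  and D: "!!i j. i < codim ==> j < codim ==> dotp N (z j) (%l. peval (pdiff l (F i)) x) = (if i = j then tht else 0)" "tht ~= 0"
 shows "grads N X x <= cvec.span ((%i l. peval (pdiff l (F i)) x) ` {..<codim})"
proof
 define r where "r = (%i l. peval (pdiff l (F i)) x)"
 let ?R = "r ` {..<codim}"
 have D': "dotp N (z j) (r i) = (if i = j then tht else 0)" if "i < codim" "j < codim" for i j
  using D(1) [OF that] by (simp add: r_def)
 have inj: "inj_on r {..<codim}"
 proof (rule inj_onI)
  fix i j assume "i : {..<codim}" "j : {..<codim}" "r i = r j"
  thus "i = j" using D' [of i j] D' [of j j] D(2) by (auto split: if_splits)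
 qed
 have ind: "cvec.independent ?R"
 proof
  assume "cvec.dependent ?R"
  then obtain i where i: "i < codim" "r i : cvec.span (?R - {r i})" unfolding cvec.dependent_def by blast
  have "dotp N (z i) (r i) = 0"
  proof (rule dotp_span [OF _ i(2)])
  fix b assume "b : ?R - {r i}"
  then obtain j where "j < codim" "b = r j" "j ~= i" by blast
  thus "dotp N (z i) b = 0" using D' i(1) by simp
  qed
  thus False using D' i(1) D(2) by simp
 qed
 have RG: "?R <= grads N X x"
 proof
  fix v assume "v : ?R"
  then obtain i where i: "i < codim" "v = (%l. peval (pdiff l (F i)) x)" unfolding r_def by blast
  thus "v : grads N X x" using F [OF i(1)] unfolding grads_def by blast
 qed
 have dimg: "cvec.dim (grads N X x) = codim" using dim_grads [OF P] .
 fix v assume v: "v : grads N X x"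
 show "v : cvec.span ((%i l. peval (pdiff l (F i)) x) ` {..<codim})"
 proof (rule ccontr)
  assume nv: "v ~: cvec.span ((%i l. peval (pdiff l (F i)) x) ` {..<codim})"
  hence nv: "v ~: cvec.span ?R" by (simp add: r_def)
  have iv: "cvec.independent (insert v ?R)" by (rule cvec.independent_insertI [OF nv ind])
  have vR: "v ~: ?R" using cvec.span_base [of v ?R] nv by blast
  obtain B where B: "B <= grads N X x" "cvec.independent B" "grads N X x <= cvec.span B" "card B = codim"
  using cvec.basis_exists [of "grads N X x"] dimg by metis
  have fB: "finite B"
  using cvec.independent_span_bound [of "unit ` {..N}" B] B(1,2) grads_span [of N X x] by blast
  have "insert v ?R <= cvec.span B" using v RG B(3) by blast
  hence "card (insert v ?R) <= codim" using cvec.independent_span_bound [OF fB iv] B(4) by simp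
  moreover have "card (insert v ?R) = Suc codim" using vR inj by (simp add: card_image)
  ultimately show False by simp
 qed
qed

abbreviation cone :: "rvec => bool" where
 "cone x \<equiv> real_cone N X x"

definition fr :: "(nat => rpoly) => nat => (nat => nat) => nat => rpoly" where
 "fr F a J i = (if i < codim then F i else if i = codim then Xv a else Xv (J (i - Suc codim)))"

text \<open>codim equations of X, the coordinate that is normalised to 1 in the affine chart, and n coordinates
that serve as local parameters.\<close>

definition is_frame :: "(nat => rpoly) => (nat => nat) => nat => (nat => nat) => bool" where
 "is_frame F d a J \<longleftrightarrow> (ALL i<codim. F i : ideal (d i)) & a <= N & (ALL j<n. J j <= N)"

lemma fr_forms:
 assumes "is_frame F d a J" "i <= N" shows "fr F a J i : forms N (if i < codim then d i else 1)"
 using assms codim_n forms_Xv [of "J (i - Suc codim)" N] forms_Xv [of a N] unfolding is_frame_def fr_def by auto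

text \<open>A basis of the space of gradients at x is independent of the unit vector in direction a, because by
the Euler relation all gradients annihilate x and x a is nonzero; extend by unit vectors.\<close>

theorem frame_exists:
 assumes x: "cone x" and a: "x a ~= 0"
 obtains F d J where "is_frame F d a J" "reval (jac N (fr F a J)) x ~= 0"
proof -
 let ?P = "proj_point (cx x)" and ?x = "cx x" and ?U = "unit ` {..N}"
 have P: "?P : X" "?x : ?P" using x proj_point_self unfolding real_cone_def by blast+
 have xN: "x i = 0" if "i > N" for i using x that unfolding real_cone_def coord_vectors_def by simp
 hence aN: "a <= N" using a by (meson not_le)
 obtain B where B: "B <= grads N X ?x" "cvec.independent B" "grads N X ?x <= cvec.span B" "card B = codim"
  using cvec.basis_exists [of "grads N X ?x"] dim_grads [OF P] by metis
 have fB: "finite B"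
  using cvec.independent_span_bound [of ?U B] B(1,2) grads_span [of N X ?x] by blast
 obtain h where h: "bij_betw h {..<codim} B"
  using ex_bij_betw_nat_finite [OF fB] B(4) by (auto simp: lessThan_atLeast0)
 have hB: "h i : B" if "i < codim" for i using bij_betwE [OF h] that by simp
 have "ALL i:{..<codim}. EX t. fst t : ideal (snd t) & h i = (%l. peval (pdiff l (fst t)) ?x)"
 proof
  fix i assume "i : {..<codim}"
  hence "h i : grads N X ?x" using hB B(1) by blast
  then obtain F d where "F : ideal d" "h i = (%l. peval (pdiff l F) ?x)" unfolding grads_def by blast
  thus "EX t. fst t : ideal (snd t) & h i = (%l. peval (pdiff l (fst t)) ?x)" by (intro exI [of _ "(F, d)"]) simp
 qed
 then obtain t where t: "ALL i:{..<codim}. fst (t i) : ideal (snd (t i)) & h i = (%l. peval (pdiff l (fst (t i))) ?x)"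
  unfolding bchoice_iff by blast
 define F where "F i = fst (t i)" for i
 define d where "d i = snd (t i)" for i
 have F: "F i : ideal (d i)" "h i = (%l. peval (pdiff l (F i)) ?x)" if "i < codim" for i
  using t that unfolding F_def d_def by blast+
 have euler: "dotp N ?x b = 0" if "b : B" for b
 proof -
  obtain i where i: "i < codim" "b = h i" using h `b : B` unfolding bij_betw_def by blast
  have Fi: "F i : forms N (d i)" "vanishes_on (F i) X" using F(1) [OF i(1)] by blast+
  have "peval (F i) ?x = 0" using Fi(2) P unfolding vanishes_defs by blast
  hence "(SUM l<=N. ?x l * peval (pdiff l (F i)) ?x) = 0"
  using arg_cong [OF euler_forms [OF Fi(1)], of "%F. peval F ?x"] by (simp add: peval_sum peval_mult)
  thus ?thesis unfolding dotp_def i(2) F(2) [OF i(1)] .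
 qed
 have ua: "dotp N ?x (unit a) = ?x a"
  using aN by (simp add: dotp_def if_distrib [of "%t. _ * t"] cong: if_cong)
 hence "unit a ~: cvec.span B" using dotp_span [of B N ?x, OF euler] a by auto
 hence iS: "cvec.independent (insert (unit a) B)" and uaB: "unit a ~: B"
  using B(2) cvec.span_base by (auto simp: cvec.independent_insert)
 let ?S = "insert (unit a) B"
 obtain B' where B': "?S <= B'" "B' <= ?S Un ?U" "cvec.independent B'" "?S Un ?U <= cvec.span B'"
  using cvec.maximal_independent_subset_extend [of ?S "?S Un ?U", OF _ iS] by blast
 have iU: "cvec.independent ?U"
 proof
  assume "cvec.dependent ?U"
  then obtain l where l: "l <= N" "unit l : cvec.span (?U - {unit l})" unfolding cvec.dependent_def by blast
  have "dotp N (unit l) (unit l) = 0"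
  proof (rule dotp_span [OF _ l(2)])
  fix b assume "b : ?U - {unit l}"
  then obtain k where "b = unit k" "k ~= l" by blast
  thus "dotp N (unit l) b = 0" unfolding dotp_def by (intro sum.neutral) auto
  qed
  thus False using l(1) by (simp add: dotp_def if_distrib [of "%t. _ * t"] cong: if_cong)
 qed
 have injU: "inj_on unit {..N}" by (rule inj_onI) (metis zero_neq_one)
 have cU: "card ?U = Suc N" using injU by (simp add: card_image)
 have fU: "finite ?U" by simp
 have "?S Un ?U <= cvec.span ?U"
  using B(1) grads_span [of N X ?x] aN by (auto intro: cvec.span_base)
 hence B'U: "B' <= cvec.span ?U" using B'(2) by blast
 hence fB': "finite B'" and cB': "card B' <= Suc N"
  using cvec.independent_span_bound [OF fU B'(3)] cU by simp_all
 have "Suc N <= card B'" using cvec.independent_span_bound [OF fB' iU] B'(4) cU by simp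
 hence cB': "card B' = Suc N" using cB' by simp
 have cS: "card ?S = Suc codim" using uaB fB B(4) by simp
 have cR: "card (B' - ?S) = n" using B'(1) fB fB' cB' cS codim_n by (simp add: card_Diff_subset)
 obtain g where g: "bij_betw g {..<n} (B' - ?S)"
  using ex_bij_betw_nat_finite [of "B' - ?S"] fB' cR by (auto simp: lessThan_atLeast0)
 have "ALL j:{..<n}. EX k. k <= N & g j = unit k"
 proof
  fix j assume "j : {..<n}"
  hence "g j : B' - ?S" using bij_betwE [OF g] by blast
  hence "g j : ?U" using B'(2) by blast
  thus "EX k. k <= N & g j = unit k" by blast
 qed
 then obtain J where J: "ALL j:{..<n}. J j <= N & g j = unit (J j)" unfolding bchoice_iff by blast
 have frm: "is_frame F d a J" unfolding is_frame_def using F(1) aN J by simp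
 define r where "r i = (%l. if l <= N then peval (pdiff l (fr F a J i)) ?x else 0)" for i
 have gN: "v l = 0" if "v : B" "l > N" for v l
 proof -
  have "v : cvec.span ?U" using that(1) B(1) grads_span [of N X ?x] by blast
  moreover have "cvec.span ?U <= {v. v l = 0}"
  using that(2) by (intro cvec.span_minimal cvec.subspaceI) auto
  ultimately show ?thesis by blast
 qed
 have r1: "r i = h i" if "i < codim" for i
  using F(2) [OF that] gN [OF hB [OF that]] that unfolding r_def fr_def by (auto simp: fun_eq_iff)
 have r2: "r codim = unit a" using aN unfolding r_def fr_def by (auto simp: fun_eq_iff pdiff_Xv)
 have r3: "r (Suc codim + j) = g j" if "j < n" for j
  using J that unfolding r_def fr_def by (auto simp: fun_eq_iff pdiff_Xv)
 have rB': "r ` {..N} = B'"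
 proof
  show "r ` {..N} <= B'"
  proof clarify
  fix i assume i: "i <= N"
  consider "i < codim" | "i = codim" | j where "i = Suc codim + j" "j < n"
  proof -
  have "i < codim | i = codim | (i = Suc codim + (i - Suc codim) & i - Suc codim < n)"
  using i codim_n by linarith
  thus thesis using that by blast
  qed
  thus "r i : B'"
  proof cases
  case 1
  thus ?thesis using r1 hB B'(1) by auto
  next
  case 2
  thus ?thesis using r2 B'(1) by auto
  next
  case 3
  thus ?thesis using r3 bij_betwE [OF g] by auto
  qed
  qed
  show "B' <= r ` {..N}"
  proof
  fix v assume v: "v : B'"
  consider "v : B" | "v = unit a" | "v : B' - ?S" using v by blast
  thus "v : r ` {..N}"
  proof cases
  case 1
  then obtain i where "i < codim" "v = h i" using h unfolding bij_betw_def by blast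
  thus ?thesis using r1 codim_n by (intro image_eqI [of _ _ i]) auto
  next
  case 2
  thus ?thesis using r2 codim_n by (intro image_eqI [of _ _ codim]) auto
  next
  case 3
  then obtain j where "j < n" "v = g j" using g unfolding bij_betw_def by blast
  thus ?thesis using r3 codim_n by (intro image_eqI [of _ _ "Suc codim + j"]) auto
  qed
  qed
 qed
 have rinj: "inj_on r {..N}" by (rule eq_card_imp_inj_on) (simp_all add: rB' cB')
 have "ALL l:{..N}. EX w. unit l = (SUM i<=N. (%k. w i * r i k))"
 proof
  fix l assume "l : {..N}"
  hence "unit l : cvec.span B'" using B'(4) by blast
  then obtain u where "unit l = (SUM v:B'. (%k. u v * v k))" unfolding cvec.span_finite [OF fB'] by blast
  also have "... = (SUM i<=N. (%k. u (r i) * r i k))"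
  unfolding rB' [symmetric] by (rule sum.reindex [OF rinj, unfolded o_def])
  finally show "EX w. unit l = (SUM i<=N. (%k. w i * r i k))" by (intro exI [of _ "%i. u (r i)"])
 qed
 then obtain w where w: "ALL l:{..N}. unit l = (SUM i<=N. (%k. w l i * r i k))" unfolding bchoice_iff by blast
 define A where "A = Matrix.mat (Suc N) (Suc N) (%(i, l). peval (pdiff l (fr F a J i)) ?x)"
 define W where "W = Matrix.mat (Suc N) (Suc N) (%(l, i). w l i)"
 have "W * A = 1\<^sub>m (Suc N)"
 proof (rule eq_matI)
  fix l k assume "l < dim_row (1\<^sub>m (Suc N) :: complex mat)" "k < dim_col (1\<^sub>m (Suc N) :: complex mat)"
  hence lk: "l <= N" "k <= N" by simp_all
  have "(W * A) $$ (l, k) = (SUM i<=N. w l i * r i k)"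
  using lk by (simp add: W_def A_def scalar_prod_def r_def lessThan_Suc_atMost atLeast0LessThan del: sum.lessThan_Suc)
  also have "... = unit l k"
  using fun_cong [OF w [rule_format, of l], of k] lk by (simp add: fsum_apply)
  finally show "(W * A) $$ (l, k) = 1\<^sub>m (Suc N) $$ (l, k)" using lk by simp
 qed (simp_all add: W_def A_def)
 hence "Determinant.det W * Determinant.det A = 1"
  using Determinant.det_mult [of W "Suc N" A] by (simp add: W_def A_def)
 hence "Determinant.det A ~= 0" by auto
 hence "peval (jac N (fr F a J)) ?x ~= 0" unfolding peval_jac A_def .
 hence "reval (jac N (fr F a J)) x ~= 0" unfolding peval_cx by simp
 thus thesis using that frm by blast
qed

text \<open>On X the gradient of an element of the ideal is a combination of the gradients of the frame equations,
and these are annihilated by the remaining dual fields.\<close>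

lemma dder_ideal_zero:
 assumes fm: "is_frame F d a J" and G: "G : ideal m" and P: "P : X" "x : P"
  and th: "peval (jac N (fr F a J)) x ~= 0" and j: "codim <= j" "j <= N"
 shows "peval (dder N (fr F a J) j G) x = 0"
proof -
 let ?f = "fr F a J"
 have D: "dotp N (%l. peval (dual N ?f j l) x) (%l. peval (pdiff l (F i)) x) = (if i = j then peval (jac N ?f) x else 0)"
  if "i < codim" "j <= N" for i j
  using arg_cong [OF dual_right [of i N j ?f], of "%F. peval F x"] that codim_n
  by (simp add: peval_sum peval_mult dotp_def fr_def mult.commute)
 have "grads N X x <= cvec.span ((%i l. peval (pdiff l (F i)) x) ` {..<codim})"
 proof (rule independent_grads_span [OF P])
  show "F i : ideal (d i)" if "i < codim" for i using fm that unfolding is_frame_def by blast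
  show "dotp N (%l. peval (dual N ?f j l) x) (%l. peval (pdiff l (F i)) x) = (if i = j then peval (jac N ?f) x else 0)"
  if "i < codim" "j < codim" for i j using D that codim_n by simp
 qed (rule th)
 moreover have "(%l. peval (pdiff l G) x) : grads N X x" using G unfolding grads_def by blast
 ultimately have "(%l. peval (pdiff l G) x) : cvec.span ((%i l. peval (pdiff l (F i)) x) ` {..<codim})" by blast
 hence "dotp N (%l. peval (dual N ?f j l) x) (%l. peval (pdiff l G) x) = 0"
  by (rule dotp_span [rotated]) (use D j in auto)
 thus ?thesis by (simp add: dder_def peval_sum peval_mult dotp_def)
qed

lemma jac_dder_ideal:
 assumes fm: "is_frame F d a J" and G: "G : ideal m" and j: "codim <= j" "j <= N"
 shows "vanishes_on (jac N (fr F a J) * dder N (fr F a J) j G) X"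
 unfolding vanishes_defs
proof (intro ballI)
 fix P x assume "P : X" "x : P"
 thus "peval (jac N (fr F a J) * dder N (fr F a J) j G) x = 0"
  using dder_ideal_zero [OF fm G _ _ _ j] by (cases "peval (jac N (fr F a J)) x = 0") (auto simp: peval_mult)
qed

end

section \<open>The real locus is locally a common zero set\<close>

lemma has_derivative_of_quadratic_error:
 fixes u :: "real => real"
 assumes "t : S" "!!t'. t' : S ==> abs (u t' - u t - c * (t' - t)) <= C * (t' - t)\<^sup>2"
 shows "(u has_field_derivative c) (at t within S)"
 unfolding has_field_derivative_iff
proof (rule Lim_null_comparison [THEN LIM_zero_cancel])
 show "eventually (%t'. norm ((u t' - u t) / (t' - t) - c) <= C * abs (t' - t)) (at t within S)"
  unfolding eventually_at_topological
 proof (intro exI [of _ UNIV] conjI ballI impI)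
  fix t' assume t': "t' ~= t" "t' : S"
  hence "(u t' - u t) / (t' - t) - c = (u t' - u t - c * (t' - t)) / (t' - t)" by (simp add: field_simps)
  hence "norm ((u t' - u t) / (t' - t) - c) <= C * (t' - t)\<^sup>2 / abs (t' - t)"
  using assms(2) [OF t'(2)] by (simp add: divide_right_mono)
  also have "(t' - t)\<^sup>2 = abs (t' - t) * abs (t' - t)" by (simp add: power2_eq_square)
  also have "C * (abs (t' - t) * abs (t' - t)) / abs (t' - t) = C * abs (t' - t)"
  using t'(1) by (simp del: abs_mult_self_eq)
  finally show "norm ((u t' - u t) / (t' - t) - c) <= C * abs (t' - t)" .
 qed auto
 have "((%t'. C * abs (t' - t)) \<longlongrightarrow> C * abs (t - t)) (at t within S)" by (intro tendsto_intros)
 thus "((%t'. C * abs (t' - t)) \<longlongrightarrow> 0) (at t within S)" by simp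
qed

text \<open>One integration step: a bound of order p on the derivative gives order p + 1 with the factor
1 / (p + 1), which compensates the factorial growth of iterated derivatives.\<close>

lemma power_bound_of_derivative:
 fixes u :: "real => real"
 assumes u: "!!s. 0 <= s ==> s <= 1 ==> (u has_field_derivative u' s) (at s within {0..1})"
  "!!s. 0 <= s ==> s <= 1 ==> abs (u' s) <= K * s ^ p" and u0: "u 0 = 0" and t: "0 <= t" "t <= 1"
 shows "abs (u t) <= K * t ^ Suc p / real (Suc p)"
proof -
 have "0 <= K * t ^ Suc p / real (Suc p) + c * u t" if c: "abs c = 1" for c
 proof -
  let ?g = "%s. K / real (Suc p) * s ^ Suc p + c * u s"
  have d: "(?g has_field_derivative K / real (Suc p) * (real (Suc p) * s ^ p) + c * u' s) (at s within {0..1})"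
  if "0 <= s" "s <= 1" for s
  using u(1) [OF that] by (auto intro!: derivative_eq_intros simp del: of_nat_Suc power_Suc)
  have "?g 0 <= ?g t"
  proof (rule DERIV_nonneg_imp_increasing_open [OF t(1)])
  fix s assume s: "0 < s" "s < t"
  hence s1: "0 <= s" "s <= 1" "s < 1" using t by auto
  have "abs (c * u' s) <= K * s ^ p" using u(2) [OF s1(1,2)] c by (simp add: abs_mult)
  hence "0 <= K / real (Suc p) * (real (Suc p) * s ^ p) + c * u' s" by (simp del: of_nat_Suc)
  moreover have "at s within {0..1} = at s" using s s1 by (intro at_within_Icc_at) auto
  ultimately show "EX y. (?g has_field_derivative y) (at s) & 0 <= y" using d [OF s1(1,2)] by metis
  next
  have "continuous_on {0..1} ?g" using d by (intro DERIV_continuous_on) auto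
  thus "continuous_on {0..t} ?g" by (rule continuous_on_subset) (use t in auto)
  qed
  thus ?thesis using u0 by simp
 qed
 from this [of 1] this [of "-1"] show ?thesis by simp
qed

lemma le_geometric_imp_nonpos:
 fixes y c q :: real
 assumes "!!p. y <= c * q ^ p" "0 <= q" "q < 1" shows "y <= 0"
proof -
 have "(%p. c * q ^ p) \<longlonglongrightarrow> c * 0" using assms by (intro tendsto_mult tendsto_const LIMSEQ_power_zero) auto
 hence "(%p. c * q ^ p) \<longlonglongrightarrow> 0" by simp
 thus ?thesis by (rule LIMSEQ_le_const) (use assms(1) in auto)
qed

context smooth_variety
begin

lemma cone_ideal: "cone x ==> G : ideal m ==> reval G x = 0"
proof -
 assume x: "cone x" and G: "G : ideal m"
 have "peval G (cx x) = 0"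
  using x G proj_point_self [of "cx x"] unfolding real_cone_def vanishes_defs by blast
 thus "reval G x = 0" by (simp add: peval_cx)
qed

lemma coneI:
 assumes "!!i. i > N ==> x i = 0" "x a ~= 0" "!!G m. G : ideal m ==> reval G x = 0"
 shows "cone x"
proof -
 have cv: "cx x : coord_vectors N" unfolding coord_vectors_def using assms(1,2) by auto
 hence Pp: "proj_point (cx x) : proj_space N" unfolding proj_space_def by blast
 obtain S where S: "S <= (UN d. forms N d)" "X = {P : proj_space N. ALL F:S. vanishes_at F P}"
  using Xclosed unfolding real_closed_def by blast
 have "vanishes_at G (proj_point (cx x))" if G: "G : S" for G
 proof -
  obtain m where m: "G : forms N m" using S(1) G by blast
  have "vanishes_on G X" unfolding vanishes_on_def using S(2) G by blast
  hence "reval G x = 0" using assms(3) m by blast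
  thus ?thesis using vanishes_at_proj_point [OF m] by (simp add: peval_cx)
 qed
 hence "proj_point (cx x) : X" using Pp S(2) by blast
 thus ?thesis using cv by (simp add: real_cone_def)
qed

lemma frame_inverse:
 assumes th: "reval (jac N f) x0 ~= 0"
 shows "i <= N ==> j <= N ==> (SUM l<=N. reval (pdiff l (f i)) x0 * (reval (dual N f j l) x0 / reval (jac N f) x0)) = (if i = j then 1 else 0)"
  and "l <= N ==> k <= N ==> (SUM i<=N. reval (dual N f i l) x0 / reval (jac N f) x0 * reval (pdiff k (f i)) x0) = (if l = k then 1 else 0)"
proof -
 let ?T = "reval (jac N f) x0"
 show "i <= N ==> j <= N ==> (SUM l<=N. reval (pdiff l (f i)) x0 * (reval (dual N f j l) x0 / ?T)) = (if i = j then 1 else 0)"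
 proof -
  assume ij: "i <= N" "j <= N"
  have "(SUM l<=N. reval (pdiff l (f i)) x0 * (reval (dual N f j l) x0 / ?T)) = reval (SUM l<=N. pdiff l (f i) * dual N f j l) x0 / ?T"
  by (simp add: reval_sum reval_mult sum_divide_distrib)
  thus ?thesis unfolding dual_right [OF ij] using th by simp
 qed
 show "l <= N ==> k <= N ==> (SUM i<=N. reval (dual N f i l) x0 / ?T * reval (pdiff k (f i)) x0) = (if l = k then 1 else 0)"
 proof -
  assume lk: "l <= N" "k <= N"
  have "(SUM i<=N. reval (dual N f i l) x0 / ?T * reval (pdiff k (f i)) x0) = reval (SUM i<=N. dual N f i l * pdiff k (f i)) x0 / ?T"
  by (simp add: reval_sum reval_mult sum_divide_distrib)
  thus ?thesis unfolding dual_left [OF lk] using th by simp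
 qed
qed

text \<open>The ideal of X is stable under the dual fields tangent to X. Move from x0 to x along the curve on
which all frame coordinates change linearly. For G in the ideal, the derivative along the curve is a
combination of the dder j G / jac with dder j G again in the ideal; so all iterated derivatives vanish
at x0. The norms of k-fold derivatives grow like k! M^k, hence G vanishes along a curve that is short
enough, and the same length serves for every G.\<close>

theorem local_manifold:
 assumes fm: "is_frame F d a J" and c0: "cone x0" and a1: "x0 a = 1"
  and th: "reval (jac N (fr F a J)) x0 ~= 0"
 obtains rho where "rho > 0" "!!x. near N x0 rho x ==> ALL i>N. x i = 0 ==> x a = 1 ==>
  ALL i<codim. reval (F i) x = 0 ==> cone x"
proof -
 define f where "f = fr F a J"
 define df where "df i = (if i < codim then d i else 1)" for i
 have f: "f i : forms N (df i)" if "i <= N" for i using fr_forms [OF fm that] by (simp add: f_def df_def)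
 define T where "T = reval (jac N f) x0"
 have T: "T ~= 0" using th by (simp add: T_def f_def)
 have aN: "a <= N" using fm by (simp add: is_frame_def)
 have x0N: "x0 i = 0" if "i > N" for i using c0 that unfolding real_cone_def coord_vectors_def by simp
 obtain rho1 K where rK: "rho1 > 0" "K > 0"
  "!!x y. near N x0 rho1 x ==> near N x0 rho1 y ==>
  vdist N x y <= K * (SUM i<=N. abs (reval (f i) x - reval (f i) y))"
  "!!r z. 0 < r ==> r <= rho1 ==> (SUM i<=N. abs (z i - reval (f i) x0)) <= r / (6 * K) ==>
  EX x. (near N x0 r x) & (ALL i>N. x i = x0 i) & (ALL i<=N. reval (f i) x = z i)"
 proof (rule inverse_function [of N "%i. reval (f i)" "%i l. reval (pdiff l (f i)) x0" x0 "%l j. reval (dual N f j l) x0 / T"])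
  show "sdiff N (reval (f i)) (%l. reval (pdiff l (f i)) x0) x0" if "i <= N" for i
  using f [OF that] by (rule sdiff_reval)
 qed (use frame_inverse [of f x0] T in \<open>simp_all add: T_def\<close>)
 define R where "R = nrm N x0 + 1"
 have R1: "R >= 1" by (simp add: R_def)
 note inR = inbox_near [of N _ x0, folded R_def]
 have x0R: "inbox N R x0" unfolding R_def using coord_le_nrm [of _ N x0] by fastforce
 define dj where "dj = (SUM i<=N. df i - 1)"
 have jf: "jac N f : forms N dj" unfolding dj_def by (rule jac_forms) (rule f)
 obtain dl0 where d0: "dl0 > 0" "!!x. near N x0 dl0 x ==> abs T <= 2 * abs (reval (jac N f) x)"
  unfolding T_def by (rule nonzero_near [OF sdiff_reval [OF jf] T [unfolded T_def]]) blast
 define CS where "CS = (SUM i<=N. lipc N (df i) (f i) R)"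
 have CS: "CS >= 0" unfolding CS_def by (intro sum_nonneg lipc_nonneg)
 define e where "e j = (SUM i<N. df (insert_index j i) - 1)" for j
 define E where "E = dj + (SUM j<=N. e j) + 1"
 have eE: "dj + (e j + (m - 1)) <= m + E" if "j <= N" for j m
 proof -
  have "e j <= (SUM j<=N. e j)" using that by (intro member_le_sum) auto
  thus ?thesis unfolding E_def by linarith
 qed
 define Om where "Om = norm1 (jac N f) * (SUM j<=N. SUM l<=N. norm1 (dual N f j l))"
 have Om: "Om >= 0" unfolding Om_def by (intro mult_nonneg_nonneg sum_nonneg norm1_nonneg)
 define M where "M = Om * real E * R ^ E"
 have M: "M >= 0" unfolding M_def using Om R1 by simp
 define dl where "dl = min (min rho1 1) dl0"
 have dl: "dl > 0" "dl <= rho1" "dl <= 1" "dl <= dl0" using rK(1) d0(1) by (auto simp: dl_def)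
 have TH: "abs T <= 2 * abs (reval (jac N f) x)" if x: "near N x0 dl x" for x
  by (rule d0(2)) (use x dl(4) in \<open>meson less_le_trans\<close>)
 \<comment> \<open>The second bound makes the geometric ratio of the iterated estimate less than 1.\<close>
 define eta where "eta = min (dl / (6 * K)) (T\<^sup>2 / (16 * (M + 1)))"
 have eta: "eta > 0" using dl(1) rK(2) T M by (auto simp: eta_def)
 define rho where "rho = min dl (eta / (CS * real (Suc N) + 1))"
 have pos2: "0 < CS * real (Suc N) + 1" using CS by (simp add: add_nonneg_pos)
 have rho: "rho > 0" "rho <= dl" using dl(1) eta pos2 by (auto simp: rho_def)
 have "rho * (CS * real (Suc N) + 1) <= eta" unfolding pos_le_divide_eq [OF pos2, symmetric] by (simp add: rho_def)
 hence rhoeta: "CS * (real (Suc N) * rho) <= eta" using rho(1) by (simp add: algebra_simps)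
 show thesis
 proof (rule that [OF rho(1)])
  fix x assume x: "near N x0 rho x" and xN: "ALL i>N. x i = 0" and xa: "x a = 1"
  and xF: "ALL i<codim. reval (F i) x = 0"
  have xdl: "near N x0 dl x" using x rho(2) by (meson less_le_trans)
  define D where "D i = reval (f i) x - reval (f i) x0" for i
  define DS where "DS = (SUM i<=N. abs (D i))"
  have DS0: "DS >= 0" by (simp add: DS_def sum_nonneg)
  have D0: "D i = 0" if i: "i <= codim" for i
  proof (cases "i = codim")
  case True
  thus ?thesis using xa a1 by (simp add: D_def f_def fr_def)
  next
  case False
  hence "i < codim" using i by simp
  moreover have "reval (F i) x0 = 0" using cone_ideal [OF c0] fm `i < codim` unfolding is_frame_def by blast
  ultimately show ?thesis using xF by (simp add: D_def f_def fr_def)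
  qed
  have "DS <= (SUM i<=N. lipc N (df i) (f i) R * (real (Suc N) * rho))"
  unfolding DS_def
  proof (rule sum_mono)
  fix i assume "i : {..N}"
  hence "abs (D i) <= lipc N (df i) (f i) R * vdist N x x0"
  unfolding D_def by (intro reval_lipschitz f inR [OF xdl dl(3)] x0R) simp
  also have "... <= lipc N (df i) (f i) R * (real (Suc N) * rho)"
  using x by (intro mult_left_mono nrm_bound lipc_nonneg) (auto intro: less_imp_le)
  finally show "abs (D i) <= lipc N (df i) (f i) R * (real (Suc N) * rho)" .
  qed
  also have "... = CS * (real (Suc N) * rho)" by (simp add: CS_def sum_distrib_right)
  finally have DS: "DS <= eta" using rhoeta by linarith
  have "ALL t:{0..1}. EX y. (near N x0 dl y) & (ALL i>N. y i = x0 i) & (ALL i<=N. reval (f i) y = reval (f i) x0 + t * D i)"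
  proof
  fix t :: real assume t: "t : {0..1}"
  have "(SUM i<=N. abs (reval (f i) x0 + t * D i - reval (f i) x0)) = t * DS"
  using t by (simp add: DS_def abs_mult sum_distrib_left)
  also have "... <= DS" using t DS0 by (simp add: mult_left_le_one_le)
  also have "... <= dl / (6 * K)" using DS by (simp add: eta_def)
  finally show "EX y. (near N x0 dl y) & (ALL i>N. y i = x0 i) & (ALL i<=N. reval (f i) y = reval (f i) x0 + t * D i)"
  using rK(4) [OF dl(1,2), of "%i. reval (f i) x0 + t * D i"] by blast
  qed
  then obtain gam where "ALL t:{0..1}. (near N x0 dl (gam t)) & (ALL i>N. gam t i = x0 i) & (ALL i<=N. reval (f i) (gam t) = reval (f i) x0 + t * D i)"
  unfolding bchoice_iff by blast
  hence gam: "near N x0 dl (gam t)" "!!i. i <= N ==> reval (f i) (gam t) = reval (f i) x0 + t * D i"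
  if "0 <= t" "t <= 1" for t using that by simp_all
  have dlrho1: "near N x0 rho1 y" if "near N x0 dl y" for y
  using that dl(2) by (meson less_le_trans)
  define L where "L = K * DS"
  have L: "L >= 0" using rK(2) DS0 by (simp add: L_def)
  have lip: "vdist N (gam t') (gam t) <= L * abs (t' - t)" if t: "0 <= t" "t <= 1" "0 <= t'" "t' <= 1" for t t'
  proof -
  have "vdist N (gam t') (gam t) <= K * (SUM i<=N. abs (reval (f i) (gam t') - reval (f i) (gam t)))"
  by (rule rK(3)) (use t gam(1) dlrho1 in auto)
  also have "(SUM i<=N. abs (reval (f i) (gam t') - reval (f i) (gam t))) = (SUM i<=N. abs (D i) * abs (t' - t))"
  using gam(2) t by (intro sum.cong) (simp_all flip: abs_mult add: algebra_simps)
  also have "K * ... = L * abs (t' - t)" by (simp add: L_def DS_def sum_distrib_right)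
  finally show ?thesis .
  qed
  have same: "reval G y = reval G y'" if "near N x0 dl y" "near N x0 dl y'"
  "!!i. i <= N ==> reval (f i) y = reval (f i) y'" "G : forms N m" for y y' G m
  proof -
  have "vdist N y y' <= K * (SUM i<=N. abs (reval (f i) y - reval (f i) y'))"
  by (rule rK(3)) (use that dlrho1 in auto)
  also have "... = 0" using that(3) by simp
  finally have "abs (y i - y' i) <= 0" if "i <= N" for i using coord_le_nrm [OF that, of "%i. y i - y' i"] by linarith
  thus ?thesis using reval_cong [OF that(4), of y y'] by simp
  qed
  define kap where "kap = 4 * DS / T\<^sup>2"
  have kap: "kap >= 0" using DS0 by (simp add: kap_def)
  define A where "A = kap * M"
  have A: "A >= 0" "2 * A < 1"
  proof -
  show "A >= 0" using kap M by (simp add: A_def)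
  have "DS <= T\<^sup>2 / (16 * (M + 1))" using DS by (simp add: eta_def)
  hence "DS * (16 * (M + 1)) <= T\<^sup>2" using M by (simp add: pos_le_divide_eq)
  hence "8 * DS * M <= T\<^sup>2 / 2" using M DS0 by (simp add: algebra_simps)
  also have "... < T\<^sup>2" using T by simp
  finally show "2 * A < 1" using T by (simp add: A_def kap_def field_simps)
  qed
  \<comment> \<open>With the factor jac the derivative along the curve has the denominator jac^2, which is at least T^2/4.\<close>
  define nab where "nab j G = jac N f * dder N f j G" for j G
  have nabI: "nab j G : ideal (dj + (e j + (m - 1)))" if "G : ideal m" "codim <= j" "j <= N" for j G m
  proof -
  have "nab j G : forms N (dj + (e j + (m - 1)))"
  unfolding nab_def e_def using that f by (intro forms_mult jf dder_forms) auto
  moreover have "vanishes_on (nab j G) X" unfolding nab_def f_def by (rule jac_dder_ideal [OF fm that])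
  ultimately show ?thesis by blast
  qed
  have nabn: "norm1 (nab j G) <= Om * (real m * norm1 G)" if "G : forms N m" "j <= N" for j G m
  proof -
  have "norm1 (dder N f j G) <= (SUM l<=N. norm1 (dual N f j l) * (real m * norm1 G))"
  unfolding dder_def
  by (intro order_trans [OF norm1_sum] sum_mono order_trans [OF norm1_mult] mult_left_mono norm1_pdiff [OF that(1)] norm1_nonneg)
  also have "... = (SUM l<=N. norm1 (dual N f j l)) * (real m * norm1 G)" by (simp add: sum_distrib_right)
  also have "... <= (SUM j<=N. SUM l<=N. norm1 (dual N f j l)) * (real m * norm1 G)"
  using that(2) by (intro mult_right_mono member_le_sum [of j "{..N}" "%j. SUM l<=N. norm1 (dual N f j l)"])
  (auto intro: sum_nonneg norm1_nonneg mult_nonneg_nonneg)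
  finally have "norm1 (jac N f) * norm1 (dder N f j G) <= norm1 (jac N f) * ((SUM j<=N. SUM l<=N. norm1 (dual N f j l)) * (real m * norm1 G))"
  by (intro mult_left_mono norm1_nonneg)
  thus ?thesis unfolding nab_def Om_def using norm1_mult [of "jac N f" "dder N f j G"] by (simp add: mult.assoc)
  qed
  have u0: "reval G (gam 0) = 0" if "G : ideal m" for G m
  proof -
  have "reval G (gam 0) = reval G x0"
  by (rule same) (use gam [of 0] dl(1) that in auto)
  thus ?thesis using cone_ideal [OF c0 that] by simp
  qed
  define u' where "u' G t = (SUM i<=N. reval (dder N f i G) (gam t) * D i) / reval (jac N f) (gam t)" for G t
  have deriv: "((%t. reval G (gam t)) has_field_derivative u' G t) (at t within {0..1})"
  if G: "G : forms N m" and t: "0 <= t" "t <= 1" for G m t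
  proof -
  let ?y = "gam t" and ?w = "%t' l. gam t' l - gam t l" and ?tht = "reval (jac N f) (gam t)"
  have tht: "?tht ~= 0" using TH [OF gam(1) [OF t]] T by auto
  have yR: "inbox N R (gam t')" if "0 <= t'" "t' <= 1" for t' by (rule inR [OF gam(1) [OF that] dl(3)])
  have quadr: "EX C>=0. ALL t':{0..1}. abs (reval H (gam t') - reval H ?y - (SUM l<=N. reval (pdiff l H) ?y * ?w t' l)) <= C * (t' - t)\<^sup>2"
  if H: "H : forms N k" for H k
  proof -
  obtain C where C: "C >= 0" "!!x y. inbox N R x ==> inbox N R y ==>
  abs (reval H x - reval H y - (SUM l<=N. reval (pdiff l H) y * (x l - y l))) <= C * (vdist N x y)\<^sup>2"
  by (rule reval_estimates [OF H, of R]) blast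
  show ?thesis
  proof (intro exI [of _ "C * L\<^sup>2"] conjI ballI)
  fix t' :: real assume "t' : {0..1}"
  hence t': "0 <= t'" "t' <= 1" by auto
  have "(nrm N (?w t'))\<^sup>2 <= (L * abs (t' - t))\<^sup>2" by (rule power_mono [OF lip [OF t t']]) simp
  hence "C * (nrm N (?w t'))\<^sup>2 <= C * (L\<^sup>2 * (t' - t)\<^sup>2)" using C(1) by (intro mult_left_mono) (simp_all add: power_mult_distrib)
  thus "abs (reval H (gam t') - reval H ?y - (SUM l<=N. reval (pdiff l H) ?y * ?w t' l)) <= C * L\<^sup>2 * (t' - t)\<^sup>2"
  using C(2) [OF yR [OF t'] yR [OF t]] by (simp add: mult.assoc)
  qed (use C(1) in simp)
  qed
  obtain CG where CG: "ALL t':{0..1}. abs (reval G (gam t') - reval G ?y - (SUM l<=N. reval (pdiff l G) ?y * ?w t' l)) <= CG * (t' - t)\<^sup>2"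
  using quadr [OF G] by blast
  have "ALL i:{..N}. EX C. ALL t':{0..1}. abs (reval (f i) (gam t') - reval (f i) ?y - (SUM l<=N. reval (pdiff l (f i)) ?y * ?w t' l)) <= C * (t' - t)\<^sup>2"
  using quadr f by (meson atMost_iff)
  then obtain Cf where Cf: "ALL i:{..N}. ALL t':{0..1}. abs (reval (f i) (gam t') - reval (f i) ?y - (SUM l<=N. reval (pdiff l (f i)) ?y * ?w t' l)) <= Cf i * (t' - t)\<^sup>2"
  unfolding bchoice_iff by blast
  define g where "g i = reval (dder N f i G) ?y" for i
  show ?thesis
  proof (rule has_derivative_of_quadratic_error [where C = "CG + (SUM i<=N. abs (g i) * Cf i) / abs (?tht)"])
  fix t' :: real assume t': "t' : {0..1}"
  define v where "v i = (SUM l<=N. reval (pdiff l (f i)) ?y * ?w t' l)" for i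
  define V where "V = (SUM l<=N. reval (pdiff l G) ?y * ?w t' l)"
  have V: "?tht * V = (SUM i<=N. g i * v i)" unfolding V_def g_def v_def by (rule differential_expand)
  have "abs (g i * v i - g i * (D i * (t' - t))) <= abs (g i) * Cf i * (t' - t)\<^sup>2" if i: "i <= N" for i
  proof -
  have "reval (f i) (gam t') - reval (f i) ?y = D i * (t' - t)" using gam(2) i t t' by (simp add: algebra_simps)
  moreover have "abs (reval (f i) (gam t') - reval (f i) ?y - v i) <= Cf i * (t' - t)\<^sup>2" using Cf i t' by (simp add: v_def)
  ultimately have "abs (v i - D i * (t' - t)) <= Cf i * (t' - t)\<^sup>2" by (simp only: abs_minus_commute)
  hence "abs (g i) * abs (v i - D i * (t' - t)) <= abs (g i) * (Cf i * (t' - t)\<^sup>2)" by (rule mult_left_mono) simp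
  thus ?thesis by (simp only: abs_mult [symmetric] right_diff_distrib mult.assoc)
  qed
  hence "(SUM i<=N. abs (g i * v i - g i * (D i * (t' - t)))) <= (SUM i<=N. abs (g i) * Cf i * (t' - t)\<^sup>2)" by (intro sum_mono) simp
  hence "abs (?tht * V - (SUM i<=N. g i * D i) * (t' - t)) <= (SUM i<=N. abs (g i) * Cf i) * (t' - t)\<^sup>2"
  unfolding V sum_distrib_right mult.assoc [of "g _" "D _"] sum_subtractf [symmetric] by (rule order_trans [OF sum_abs])
  hence "abs (?tht * V - (SUM i<=N. g i * D i) * (t' - t)) / abs (?tht) <= (SUM i<=N. abs (g i) * Cf i) * (t' - t)\<^sup>2 / abs (?tht)"
  by (rule divide_right_mono) simp
  moreover have "V - u' G t * (t' - t) = (?tht * V - (SUM i<=N. g i * D i) * (t' - t)) / ?tht"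
  using tht by (simp add: u'_def g_def diff_divide_distrib)
  ultimately have "abs (V - u' G t * (t' - t)) <= (SUM i<=N. abs (g i) * Cf i) / abs (?tht) * (t' - t)\<^sup>2" by simp
  moreover have "abs (reval G (gam t') - reval G ?y - V) <= CG * (t' - t)\<^sup>2" using CG t' by (simp add: V_def)
  ultimately show "abs (reval G (gam t') - reval G ?y - u' G t * (t' - t)) <= (CG + (SUM i<=N. abs (g i) * Cf i) / abs (?tht)) * (t' - t)\<^sup>2"
  unfolding distrib_right by linarith
  qed (use t in simp)
  qed
  have u'b: "abs (u' G t) <= kap * b" if t: "0 <= t" "t <= 1" and b: "!!j. j : {codim<..N} ==> abs (reval (nab j G) (gam t)) <= b" "b >= 0" for G t b
  proof -
  let ?tht = "reval (jac N f) (gam t)"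
  have th: "abs T <= 2 * abs (?tht)" by (rule TH [OF gam(1) [OF t]])
  hence tht: "?tht ~= 0" using T by auto
  have "abs (u' G t) = abs (SUM i<=N. reval (nab i G) (gam t) * D i) / ?tht\<^sup>2"
  proof -
  have "(SUM i<=N. reval (nab i G) (gam t) * D i) = ?tht * (SUM i<=N. reval (dder N f i G) (gam t) * D i)"
  by (simp add: nab_def reval_mult mult.assoc sum_distrib_left)
  moreover have "?tht\<^sup>2 = abs (?tht) * abs (?tht)" by (simp add: power2_eq_square)
  ultimately show ?thesis using tht by (simp only: u'_def abs_mult abs_divide) (simp del: abs_mult_self_eq)
  qed
  also have "... <= (SUM i<=N. b * abs (D i)) / ?tht\<^sup>2"
  proof (intro divide_right_mono order_trans [OF sum_abs] sum_mono)
  fix i assume "i : {..N}"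
  thus "abs (reval (nab i G) (gam t) * D i) <= b * abs (D i)"
  using b(1) [of i] D0 [of i] by (cases "i <= codim") (auto simp: abs_mult intro: mult_right_mono)
  qed simp
  also have "... = (DS * b) / ?tht\<^sup>2" by (simp add: DS_def mult.commute flip: sum_distrib_left)
  also have "... <= (DS * b) / (T\<^sup>2 / 4)"
  proof (rule divide_left_mono)
  have "(abs T)\<^sup>2 <= (2 * abs (?tht))\<^sup>2" using th by (rule power_mono) simp
  thus "T\<^sup>2 / 4 <= ?tht\<^sup>2" by (simp add: power_mult_distrib)
  qed (use DS0 b(2) T tht in auto)
  also have "... = kap * b" by (simp add: kap_def)
  finally show ?thesis .
  qed
  have claim: "abs (reval G (gam t)) <= norm1 G * A ^ p * R ^ (E * q) * real ((q + p) choose p) * t ^ p"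
  if "G : ideal m" "m <= E * q" "0 <= t" "t <= 1" for G m q t p
  using that
  proof (induction p arbitrary: G m q t)
  case 0
  have "abs (reval G (gam t)) <= norm1 G * R ^ m"
  using "0.prems" inR [OF gam(1) dl(3)] by (intro reval_bound) auto
  also have "... <= norm1 G * R ^ (E * q)"
  using "0.prems" R1 by (intro mult_left_mono power_increasing norm1_nonneg) auto
  finally show ?case by simp
  next
  case (Suc p)
  define b where "b = A ^ p * R ^ (E * Suc q) * real ((Suc q + p) choose p)"
  have b: "b >= 0" unfolding b_def using A R1 by simp
  define Kc where "Kc = kap * (Om * (real m * norm1 G) * b)"
  have nb: "abs (reval (nab j G) (gam s)) <= Om * (real m * norm1 G) * b * s ^ p" if s: "0 <= s" "s <= 1" and j: "j : {codim<..N}" for s j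
  proof -
  have jj: "codim <= j" "j <= N" using j by auto
  have "dj + (e j + (m - 1)) <= E * Suc q" using eE [OF jj(2), of m] Suc.prems(2) by simp
  hence "abs (reval (nab j G) (gam s)) <= norm1 (nab j G) * A ^ p * R ^ (E * Suc q) * real ((Suc q + p) choose p) * s ^ p"
  by (rule Suc.IH [OF nabI [OF Suc.prems(1) jj] _ s])
  also have "... = norm1 (nab j G) * b * s ^ p" by (simp add: b_def mult.assoc)
  also have "... <= Om * (real m * norm1 G) * b * s ^ p"
  using nabn [OF _ jj(2), of G m] Suc.prems(1) b s by (intro mult_right_mono) auto
  finally show ?thesis .
  qed
  have "abs (reval G (gam t)) <= Kc * t ^ Suc p / real (Suc p)"
  proof (rule power_bound_of_derivative [where u' = "u' G"])
  fix s :: real assume s: "0 <= s" "s <= 1"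
  show "((%t. reval G (gam t)) has_field_derivative u' G s) (at s within {0..1})" using Suc.prems(1) by (intro deriv s) auto
  have "abs (u' G s) <= kap * (Om * (real m * norm1 G) * b * s ^ p)"
  by (rule u'b [OF s nb [OF s]]) (use Om b s norm1_nonneg [of G] in auto)
  thus "abs (u' G s) <= Kc * s ^ p" by (simp add: Kc_def mult.assoc)
  qed (use u0 [OF Suc.prems(1)] Suc.prems in auto)
  also have "Kc / real (Suc p) <= norm1 G * A ^ Suc p * R ^ (E * q) * real ((q + Suc p) choose Suc p)"
  proof -
  have bin: "real (Suc p) * real ((q + Suc p) choose Suc p) = real (Suc q) * real ((Suc q + p) choose p)"
  proof -
  have "Suc p * ((q + Suc p) choose Suc p) = (q + Suc p) * ((q + Suc p - 1) choose p)" by (rule binomial_absorption)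
  also have "... = (q + Suc p - p) * ((q + Suc p) choose p)" by (rule binomial_absorb_comp [symmetric])
  finally have "Suc p * ((q + Suc p) choose Suc p) = Suc q * ((Suc q + p) choose p)" by simp
  thus ?thesis unfolding of_nat_mult [symmetric] of_nat_eq_iff .
  qed
  have "Kc = (norm1 G * A ^ p * R ^ (E * q) * real ((Suc q + p) choose p)) * (kap * Om * R ^ E) * real m"
  unfolding Kc_def b_def by (simp add: power_add mult_ac)
  also have "... <= (norm1 G * A ^ p * R ^ (E * q) * real ((Suc q + p) choose p)) * (kap * Om * R ^ E) * (real E * real (Suc q))"
  proof (rule mult_left_mono)
  have "real m <= real (E * q)" using Suc.prems(2) by (simp only: of_nat_le_iff)
  also have "... <= real E * real (Suc q)" by (simp add: algebra_simps)
  finally show "real m <= real E * real (Suc q)" .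
  show "0 <= (norm1 G * A ^ p * R ^ (E * q) * real ((Suc q + p) choose p)) * (kap * Om * R ^ E)"
  using A R1 kap Om norm1_nonneg [of G] by simp
  qed
  also have "... = norm1 G * A ^ Suc p * R ^ (E * q) * (real (Suc q) * real ((Suc q + p) choose p))"
  by (simp add: A_def M_def mult_ac del: of_nat_Suc)
  also have "... = norm1 G * A ^ Suc p * R ^ (E * q) * real ((q + Suc p) choose Suc p) * real (Suc p)"
  unfolding bin [symmetric] by (simp only: mult_ac)
  finally show ?thesis by (simp add: pos_divide_le_eq del: of_nat_Suc binomial_Suc_Suc)
  qed
  hence "Kc * t ^ Suc p / real (Suc p) <= norm1 G * A ^ Suc p * R ^ (E * q) * real ((q + Suc p) choose Suc p) * t ^ Suc p"
  using mult_right_mono [of "Kc / real (Suc p)" _ "t ^ Suc p"] Suc.prems(3) by (simp del: of_nat_Suc power_Suc binomial_Suc_Suc)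
  finally show ?case .
  qed
  show "cone x"
  proof (rule coneI)
  show "x i = 0" if "i > N" for i using xN that by blast
  show "x a ~= 0" using xa by simp
  fix G m assume G: "G : ideal m"
  have E1: "E >= 1" by (simp add: E_def)
  hence mE: "m <= E * m" by simp
  have "abs (reval G (gam 1)) <= (norm1 G * R ^ (E * m) * 2 ^ m) * (2 * A) ^ p" for p
  proof -
  have "abs (reval G (gam 1)) <= norm1 G * A ^ p * R ^ (E * m) * real ((m + p) choose p) * 1 ^ p"
  by (rule claim [OF G mE]) auto
  also have "... = (norm1 G * A ^ p * R ^ (E * m)) * real ((m + p) choose p)" by simp
  also have "... <= (norm1 G * A ^ p * R ^ (E * m)) * 2 ^ (m + p)"
  proof (rule mult_left_mono)
  have "((m + p) choose p) <= 2 ^ (m + p)" by (rule binomial_le_pow2)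
  thus "real ((m + p) choose p) <= 2 ^ (m + p)" by (metis of_nat_le_iff of_nat_numeral of_nat_power)
  show "0 <= norm1 G * A ^ p * R ^ (E * m)" using A R1 norm1_nonneg [of G] by simp
  qed
  also have "... = (norm1 G * R ^ (E * m) * 2 ^ m) * (2 * A) ^ p" by (simp add: power_add power_mult_distrib mult_ac)
  finally show ?thesis .
  qed
  hence "abs (reval G (gam 1)) <= 0" by (rule le_geometric_imp_nonpos) (use A in auto)
  moreover have "reval G (gam 1) = reval G x"
  by (rule same [where m = m]) (use gam [of 1] xdl G in \<open>auto simp: D_def\<close>)
  ultimately show "reval G x = 0" by simp
  qed
 qed
qed

end

section \<open>The divisor cut out by a form\<close>

definition ev :: "nat => (nat => rpoly) => cvector => cvector" where
 "ev r F x = (%j. if j <= r then peval (F j) x else 0)"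

lemma peval_psub_ev: "G : forms r m ==> peval (psub F G) x = peval G (ev r F x)"
 unfolding peval_psub by (rule peval_cong [of G r m]) (auto simp: ev_def)

lemma peval_form_zero:
 assumes "G : forms r m" "m >= 1" "!!i. i <= r ==> y i = 0" shows "peval G y = 0"
proof -
 have "peval G y = peval G (%i. 0 * y i)" using assms(3) by (intro peval_cong [OF assms(1)]) simp
 also have "... = 0" using peval_scale [OF assms(1), of 0 y] assms(2) by simp
 finally show ?thesis .
qed

locale embedded =
 fixes N r :: nat and X :: "point set" and phi :: "point => point"
 assumes irr: "real_irreducible N X" and emb: "real_embedding N X r phi"
begin

lemma Xsub: "X <= proj_space N" and Xne: "X ~= {}"
 using irr real_closed_subset unfolding real_irreducible_def by simp_all

lemma rep_exists:
 assumes "P : X"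
 shows "EX F d j. local_rep N X r phi F & (ALL j<=r. F j : forms N d) & j <= r & ~ vanishes_at (F j) P"
proof -
 have "real_morphism N X r phi" using emb by (simp add: real_embedding_def)
 then obtain F j where F: "local_rep N X r phi F" "j <= r" "~ vanishes_at (F j) P"
  using assms unfolding real_morphism_def by blast
 then obtain d where "ALL j<=r. F j : forms N d" unfolding local_rep_def by blast
 thus ?thesis using F by blast
qed

lemma rep_forms: "local_rep N X r phi F ==> EX d. ALL j<=r. F j : forms N d"
 unfolding local_rep_def by blast

lemma rep_nonzero:
 assumes F: "local_rep N X r phi F" and j: "j <= r" and P: "P : X" "x : P"
 shows "vanishes_at (F j) P \<longleftrightarrow> peval (F j) x = 0"
proof -
 obtain d where "ALL j<=r. F j : forms N d" using rep_forms [OF F] by blast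
 thus ?thesis using vanishes_at_rep [of P N x "F j" N d] Xsub P j by blast
qed

lemma rep_eval:
 assumes "local_rep N X r phi F" "P : X" "x : P" "j <= r" "peval (F j) x ~= 0"
 shows "phi P = proj_point (ev r F x)"
 using assms unfolding local_rep_def ev_def by blast

lemma rep_proportional:
 assumes F: "local_rep N X r phi F" and F': "local_rep N X r phi F'" and P: "P : X" "x : P"
  and j: "j <= r" "peval (F j) x ~= 0" and j': "j' <= r" "peval (F' j') x ~= 0"
 obtains t where "t ~= 0" "!!i. i <= r ==> peval (F i) x = t * peval (F' i) x"
proof -
 have "proj_point (ev r F x) = proj_point (ev r F' x)"
  using rep_eval [OF F P j] rep_eval [OF F' P j'] by simp
 hence "ev r F x : proj_point (ev r F' x)" using proj_point_self by blast
 then obtain t where t: "t ~= 0" "ev r F x = (%i. t * ev r F' x i)" unfolding proj_point_def by blast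
 show thesis
 proof (rule that [OF t(1)])
  fix i assume "i <= r"
  thus "peval (F i) x = t * peval (F' i) x" using fun_cong [OF t(2), of i] by (simp add: ev_def)
 qed
qed

text \<open>Two local representations of phi are proportional, and both sides have the same degree in each.\<close>

lemma rep_swap:
 assumes F: "local_rep N X r phi F" and F': "local_rep N X r phi F'" and P: "P : X" "x : P"
  and G: "G : forms r m" and L: "L : forms r 1" and m: "m >= 1"
 shows "peval (psub F G) x * peval (psub F' L) x ^ m = peval (psub F' G) x * peval (psub F L) x ^ m"
proof (cases "(EX j<=r. peval (F j) x ~= 0) & (EX j<=r. peval (F' j) x ~= 0)")
 case True
 then obtain t where t: "!!i. i <= r ==> peval (F i) x = t * peval (F' i) x"
  using rep_proportional [OF F F' P] by metis
 have "ev r F x = (%i. t * ev r F' x i)" using t by (auto simp: ev_def)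
 hence "peval (psub F H) x = t ^ k * peval (psub F' H) x" if "H : forms r k" for H k
  using peval_scale [OF that] that by (simp add: peval_psub_ev)
 from this [OF G] this [OF L] show ?thesis by (simp add: power_mult_distrib)
next
 case False
 have z: "peval (psub F0 H) x = 0" if "ALL j<=r. peval (F0 j) x = 0" "H : forms r k" "k >= 1" for F0 H k
  unfolding peval_psub using that by (intro peval_form_zero [of H r k]) auto
 show ?thesis
 proof (cases "EX j<=r. peval (F j) x ~= 0")
  case True
  hence "ALL j<=r. peval (F' j) x = 0" using False by blast
  thus ?thesis using z [OF _ G m] z [OF _ L] m by (simp add: zero_power)
 next
  case False
  hence "ALL j<=r. peval (F j) x = 0" by blast
  thus ?thesis using z [OF _ G m] z [OF _ L] m by (simp add: zero_power)
 qed
qed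

lemma psub_Xv: "peval (psub F (Xv i)) x = peval (F i) x"
 by (simp add: peval_psub)

lemma vanish_iff:
 assumes F: "local_rep N X r phi F" and P: "P : X" "x : P" and j: "j <= r" "peval (F j) x ~= 0" and G: "G : forms r m"
 shows "vanishes_at G (phi P) \<longleftrightarrow> peval (psub F G) x = 0"
 unfolding rep_eval [OF F P j] vanishes_at_proj_point [OF G] peval_psub_ev [OF G] ..

lemma cancel:
 assumes A: "A : forms N d" "~ vanishes_on A X" and B: "B : forms N e"
  and AB: "!!P x. P : X ==> x : P ==> peval A x * peval B x = 0"
 shows "vanishes_on B X"
 using irreducible_prime [OF irr A(1) B] A(2) AB unfolding vanishes_defs peval_mult by blast

lemma nonvanishing_mult:
 assumes "A : forms N d" "B : forms N e" "~ vanishes_on A X" "~ vanishes_on B X"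
 shows "~ vanishes_on (A * B) X"
 using irreducible_prime [OF irr assms(1,2)] assms(3,4) by blast

lemma nonvanishingI: "P : X ==> ~ vanishes_at A P ==> ~ vanishes_on A X"
 unfolding vanishes_on_def by blast

lemma psub_nonvanishing:
 assumes F: "local_rep N X r phi F" and j: "j <= r" "~ vanishes_on (F j) X"
  and G: "G : forms r m" "m >= 1" and Q: "Q : X" "~ vanishes_at G (phi Q)"
 shows "~ vanishes_on (psub F G) X"
proof
 assume v: "vanishes_on (psub F G) X"
 obtain F' d' i where F': "local_rep N X r phi F'" "ALL j<=r. F' j : forms N d'" "i <= r" "~ vanishes_at (F' i) Q"
  using rep_exists [OF Q(1)] by blast
 obtain d where d: "ALL j<=r. F j : forms N d" using rep_forms [OF F] by blast
 have "vanishes_on (psub F' G) X"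
 proof (rule cancel)
  show "F j ^ m : forms N (m * d)" using d j by (intro forms_power) blast
  show "~ vanishes_on (F j ^ m) X" using j(2) by (rule power_not_vanishing)
  show "psub F' G : forms N (m * d')" using F'(2) by (intro forms_psub [OF G(1)]) blast
  fix P x assume P: "P : X" "x : P"
  have "peval (psub F G) x = 0" using v P unfolding vanishes_defs by blast
  thus "peval (F j ^ m) x * peval (psub F' G) x = 0"
  using rep_swap [OF F F'(1) P G(1) forms_Xv [OF j(1)] G(2)] by (simp add: psub_Xv peval_power mult.commute)
 qed
 moreover obtain x where x: "x : Q" using Xsub Q(1) proj_space_rep by blast
 have "peval (F' i) x ~= 0" using rep_nonzero [OF F'(1,3) Q(1) x] F'(4) by blast
 hence "peval (psub F' G) x ~= 0" using vanish_iff [OF F'(1) Q(1) x F'(3) _ G(1)] Q(2) by blast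
 ultimately show False using Q(1) x unfolding vanishes_defs by blast
qed

text \<open>Near P the divisor has the equation psub F G / F_j^m, where F represents phi with F_j nonzero at P.
Changing the representation multiplies by an m-th power of a unit. Comparison with the pullback of
the hyperplane shows that the quotient of the two divisors is G / L^m, which does not depend on P.\<close>

theorem linear_system_form:
 assumes hyp: "hyperplane_pullback N X r phi a E" and DE: "lin_equiv N X D E" and D: "real_divisor N X D"
  and G: "G : forms r m" "m >= 1" and Q0: "Q0 : X" "~ vanishes_at G (phi Q0)"
 obtains Z where "Z : linear_system N X (multiple m D)" "support N X Z = {P : X. vanishes_at G (phi P)}"
proof -
 have "ALL P:X. EX t. local_rep N X r phi (fst t) & (ALL j<=r. fst t j : forms N (fst (snd t))) & snd (snd t) <= r & ~ vanishes_at (fst t (snd (snd t))) P"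
 proof
  fix P assume "P : X"
  then obtain F d j where "local_rep N X r phi F & (ALL j<=r. F j : forms N d) & j <= r & ~ vanishes_at (F j) P"
  using rep_exists by blast
  thus "EX t. local_rep N X r phi (fst t) & (ALL j<=r. fst t j : forms N (fst (snd t))) & snd (snd t) <= r & ~ vanishes_at (fst t (snd (snd t))) P"
  by (intro exI [of _ "(F, d, j)"]) simp
 qed
 then obtain t where t: "ALL P:X. local_rep N X r phi (fst (t P)) & (ALL j<=r. fst (t P) j : forms N (fst (snd (t P)))) & snd (snd (t P)) <= r & ~ vanishes_at (fst (t P) (snd (snd (t P)))) P"
  unfolding bchoice_iff by blast
 define F where "F P = fst (t P)" for P
 define d where "d P = fst (snd (t P))" for P
 define j where "j P = snd (snd (t P))" for P
 have F: "local_rep N X r phi (F P)" "!!i. i <= r ==> F P i : forms N (d P)" "j P <= r" "~ vanishes_at (F P (j P)) P" if "P : X" for P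
  using t that unfolding F_def d_def j_def by blast+
 have Fnv: "~ vanishes_on (F P (j P)) X" if "P : X" for P using nonvanishingI [OF that F(4) [OF that]] .
 have Gf: "psub (F P) G : forms N (m * d P)" if "P : X" for P using F(2) [OF that] by (intro forms_psub [OF G(1)])
 have Gn: "~ vanishes_on (psub (F P) G) X" if P: "P : X" for P
  by (rule psub_nonvanishing [OF F(1,3) [OF P] Fnv [OF P] G Q0])
 have Fm: "F P (j P) ^ m : forms N (m * d P)" if "P : X" for P using F(2,3) [OF that] by (intro forms_power)
 have Fmn: "~ vanishes_on (F P (j P) ^ m) X" if "P : X" for P using Fnv [OF that] by (rule power_not_vanishing)
 define Z where "Z P = (psub (F P) G, F P (j P) ^ m)" for P
 have Znz: "nonzero_rat N X (Z P)" if "P : X" for P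
  unfolding nonzero_rat_def Z_def fst_conv snd_conv using Gf [OF that] Gn [OF that] Fm [OF that] Fmn [OF that] by blast
 have swap: "peval (psub (F P) G) x * peval (F Q i) x ^ m = peval (psub (F Q) G) x * peval (F P i) x ^ m"
  if "P : X" "Q : X" "R : X" "x : R" "i <= r" for P Q R x i
  using rep_swap [OF F(1) [OF that(1)] F(1) [OF that(2)] that(3,4) G(1) forms_Xv [OF that(5)] G(2)]
  by (simp add: psub_Xv)
 have Xx: "EX x. x : P" if "P : X" for P using Xsub that proj_space_rep by blast
 have nzx: "peval (F P (j P)) x ~= 0" if "P : X" "x : P" for P x
  using rep_nonzero [OF F(1,3) [OF that(1)] that] F(4) [OF that(1)] by blast
 have vat: "vanishes_at (A ^ m) P \<longleftrightarrow> vanishes_at A P" for A P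
  unfolding vanishes_at_def peval_power using G(2) by simp
 have rd: "real_divisor N X Z"
  unfolding real_divisor_def
 proof (intro ballI conjI)
  fix P assume P: "P : X"
  show "nonzero_rat N X (Z P)" by (rule Znz [OF P])
  show "EX H:UN d. forms N d. ~ vanishes_at H P & (ALL Q:X. ~ vanishes_at H Q --> unit_at N X Q (rat_div (Z Q) (Z P)))"
  proof (intro bexI [of _ "F P (j P)"] conjI ballI impI)
  show "F P (j P) : (UN d. forms N d)" using F(2,3) [OF P] by blast
  show "~ vanishes_at (F P (j P)) P" using F(4) [OF P] .
  fix Q assume Q: "Q : X" and h: "~ vanishes_at (F P (j P)) Q"
  obtain x where x: "x : Q" using Xx [OF Q] by blast
  have px: "peval (F P (j P)) x ~= 0" using rep_nonzero [OF F(1,3) [OF P] Q x] h by blast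
  obtain s where s: "s ~= 0" "!!i. i <= r ==> peval (F P i) x = s * peval (F Q i) x"
  using rep_proportional [OF F(1) [OF P] F(1) [OF Q] Q x F(3) [OF P] px F(3) [OF Q] nzx [OF Q x]] by blast
  have qx: "peval (F Q (j P)) x ~= 0" using s(2) [OF F(3) [OF P]] px by auto
  hence qv: "~ vanishes_at (F Q (j P)) Q" using x unfolding vanishes_at_def by blast
  show "unit_at N X Q (rat_div (Z Q) (Z P))"
  unfolding unit_at_def
  proof (intro exI [of _ "(F Q (j P) ^ m, F Q (j Q) ^ m)"] conjI)
  show "~ vanishes_at (fst (F Q (j P) ^ m, F Q (j Q) ^ m)) Q" using qv by (simp add: vat)
  show "~ vanishes_at (snd (F Q (j P) ^ m, F Q (j Q) ^ m)) Q" using F(4) [OF Q] by (simp add: vat)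
  have "F Q (j P) ^ m : forms N (m * d Q)" using F(2) [OF Q F(3) [OF P]] by (rule forms_power)
  moreover have "~ vanishes_on (F Q (j P) ^ m) X" using nonvanishingI [OF Q qv] by (rule power_not_vanishing)
  ultimately show "nonzero_rat N X (F Q (j P) ^ m, F Q (j Q) ^ m)"
  unfolding nonzero_rat_def fst_conv snd_conv using Fm [OF Q] Fmn [OF Q] by blast
  show "rat_eq X (rat_div (Z Q) (Z P)) (F Q (j P) ^ m, F Q (j Q) ^ m)"
  unfolding rat_eq_def vanishes_defs rat_div_def Z_def fst_conv snd_conv peval_diff peval_mult peval_power
  using swap [OF Q P _ _ F(3) [OF P]] by (simp add: mult_ac)
  qed
  qed
 qed
 have nzpow: "~ vanishes_at (snd (Z P)) P" if P: "P : X" for P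
 proof -
  obtain x where x: "x : P" using Xx [OF P] by blast
  have "peval (snd (Z P)) x ~= 0" using nzx [OF P x] by (simp add: Z_def peval_power)
  thus ?thesis using x unfolding vanishes_at_def by blast
 qed
 have eff: "effective N X Z"
  unfolding effective_def regular_at_def
 proof
  fix P assume P: "P : X"
  show "EX g. nonzero_rat N X g & rat_eq X (Z P) g & ~ vanishes_at (snd g) P"
  proof (intro exI [of _ "Z P"] conjI)
  show "~ vanishes_at (snd (Z P)) P" using nzpow P by blast
  show "rat_eq X (Z P) (Z P)" by (simp add: rat_eq_def vanishes_defs mult.commute peval_0)
  qed (rule Znz [OF P])
 qed
 have sup: "support N X Z = {P : X. vanishes_at G (phi P)}"
 proof -
  have "unit_at N X P (Z P) \<longleftrightarrow> ~ vanishes_at G (phi P)" if P: "P : X" for P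
  proof -
  obtain x where x: "x : P" using Xx [OF P] by blast
  have vg: "vanishes_at G (phi P) \<longleftrightarrow> peval (psub (F P) G) x = 0"
  by (rule vanish_iff [OF F(1) [OF P] P x F(3) [OF P] nzx [OF P x] G(1)])
  show ?thesis
  proof
  assume "unit_at N X P (Z P)"
  then obtain g where g: "nonzero_rat N X g" "rat_eq X (Z P) g" "~ vanishes_at (fst g) P"
  unfolding unit_at_def by blast
  obtain e where e: "fst g : forms N e" using g(1) unfolding nonzero_rat_def by blast
  have "P : proj_space N" using P Xsub by blast
  hence "peval (fst g) x ~= 0" using vanishes_at_rep [OF _ x e] g(3) by blast
  moreover have "peval (fst (Z P) * snd g - fst g * snd (Z P)) x = 0"
  using g(2) P x unfolding rat_eq_def vanishes_defs by blast
  hence "peval (psub (F P) G) x * peval (snd g) x = peval (fst g) x * peval (F P (j P)) x ^ m"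
  by (simp add: Z_def peval_diff peval_mult peval_power)
  ultimately have "peval (psub (F P) G) x ~= 0" using nzx [OF P x] by auto
  thus "~ vanishes_at G (phi P)" using vg by blast
  next
  assume "~ vanishes_at G (phi P)"
  hence "peval (psub (F P) G) x ~= 0" using vg by blast
  hence "~ vanishes_at (psub (F P) G) P" using x unfolding vanishes_at_def by blast
  thus "unit_at N X P (Z P)"
  unfolding unit_at_def
  proof (intro exI [of _ "Z P"] conjI)
  show "~ vanishes_at (snd (Z P)) P" using nzpow P by blast
  show "rat_eq X (Z P) (Z P)" by (simp add: rat_eq_def vanishes_defs mult.commute peval_0)
  assume "~ vanishes_at (psub (F P) G) P"
  thus "~ vanishes_at (fst (Z P)) P" by (simp add: Z_def)
  qed (rule Znz [OF P])
  qed
  qed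
  thus ?thesis unfolding support_def by blast
 qed
 have le: "lin_equiv N X Z (multiple m D)"
 proof -
  obtain h0 where h0: "nonzero_rat N X h0" "!!P. P : X ==> unit_at N X P (rat_div (D P) (rat_mult h0 (E P)))"
  using DE unfolding lin_equiv_def by blast
  obtain P0 y where P0: "P0 : X" "y : phi P0" "(SUM i<=r. complex_of_real (a i) * y i) ~= 0"
  and Ed: "real_divisor N X E" and Eu: "!!P F j. P : X ==> j <= r ==> local_rep N X r phi F ==> ~ vanishes_at (F j) P ==>
  unit_at N X P (rat_div (E P) (SUM i<=r. single 0 (a i) * F i, F j))"
  using hyp unfolding hyperplane_pullback_def by blast
  define L where "L = (SUM i<=r. single 0 (a i) * Xv i)"
  have Lf: "L : forms r 1" unfolding L_def by (intro forms_sum forms_scale forms_Xv) simp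
  have LF: "peval (psub F' L) x = peval (SUM i<=r. single 0 (a i) * F' i) x" for F' x
  by (simp add: L_def peval_psub peval_sum peval_mult peval_const)
  have L0: "~ vanishes_at L (phi P0)"
  unfolding vanishes_at_def using P0(2,3) by (auto simp: L_def peval_sum peval_mult peval_const)
  have LFf: "psub (F P) L : forms N (d P)" if "P : X" for P
  using forms_psub [OF Lf, of "F P" N "d P"] F(2) [OF that] by simp
  have LFn: "~ vanishes_on (psub (F P) L) X" if P: "P : X" for P
  by (rule psub_nonvanishing [OF F(1,3) [OF P] Fnv [OF P] Lf _ P0(1) L0]) simp
  define Ps where "Ps = Q0"
  have Ps: "Ps : X" using Q0(1) by (simp add: Ps_def)
  obtain e0 where e0: "fst h0 : forms N e0" "snd h0 : forms N e0" "~ vanishes_on (fst h0) X" "~ vanishes_on (snd h0) X"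
  using h0(1) unfolding nonzero_rat_def by blast
  define h where "h = (psub (F Ps) G * snd h0 ^ m, psub (F Ps) L ^ m * fst h0 ^ m)"
  have hnz: "nonzero_rat N X h"
  unfolding nonzero_rat_def h_def fst_conv snd_conv
  proof (intro conjI exI [of _ "m * d Ps + m * e0"])
  show "psub (F Ps) G * snd h0 ^ m : forms N (m * d Ps + m * e0)" by (intro forms_mult Gf [OF Ps] forms_power e0)
  show "psub (F Ps) L ^ m * fst h0 ^ m : forms N (m * d Ps + m * e0)" by (intro forms_mult LFf [OF Ps] forms_power e0)
  show "~ vanishes_on (psub (F Ps) G * snd h0 ^ m) X"
  by (rule nonvanishing_mult [OF Gf [OF Ps] forms_power [OF e0(2)] Gn [OF Ps] power_not_vanishing [OF e0(4)]])
  show "~ vanishes_on (psub (F Ps) L ^ m * fst h0 ^ m) X"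
  by (rule nonvanishing_mult [OF forms_power [OF LFf [OF Ps]] forms_power [OF e0(1)] power_not_vanishing [OF LFn [OF Ps]] power_not_vanishing [OF e0(3)]])
  qed
  have "unit_at N X P (rat_div (Z P) (rat_mult h (multiple m D P)))" if P: "P : X" for P
  proof -
  obtain g1 where g1: "nonzero_rat N X g1" "rat_eq X (rat_div (D P) (rat_mult h0 (E P))) g1" "~ vanishes_at (fst g1) P" "~ vanishes_at (snd g1) P"
  using h0(2) [OF P] unfolding unit_at_def by blast
  obtain g2 where g2: "nonzero_rat N X g2" "rat_eq X (rat_div (E P) (SUM i<=r. single 0 (a i) * F P i, F P (j P))) g2"
  "~ vanishes_at (fst g2) P" "~ vanishes_at (snd g2) P"
  using Eu [OF P F(3) [OF P] F(1) [OF P] F(4) [OF P]] unfolding unit_at_def by blast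
  obtain c1 where c1: "fst g1 : forms N c1" "snd g1 : forms N c1" using g1(1) unfolding nonzero_rat_def by blast
  obtain c2 where c2: "fst g2 : forms N c2" "snd g2 : forms N c2" using g2(1) unfolding nonzero_rat_def by blast
  have "nonzero_rat N X (D P)" using D P unfolding real_divisor_def by blast
  then obtain cD where cD: "fst (D P) : forms N cD" "snd (D P) : forms N cD" unfolding nonzero_rat_def by blast
  have "nonzero_rat N X (E P)" using Ed P unfolding real_divisor_def by blast
  then obtain cE where cE: "fst (E P) : forms N cE" "snd (E P) : forms N cE" "~ vanishes_on (fst (E P)) X" "~ vanishes_on (snd (E P)) X"
  unfolding nonzero_rat_def by blast
  define g where "g = ((snd g1 * snd g2) ^ m, (fst g1 * fst g2) ^ m)"
  have Pp: "P : proj_space N" using P Xsub by blast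
  obtain x0 where x0: "x0 : P" using Xx [OF P] by blast
  have nv: "~ vanishes_at ((A * B) ^ m) P" if "~ vanishes_at A P" "~ vanishes_at B P" "A : forms N k" "B : forms N l" for A B k l
  proof -
  have "peval ((A * B) ^ m) x0 ~= 0"
  using that vanishes_at_rep [OF Pp x0 that(3)] vanishes_at_rep [OF Pp x0 that(4)] by (simp add: peval_power peval_mult)
  thus ?thesis using x0 unfolding vanishes_at_def by blast
  qed
  have gv: "~ vanishes_at (fst g) P" "~ vanishes_at (snd g) P"
  unfolding g_def fst_conv snd_conv
  by (rule nv [OF g1(4) g2(4) c1(2) c2(2)], rule nv [OF g1(3) g2(3) c1(1) c2(1)])
  have gf: "fst g : forms N (m * (c1 + c2))" "snd g : forms N (m * (c1 + c2))"
  unfolding g_def fst_conv snd_conv by (intro forms_power forms_mult c1 c2)+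
  have gnz: "nonzero_rat N X g"
  unfolding nonzero_rat_def using gf gv nonvanishingI [OF P] by blast
  let ?Z = "rat_div (Z P) (rat_mult h (multiple m D P))"
  have fZ: "fst ?Z = psub (F P) G * (psub (F Ps) L ^ m * fst h0 ^ m * snd (D P) ^ m)"
  "snd ?Z = F P (j P) ^ m * (psub (F Ps) G * snd h0 ^ m * fst (D P) ^ m)"
  by (simp_all add: rat_div_def rat_mult_def multiple_def rat_power_def Z_def h_def)
  have "vanishes_on (fst ?Z * snd g - fst g * snd ?Z) X"
  proof (rule cancel)
  show "(fst (E P) * snd (E P)) ^ m : forms N (m * (cE + cE))" by (intro forms_power forms_mult cE)
  show "~ vanishes_on ((fst (E P) * snd (E P)) ^ m) X"
  by (intro power_not_vanishing nonvanishing_mult [OF cE])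
  have "fst ?Z * snd g : forms N (m * d P + (m * d Ps + m * e0 + m * cD) + m * (c1 + c2))"
  unfolding fZ by (intro forms_mult forms_power Gf [OF P] LFf [OF Ps] e0 cD gf)
  moreover have "fst g * snd ?Z : forms N (m * (c1 + c2) + (m * d P + (m * d Ps + m * e0 + m * cD)))"
  unfolding fZ by (intro forms_mult Fm [OF P] forms_power Gf [OF Ps] e0 cD gf)
  ultimately show "fst ?Z * snd g - fst g * snd ?Z : forms N (m * d P + (m * d Ps + m * e0 + m * cD) + m * (c1 + c2))"
  by (intro forms_diff) (simp_all add: add_ac)
  fix R x assume R: "R : X" "x : R"
  define p where "p A = peval A x" for A
  have i1: "p (fst (D P)) * (p (snd h0) * p (snd (E P))) * p (snd g1) = p (fst g1) * (p (snd (D P)) * (p (fst h0) * p (fst (E P))))"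
  using g1(2) R unfolding rat_eq_def vanishes_defs rat_div_def rat_mult_def p_def
  by (simp add: peval_diff peval_mult)
  have i2: "p (fst (E P)) * p (F P (j P)) * p (snd g2) = p (fst g2) * (p (snd (E P)) * p (psub (F P) L))"
  using g2(2) R unfolding rat_eq_def vanishes_defs rat_div_def p_def LF
  by (simp add: peval_diff peval_mult)
  have i3: "p (psub (F P) G) * p (psub (F Ps) L) ^ m = p (psub (F Ps) G) * p (psub (F P) L) ^ m"
  unfolding p_def by (rule rep_swap [OF F(1) [OF P] F(1) [OF Ps] R G(1) Lf G(2)])
  have "(p (fst (E P)) * p (snd (E P))) ^ m * (p (psub (F P) G) * (p (psub (F Ps) L) ^ m * p (fst h0) ^ m * p (snd (D P)) ^ m) * (p (fst g1) * p (fst g2)) ^ m)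
  = (p (psub (F P) G) * p (psub (F Ps) L) ^ m) * ((p (fst g1) * (p (snd (D P)) * (p (fst h0) * p (fst (E P))))) * (p (fst g2) * p (snd (E P)))) ^ m"
  by (simp add: power_mult_distrib mult_ac)
  also have "... = p (psub (F Ps) G) * ((p (fst g1) * (p (snd (D P)) * (p (fst h0) * p (fst (E P))))) * (p (fst g2) * (p (snd (E P)) * p (psub (F P) L)))) ^ m"
  unfolding i3 by (simp add: power_mult_distrib mult_ac)
  also have "... = p (psub (F Ps) G) * ((p (fst (D P)) * (p (snd h0) * p (snd (E P))) * p (snd g1)) * (p (fst (E P)) * p (F P (j P)) * p (snd g2))) ^ m"
  unfolding i1 i2 ..
  also have "... = (p (fst (E P)) * p (snd (E P))) ^ m * ((p (snd g1) * p (snd g2)) ^ m * (p (F P (j P)) ^ m * (p (psub (F Ps) G) * p (snd h0) ^ m * p (fst (D P)) ^ m)))"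
  by (simp add: power_mult_distrib mult_ac)
  finally show "peval ((fst (E P) * snd (E P)) ^ m) x * peval (fst ?Z * snd g - fst g * snd ?Z) x = 0"
  unfolding fZ g_def fst_conv snd_conv peval_diff peval_mult peval_power p_def right_diff_distrib by simp
  qed
  hence "rat_eq X ?Z g" unfolding rat_eq_def .
  thus ?thesis unfolding unit_at_def using gnz gv by blast
  qed
  thus ?thesis unfolding lin_equiv_def using hnz by blast
 qed
 show thesis
 proof (rule that [of Z])
  show "Z : linear_system N X (multiple m D)" unfolding linear_system_def using rd eff le by blast
 qed (rule sup)
qed

end

section \<open>Smoothness of the image of a closed immersion\<close>

lemma dotp_commute: "dotp N a b = dotp N b a"
 by (simp add: dotp_def mult.commute)

text \<open>Rank plus nullity for the pairing with G.\<close>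

lemma dim_annihilator:
 assumes G: "G <= cvec.span (unit ` {..N})"
 shows "cvec.dim {v : cvec.span (unit ` {..N}). ALL g:G. dotp N v g = 0} + cvec.dim G = Suc N"
proof -
 let ?U = "unit ` {..N}" and ?A = "{v : cvec.span (unit ` {..N}). ALL g:G. dotp N v g = 0}"
 interpret vsp: vector_space_pair "%(a::complex) (v::nat => complex) i. a * v i" "(*) :: complex => complex => complex"
  by (rule vector_space_pair.intro [OF cvec.vector_space_axioms]) (unfold_locales, auto simp: distrib_left distrib_right)
 obtain B where B: "B <= G" "cvec.independent B" "G <= cvec.span B" "card B = cvec.dim G"
  using cvec.basis_exists [of G] by metis
 obtain B' where B': "B <= B'" "B' <= B Un ?U" "cvec.independent B'" "B Un ?U <= cvec.span B'"
  using cvec.maximal_independent_subset_extend [of B "B Un ?U"] B(2) by blast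
 have B'U: "B' <= cvec.span ?U" using B'(2) B(1) G cvec.span_base by blast
 have fB': "finite B'" "card B' <= Suc N"
  using cvec.independent_span_bound [of ?U B'] B'(3) B'U card_units [of N] by auto
 have "card ?U <= card B'" using cvec.independent_span_bound [of B' ?U] fB'(1) independent_units B'(4) by blast
 hence cB': "card B' = Suc N" using fB'(2) card_units [of N] by simp
 have "EX w. w : cvec.span ?U & (ALL b':B'. dotp N w b' = (if b' = b then 1 else 0))" for b
 proof -
  obtain g where g: "Vector_Spaces.linear (%(a::complex) (v::nat => complex) i. a * v i) (*) g"
  "ALL b':B'. g b' = (if b' = b then 1 else 0 :: complex)"
  using vsp.linear_independent_extend [OF B'(3), of "%b'. if b' = b then 1 else 0"] by blast
  interpret g: Vector_Spaces.linear "%(a::complex) (v::nat => complex) i. a * v i" "(*)" g by (rule g(1))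
  define w where "w = (%i. if i <= N then g (unit i) else 0)"
  have wg: "dotp N w v = g v" if "v : cvec.span ?U" for v
  proof -
  have "v = (SUM l<=N. (%i. v l * unit l i))"
  proof
  fix i show "v i = (SUM l<=N. (%i. v l * unit l i)) i"
  using that unfolding in_span_units
  by (cases "i <= N") (simp_all add: fsum_apply if_distrib [of "%t. _ * t"] cong: if_cong)
  qed
  hence "g v = g (SUM l<=N. (%i. v l * unit l i))" by (rule arg_cong)
  also have "... = (SUM l<=N. v l * g (unit l))" by (simp only: g.sum g.scale)
  finally have "g v = (SUM l<=N. v l * g (unit l))" .
  thus ?thesis by (simp add: dotp_def w_def mult.commute)
  qed
  show ?thesis
  proof (intro exI conjI ballI)
  show "w : cvec.span ?U" unfolding in_span_units by (simp add: w_def)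
  fix b' assume b': "b' : B'"
  show "dotp N w b' = (if b' = b then 1 else 0)" using wg [OF subsetD [OF B'U b']] g(2) b' by simp
  qed
 qed
 then obtain w where w: "!!b. w b : cvec.span ?U" "!!b b'. b' : B' ==> dotp N (w b) b' = (if b' = b then 1 else 0)"
  by metis
 let ?W = "w ` (B' - B)"
 have WA: "?W <= ?A"
 proof
  fix v assume "v : ?W"
  then obtain b where b: "b : B'" "b ~: B" "v = w b" by blast
  have "dotp N (w b) g = 0" if "g : G" for g
  by (rule dotp_span [of B]) (use w(2) B'(1) b that B(3) in auto)
  thus "v : ?A" using w(1) b(3) by simp
 qed
 have inj: "inj_on w (B' - B)"
  by (rule inj_onI) (metis DiffD1 w(2) zero_neq_one)
 have ind: "cvec.independent ?W"
 proof
  assume "cvec.dependent ?W"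
  then obtain b where b: "b : B' - B" "w b : cvec.span (?W - {w b})" unfolding cvec.dependent_def by blast
  have "dotp N b (w b) = 0"
  proof (rule dotp_span [OF _ b(2)])
  fix c assume "c : ?W - {w b}"
  then obtain b' where "b' : B'" "c = w b'" "b' ~= b" by blast
  thus "dotp N b c = 0" using w(2) [of b b'] b(1) by (simp add: dotp_commute)
  qed
  thus False using w(2) [of b b] b(1) by (simp add: dotp_commute)
 qed
 have sp: "?A <= cvec.span ?W"
 proof
  fix v assume v: "v : ?A"
  define u where "u = (SUM b:B'-B. (%i. dotp N v b * w b i))"
  have uW: "u : cvec.span ?W" unfolding u_def by (intro cvec.span_sum cvec.span_scale cvec.span_base) blast
  have ui: "u i = (SUM b:B'-B. dotp N v b * w b i)" for i by (simp add: u_def fsum_apply)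
  have ub: "dotp N u b' = (SUM b:B'-B. dotp N v b * dotp N (w b) b')" for b'
  unfolding dotp_def ui sum_distrib_right sum_distrib_left by (subst sum.swap) (simp add: mult.assoc)
  have "dotp N (%i. v i - u i) b' = 0" if b': "b' : B'" for b'
  proof -
  have "dotp N u b' = (SUM b:B'-B. if b' = b then dotp N v b else 0)"
  unfolding ub by (rule sum.cong) (use w(2) [OF b'] in auto)
  also have "... = (if b' : B then 0 else dotp N v b')" using b' fB'(1) by (simp add: sum.delta)
  also have "... = dotp N v b'" using v B(1) by auto
  finally show ?thesis by (simp add: dotp_def left_diff_distrib sum_subtractf)
  qed
  hence z: "dotp N (%i. v i - u i) c = 0" if "c : ?U" for c
  by (rule dotp_span [of B']) (use that B'(4) in auto)
  have "u : cvec.span ?U" unfolding u_def using w(1) by (intro cvec.span_sum cvec.span_scale) blast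
  hence "v i = u i" for i
  using z [of "unit i"] v unfolding in_span_units by (cases "i <= N") auto
  hence "v = u" by blast
  thus "v : cvec.span ?W" using uW by simp
 qed
 have "cvec.dim ?A = card ?W" using cvec.basis_card_eq_dim [OF WA sp ind] by simp
 also have "... = card B' - card B" using card_image [OF inj] card_Diff_subset [OF finite_subset [OF B'(1) fB'(1)] B'(1)] by simp
 finally show ?thesis using cB' B(4) card_mono [OF fB'(1) B'(1)] by simp
qed

lemma dim_le_injective:
 assumes lin: "Vector_Spaces.linear (%(a::complex) (v::nat => complex) i. a * v i) (%(a::complex) (v::nat => complex) i. a * v i) A"
  and S: "cvec.subspace S" "!!v. v : S ==> A v : T" "!!v. v : S ==> A v = 0 ==> v = 0"
  and T: "T <= cvec.span (unit ` {..N})"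
 shows "cvec.dim S <= cvec.dim T"
proof -
 interpret A: Vector_Spaces.linear "%(a::complex) (v::nat => complex) i. a * v i" "%(a::complex) (v::nat => complex) i. a * v i" A
  by (rule lin)
 interpret vsp: vector_space_pair "%(a::complex) (v::nat => complex) i. a * v i" "%(a::complex) (v::nat => complex) i. a * v i"
  by unfold_locales
 obtain B where B: "B <= S" "cvec.independent B" "S <= cvec.span B" "card B = cvec.dim S"
  using cvec.basis_exists [of S] by metis
 obtain C where C: "C <= T" "cvec.independent C" "T <= cvec.span C" "card C = cvec.dim T"
  using cvec.basis_exists [of T] by metis
 have fC: "finite C" using cvec.independent_span_bound [of "unit ` {..N}" C] C(1,2) T by blast
 have sB: "cvec.span B <= S" using B(1) S(1) by (rule cvec.span_minimal)
 have inj: "inj_on A (cvec.span B)"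
 proof (rule inj_onI)
  fix u v assume uv: "u : cvec.span B" "v : cvec.span B" "A u = A v"
  hence "u - v : S" using sB S(1) cvec.subspace_diff by blast
  moreover have "A (u - v) = 0" using uv(3) by (simp add: A.diff)
  ultimately show "u = v" using S(3) by fastforce
 qed
 have ind: "cvec.independent (A ` B)" by (rule vsp.linear_independent_injective_image [OF lin B(2) inj])
 have "A ` B <= cvec.span C" using B(1) S(2) C(3) by blast
 hence "card (A ` B) <= card C" using cvec.independent_span_bound [OF fC ind] by blast
 moreover have "card (A ` B) = card B"
  by (rule card_image) (use inj in \<open>rule inj_on_subset\<close>, simp add: cvec.span_superset)
 ultimately show ?thesis using B(4) C(4) by simp
qed

lemma DERIV_peval:
 assumes F: "F : forms N d" and c: "!!i. i <= N ==> ((%s. c s i) has_field_derivative c' i) (at s0)"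
 shows "((%s. peval F (c s)) has_field_derivative (SUM l<=N. peval (pdiff l F) (c s0) * c' l)) (at s0)"
 using F
proof (induction F rule: rpoly_induct)
 case (var i)
 thus ?case using c [OF var] by (simp add: pdiff_Xv if_distrib [of "%F. peval F _ * _"] cong: if_cong)
next
 case (add F G)
 show ?case using DERIV_add [OF add] by (simp add: peval_add pdiff_add distrib_right sum.distrib)
next
 case (mult F G)
 have "(SUM l<=N. peval (pdiff l (F * G)) (c s0) * c' l) =
  (SUM l<=N. peval (pdiff l F) (c s0) * c' l) * peval G (c s0) + (SUM l<=N. peval (pdiff l G) (c s0) * c' l) * peval F (c s0)"
  by (simp add: pdiff_mult peval_add peval_mult distrib_right distrib_left sum.distrib sum_distrib_left sum_distrib_right mult_ac)
 thus ?case using DERIV_mult [OF mult] by (simp add: peval_mult)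
qed (simp add: peval_const)

definition tang :: "nat => point set => cvector => cvector set" where
 "tang N X x = {v : cvec.span (unit ` {..N}). ALL g:grads N X x. dotp N v g = 0}"

lemma local_rep_times:
 assumes L: "local_rep N X r phi F" and b: "b <= N"
 shows "local_rep N X r phi (%j. Xv b * F j)"
proof -
 obtain d where d: "ALL j<=r. F j : forms N d" using L unfolding local_rep_def by blast
 have "phi P = proj_point (%j. if j <= r then peval (Xv b * F j) x else 0)"
  if P: "P : X" "x : P" and nz: "EX j<=r. peval (Xv b * F j) x ~= 0" for P x
 proof -
  have xb: "x b ~= 0" and "EX j<=r. peval (F j) x ~= 0" using nz by (auto simp: peval_mult)
  hence "phi P = proj_point (ev r F x)" using L P unfolding local_rep_def ev_def by blast
  moreover have "(%j. if j <= r then peval (Xv b * F j) x else 0) : proj_point (ev r F x)"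
  unfolding proj_point_def using xb by (intro CollectI exI [of _ "x b"]) (auto simp: ev_def peval_mult)
  ultimately show ?thesis using proj_point_eqI by metis
 qed
 moreover have "EX d. ALL j<=r. Xv b * F j : forms N d" using d forms_mult [OF forms_Xv [OF b]] by blast
 ultimately show ?thesis unfolding local_rep_def by blast
qed

text \<open>On X the vectors H (F x) and x are proportional, so x i H k (F x) - x k H i (F x) vanishes on X. Its
derivative along a tangent vector v killed by the differential of F shows that v is proportional to x.
By the Euler relation the differential maps x to d F(x), which is nonzero as d >= 1; hence v = 0.\<close>

lemma tangent_space_injects:
 assumes X: "X <= proj_space N" and F: "local_rep N X r phi F" "!!j. j <= r ==> F j : forms N d" "d >= 1"
  and P: "P : X" "x : P" and j0: "j0 <= r" "peval (F j0) x ~= 0"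
  and phi: "!!P. P : X ==> phi P : Y" "!!P. P : X ==> psi (phi P) = P"
  and H: "local_rep r Y N psi H" "i0 <= N" "peval (H i0) y ~= 0" and y: "y : phi P"
 shows "cvec.dim (tang N X x) <= cvec.dim (tang r Y y)"
proof -
 obtain e where He: "!!i. i <= N ==> H i : forms r e" using H(1) unfolding local_rep_def by blast
 let ?y = "ev r F x"
 have yi: "?y i = peval (F i) x" if "i <= r" for i using that by (simp add: ev_def)
 have Fev: "phi P' = proj_point (ev r F x')" if "P' : X" "x' : P'" "j <= r" "peval (F j) x' ~= 0" for P' x' j
  using F(1) that unfolding local_rep_def ev_def by blast
 obtain t where t: "t ~= 0" "y = (%i. t * ?y i)"
  using y Fev [OF P j0] unfolding proj_point_def by auto
 define A where "A v = (%k. if k <= r then dotp N v (%l. peval (pdiff l (F k)) x) else 0)" for v :: cvector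
 have linA: "Vector_Spaces.linear (%(a::complex) (v::nat => complex) i. a * v i) (%(a::complex) (v::nat => complex) i. a * v i) A"
  by unfold_locales (auto simp: A_def dotp_def fun_eq_iff algebra_simps sum.distrib sum_distrib_left)
 have xN: "x i = 0" if "i > N" for i
 proof -
  obtain x' where "P = proj_point x'" "x' : coord_vectors N" using X P(1) proj_space_rep by blast
  thus ?thesis using P(2) that unfolding proj_point_def coord_vectors_def by auto
 qed
 have curve: "((%s. peval (F k) (%i. x i + s * v i)) has_field_derivative A v k) (at 0)" if "k <= r" for k v
 proof -
  have "((%s. peval (F k) ((%s i. x i + s * v i) s)) has_field_derivative
  (SUM l<=N. peval (pdiff l (F k)) ((%s i. x i + s * v i) 0) * v l)) (at 0)"
  by (rule DERIV_peval [OF F(2) [OF that]]) (auto intro!: derivative_eq_intros)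
  thus ?thesis using that by (simp add: A_def dotp_def mult.commute)
 qed
 have comp: "((%s. peval G (%i. peval (F i) (%i. x i + s * v i))) has_field_derivative (SUM k<=r. peval (pdiff k G) ?y * A v k)) (at 0)"
  if G: "G : forms r m" for G m v
 proof -
  have "((%s. peval G ((%s i. peval (F i) (%i. x i + s * v i)) s)) has_field_derivative
  (SUM k<=r. peval (pdiff k G) ((%s i. peval (F i) (%i. x i + s * v i)) 0) * A v k)) (at 0)"
  by (rule DERIV_peval [OF G curve])
  moreover have "peval (pdiff k G) (%i. peval (F i) x) = peval (pdiff k G) ?y" for k
  by (rule peval_cong [OF pdiff_forms [OF G]]) (simp add: ev_def)
  ultimately show ?thesis by simp
 qed
 have tangd: "(SUM l<=N. peval (pdiff l R) x * v l) = 0" if "R : forms N m" "vanishes_on R X" "v : tang N X x" for R m v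
 proof -
  have "(%l. peval (pdiff l R) x) : grads N X x" unfolding grads_def using that by blast
  thus ?thesis using that(3) unfolding tang_def dotp_def by (auto simp: mult.commute)
 qed
 have line: "((%s. peval R (%i. x i + s * v i)) has_field_derivative (SUM l<=N. peval (pdiff l R) x * v l)) (at 0)"
  if "R : forms N m" for R m v
 proof -
  have "((%s. peval R ((%s i. x i + s * v i) s)) has_field_derivative
  (SUM l<=N. peval (pdiff l R) ((%s i. x i + s * v i) 0) * v l)) (at 0)"
  by (rule DERIV_peval [OF that]) (auto intro!: derivative_eq_intros)
  thus ?thesis by simp
 qed
 have fromH: "P' = proj_point (ev N H z)" if "P' : X" "z : phi P'" "EX i<=N. peval (H i) z ~= 0" for P' z
 proof -
  have "psi (phi P') = proj_point (ev N H z)"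
  using H(1) phi(1) [OF that(1)] that(2,3) unfolding local_rep_def ev_def by blast
  thus ?thesis by (simp only: phi(2) [OF that(1)])
 qed
 show ?thesis
 proof (rule dim_le_injective [OF linA])
  show "cvec.subspace (tang N X x)" unfolding tang_def
  by (rule cvec.subspaceI) (auto simp: dotp_def distrib_right sum.distrib mult.assoc cvec.span_add cvec.span_scale cvec.span_zero simp flip: sum_distrib_left)
  show "tang r Y y <= cvec.span (unit ` {..r})" unfolding tang_def by blast
 next
  fix v assume v: "v : tang N X x"
  have "dotp r (A v) g = 0" if g: "g : grads r Y y" for g
  proof -
  obtain G m where G: "g = (%i. peval (pdiff i G) y)" "G : forms r m" "vanishes_on G Y"
  using g unfolding grads_def by blast
  have van: "vanishes_on (psub F G) X"
  unfolding vanishes_defs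
  proof (intro ballI)
  fix P' x' assume P': "P' : X" "x' : P'"
  have zero: "peval G (ev r F x'') = 0" if "P'' : X" "x'' : P''" "j <= r" "peval (F j) x'' ~= 0" for P'' x'' j
  using Fev [OF that] phi(1) [OF that(1)] G(3) proj_point_self unfolding vanishes_defs by metis
  have "peval G (ev r F x') = 0"
  proof (cases "EX j<=r. peval (F j) x' ~= 0")
  case False
  hence e0: "ev r F x' = (%i. 0 * ?y i)" by (auto simp: ev_def)
  have "peval G ?y = 0" by (rule zero [OF P j0])
  thus ?thesis unfolding e0 peval_scale [OF G(2)] by simp
  qed (use zero [OF P'] in blast)
  thus "peval (psub F G) x' = 0" using peval_psub_ev [OF G(2)] by simp
  qed
  have sf: "psub F G : forms N (m * d)" using G(2) F(2) by (rule forms_psub)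
  have "((%s. peval (psub F G) (%i. x i + s * v i)) has_field_derivative (SUM k<=r. peval (pdiff k G) ?y * A v k)) (at 0)"
  unfolding peval_psub by (rule comp [OF G(2)])
  hence "(SUM l<=N. peval (pdiff l (psub F G)) x * v l) = (SUM k<=r. peval (pdiff k G) ?y * A v k)"
  by (rule DERIV_unique [OF line [OF sf]])
  hence "(SUM k<=r. peval (pdiff k G) ?y * A v k) = 0" using tangd [OF sf van v] by simp
  hence "t ^ (m - 1) * (SUM k<=r. peval (pdiff k G) ?y * A v k) = 0" by simp
  thus ?thesis unfolding G(1) dotp_def t(2) peval_scale [OF pdiff_forms [OF G(2)]]
  by (simp add: sum_distrib_left mult_ac)
  qed
  moreover have "A v : cvec.span (unit ` {..r})" unfolding in_span_units by (simp add: A_def)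
  ultimately show "A v : tang r Y y" unfolding tang_def by blast
 next
  fix v assume v: "v : tang N X x" and Av: "A v = 0"
  define g where "g k = peval (H k) ?y" for k
  have vk: "v k * g l = v l * g k" if kl: "k <= N" "l <= N" for k l
  proof -
  define R where "R = F j0 * (Xv k * psub F (H l) - Xv l * psub F (H k))"
  have Rf: "R : forms N (d + (1 + e * d))"
  unfolding R_def using kl F(2) j0(1) He by (intro forms_mult forms_diff forms_Xv forms_psub) auto
  have pR: "peval R x' = peval (F j0) x' * (x' k * peval (H l) (ev r F x') - x' l * peval (H k) (ev r F x'))" for x'
  using peval_psub_ev [OF He] kl by (simp add: R_def peval_mult peval_diff)
  have ppt: "x' k * peval (H l) (ev r F x') = x' l * peval (H k) (ev r F x')"
  if P': "P' : X" "x' : P'" and nz: "peval (F j0) x' ~= 0" for P' x'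
  proof (cases "EX i<=N. peval (H i) (ev r F x') ~= 0")
  case True
  have "phi P' = proj_point (ev r F x')" by (rule Fev [OF P' j0(1) nz])
  hence "ev r F x' : phi P'" by (simp add: proj_point_self)
  hence "P' = proj_point (ev N H (ev r F x'))" by (rule fromH [OF P'(1) _ True])
  then obtain s where "x' = (%i. s * ev N H (ev r F x') i)" using P'(2) unfolding proj_point_def by blast
  hence "x' k = s * peval (H k) (ev r F x')" "x' l = s * peval (H l) (ev r F x')"
  using kl by (metis ev_def)+
  thus ?thesis by simp
  qed (use kl in auto)
  have "peval R x' = 0" if "P' : X" "x' : P'" for P' x'
  unfolding pR using ppt [OF that] by (cases "peval (F j0) x' = 0") auto
  hence van: "vanishes_on R X" unfolding vanishes_defs by blast
  have c0: "((%s. peval R (%i. x i + s * v i)) has_field_derivative 0) (at 0)"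
  using line [OF Rf, of v] tangd [OF Rf van v] by simp
  have H0: "((%s. peval (H i) (ev r F (%i. x i + s * v i))) has_field_derivative 0) (at 0)" if "i <= N" for i
  proof -
  have "peval (H i) (ev r F z) = peval (H i) (%j. peval (F j) z)" for z
  by (rule peval_cong [OF He [OF that]]) (simp add: ev_def)
  thus ?thesis using comp [OF He [OF that], of v] Av by simp
  qed
  have F0: "((%s. peval (F j0) (%i. x i + s * v i)) has_field_derivative 0) (at 0)"
  using curve [OF j0(1), of v] Av by simp
  have "((%s. peval R (%i. x i + s * v i)) has_field_derivative
  peval (F j0) x * (v k * g l - v l * g k)) (at 0)"
  unfolding pR by (rule derivative_eq_intros F0 H0 kl refl)+ (simp add: g_def)
  hence "peval (F j0) x * (v k * g l - v l * g k) = 0" using DERIV_unique c0 by blast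
  thus ?thesis using j0(2) by simp
  qed
  have gi0: "g i0 ~= 0"
  proof -
  have "peval (H i0) y = t ^ e * g i0" unfolding t(2) g_def by (rule peval_scale [OF He [OF H(2)]])
  thus ?thesis using H(3) by auto
  qed
  have "P = proj_point (ev N H ?y)"
  proof -
  have "?y : phi P" using Fev [OF P j0] by (simp add: proj_point_self)
  thus ?thesis by (rule fromH [OF P(1)]) (use H(2) gi0 in \<open>auto simp: g_def\<close>)
  qed
  then obtain s where s: "s ~= 0" "x = (%i. s * ev N H ?y i)" using P(2) unfolding proj_point_def by blast
  hence xg: "x k = s * g k" if "k <= N" for k using that by (metis ev_def g_def)
  define c where "c = v i0 / (g i0 * s)"
  have vc: "v k = c * x k" for k
  proof (cases "k <= N")
  case True
  thus ?thesis using vk [OF True H(2)] gi0 s(1) xg [OF True] by (simp add: c_def field_simps)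
  next
  case False
  thus ?thesis using v xN unfolding tang_def in_span_units by simp
  qed
  have "A v j0 = c * (SUM l<=N. x l * peval (pdiff l (F j0)) x)"
  using j0(1) by (simp add: A_def dotp_def vc sum_distrib_left mult.assoc)
  also have "(SUM l<=N. x l * peval (pdiff l (F j0)) x) = peval (SUM l<=N. Xv l * pdiff l (F j0)) x"
  by (simp add: peval_sum peval_mult)
  also have "... = of_nat d * peval (F j0) x"
  unfolding euler_forms [OF F(2) [OF j0(1)]] by (simp only: peval_mult peval_const of_real_of_nat_eq)
  finally have "c * (of_nat d * peval (F j0) x) = 0" using Av by simp
  hence "c = 0" using F(3) j0(2) by simp
  thus "v = 0" using vc by (simp add: fun_eq_iff)
 qed
qed

text \<open>Tangent spaces of X and of its image inject into each other, hence have the same dimension n + 1; the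
annihilator formula turns this into the rank of the gradients in P^r.\<close>

theorem (in embedded) smooth_image:
 assumes rv: "real_variety N X" and dim: "variety_dim N X = n"
 shows "smooth_variety r n (phi ` X)"
proof -
 obtain psi where mor: "real_morphism N X r phi" and cl: "real_closed r (phi ` X)"
  and psi: "real_morphism r (phi ` X) N psi" "!!P. P : X ==> psi (phi P) = P"
  using emb unfolding real_embedding_def by blast
 have nN: "n <= N" using variety_dim_le [OF irr] dim by simp
 have le: "cvec.dim (tang M A x) <= cvec.dim (tang s B y)"
  if A: "A <= proj_space M" "B <= proj_space s" "real_morphism M A s f" "real_morphism s B M g"
  "!!P. P : A ==> f P : B" "!!P. P : A ==> g (f P) = P" and P: "P : A" "x : P" "y : f P"
  for M A s B f g P x y
 proof -
  obtain F j where F: "local_rep M A s f F" "j <= s" "~ vanishes_at (F j) P"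
  using A(3) P(1) unfolding real_morphism_def by blast
  obtain d where d: "!!j. j <= s ==> F j : forms M d" using F(1) unfolding local_rep_def by blast
  obtain H i where H: "local_rep s B M g H" "i <= M" "~ vanishes_at (H i) (f P)"
  using A(4,5) P(1) unfolding real_morphism_def by blast
  obtain e where e: "!!j. j <= M ==> H j : forms s e" using H(1) unfolding local_rep_def by blast
  have Fx: "peval (F j) x ~= 0" using vanishes_at_rep [of P M x "F j" M d] A(1) P F(2,3) d by blast
  have Hy: "peval (H i) y ~= 0" using vanishes_at_rep [of "f P" s y "H i" s e] A(2) A(5) [OF P(1)] P H(2,3) e by blast
  obtain b where b: "b <= M" "x b ~= 0"
  proof -
  obtain x' where x': "P = proj_point x'" "x' : coord_vectors M" using A(1) P(1) proj_space_rep by blast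
  then obtain b where b: "x' b ~= 0" unfolding coord_vectors_def by blast
  hence "b <= M" using x'(2) unfolding coord_vectors_def by (metis (mono_tags, lifting) mem_Collect_eq not_le)
  thus thesis using that [of b] b x'(1) P(2) unfolding proj_point_def by auto
  qed
  show ?thesis
  proof (rule tangent_space_injects [OF A(1) local_rep_times [OF F(1) b(1)] _ _ P(1,2) F(2) _ A(5,6) H(1,2) Hy P(3)])
  show "Xv b * F k : forms M (1 + d)" if "k <= s" for k by (intro forms_mult forms_Xv b(1) d that)
  qed (use b(2) Fx in \<open>auto simp: peval_mult\<close>)
 qed
 have dim_eq: "cvec.dim (tang r (phi ` X) y) = Suc n" if Q: "Q : phi ` X" "y : Q" for Q y
 proof -
  obtain P where P: "P : X" "Q = phi P" using Q(1) by blast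
  obtain x where x: "x : P" using P(1) Xsub proj_space_rep by blast
  have "cvec.dim (grads N X x) = N - n"
  using rv P(1) x dim unfolding real_variety_def smooth_def grads_def by blast
  hence "cvec.dim (tang N X x) = Suc n" using dim_annihilator [OF grads_span, of N X x] nN unfolding tang_def by simp
  moreover have "cvec.dim (tang N X x) <= cvec.dim (tang r (phi ` X) y)"
  by (rule le [OF Xsub real_closed_subset [OF cl] mor psi(1) _ psi(2) P(1) x]) (use Q P in auto)
  moreover have "cvec.dim (tang r (phi ` X) y) <= cvec.dim (tang N X x)"
  by (rule le [OF real_closed_subset [OF cl] Xsub psi(1) mor _ _ Q]) (use psi(2) P x in auto)
  ultimately show ?thesis by simp
 qed
 obtain P where P: "P : X" using Xne by blast
 have "phi P : proj_space r" using real_closed_subset [OF cl] P by blast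
 then obtain y where y: "y : phi P" by (rule proj_space_rep)
 have "n <= r" using dim_eq [OF imageI [OF P] y] dim_annihilator [OF grads_span, of r "phi ` X" y] unfolding tang_def by simp
 moreover have "cvec.dim (grads r (phi ` X) y) = r - n" if "Q : phi ` X" "y : Q" for Q y
  using dim_eq [OF that] dim_annihilator [OF grads_span, of r "phi ` X" y] unfolding tang_def by simp
 ultimately show ?thesis using cl by (intro smooth_variety.intro) auto
qed

section \<open>The real locus as a space of symmetric matrices\<close>

definition nsq :: "nat => rvec => real" where
 "nsq r y = (SUM i<=r. (y i)\<^sup>2)"

text \<open>Real projective space as the projections onto lines, the symmetric matrices y y^T / |y|^2. This gives
a model of the real locus inside a metrisable vector space, where charts and limits are accessible.\<close>

definition ver :: "nat => rvec => nat => rvec" where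
 "ver r y = (%i j. y i * y j / nsq r y)"

lemma nsq_pos: "i <= r ==> y i ~= 0 ==> nsq r y > 0"
 unfolding nsq_def by (rule sum_pos2 [of _ i]) auto

lemma ver_scale: "t ~= 0 ==> ver r (%i. t * y i) = ver r y"
proof -
 assume t: "t ~= 0"
 have "nsq r (%i. t * y i) = t\<^sup>2 * nsq r y" by (simp add: nsq_def power_mult_distrib sum_distrib_left)
 moreover have "t * y i * (t * y j) = t\<^sup>2 * (y i * y j)" for i j by (simp add: power2_eq_square)
 ultimately show ?thesis using t by (simp add: ver_def power2_eq_square)
qed

lemma ver_ratio: "y a ~= 0 ==> a <= r ==> y i / y a = ver r y i a / ver r y a a"
 using nsq_pos [of a r y] by (simp add: ver_def)

lemma ver_eq_imp_proportional:
 assumes "ver r y = ver r y'" "y a ~= 0" "a <= r" "EX i<=r. y' i ~= 0"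
 shows "y' a ~= 0" "!!i. y' i = y' a / y a * y i"
proof -
 have "ver r y a a ~= 0" using nsq_pos [of a r y] assms(2,3) by (simp add: ver_def)
 thus a: "y' a ~= 0" unfolding assms(1) by (auto simp: ver_def)
 show "y' i = y' a / y a * y i" for i
  using ver_ratio [of y a r i] ver_ratio [of y' a r i] a assms(1-3) by (simp add: field_simps)
qed

lemma real_coneD:
 assumes "real_cone r Y y"
 shows "cx y : coord_vectors r" "proj_point (cx y) : Y" "!!i. i > r ==> y i = 0" "EX i<=r. y i ~= 0"
proof -
 show c: "cx y : coord_vectors r" and "proj_point (cx y) : Y" using assms by (simp_all add: real_cone_def)
 show z: "y i = 0" if "i > r" for i using c that by (simp add: coord_vectors_def)
 obtain i where "y i ~= 0" using c by (auto simp: coord_vectors_def)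
 thus "EX i<=r. y i ~= 0" using z by (meson not_le)
qed

lemma real_cone_rep:
 assumes Y: "Y <= proj_space r" "Q : Y" and y: "cx y : Q"
 shows "real_cone r Y y" "Q = proj_point (cx y)"
proof -
 have "Q : proj_space r" using Y by blast
 then obtain z where z: "Q = proj_point z" "z : coord_vectors r" by (rule proj_space_rep)
 then obtain t where t: "t ~= 0" "cx y = (%i. t * z i)" using y by (auto simp: proj_point_def)
 hence "cx y : coord_vectors r" using z(2) unfolding coord_vectors_def by auto
 moreover show Q: "Q = proj_point (cx y)" using proj_point_eqI [of "cx y" z] y z(1) by simp
 ultimately show "real_cone r Y y" using Y(2) by (simp add: real_cone_def)
qed

lemma real_cone_scale:
 assumes "real_cone r Y y" "t ~= 0" shows "real_cone r Y (%i. t * y i)"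
proof -
 have "cx (%i. t * y i) : proj_point (cx y)"
  using assms(2) unfolding proj_point_def by (intro CollectI exI [of _ "complex_of_real t"]) simp
 hence "proj_point (cx (%i. t * y i)) = proj_point (cx y)" by (rule proj_point_eqI)
 moreover have "cx (%i. t * y i) : coord_vectors r" using real_coneD(1) [OF assms(1)] assms(2) by (auto simp: coord_vectors_def)
 ultimately show ?thesis using real_coneD(2) [OF assms(1)] by (simp add: real_cone_def)
qed

lemma real_rep_proportional:
 assumes "cx y : Q" "cx y' : Q" "Q : proj_space r"
 obtains t where "t ~= 0" "y' = (%i. t * y i)"
proof -
 have "Q = proj_point (cx y)" and c: "real_cone r {Q} y" using real_cone_rep [of "{Q}" r Q y] assms by auto
 then obtain s where s: "s ~= 0" "cx y' = (%i. s * cx y i)" using assms(2) unfolding proj_point_def by auto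
 obtain a where a: "y a ~= 0" using real_coneD(4) [OF c] by blast
 have "complex_of_real (y' a) = s * y a" using s(2) by (rule fun_cong)
 hence sr: "s = complex_of_real (y' a / y a)" using a by simp
 have "y' i = (y' a / y a) * y i" for i
 proof -
  have "complex_of_real (y' i) = complex_of_real ((y' a / y a) * y i)"
  using fun_cong [OF s(2), of i] unfolding sr by simp
  thus ?thesis unfolding of_real_eq_iff .
 qed
 moreover have "y' a / y a ~= 0" using s(1) sr by auto
 ultimately show thesis using that [of "y' a / y a"] by blast
qed

lemma topspace_proj_topology: "topspace (proj_topology N) = proj_space N"
proof (rule subset_antisym)
 show "topspace (proj_topology N) <= proj_space N" using openin_topspace [of "proj_topology N"] unfolding openin_proj_topology by blast
 have "\<Union>(proj_space N) = coord_vectors N"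
 proof (intro subset_antisym subsetI)
  fix x assume "x : \<Union>(proj_space N)"
  then obtain P x0 where P: "x : P" "P = proj_point x0" "x0 : coord_vectors N" unfolding proj_space_def by blast
  thus "x : coord_vectors N" unfolding proj_point_def coord_vectors_def by auto
 next
  fix x assume "x : coord_vectors N"
  thus "x : \<Union>(proj_space N)" unfolding proj_space_def using proj_point_self by blast
 qed
 hence "openin (proj_topology N) (proj_space N)" unfolding openin_proj_topology by simp
 thus "proj_space N <= topspace (proj_topology N)" by (rule openin_subset)
qed

lemma compact_real_cone:
 assumes "real_closed r Y" shows "compact {y. real_cone r Y y & nsq r y = 1}"
proof -
 obtain S where S: "S <= (UN d. forms r d)" "Y = {P : proj_space r. ALL F:S. vanishes_at F P}"
  using assms unfolding real_closed_def by blast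
 have eq: "{y. real_cone r Y y & nsq r y = 1} =
  cbx (Suc r) (%_. -1) (%_. 1) Int ({y. nsq r y = 1} Int (INT F:S. {y. reval F y = 0}))" (is "?L = ?R")
 proof (intro subset_antisym subsetI)
  fix y assume "y : ?L"
  hence y: "real_cone r Y y" "nsq r y = 1" by auto
  have "abs (y i) <= 1" if "i <= r" for i
  proof -
  have "(y i)\<^sup>2 <= nsq r y" unfolding nsq_def using that by (intro member_le_sum) auto
  thus ?thesis using y(2) by (simp add: abs_square_le_1)
  qed
  moreover have "reval F y = 0" if F: "F : S" for F
  proof -
  obtain d where d: "F : forms r d" using S(1) F by blast
  have "vanishes_at F (proj_point (cx y))" using real_coneD(2) [OF y(1)] S(2) F by blast
  thus ?thesis unfolding vanishes_at_proj_point [OF d] by (simp add: peval_cx)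
  qed
  ultimately show "y : ?R" using y(2) real_coneD(3) [OF y(1)] by (auto simp: cbx_def abs_le_iff)
 next
  fix y assume y: "y : ?R"
  obtain i where i: "y i ~= 0"
  proof (rule ccontr)
  assume "~ thesis"
  hence "y i = 0" for i using that by blast
  thus False using y by (simp add: nsq_def)
  qed
  have cv: "cx y : coord_vectors r" using y i by (auto simp: cbx_def coord_vectors_def)
  have "vanishes_at F (proj_point (cx y))" if F: "F : S" for F
  proof -
  obtain d where d: "F : forms r d" using S(1) F by blast
  show ?thesis unfolding vanishes_at_proj_point [OF d] using y F by (simp add: peval_cx)
  qed
  hence "proj_point (cx y) : Y" using S(2) cv by (auto simp: proj_space_def)
  thus "y : ?L" using cv y by (simp add: real_cone_def)
 qed
 have "closed ({y. nsq r y = 1} Int (INT F:S. {y. reval F y = 0}))"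
  unfolding nsq_def by (intro closed_Int closed_INT ballI closed_Collect_eq continuous_intros continuous_on_reval)
 thus ?thesis unfolding eq by (intro compact_Int_closed compact_cbx)
qed

lemma ver_normalize:
 assumes "real_cone r Y y" obtains y' where "real_cone r Y y'" "nsq r y' = 1" "ver r y' = ver r y" "y = (%i. sqrt (nsq r y) * y' i)"
proof -
 obtain i where "i <= r" "y i ~= 0" using real_coneD(4) [OF assms] by blast
 hence p: "nsq r y > 0" by (rule nsq_pos)
 define t where "t = 1 / sqrt (nsq r y)"
 have t: "t ~= 0" "t\<^sup>2 * nsq r y = 1" using p by (simp_all add: t_def power_divide)
 show thesis
 proof (rule that [of "%i. t * y i"])
  show "nsq r (%i. t * y i) = 1" using t(2) by (simp add: nsq_def power_mult_distrib flip: sum_distrib_left)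
  show "real_cone r Y (%i. t * y i)" by (rule real_cone_scale [OF assms t(1)])
  show "ver r (%i. t * y i) = ver r y" by (rule ver_scale [OF t(1)])
  show "y = (%i. sqrt (nsq r y) * (t * y i))" using p by (simp add: t_def)
 qed
qed

text \<open>The map P |-> ver (phi P) is a continuous bijection from a compact space onto a Hausdorff space.\<close>

theorem (in embedded) real_locus_homeomorphic:
 assumes G: "G : forms r m"
 shows "EX h. homeomorphic_map (subtop (proj_topology N) (real_locus {P : X. vanishes_at G (phi P)}))
  (top_of_set (ver r ` {y. real_cone r (phi ` X) y & reval G y = 0})) h"
proof -
 obtain psi where mor: "real_morphism N X r phi" and cl: "real_closed r (phi ` X)"
  and psi: "real_morphism r (phi ` X) N psi" "!!P. P : X ==> psi (phi P) = P"
  using emb unfolding real_embedding_def by blast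
 have Ysub: "phi ` X <= proj_space r" using cl by (rule real_closed_subset)
 have Xcl: "real_closed N X" using irr by (simp add: real_irreducible_def)
 let ?T = "subtop (proj_topology N) (real_locus X)" and ?M = "ver r ` {y. real_cone r (phi ` X) y}"
 note topP = topspace_proj_topology [of N]
 have topT: "topspace ?T = real_locus X" using Xsub topP unfolding real_locus_def by auto
 have real_rep: "EX x. real_cone N X x & cx x : P" if "P : real_locus X" for P
 proof -
  obtain x where x: "x : P" "ALL i. x i : \<real>" and P: "P : X" using `P : real_locus X` unfolding real_locus_def by blast
  have "cx (%i. Re (x i)) = x" using x(2) by (simp add: fun_eq_iff)
  hence "cx (%i. Re (x i)) : P" using x(1) by simp
  thus ?thesis using real_cone_rep(1) [OF Xsub P] by (intro exI [of _ "%i. Re (x i)"]) simp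
 qed
 have compT: "compact_space ?T"
 proof -
  let ?K = "{x. real_cone N X x & nsq N x = 1}"
  have cm: "continuous_map (top_of_set ?K) (proj_topology N) (%x. proj_point (cx x))"
  unfolding continuous_map_def topspace_euclidean_subtopology topP
  proof (intro conjI allI impI)
  show "(%x. proj_point (cx x)) : ?K \<rightarrow> proj_space N" using real_coneD(1) unfolding proj_space_def by blast
  fix U assume "openin (proj_topology N) U"
  hence U: "U <= proj_space N" "openin (top_of_set (coord_vectors N)) (\<Union>U)" by (simp_all add: openin_proj_topology)
  then obtain O' where O': "open O'" "\<Union>U = coord_vectors N Int O'" by (auto simp: openin_open)
  have "proj_point (cx x) : U \<longleftrightarrow> cx x : O'" if x: "x : ?K" for x
  proof
  assume "proj_point (cx x) : U"
  thus "cx x : O'" using proj_point_self O'(2) by blast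
  next
  assume "cx x : O'"
  hence "cx x : \<Union>U" using O'(2) x real_coneD(1) by blast
  then obtain P where P: "P : U" "cx x : P" by blast
  thus "proj_point (cx x) : U" using real_cone_rep(2) [of "{P}" N P x] U(1) by auto
  qed
  hence "{x : ?K. proj_point (cx x) : U} = ?K Int cx -` O'" by blast
  moreover have "open (cx -` O')"
  by (rule open_vimage [OF O'(1)]) (intro continuous_on_coordinatewise_then_product continuous_intros)
  ultimately show "openin (top_of_set ?K) {x : ?K. proj_point (cx x) : U}" by (auto simp: openin_open)
  qed
  have im: "(%x. proj_point (cx x)) ` ?K = real_locus X"
  proof (intro subset_antisym subsetI)
  fix P assume "P : (%x. proj_point (cx x)) ` ?K"
  then obtain x where x: "real_cone N X x" "P = proj_point (cx x)" by blast
  thus "P : real_locus X" unfolding real_locus_def using real_coneD(2) [OF x(1)] proj_point_self [of "cx x"] by (auto intro!: bexI [of _ "cx x"])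
  next
  fix P assume P: "P : real_locus X"
  then obtain x where x: "real_cone N X x" "cx x : P" using real_rep by blast
  obtain x' where x': "real_cone N X x'" "nsq N x' = 1" "x = (%i. sqrt (nsq N x) * x' i)" by (rule ver_normalize [OF x(1)])
  obtain i where "i <= N" "x i ~= 0" using real_coneD(4) [OF x(1)] by blast
  hence "sqrt (nsq N x) ~= 0" using nsq_pos [of i N x] by simp
  hence "cx x : proj_point (cx x')" unfolding proj_point_def
  by (intro CollectI exI [of _ "complex_of_real (sqrt (nsq N x))"] conjI) (subst x'(3), simp, simp only: of_real_eq_0_iff not_False_eq_True)
  hence "proj_point (cx x) = proj_point (cx x')" by (rule proj_point_eqI)
  moreover have "P = proj_point (cx x)" using real_cone_rep(2) [OF Xsub _ x(2)] P unfolding real_locus_def by blast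
  ultimately show "P : (%x. proj_point (cx x)) ` ?K" using x' by blast
  qed
  have "compactin (proj_topology N) ((%x. proj_point (cx x)) ` ?K)"
  proof (rule image_compactin [OF _ cm])
  show "compactin (top_of_set ?K) ?K" using compact_real_cone [OF Xcl] by (simp add: compactin_subtopology)
  qed
  thus ?thesis unfolding im by (rule compact_space_subtopology)
 qed
 have wd: "ver r y = ver r y'" if Q: "cx y : Q" "cx y' : Q" "Q : phi ` X" for y y' Q
 proof -
  obtain t where t: "t ~= 0" "y' = (%i. t * y i)"
  by (rule real_rep_proportional [OF Q(1,2) subsetD [OF Ysub Q(3)]])
  show ?thesis unfolding t(2) by (rule ver_scale [OF t(1), symmetric])
 qed
 define h where "h P = ver r (SOME y. cx y : phi P)" for P
 have hy: "h P = ver r y" if "P : X" "cx y : phi P" for P y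
  unfolding h_def using someI [of "%y. cx y : phi P", OF that(2)] wd that by blast
 have real_image: "cx (%i. if i <= r then reval (F i) x else 0) : phi P & peval (F j) (cx x) = reval (F j) x"
  if F: "local_rep N X r phi F" "j <= r" "~ vanishes_at (F j) P" and P: "P : X" "cx x : P" for F j P x
 proof -
  have nz: "peval (F j) (cx x) ~= 0" using rep_nonzero [OF F(1,2) P] F(3) by simp
  have "phi P = proj_point (ev r F (cx x))" by (rule rep_eval [OF F(1) P F(2) nz])
  moreover have "ev r F (cx x) = cx (%i. if i <= r then reval (F i) x else 0)" by (auto simp: ev_def peval_cx)
  ultimately show ?thesis using proj_point_self by (simp add: peval_cx)
 qed
 have rep_real: "EX y. cx y : phi P" if P: "P : real_locus X" for P
 proof -
  obtain x where x: "cx x : P" using real_rep [OF P] by blast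
  have PX: "P : X" using P by (simp add: real_locus_def)
  then obtain F j where F: "local_rep N X r phi F" "j <= r" "~ vanishes_at (F j) P" using mor unfolding real_morphism_def by blast
  show ?thesis by (rule exI [of _ "%i. if i <= r then reval (F i) x else 0"]) (use real_image [OF F PX x] in blast)
 qed
 have vanG: "vanishes_at G (phi P) \<longleftrightarrow> reval G y = 0" if "P : X" "cx y : phi P" for P y
  using vanishes_at_rep [of "phi P" r "cx y" G r m] Ysub that G by (auto simp: peval_cx)
 have back_real: "P : real_locus X" if P: "P : X" "cx y : phi P" for P y
 proof -
  have QY: "phi P : phi ` X" using P(1) by blast
  obtain H j where H: "local_rep r (phi ` X) N psi H" "j <= N" "~ vanishes_at (H j) (phi P)"
  using psi(1) QY unfolding real_morphism_def by blast
  obtain d where d: "H j : forms r d" using H(1,2) unfolding local_rep_def by blast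
  have "peval (H j) (cx y) ~= 0" using vanishes_at_rep [of "phi P" r "cx y" "H j" r d] Ysub QY P(2) H(3) d by auto
  hence "psi (phi P) = proj_point (%j. if j <= N then peval (H j) (cx y) else 0)"
  using H(1,2) QY P(2) unfolding local_rep_def by blast
  hence "(%j. if j <= N then peval (H j) (cx y) else 0) : P" using psi(2) [OF P(1)] proj_point_self by simp
  moreover have "ALL i. (%j. if j <= N then peval (H j) (cx y) else 0) i : \<real>" by (simp add: peval_cx)
  ultimately have "EX x:P. ALL i. x i : \<real>" by (intro bexI [of _ "%j. if j <= N then peval (H j) (cx y) else 0"])
  thus ?thesis using P(1) by (simp add: real_locus_def)
 qed
 have cont: "continuous_map ?T (top_of_set ?M) h"
  unfolding continuous_map_in_subtopology
 proof (intro conjI)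
  show "h : topspace ?T \<rightarrow> ?M"
  proof
  fix P assume P: "P : topspace ?T"
  hence PX: "P : X" using topT by (simp add: real_locus_def)
  obtain y where y: "cx y : phi P" using rep_real P topT by blast
  show "h P : ?M" unfolding hy [OF PX y] using real_cone_rep(1) [OF Ysub imageI [OF PX] y] by blast
  qed
  show "continuous_map ?T euclidean h"
  unfolding continuous_map_def topT
  proof (intro conjI allI impI)
  fix W :: "(nat => rvec) set" assume "openin euclidean W"
  hence W: "open W" by simp
  show "openin ?T {P : real_locus X. h P : W}"
  proof (subst openin_subopen, intro ballI)
  fix P0 assume "P0 : {P : real_locus X. h P : W}"
  hence P0: "P0 : real_locus X" "h P0 : W" "P0 : X" by (auto simp: real_locus_def)
  obtain F j where F: "local_rep N X r phi F" "j <= r" "~ vanishes_at (F j) P0"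
  using mor P0(3) unfolding real_morphism_def by blast
  obtain d where d: "!!i. i <= r ==> F i : forms N d" using F(1) unfolding local_rep_def by blast
  define q where "q x = (SUM l<=r. (cmod (ev r F x l))\<^sup>2)" for x
  define c where "c x = (%i k. Re (ev r F x i * cnj (ev r F x k)) / q x)" for x
  have evt: "ev r F (%i. t * x i) = (%i. t ^ d * ev r F x i)" for t x
  using peval_scale [OF d] by (auto simp: ev_def)
  have ct: "c (%i. t * x i) = c x" if "t ~= 0" for t x
  proof -
  have e: "Re (t ^ d * u * cnj (t ^ d * v)) = (cmod (t ^ d))\<^sup>2 * Re (u * cnj v)" for u v
  proof -
  have "t ^ d * u * cnj (t ^ d * v) = (t ^ d * cnj (t ^ d)) * (u * cnj v)" by (simp add: mult_ac)
  also have "... = complex_of_real ((cmod (t ^ d))\<^sup>2) * (u * cnj v)" by (simp only: complex_norm_square [symmetric])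
  finally show ?thesis by (simp only: Re_complex_of_real times_complex.sel Im_complex_of_real mult_zero_left diff_zero)
  qed
  have "q (%i. t * x i) = (cmod (t ^ d))\<^sup>2 * q x"
  unfolding q_def evt norm_mult power_mult_distrib sum_distrib_left ..
  thus ?thesis using that unfolding c_def evt e by (simp add: fun_eq_iff)
  qed
  have ch: "c (cx x) = h P" if P: "P : X" "cx x : P" and nz: "peval (F j) (cx x) ~= 0" for P x
  proof -
  have nv: "~ vanishes_at (F j) P" using nz P(2) unfolding vanishes_at_def by blast
  let ?y = "%i. if i <= r then reval (F i) x else 0"
  have "h P = ver r ?y" using real_image [OF F(1,2) nv P] by (intro hy [OF P(1)]) blast
  moreover have "ev r F (cx x) = cx ?y" by (auto simp: ev_def peval_cx)
  hence "c (cx x) = ver r ?y" by (simp add: c_def q_def ver_def nsq_def)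
  ultimately show ?thesis by simp
  qed
  define U where "U = {P : proj_space N. EX x:P. peval (F j) x ~= 0 & c x : W}"
  have all: "peval (F j) x' ~= 0 & c x' : W" if P: "P : proj_space N" "x : P" "x' : P" "peval (F j) x ~= 0" "c x : W" for P x x'
  proof -
  obtain z where z: "P = proj_point z" using P(1) proj_space_rep by blast
  hence "P = proj_point x" using proj_point_eqI P(2) by blast
  then obtain t where t: "t ~= 0" "x' = (%i. t * x i)" using P(3) unfolding proj_point_def by blast
  show ?thesis unfolding t(2) ct [OF t(1)] peval_scale [OF d [OF F(2)]] using P t(1) by simp
  qed
  have UU: "\<Union>U = coord_vectors N Int {x. peval (F j) x ~= 0 & c x : W}"
  proof (intro subset_antisym subsetI)
  fix x assume "x : \<Union>U"
  then obtain P x0 where P: "P : proj_space N" "x : P" "x0 : P" "peval (F j) x0 ~= 0" "c x0 : W" unfolding U_def by blast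
  obtain z where z: "P = proj_point z" "z : coord_vectors N" using P(1) proj_space_rep by blast
  hence "x : coord_vectors N" using P(2) unfolding proj_point_def coord_vectors_def by auto
  thus "x : coord_vectors N Int {x. peval (F j) x ~= 0 & c x : W}" using all [OF P(1,3,2,4,5)] by blast
  next
  fix x assume "x : coord_vectors N Int {x. peval (F j) x ~= 0 & c x : W}"
  hence "proj_point x : U" unfolding U_def proj_space_def using proj_point_self by blast
  thus "x : \<Union>U" using proj_point_self by blast
  qed
  have cpe: "continuous_on S (peval G)" for G and S :: "cvector set"
  unfolding peval_def by (intro continuous_intros)
  have ce: "continuous_on S (%x. ev r F x i)" for i and S :: "cvector set"
  unfolding ev_def by (cases "i <= r") (use cpe in auto)
  have op1: "open {x. peval (F j) x ~= 0}" by (intro open_Collect_neq cpe continuous_intros)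
  have q0: "q x ~= 0" if "peval (F j) x ~= 0" for x
  proof -
  have "q x > 0" unfolding q_def by (rule sum_pos2 [of _ j]) (use F(2) that in \<open>auto simp: ev_def\<close>)
  thus ?thesis by simp
  qed
  have cc: "continuous_on {x. peval (F j) x ~= 0} c"
  unfolding c_def q_def
  by (intro continuous_on_coordinatewise_then_product continuous_intros ce) (use q0 in \<open>auto simp: q_def\<close>)
  have "open ({x. peval (F j) x ~= 0} Int c -` W)"
  using cc op1 W by (metis (no_types) continuous_on_open_vimage inf_commute)
  hence "open {x. peval (F j) x ~= 0 & c x : W}" by (simp add: Int_def vimage_def)
  hence oU: "openin (proj_topology N) U"
  unfolding openin_proj_topology UU by (auto simp: U_def openin_open)
  obtain x0 where x0: "cx x0 : P0" using real_rep [OF P0(1)] by blast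
  show "EX T. openin ?T T & P0 : T & T <= {P : real_locus X. h P : W}"
  proof (intro exI conjI)
  show "openin ?T (U Int real_locus X)" using oU by (auto simp: openin_subtopology)
  have "peval (F j) (cx x0) ~= 0" using rep_nonzero [OF F(1,2) P0(3) x0] F(3) by simp
  thus "P0 : U Int real_locus X" using ch [OF P0(3) x0] P0 x0 Xsub unfolding U_def by auto
  show "U Int real_locus X <= {P : real_locus X. h P : W}"
  proof
  fix P assume P: "P : U Int real_locus X"
  then obtain x where x: "cx x : P" using real_rep by blast
  have PX: "P : X" using P by (simp add: real_locus_def)
  obtain x1 where "x1 : P" "peval (F j) x1 ~= 0" "c x1 : W" using P unfolding U_def by blast
  hence "peval (F j) (cx x) ~= 0 & c (cx x) : W" using all [of P x1 "cx x"] x PX Xsub by blast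
  thus "P : {P : real_locus X. h P : W}" using ch [OF PX x] P by simp
  qed
  qed
  qed
  qed simp
 qed
 have him: "h ` {P : real_locus X. C P} = ver r ` {y. real_cone r (phi ` X) y & C' y}"
  if C: "!!P y. P : X ==> cx y : phi P ==> C P \<longleftrightarrow> C' y" for C C'
 proof (intro subset_antisym subsetI)
  fix v assume "v : h ` {P : real_locus X. C P}"
  then obtain P where P: "v = h P" "P : real_locus X" "C P" by blast
  hence PX: "P : X" by (simp add: real_locus_def)
  obtain y where y: "cx y : phi P" using rep_real [OF P(2)] by blast
  show "v : ver r ` {y. real_cone r (phi ` X) y & C' y}"
  using real_cone_rep(1) [OF Ysub imageI [OF PX] y] C [OF PX y] P hy [OF PX y] by blast
 next
  fix v assume "v : ver r ` {y. real_cone r (phi ` X) y & C' y}"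
  then obtain y where y: "v = ver r y" "real_cone r (phi ` X) y" "C' y" by blast
  obtain P where P: "P : X" "proj_point (cx y) = phi P" using real_coneD(2) [OF y(2)] by blast
  have c: "cx y : phi P" unfolding P(2) [symmetric] by (rule proj_point_self)
  show "v : h ` {P : real_locus X. C P}" 
  proof (rule image_eqI [of _ _ P])
  show "v = h P" using y(1) hy [OF P(1) c] by simp
  show "P : {P : real_locus X. C P}" using y(3) back_real [OF P(1) c] C [OF P(1) c] by simp
  qed
 qed
 have inj: "inj_on h (real_locus X)"
 proof (rule inj_onI)
  fix P P' assume PP: "P : real_locus X" "P' : real_locus X" "h P = h P'"
  hence PX: "P : X" "P' : X" by (auto simp: real_locus_def)
  obtain y y' where y: "cx y : phi P" "cx y' : phi P'" using rep_real PP by blast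
  have eq: "ver r y = ver r y'" using PP(3) hy [OF PX(1) y(1)] hy [OF PX(2) y(2)] by simp
  have c: "real_cone r (phi ` X) y" "real_cone r (phi ` X) y'" and phiy: "phi P = proj_point (cx y)" "phi P' = proj_point (cx y')"
  using real_cone_rep [OF Ysub] PX y by blast+
  obtain a where a: "a <= r" "y a ~= 0" using real_coneD(4) [OF c(1)] by blast
  note p = ver_eq_imp_proportional [OF eq a(2,1) real_coneD(4) [OF c(2)]]
  have "cx y' = (%i. complex_of_real (y' a / y a) * cx y i)"
  unfolding of_real_mult [symmetric] p(2) [symmetric] ..
  hence "cx y' : proj_point (cx y)" unfolding proj_point_def using p(1) a(2)
  by (intro CollectI exI [of _ "complex_of_real (y' a / y a)"] conjI) (assumption, simp)
  hence "phi P' = phi P" unfolding phiy by (rule proj_point_eqI)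
  thus "P = P'" using psi(2) PX by metis
 qed
 have hm: "homeomorphic_map ?T (top_of_set ?M) h"
 proof (rule continuous_imp_homeomorphic_map [OF cont compT])
  show "Hausdorff_space (top_of_set ?M)" by (simp add: Hausdorff_space_subtopology)
  show "h ` topspace ?T = topspace (top_of_set ?M)" using him [of "%_. True" "%_. True"] topT by simp
  show "inj_on h (topspace ?T)" using inj topT by simp
 qed
 let ?S = "real_locus {P : X. vanishes_at G (phi P)}" and ?V = "ver r ` {y. real_cone r (phi ` X) y & reval G y = 0}"
 have S: "?S = {P : real_locus X. vanishes_at G (phi P)}" unfolding real_locus_def by blast
 have "homeomorphic_map (subtop ?T ?S) (subtop (top_of_set ?M) ?V) h"
 proof (rule homeomorphic_map_subtopologies [OF hm])
  have "topspace ?T Int ?S = {P : real_locus X. vanishes_at G (phi P)}" using S topT by auto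
  thus "h ` (topspace ?T Int ?S) = topspace (top_of_set ?M) Int ?V"
  using him [of "%P. vanishes_at G (phi P)" "%y. reval G y = 0", OF vanG] by auto
 qed
 moreover have "subtop ?T ?S = subtop (proj_topology N) ?S"
  unfolding subtopology_subtopology S by (rule arg_cong [of _ _ "subtop _"]) auto
 moreover have "subtop (top_of_set ?M) ?V = top_of_set ?V"
  unfolding subtopology_subtopology by (rule arg_cong [of _ _ "subtop _"]) auto
 ultimately show ?thesis by metis
qed

section \<open>Charts of the real locus and of its regular sections\<close>

lemma ratio_lipschitz:
 assumes F: "F : forms N d" and G: "G : forms N e" "reval G x0 ~= 0"
 obtains rho L where "rho > 0" "L > 0" "!!x y. near N x0 rho x ==> near N x0 rho y ==>
  abs (reval F x * (1 / reval G x) - reval F y * (1 / reval G y)) <= L * vdist N x y"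
proof -
 define R where "R = nrm N x0 + 1"
 note inR = inbox_near [of N _ x0, folded R_def]
 obtain A where A: "A >= 0" "!!x. inbox N R x ==> abs (reval F x) <= A"
  "!!x y. inbox N R x ==> inbox N R y ==> abs (reval F x - reval F y) <= A * vdist N x y"
  by (rule reval_estimates [OF F, of R]) blast
 obtain B where B: "B >= 0"
  "!!x y. inbox N R x ==> inbox N R y ==> abs (reval G x - reval G y) <= B * vdist N x y"
  by (rule reval_estimates [OF G(1), of R]) blast
 obtain rho1 where r1: "rho1 > 0" "!!x. near N x0 rho1 x ==> abs (reval G x0) <= 2 * abs (reval G x)"
  by (rule nonzero_near [OF sdiff_reval [OF G(1)] G(2)]) blast
 define g where "g = 2 / abs (reval G x0)"
 have g: "g > 0" using G(2) by (simp add: g_def)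
 define L where "L = A * g + A * (g * g) * B + 1"
 have L: "L > 0" unfolding L_def using A(1) B(1) g by (simp add: add_nonneg_pos)
 show thesis
 proof (rule that [of "min rho1 1" L])
  fix x y assume xy: "ALL i<=N. abs (x i - x0 i) < min rho1 1" "ALL i<=N. abs (y i - x0 i) < min rho1 1"
  have R: "inbox N R x" "inbox N R y" using inR [OF xy(1)] inR [OF xy(2)] by simp_all
  have ig: "abs (1 / reval G z) <= g & reval G z ~= 0" if z: "ALL i<=N. abs (z i - x0 i) < min rho1 1" for z
  proof -
  have h: "abs (reval G x0) <= 2 * abs (reval G z)" using r1(2) z by simp
  moreover have "0 < abs (reval G x0)" using G(2) by simp
  ultimately have p: "0 < abs (reval G z)" by linarith
  hence "1 / abs (reval G z) <= g" using h G(2) by (simp add: g_def field_simps)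
  thus ?thesis using p by simp
  qed
  let ?n = "vdist N x y" and ?u = "1 / reval G x" and ?v = "1 / reval G y"
  have "reval F x * ?u - reval F y * ?v = (reval F x - reval F y) * ?u + reval F y * (?u * ?v) * (reval G y - reval G x)"
  using ig [OF xy(1)] ig [OF xy(2)] by (simp add: field_simps)
  hence "abs (reval F x * ?u - reval F y * ?v) <= abs (reval F x - reval F y) * abs (?u) + abs (reval F y) * (abs (?u) * abs (?v)) * abs (reval G y - reval G x)"
  using abs_triangle_ineq by (simp only: abs_mult [symmetric])
  also have "... <= (A * ?n) * g + A * (g * g) * (B * ?n)"
  using A(1,2) A(3) [OF R] B(1) B(2) [OF R] R ig [OF xy(1)] ig [OF xy(2)] g
  by (intro add_mono mult_mono mult_nonneg_nonneg) (auto simp: abs_minus_commute simp del: abs_divide)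
  also have "... <= L * ?n" by (simp add: L_def algebra_simps)
  finally show "abs (reval F x * ?u - reval F y * ?v) <= L * ?n" .
 qed (use r1(1) L in auto)
qed

lemma continuous_on_ver: "continuous_on {y. nsq r y ~= 0} (ver r)"
 unfolding ver_def nsq_def by (intro continuous_on_coordinatewise_then_product continuous_intros) auto

lemma jac_fun_upd:
 assumes j: "j <= N"
 shows "jac N (f(j := L)) = dder N f j L"
proof -
 have "mat_delete (pmat N (f(j := L))) j l = mat_delete (pmat N f) j l" if "l <= N" for l
  using j that by (intro eq_matI) (auto simp: mat_delete_def pmat_def)
 hence "dual N (f(j := L)) j l = dual N f j l" if "l <= N" for l
  using that by (simp add: dual_def cofactor_def)
 hence "(SUM l<=N. pdiff l ((f(j := L)) j) * dual N (f(j := L)) j l) = (SUM l<=N. pdiff l L * dual N f j l)"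
  by (intro sum.cong) auto
 thus ?thesis using dual_right [OF j j, of "f(j := L)"] by (simp add: dder_def mult.commute)
qed

context smooth_variety
begin

text \<open>The inverse function theorem for the N + 1 functions f, restricted to the level set where the equations
vanish and x a = 1; by local_manifold this level set is the affine cone of X near x0.\<close>

theorem local_coordinates:
 assumes fm: "is_frame F d a J" and c0: "cone x0" and a1: "x0 a = 1"
  and th: "reval (jac N (fr F a J)) x0 ~= 0"
  and f: "!!i. i <= codim ==> f i = fr F a J i" "!!i. i <= N ==> f i : forms N (df i)" "reval (jac N f) x0 ~= 0"
 obtains rho K where "rho > 0" "K > 0"
  "!!x y. cone x ==> cone y ==> x a = 1 ==> y a = 1 ==> near N x0 rho x ==> near N x0 rho y ==>
  vdist N x y <= K * (SUM i:{codim<..N}. abs (reval (f i) x - reval (f i) y))"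
  "!!e z. 0 < e ==> e <= rho ==> (SUM i:{codim<..N}. abs (z i - reval (f i) x0)) <= e / (6 * K) ==>
  EX x. cone x & x a = 1 & (near N x0 e x) & (ALL i:{codim<..N}. reval (f i) x = z i)"
proof -
 obtain rho1 where r1: "rho1 > 0" "!!x. near N x0 rho1 x ==> ALL i>N. x i = 0 ==> x a = 1 ==>
  ALL i<codim. reval (F i) x = 0 ==> cone x"
  by (rule local_manifold [OF fm c0 a1 th]) blast
 obtain rho2 K where r2: "rho2 > 0" "K > 0"
  "!!x y. near N x0 rho2 x ==> near N x0 rho2 y ==>
  vdist N x y <= K * (SUM i<=N. abs (reval (f i) x - reval (f i) y))"
  "!!r z. 0 < r ==> r <= rho2 ==> (SUM i<=N. abs (z i - reval (f i) x0)) <= r / (6 * K) ==>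
  EX x. (near N x0 r x) & (ALL i>N. x i = x0 i) & (ALL i<=N. reval (f i) x = z i)"
 proof (rule inverse_function [of N "%i. reval (f i)" "%i l. reval (pdiff l (f i)) x0" x0 "%l j. reval (dual N f j l) x0 / reval (jac N f) x0"])
  show "sdiff N (reval (f i)) (%l. reval (pdiff l (f i)) x0) x0" if "i <= N" for i
  using f(2) [OF that] by (rule sdiff_reval)
 qed (use frame_inverse [OF f(3)] in simp_all)
 have x0N: "ALL i>N. x0 i = 0" using c0 unfolding real_cone_def coord_vectors_def by simp
 have fa: "reval (f i) x = (if i < codim then reval (F i) x else x a)" if "i <= codim" for i x
  using f(1) [OF that] that by (simp add: fr_def)
 have Fz: "reval (F i) x = 0" if "cone x" "i < codim" for i x
  using cone_ideal [OF that(1)] fm that(2) unfolding is_frame_def by blast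
 have low: "reval (f i) x = reval (f i) x0" if "cone x" "x a = 1" "i <= codim" for i x
  using fa [OF that(3)] Fz that c0 a1 by simp
 have sum0: "(SUM i<=N. abs (u i - v i)) = (SUM i:{codim<..N}. abs (u i - v i))" if "!!i. i <= codim ==> u i = v i" for u v :: rvec
  by (rule sum.mono_neutral_right) (use that in auto)
 have cN: "codim <= N" using codim_n by simp
 show thesis
 proof (rule that [of "min rho1 rho2" K])
  fix x y assume xy: "cone x" "cone y" "x a = 1" "y a = 1" "ALL i<=N. abs (x i - x0 i) < min rho1 rho2" "ALL i<=N. abs (y i - x0 i) < min rho1 rho2"
  have "vdist N x y <= K * (SUM i<=N. abs (reval (f i) x - reval (f i) y))"
  using xy by (intro r2(3)) auto
  also have "(SUM i<=N. abs (reval (f i) x - reval (f i) y)) = (SUM i:{codim<..N}. abs (reval (f i) x - reval (f i) y))"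
  by (rule sum0) (use low xy in simp)
  finally show "vdist N x y <= K * (SUM i:{codim<..N}. abs (reval (f i) x - reval (f i) y))" .
 next
  fix e z assume e: "0 < e" "e <= min rho1 rho2" and z: "(SUM i:{codim<..N}. abs (z i - reval (f i) x0)) <= e / (6 * K)"
  define z' where "z' i = (if i <= codim then reval (f i) x0 else z i)" for i
  have "(SUM i<=N. abs (z' i - reval (f i) x0)) = (SUM i:{codim<..N}. abs (z' i - reval (f i) x0))"
  by (rule sum0) (simp add: z'_def)
  also have "... = (SUM i:{codim<..N}. abs (z i - reval (f i) x0))" by (rule sum.cong) (auto simp: z'_def)
  finally have "(SUM i<=N. abs (z' i - reval (f i) x0)) <= e / (6 * K)" using z by simp
  then obtain x where x: "near N x0 e x" "ALL i>N. x i = x0 i" "ALL i<=N. reval (f i) x = z' i"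
  using r2(4) [of e z'] e by auto
  have xl: "reval (f i) x = reval (f i) x0" if "i <= codim" for i using x(3) that cN by (simp add: z'_def)
  have xa: "x a = 1" using xl [of codim] fa [of codim] a1 by simp
  have xF: "ALL i<codim. reval (F i) x = 0" using xl fa Fz [OF c0] by (metis less_imp_le)
  have "cone x" by (rule r1(2) [OF _ _ xa xF]) (use x x0N e in auto)
  moreover have "ALL i:{codim<..N}. reval (f i) x = z i" using x(3) by (auto simp: z'_def)
  ultimately show "EX x. cone x & x a = 1 & (near N x0 e x) & (ALL i:{codim<..N}. reval (f i) x = z i)"
  using xa x(1) by blast
 qed (use r1(1) r2(1,2) in auto)
qed

text \<open>At a zero of L some derivative along X is nonzero. The frame is existentially quantified, because
different points need different frames.\<close>

definition regular :: "rpoly => rvec => bool" where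
 "regular L x \<longleftrightarrow> (reval L x = 0 --> (EX F d a J j. is_frame F d a J & x a = 1 & reval (jac N (fr F a J)) x ~= 0 &
  j : {codim<..N} & reval (dder N (fr F a J) j L) x ~= 0))"

abbreviation section_locus :: "rpoly => (nat => rvec) set" where
 "section_locus L \<equiv> ver N ` {y. cone y & reval L y = 0}"

lemma affine_point:
 assumes L: "L : forms N m" and v: "v : section_locus L" and va: "v a a ~= 0" and a: "a <= N"
 defines "x \<equiv> (%i. v i a / v a a)"
 shows "cone x" "x a = 1" "ver N x = v" "reval L x = 0"
proof -
 obtain y where y: "v = ver N y" "cone y" "reval L y = 0" using v by blast
 have ya: "y a ~= 0" using va unfolding y(1) ver_def by auto
 have x: "x = (%i. (1 / y a) * y i)" unfolding x_def y(1) by (simp add: fun_eq_iff ver_ratio [of y a N, OF ya a, symmetric])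
 show "cone x" unfolding x using ya by (intro real_cone_scale [OF y(2)]) simp
 show "x a = 1" using va by (simp add: x_def)
 show "ver N x = v" unfolding x y(1) using ya by (intro ver_scale) simp
 show "reval L x = 0" unfolding x reval_scale [OF L] y(3) by simp
qed

text \<open>Exchange the j0-th parameter for L; the remaining parameters are coordinates on L = 0.\<close>

theorem regular_section_chart:
 assumes L: "L : forms N m" and reg: "regular L x0" and c0: "cone x0" and L0: "reval L x0 = 0"
 shows "EX S. chart_at (top_of_set (section_locus L)) (ver N x0) S"
proof -
 obtain F d a J j0 where fm: "is_frame F d a J" and a1: "x0 a = 1" and th: "reval (jac N (fr F a J)) x0 ~= 0"
  and j0: "j0 : {codim<..N}" and dd: "reval (dder N (fr F a J) j0 L) x0 ~= 0"
  using reg L0 unfolding regular_def by blast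
 have aN: "a <= N" using fm by (simp add: is_frame_def)
 define f where "f = (fr F a J)(j0 := L)"
 obtain rho K where rK: "rho > 0" "K > 0"
  "!!x y. cone x ==> cone y ==> x a = 1 ==> y a = 1 ==> near N x0 rho x ==> near N x0 rho y ==>
  vdist N x y <= K * (SUM i:{codim<..N}. abs (reval (f i) x - reval (f i) y))"
  "!!e z. 0 < e ==> e <= rho ==> (SUM i:{codim<..N}. abs (z i - reval (f i) x0)) <= e / (6 * K) ==>
  EX x. cone x & x a = 1 & (near N x0 e x) & (ALL i:{codim<..N}. reval (f i) x = z i)"
 proof (rule local_coordinates [OF fm c0 a1 th, of f "%i. if i = j0 then m else if i < codim then d i else 1"])
  show "f i = fr F a J i" if "i <= codim" for i using that j0 by (auto simp: f_def)
  show "f i : forms N (if i = j0 then m else if i < codim then d i else 1)" if "i <= N" for i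
  using L fr_forms [OF fm that] j0 by (auto simp: f_def)
  show "reval (jac N f) x0 ~= 0" unfolding f_def using dd j0 by (subst jac_fun_upd) auto
 qed blast
 define I where "I = {codim<..N} - {j0}"
 define q where "q = card I"
 obtain e where e: "bij_betw e {0..<q} I" unfolding q_def using ex_bij_betw_nat_finite [of I] by (auto simp: I_def)
 have sumI: "(SUM i:{codim<..N}. g i) = g j0 + (SUM j<q. g (e j))" for g :: rvec
  using sum.remove [of "{codim<..N}" j0 g] j0 sum.reindex_bij_betw [OF e, of g] by (simp add: I_def atLeast0LessThan)
 have fL: "f j0 = L" by (simp add: f_def)
 have key: "vdist N x y <= K * (SUM j<q. abs (reval (f (e j)) x - reval (f (e j)) y))"
  if "cone x" "cone y" "x a = 1" "y a = 1" "near N x0 rho x" "near N x0 rho y" "reval L x = 0" "reval L y = 0" for x y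
  using rK(3) [OF that(1-6)] that(7,8) unfolding sumI fL by simp
 have same: "x = y"
  if xy: "cone x" "cone y" "x a = 1" "y a = 1" "near N x0 rho x" "near N x0 rho y" "reval L x = 0" "reval L y = 0"
  and eq: "!!j. j < q ==> reval (f (e j)) x = reval (f (e j)) y" for x y
 proof
  fix i
  have "vdist N x y <= 0" using key [OF xy] eq by simp
  thus "x i = y i" 
  using coord_le_nrm [of i N "%i. x i - y i"] real_coneD(3) [OF xy(1), of i] real_coneD(3) [OF xy(2), of i] by (cases "i <= N") auto
 qed
 define dl where "dl = rho / (6 * K) / real (Suc q)"
 have dl: "dl > 0" using rK(1,2) by (simp add: dl_def)
 let ?U = "obx q (%_. - dl) (%_. dl)" and ?M = "section_locus L"
 define ok where "ok z x \<longleftrightarrow> cone x & x a = 1 & (near N x0 rho x) & reval L x = 0 & (ALL j<q. reval (f (e j)) x = reval (f (e j)) x0 + z j)" for z x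
 have "EX x. ok z x"
  if z: "z : ?U" for z
 proof -
  define e' where "e' = inv_into {0..<q} e"
  have e': "e' (e j) = j" if "j < q" for j unfolding e'_def using e that by (simp add: bij_betw_def inv_into_f_f)
  have ej: "e j ~= j0" "e j : {codim<..N}" if "j < q" for j using bij_betwE [OF e] that by (auto simp: I_def)
  define w where "w i = (if i = j0 then 0 else reval (f i) x0 + z (e' i))" for i
  have "(SUM i:{codim<..N}. abs (w i - reval (f i) x0)) = (SUM j<q. abs (z j))"
  unfolding sumI using ej e' L0 fL by (simp add: w_def)
  also have "... <= (SUM j<q. dl)" by (intro sum_mono) (use z in \<open>auto simp: obx_def abs_le_iff less_imp_le minus_le_iff\<close>)
  also have "... <= real (Suc q) * dl" using dl by simp
  also have "... = rho / (6 * K)" by (simp add: dl_def)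
  finally obtain x where x: "cone x" "x a = 1" "near N x0 rho x" "ALL i:{codim<..N}. reval (f i) x = w i"
  using rK(4) [OF rK(1) order_refl, of w] by blast
  have "reval L x = 0" using x(4) j0 fL by (auto simp: w_def)
  moreover have "ALL j<q. reval (f (e j)) x = reval (f (e j)) x0 + z j" using x(4) ej e' by (simp add: w_def)
  ultimately show ?thesis using x unfolding ok_def by blast
 qed
 hence "ALL z:?U. EX x. ok z x" by blast
 then obtain xi where ok: "ALL z:?U. ok z (xi z)" by (rule bchoice [THEN exE])
 hence xi: "!!z. z : ?U ==> cone (xi z)" "!!z. z : ?U ==> xi z a = 1"
  "!!z. z : ?U ==> near N x0 rho (xi z)" "!!z. z : ?U ==> reval L (xi z) = 0"
  "!!z j. z : ?U ==> j < q ==> reval (f (e j)) (xi z) = reval (f (e j)) x0 + z j"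
  unfolding ok_def by blast+
 define A where "A v = (%i. v i a / v a a)" for v :: "nat => rvec"
 define W where "W = (INT i:{..N}. {x::nat=>real. abs (x i - x0 i) < rho}) Int (INT j:{..<q}. {x. abs (reval (f (e j)) x - reval (f (e j)) x0) < dl})"
 define S where "S = ?M Int ({v. v a a ~= 0} Int A -` W)"
 define h where "h v = (%j. if j < q then reval (f (e j)) (A v) - reval (f (e j)) x0 else 0)" for v
 have cva: "continuous_on S (%v::nat => nat => real. v i j)" for S i j
  by (rule continuous_on_product_then_coordinatewise [OF continuous_on_coord])
 have cA: "continuous_on {v. v a a ~= 0} A"
  unfolding A_def by (intro continuous_on_coordinatewise_then_product continuous_on_divide cva) auto
 have oW: "open W" unfolding W_def
  by (intro open_Int open_INT ballI open_Collect_less continuous_intros continuous_on_reval) auto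
 have o1: "open {v :: nat => nat => real. v a a ~= 0}"
  by (rule open_Collect_neq [OF cva continuous_on_const])
 have oS: "openin (top_of_set ?M) S" unfolding S_def
  by (rule openin_open_Int) (rule continuous_open_preimage [OF cA o1 oW])
 have SA: "cone (A v)" "A v a = 1" "ver N (A v) = v" "reval L (A v) = 0" "A v : W" if "v : S" for v
  using affine_point [OF L, of v a] aN that unfolding S_def A_def by auto
 have hU: "h v : ?U" if "v : S" for v
 proof -
  have "- dl < h v j & h v j < dl" if "j < q" for j
  proof -
  have "abs (reval (f (e j)) (A v) - reval (f (e j)) x0) < dl" using SA(5) [OF `v : S`] that by (simp add: W_def)
  thus ?thesis using that unfolding h_def abs_less_iff by auto
  qed
  thus ?thesis by (simp add: obx_def h_def)
 qed
 have Aver: "A (ver N x) = x" if "cone x" "x a = 1" for x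
 proof
  fix i show "A (ver N x) i = x i" unfolding A_def using ver_ratio [of x a N i] aN that(2) by (simp only:) simp
 qed
 have gS: "ver N (xi z) : S" if z: "z : ?U" for z
 proof -
  have "A (ver N (xi z)) = xi z" using Aver xi z by blast
  moreover have "ver N (xi z) a a ~= 0" using xi(2) [OF z] nsq_pos [OF aN, of "xi z"] by (simp add: ver_def)
  moreover have "xi z : W" using xi(3,5) [OF z] z unfolding W_def by (auto simp: obx_def abs_less_iff minus_less_iff)
  ultimately show ?thesis using xi z unfolding S_def by auto
 qed
 have x0A: "A (ver N x0) = x0" by (rule Aver [OF c0 a1])
 have "homeomorphic_maps (top_of_set S) (top_of_set ?U) h (%z. ver N (xi z))"
  unfolding homeomorphic_maps_def
 proof (intro conjI ballI)
  have "continuous_on S h" unfolding h_def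
  proof (rule continuous_on_coordinatewise_then_product)
  fix j
  have "continuous_on S A" by (rule continuous_on_subset [OF cA]) (auto simp: S_def)
  hence "continuous_on S (%v. reval (f (e j)) (A v))" by (rule continuous_on_compose2 [OF continuous_on_reval [of UNIV]]) auto
  thus "continuous_on S (%v. if j < q then reval (f (e j)) (A v) - reval (f (e j)) x0 else 0)"
  by (cases "j < q") (auto intro!: continuous_intros)
  qed
  thus "continuous_map (top_of_set S) (top_of_set ?U) h" using hU by auto
  have "continuous_on ?U xi"
  proof (rule continuous_on_coordinatewise_then_product)
  fix i show "continuous_on ?U (%z. xi z i)"
  proof (rule lipschitz_continuous_on [of _ _ K q])
  fix z z' assume z: "z : ?U" "z' : ?U"
  have "abs (xi z i - xi z' i) <= vdist N (xi z) (xi z')"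
  
  using coord_le_nrm [of i N "%i. xi z i - xi z' i"] real_coneD(3) [OF xi(1) [OF z(1)], of i]
  real_coneD(3) [OF xi(1) [OF z(2)], of i] by (cases "i <= N") auto
  also have "... <= K * (SUM j<q. abs (reval (f (e j)) (xi z) - reval (f (e j)) (xi z')))" using xi z by (intro key) blast+
  also have "... = K * (SUM j<q. abs (z j - z' j))" using xi(5) z by simp
  also have "... <= K * nrm q (%j. z j - z' j)" unfolding nrm_def using rK(2) by (intro mult_left_mono sum_mono2) auto
  finally show "abs (xi z i - xi z' i) <= K * nrm q (%j. z j - z' j)" .
  qed
  qed
  hence "continuous_on ?U (%z. ver N (xi z))"
  proof (rule continuous_on_compose2 [OF continuous_on_ver])
  show "xi ` ?U <= {y. nsq N y ~= 0}" 
  proof (intro subsetI CollectI, elim imageE)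
  fix y z assume "y = xi z" "z : ?U"
  hence "y a ~= 0" using xi(2) by simp
  thus "nsq N y ~= 0" using nsq_pos [OF aN, of y] by simp
  qed
  qed
  thus "continuous_map (top_of_set ?U) (top_of_set S) (%z. ver N (xi z))" using gS by auto
  fix v assume "v : topspace (top_of_set S)"
  hence v: "v : S" by simp
  have "xi (h v) = A v"
  proof (rule same)
  show "near N x0 rho (A v)" using SA(5) [OF v] by (auto simp: W_def)
  show "reval (f (e j)) (xi (h v)) = reval (f (e j)) (A v)" if "j < q" for j
  using xi(5) [OF hU [OF v] that] that by (simp add: h_def)
  qed (use xi hU [OF v] SA [OF v] in blast)+
  thus "ver N (xi (h v)) = v" using SA(3) [OF v] by simp
 next
  fix z assume "z : topspace (top_of_set ?U)"
  hence z: "z : ?U" by simp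
  show "h (ver N (xi z)) = z"
  proof
  fix j show "h (ver N (xi z)) j = z j"
  unfolding h_def Aver [OF xi(1,2) [OF z]] using xi(5) [OF z, of j] z by (simp add: obx_def)
  qed
 qed
 moreover have "subtop (top_of_set ?M) S = top_of_set S"
  unfolding subtopology_subtopology by (rule arg_cong [of _ _ "subtop _"]) (auto simp: S_def)
 moreover have "subtop (Euclidean_space q) ?U = top_of_set ?U"
  unfolding Euclidean_space_eq subtopology_subtopology by (rule arg_cong [of _ _ "subtop _"]) (auto simp: obx_def)
 moreover have "ver N x0 : S"
 proof -
  have "ver N x0 a a ~= 0" using a1 nsq_pos [OF aN, of x0] by (simp add: ver_def)
  thus ?thesis unfolding S_def using x0A c0 L0 rK(1) dl by (auto simp: W_def)
 qed
 moreover have "openin (Euclidean_space q) ?U" unfolding Euclidean_space_eq by (rule openin_obx)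
 ultimately have "chart_at (top_of_set ?M) (ver N x0) S"
  unfolding chart_at_def using oS by metis
 thus ?thesis by blast
qed

lemma compact_section_locus: "compact (section_locus L)" if "L : forms N m"
proof -
 let ?K = "{y. cone y & nsq N y = 1} Int {y. reval L y = 0}"
 have "compact ?K"
  by (intro compact_Int_closed compact_real_cone [OF Xclosed] closed_Collect_eq continuous_on_reval continuous_intros)
 moreover have "continuous_on ?K (ver N)" by (rule continuous_on_subset [OF continuous_on_ver]) auto
 ultimately have "compact (ver N ` ?K)" by (rule compact_continuous_image [rotated])
 moreover have "ver N ` ?K = section_locus L"
 proof (intro subset_antisym subsetI)
  fix v assume "v : section_locus L"
  then obtain y where y: "v = ver N y" "cone y" "reval L y = 0" by blast
  obtain y' where y': "cone y'" "nsq N y' = 1" "ver N y' = ver N y" "y = (%i. sqrt (nsq N y) * y' i)"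
  by (rule ver_normalize [OF y(2)])
  obtain i where "i <= N" "y i ~= 0" using real_coneD(4) [OF y(2)] by blast
  hence "nsq N y > 0" by (rule nsq_pos)
  moreover have "reval L y = sqrt (nsq N y) ^ m * reval L y'"
  using reval_scale [OF that, of "sqrt (nsq N y)" y'] by (simp only: y'(4) [symmetric])
  ultimately have "reval L y' = 0" using y(3) by simp
  thus "v : ver N ` ?K" using y'(1-3) y(1) by (intro image_eqI [of v "ver N" y']) simp_all
 qed auto
 ultimately show ?thesis by simp
qed

theorem regular_section_finq:
 assumes L: "L : forms N m" and reg: "!!y. cone y ==> EX a<=N. y a ~= 0 & regular L (%i. y i / y a)"
 shows "finq p (top_of_set (section_locus L)) (section_locus L) (section_locus L)"
proof -
 have "finq p (top_of_set (section_locus L)) (topspace (top_of_set (section_locus L))) (topspace (top_of_set (section_locus L)))"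
 proof (rule locally_Euclidean_finq)
  show "compact_space (top_of_set (section_locus L))" using compact_section_locus [OF L] by (simp add: compact_space_subtopology)
  show "Hausdorff_space (top_of_set (section_locus L))" by (simp add: Hausdorff_space_subtopology)
  fix v assume "v : topspace (top_of_set (section_locus L))"
  then obtain y where y: "v = ver N y" "cone y" "reval L y = 0" by auto
  obtain a where a: "a <= N" "y a ~= 0" "regular L (%i. y i / y a)" using reg [OF y(2)] by blast
  define x where "x = (%i. (1 / y a) * y i)"
  have "EX S. chart_at (top_of_set (section_locus L)) (ver N x) S"
  proof (rule regular_section_chart [OF L])
  show "regular L x" using a(3) by (simp add: x_def)
  show "cone x" unfolding x_def using a(2) by (intro real_cone_scale [OF y(2)]) simp
  show "reval L x = 0" unfolding x_def reval_scale [OF L] y(3) by simp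
  qed
  moreover have "ver N x = v" unfolding x_def y(1) using a(2) by (intro ver_scale) simp
  ultimately show "EX S. chart_at (top_of_set (section_locus L)) v S" by simp
 qed
 thus ?thesis by simp
qed

end

section \<open>A linear section with regular real locus\<close>

lemma finite_uniform:
 assumes "finite P" "!!p. p : P ==> EX rho>0. EX L>0. A p rho L"
  and mono: "!!p rho L rho' L'. A p rho L ==> 0 < rho' ==> rho' <= rho ==> L <= L' ==> A p rho' L'"
 shows "EX rho>0. EX L>(0::real). ALL p:P. A p (rho::real) L"
 using assms(1,2)
proof (induction P rule: finite_induct)
 case empty
 have "(1::real) > 0" by simp
 thus ?case by blast
next
 case (insert q P)
 have "EX rho>0. EX L>0. ALL p:P. A p rho L" using insert by blast
 then obtain rho1 L1 where 1: "rho1 > 0" "L1 > 0" "!!p. p : P ==> A p rho1 L1" by blast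
 obtain rho2 L2 where 2: "rho2 > 0" "L2 > 0" "A q rho2 L2" using insert.prems by blast
 have m: "min rho1 rho2 > 0" using 1(1) 2(1) by simp
 have "A p (min rho1 rho2) (max L1 L2)" if "p : insert q P" for p
  using mono [OF 1(3) m] mono [OF 2(3) m] that by auto
 thus ?case using m 1(2) by (intro exI [of _ "min rho1 rho2"] conjI exI [of _ "max L1 L2"]) auto
qed

definition lform :: "nat => (nat => nat) => rpoly" where
 "lform N b = (SUM k<=N. single 0 (real (b k)) * Xv k)"

lemma lform_forms: "lform N b : forms N 1"
 unfolding lform_def by (intro forms_sum forms_scale forms_Xv) simp

lemma reval_lform: "reval (lform N b) x = (SUM k<=N. real (b k) * x k)"
 by (simp only: lform_def reval_sum reval_mult reval_const reval_Xv)

lemma reval_dder_lform: "reval (dder N f j (lform N b)) x = (SUM k<=N. real (b k) * reval (dder N f j (Xv k)) x)"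
 by (simp only: lform_def dder_sum dder_mult dder_const reval_sum reval_mult reval_add reval_0 reval_const mult_zero_left add_0_left)

abbreviation grid :: "nat => nat => (nat => nat) set" where
 "grid N m \<equiv> {..N} \<rightarrow>\<^sub>E {..m}"

lemma continuous_on_ratios: "continuous_on {z. z a ~= 0} (%(z::nat => real) i. z i / z a)"
 by (rule continuous_on_coordinatewise_then_product) (intro continuous_intros continuous_on_coord, auto)

lemma nat_eq_of_close: "abs (real a - real b) < 1 ==> a = b"
 by linarith

context smooth_variety
begin

text \<open>If b is bad at x, then b vanishes at x together with its n derivatives along X. Round the n parameters
of x to multiples of 1 / (C (m + 1)): the rounded value and the N - n coefficients outside the parameters
determine b, because the n + 1 conditions determine the other coefficients with error below 1. This
leaves of order m^N of the m^(N + 1) forms.\<close>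

lemma bad_forms_near:
 assumes c0: "cone x0" and a1: "x0 a = 1"
 obtains rho c where "rho > 0"
  "!!m. card {b : grid N m. EX x. cone x & x a = 1 & (near N x0 rho x) & ~ regular (lform N b) x} <= c * (m + 1) ^ N"
proof -
 obtain F d J where fm: "is_frame F d a J" and th: "reval (jac N (fr F a J)) x0 ~= 0"
  using frame_exists [OF c0, of a] a1 by auto
 define f where "f = fr F a J"
 have aN: "a <= N" using fm by (simp add: is_frame_def)
 define I where "I = {codim<..N}"
 have cI: "card I = n" "finite I" using codim_n by (auto simp: I_def)
 define kap where "kap i = J (i - Suc codim)" for i
 have kapN: "kap i <= N" if "i : I" for i
 proof -
  have "i - Suc codim < n" using that codim_n by (auto simp: I_def)
  thus ?thesis using fm by (simp add: is_frame_def kap_def)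
 qed
 have fkap: "f i = Xv (kap i)" if "i : I" for i using that by (simp add: f_def fr_def kap_def I_def)
 have fa: "f codim = Xv a" by (simp add: f_def fr_def)
 define tht where "tht x = reval (jac N f) x" for x
 have tht0: "tht x0 ~= 0" using th by (simp add: tht_def f_def)
 have ff: "f i : forms N (if i < codim then d i else 1)" if "i <= N" for i
  unfolding f_def by (rule fr_forms [OF fm that])
 have jf: "jac N f : forms N (SUM i<=N. (if i < codim then d i else 1) - 1)" by (rule jac_forms) (rule ff)
 define g where "g i k x = reval (dder N f i (Xv k)) x * (1 / tht x)" for i k x
 have gkap: "g i (kap i') x = (if i' = i then 1 else 0)" if "i : I" "i' : I" "tht x ~= 0" for i i' x
  using dder_frame [of i' N i f] that fkap [OF that(2)] by (auto simp: g_def I_def tht_def)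
 have ga: "g i a x = 0" if "i : I" for i x
  using dder_frame [of codim N i f] that fa codim_n by (auto simp: g_def I_def)
 have inj: "inj_on kap I" and ainj: "a ~: kap ` I"
 proof -
  show "inj_on kap I"
  proof (rule inj_onI)
  fix i i' assume i: "i : I" "i' : I" "kap i = kap i'"
  thus "i = i'" using gkap [OF i(1) i(1) tht0] gkap [OF i(1) i(2) tht0] unfolding i(3) by (metis zero_neq_one)
  qed
  show "a ~: kap ` I"
  proof
  assume "a : kap ` I"
  then obtain i where "i : I" "a = kap i" by blast
  thus False using gkap [of i i x0] ga [of i x0] tht0 by simp
  qed
 qed
 obtain rho1 K where r1: "rho1 > 0" "K > 0"
  "!!x y. cone x ==> cone y ==> x a = 1 ==> y a = 1 ==> near N x0 rho1 x ==> near N x0 rho1 y ==>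
  vdist N x y <= K * (SUM i:{codim<..N}. abs (reval (f i) x - reval (f i) y))"
 proof (rule local_coordinates [OF fm c0 a1 th, of f "%i. if i < codim then d i else 1"])
  show "f i = fr F a J i" for i by (simp add: f_def)
  show "reval (jac N f) x0 ~= 0" using tht0 by (simp add: tht_def)
 qed (use ff in blast)+
 obtain rho2 where r2: "rho2 > 0" "!!x. near N x0 rho2 x ==> tht x ~= 0"
  by (rule nonzero_near [OF sdiff_reval [OF jf] tht0 [unfolded tht_def]]) (unfold tht_def, blast)
 define Lip where "Lip p rho L \<longleftrightarrow> (ALL x y. (near N x0 rho x) --> (near N x0 rho y) -->
  abs (g (fst p) (snd p) x - g (fst p) (snd p) y) <= L * vdist N x y)" for p rho L
 have "EX rho>0. EX L>0. ALL p:I \<times> {..N}. Lip p rho L"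
 proof (rule finite_uniform)
  fix p assume p: "p : I \<times> {..N}"
  have Df: "dder N f (fst p) (Xv (snd p)) : forms N ((SUM i<N. (if insert_index (fst p) i < codim then d (insert_index (fst p) i) else 1) - 1) + (1 - 1))"
  by (rule dder_forms [OF ff]) (use p in \<open>auto simp: I_def intro: forms_Xv [unfolded One_nat_def]\<close>)
  obtain rho L where "rho > 0" "L > 0" "!!x y. near N x0 rho x ==> near N x0 rho y ==>
  abs (g (fst p) (snd p) x - g (fst p) (snd p) y) <= L * vdist N x y"
  by (rule ratio_lipschitz [OF Df jf tht0 [unfolded tht_def]]) (unfold g_def tht_def, blast)
  thus "EX rho>0. EX L>0. Lip p rho L" unfolding Lip_def by blast
 next
  fix p rho L rho' L' assume A: "Lip p rho L" "0 < rho'" "rho' <= rho" "L <= L'"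
  show "Lip p rho' L'" unfolding Lip_def
  proof (intro allI impI)
  fix x y assume xy: "near N x0 rho' x" "near N x0 rho' y"
  have "abs (g (fst p) (snd p) x - g (fst p) (snd p) y) <= L * vdist N x y"
  using A(1,3) xy unfolding Lip_def by (meson less_le_trans)
  also have "... <= L' * vdist N x y" using A(4) by (intro mult_right_mono) auto
  finally show "abs (g (fst p) (snd p) x - g (fst p) (snd p) y) <= L' * vdist N x y" .
  qed
 qed (simp add: cI)
 then obtain rho3 L where r3: "rho3 > 0" "L > 0" "!!p. p : I \<times> {..N} ==> Lip p rho3 L" by blast
 define rho where "rho = min rho1 (min rho2 rho3)"
 have rho: "rho > 0" "rho <= rho1" "rho <= rho2" "rho <= rho3" using r1(1) r2(1) r3(1) by (auto simp: rho_def)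
 \<comment> \<open>With cells of width 1/(C (m + 1)), two bad forms sharing all data differ by less than 1 in every coefficient.\<close>
 define C where "C = nat \<lceil>(real (Suc N) * L + 1) * (K * real n)\<rceil> + 1"
 have C: "(real (Suc N) * L + 1) * (K * real n) <= real C" "C > 0" unfolding C_def by (linarith, simp)
 define c1 where "c1 = nat \<lceil>2 * rho * real C\<rceil>"
 have c1: "2 * rho * real C <= real c1" unfolding c1_def by linarith
 define Ob where "Ob = {..N} - insert a (kap ` I)"
 have cOb: "card Ob = N - n"
 proof -
  have "card (insert a (kap ` I)) = Suc n" using ainj card_image [OF inj] cI by simp
  moreover have "insert a (kap ` I) <= {..N}" using aN kapN by auto
  ultimately show ?thesis unfolding Ob_def using cI(2) by (subst card_Diff_subset) auto
 qed
 show thesis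
 proof (rule that [OF rho(1)])
  fix m
  let ?B = "{b : grid N m. EX x. cone x & x a = 1 & (near N x0 rho x) & ~ regular (lform N b) x}"
  have "ALL b:?B. EX x. cone x & x a = 1 & (near N x0 rho x) & ~ regular (lform N b) x" by blast
  then obtain w where w: "!!b. b : ?B ==> cone (w b)" "!!b. b : ?B ==> w b a = 1"
  "!!b. b : ?B ==> near N x0 rho (w b)" "!!b. b : ?B ==> ~ regular (lform N b) (w b)"
  unfolding bchoice_iff by blast
  have wr: "near N x0 R (w b)" if "b : ?B" "rho <= R" for b R
  using w(3) [OF that(1)] that(2) by (meson less_le_trans)
  have wtht: "tht (w b) ~= 0" if "b : ?B" for b
  by (rule r2(2)) (use w(3) [OF that] rho(3) in \<open>auto intro: less_le_trans\<close>)
  have z0: "(SUM k<=N. real (b k) * w b k) = 0" if "b : ?B" for b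
  using w(4) [OF that] unfolding regular_def reval_lform by blast
  have zj: "(SUM k<=N. real (b k) * g i k (w b)) = 0" if b: "b : ?B" and i: "i : I" for b i
  proof -
  have "reval (dder N f i (lform N b)) (w b) = 0"
  using w(4) [OF b] fm w(2) [OF b] wtht [OF b] i unfolding regular_def f_def tht_def I_def by blast
  thus ?thesis unfolding reval_dder_lform g_def by (simp flip: sum_divide_distrib)
  qed
  define M where "M = real C * real (m + 1)"
  have M: "M > 0" using C(2) by (simp add: M_def)
  \<comment> \<open>The cell of the bad point of b; together with the coefficients outside the parameters it determines b.\<close>
  define cell where "cell b i = nat \<lfloor>M * (w b (kap i) - x0 (kap i) + rho)\<rfloor>" for b i
  have cellr: "0 <= M * (w b (kap i) - x0 (kap i) + rho)" "cell b i <= c1 * (m + 1)" if b: "b : ?B" and i: "i : I" for b i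
  proof -
  have "abs (w b (kap i) - x0 (kap i)) < rho" using w(3) [OF b] kapN [OF i] by blast
  hence u: "0 <= w b (kap i) - x0 (kap i) + rho" "w b (kap i) - x0 (kap i) + rho <= 2 * rho" by linarith+
  thus p: "0 <= M * (w b (kap i) - x0 (kap i) + rho)" using M by simp
  have "M * (w b (kap i) - x0 (kap i) + rho) <= M * (2 * rho)" using u(2) M by (intro mult_left_mono) auto
  also have "... = (2 * rho * real C) * real (m + 1)" by (simp add: M_def)
  also have "... <= real c1 * real (m + 1)" using c1 by (intro mult_right_mono) auto
  finally have "M * (w b (kap i) - x0 (kap i) + rho) <= real (c1 * (m + 1))" by (simp only: of_nat_mult)
  thus "cell b i <= c1 * (m + 1)" unfolding cell_def by linarith
  qed
  define \<Phi> where "\<Phi> b = (restrict b Ob, restrict (cell b) I)" for b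
  let ?T = "(Ob \<rightarrow>\<^sub>E {..m}) \<times> (I \<rightarrow>\<^sub>E {..c1 * (m + 1)})"
  have im: "\<Phi> ` ?B <= ?T"
  proof (intro subsetI, elim imageE)
  fix t b assume t: "t = \<Phi> b" "b : ?B"
  hence "b : grid N m" by blast
  hence "restrict b Ob : Ob \<rightarrow>\<^sub>E {..m}" unfolding Ob_def by (auto simp: PiE_def Pi_def)
  moreover have "restrict (cell b) I : I \<rightarrow>\<^sub>E {..c1 * (m + 1)}" using cellr(2) [OF t(2)] by auto
  ultimately show "t : ?T" unfolding t(1) \<Phi>_def by blast
  qed
  have inj\<Phi>: "inj_on \<Phi> ?B"
  proof (rule inj_onI)
  fix b b' assume b: "b : ?B" and b': "b' : ?B" and eq: "\<Phi> b = \<Phi> b'"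
  have eO: "b k = b' k" if "k : Ob" for k using eq that unfolding \<Phi>_def by (metis Pair_inject restrict_apply')
  have ec: "cell b i = cell b' i" if "i : I" for i using eq that unfolding \<Phi>_def by (metis Pair_inject restrict_apply')
  let ?x = "w b" and ?y = "w b'"
  let ?n = "vdist N ?x ?y"
  have "abs (?x (kap i) - ?y (kap i)) <= 1 / M" if i: "i : I" for i
  proof -
  have "\<lfloor>M * (?x (kap i) - x0 (kap i) + rho)\<rfloor> = \<lfloor>M * (?y (kap i) - x0 (kap i) + rho)\<rfloor>"
  using ec [OF i] cellr(1) [OF b i] cellr(1) [OF b' i] unfolding cell_def by (simp add: eq_nat_nat_iff)
  hence "abs (M * (?x (kap i) - x0 (kap i) + rho) - M * (?y (kap i) - x0 (kap i) + rho)) <= 1" by linarith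
  also have "M * (?x (kap i) - x0 (kap i) + rho) - M * (?y (kap i) - x0 (kap i) + rho) = M * (?x (kap i) - ?y (kap i))" by (simp add: algebra_simps)
  finally show ?thesis using M by (simp add: abs_mult pos_le_divide_eq mult.commute)
  qed
  hence "(SUM i:I. abs (reval (f i) ?x - reval (f i) ?y)) <= (SUM i:I. 1 / M)" by (intro sum_mono) (simp add: fkap)
  hence "K * (SUM i:I. abs (reval (f i) ?x - reval (f i) ?y)) <= K * (real n / M)" using r1(2) cI by (intro mult_left_mono) auto
  moreover have "?n <= K * (SUM i:I. abs (reval (f i) ?x - reval (f i) ?y))"
  unfolding I_def by (rule r1(3)) (intro w(1) w(2) wr b b' rho(2))+
  ultimately have nn: "?n <= K * (real n / M)" by linarith
  have small: "real m * ((real (Suc N) * L + 1) * ?n) < 1"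
  proof -
  have "(real (Suc N) * L + 1) * ?n <= (real (Suc N) * L + 1) * (K * (real n / M))" using nn r3(2) by (intro mult_left_mono) auto
  also have "... = (real (Suc N) * L + 1) * (K * real n) / M" by simp
  also have "... <= real C / M" using C(1) M by (intro divide_right_mono) auto
  also have "... = 1 / real (m + 1)" using C(2) by (simp add: M_def)
  finally have "real m * ((real (Suc N) * L + 1) * ?n) <= real m * (1 / real (m + 1))" by (intro mult_left_mono) auto
  also have "... < 1" by simp
  finally show ?thesis .
  qed
  have n0: "?n >= 0" by simp
  have s1: "real (Suc N) * (real m * (L * ?n)) < 1" and s2: "real m * ?n < 1"
  proof -
  have "real m * ((real (Suc N) * L + 1) * ?n) = real (Suc N) * (real m * (L * ?n)) + real m * ?n" by (simp add: algebra_simps)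
  moreover have "0 <= real (Suc N) * (real m * (L * ?n))" "0 <= real m * ?n" using r3(2) n0 by simp_all
  ultimately show "real (Suc N) * (real m * (L * ?n)) < 1" "real m * ?n < 1" using small by linarith+
  qed
  have b'm: "real (b' k) <= real m" if "k <= N" for k using b' that by (auto simp: PiE_def Pi_def)
  have ekap: "b (kap i) = b' (kap i)" if i: "i : I" for i
  proof (rule nat_eq_of_close)
  define e where "e k = real (b k) - real (b' k)" for k
  have "(SUM k<=N. e k * g i k ?x) = (SUM k<=N. if k = kap i then e k else 0)"
  proof (rule sum.cong [OF refl])
  fix k assume k: "k : {..N}"
  consider "k : Ob" | "k = a" | i' where "i' : I" "k = kap i'" using k unfolding Ob_def by blast
  thus "e k * g i k ?x = (if k = kap i then e k else 0)"
  proof cases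
  case 1
  thus ?thesis using eO [OF 1] i by (auto simp: e_def)
  next
  case 2
  thus ?thesis using ga [OF i] ainj i by auto
  next
  case 3
  thus ?thesis using gkap [OF i 3(1) wtht [OF b]] inj_onD [OF inj] i by auto
  qed
  qed
  also have "... = e (kap i)" using kapN [OF i] by simp
  finally have "e (kap i) = (SUM k<=N. real (b k) * g i k ?x) - (SUM k<=N. real (b' k) * g i k ?x)"
  by (simp add: e_def left_diff_distrib sum_subtractf)
  also have "... = (SUM k<=N. real (b' k) * g i k ?y) - (SUM k<=N. real (b' k) * g i k ?x)" using zj [OF b i] zj [OF b' i] by simp
  also have "... = (SUM k<=N. real (b' k) * (g i k ?y - g i k ?x))" by (simp add: right_diff_distrib sum_subtractf)
  finally have "abs (e (kap i)) <= (SUM k<=N. abs (real (b' k) * (g i k ?y - g i k ?x)))" by simp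
  also have "... <= (SUM k<=N. real m * (L * ?n))"
  proof (rule sum_mono)
  fix k assume k: "k : {..N}"
  have "abs (g i k ?x - g i k ?y) <= L * ?n"
  using r3(3) [of "(i, k)"] i k wr [OF b rho(4)] wr [OF b' rho(4)] unfolding Lip_def by simp
  thus "abs (real (b' k) * (g i k ?y - g i k ?x)) <= real m * (L * ?n)"
  unfolding abs_mult using b'm [of k] k by (intro mult_mono) (auto simp: abs_minus_commute)
  qed
  also have "... = real (Suc N) * (real m * (L * ?n))" by simp
  also have "... < 1" by (rule s1)
  finally show "abs (real (b (kap i)) - real (b' (kap i))) < 1" by (simp add: e_def)
  qed
  have ea: "b a = b' a"
  proof (rule nat_eq_of_close)
  define e where "e k = real (b k) - real (b' k)" for k
  have "e k = 0" if "k <= N" "k ~= a" for k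
  using that eO ekap unfolding Ob_def e_def by (cases "k : kap ` I") auto
  hence "(SUM k<=N. e k * ?x k) = (SUM k<=N. if k = a then e k else 0)" using w(2) [OF b] by (intro sum.cong) auto
  hence "e a = (SUM k<=N. e k * ?x k)" using aN by simp
  also have "... = (SUM k<=N. real (b k) * ?x k) - (SUM k<=N. real (b' k) * ?x k)" by (simp add: e_def left_diff_distrib sum_subtractf)
  also have "... = (SUM k<=N. real (b' k) * ?y k) - (SUM k<=N. real (b' k) * ?x k)" using z0 [OF b] z0 [OF b'] by simp
  also have "... = (SUM k<=N. real (b' k) * (?y k - ?x k))" by (simp add: right_diff_distrib sum_subtractf)
  finally have "abs (e a) <= (SUM k<=N. abs (real (b' k) * (?y k - ?x k)))" by simp
  also have "... <= (SUM k<=N. real m * abs (?x k - ?y k))"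
  unfolding abs_mult using b'm by (intro sum_mono mult_mono) (auto simp: abs_minus_commute)
  also have "... = real m * ?n" by (simp add: nrm_def sum_distrib_left)
  also have "... < 1" by (rule s2)
  finally show "abs (real (b a) - real (b' a)) < 1" by (simp add: e_def)
  qed
  show "b = b'"
  proof (rule PiE_ext [of b "{..N}" "%_. {..m}" b'])
  fix k assume "k : {..N}"
  thus "b k = b' k" using eO ekap ea unfolding Ob_def by blast
  qed (use b b' in blast)+
  qed
  have fT: "finite ?T" using cI(2) unfolding Ob_def by (intro finite_cartesian_product finite_PiE) auto
  have "card ?B <= card ?T" using card_inj_on_le [OF inj\<Phi> im fT] .
  also have "... = (m + 1) ^ (N - n) * (c1 * (m + 1) + 1) ^ n"
  using cI cOb unfolding Ob_def by (simp add: card_cartesian_product card_PiE)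
  also have "... <= (m + 1) ^ (N - n) * ((c1 + 1) * (m + 1)) ^ n" by (intro mult_left_mono power_mono) auto
  also have "... = (c1 + 1) ^ n * ((m + 1) ^ (N - n) * (m + 1) ^ n)" by (simp add: power_mult_distrib mult_ac del: add_Suc_right)
  also have "(m + 1) ^ (N - n) * (m + 1) ^ n = (m + 1) ^ N" using n_le by (simp flip: power_add)
  finally show "card ?B <= (c1 + 1) ^ n * (m + 1) ^ N" .
 qed
qed

text \<open>By compactness finitely many boxes cover the real locus, so at most c (m + 1)^N of the (m + 1)^(N + 1)
grid forms are bad somewhere. Forms vanishing at p0 are equally rare. Hence some grid form is good.\<close>

theorem exists_regular_section:
 assumes p0: "cone p0"
 obtains L where "L : forms N 1" "reval L p0 ~= 0" "!!y. cone y ==> EX a<=N. y a ~= 0 & regular L (%i. y i / y a)"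
proof -
 let ?K = "{y. cone y & nsq N y = 1}"
 let ?bad = "%a x0 rho m. {b : grid N m. EX x. cone x & x a = 1 & (near N x0 rho x) & ~ regular (lform N b) x}"
 define good where "good y t \<longleftrightarrow> fst t <= N & y (fst t) ~= 0 & fst (snd t) > (0::real) &
  (ALL m. card (?bad (fst t) (%i. y i / y (fst t)) (fst (snd t)) m) <= snd (snd t) * (m + 1) ^ N)" for y t
 have "ALL y:?K. EX t. good y t"
 proof
  fix y assume y: "y : ?K"
  obtain a where a: "a <= N" "y a ~= 0" using real_coneD(4) y by blast
  have "cone (%i. (1 / y a) * y i)" by (rule real_cone_scale) (use y a in auto)
  hence c: "cone (%i. y i / y a)" by simp
  obtain rho c where "rho > 0" "!!m. card (?bad a (%i. y i / y a) rho m) <= c * (m + 1) ^ N"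
  by (rule bad_forms_near [OF c, of a]) (use a in simp, blast)
  thus "EX t. good y t" unfolding good_def using a by (intro exI [of _ "(a, rho, c)"]) auto
 qed
 then obtain t where t: "ALL y:?K. good y (t y)" by (rule bchoice [THEN exE])
 define al where "al y = fst (t y)" for y
 define rho where "rho y = fst (snd (t y))" for y
 define V where "V y = {z. z (al y) ~= 0} Int (%z i. z i / z (al y)) -` (INT i:{..N}. {x. abs (x i - y i / y (al y)) < rho y})" for y
 have oV: "open (V y)" for y
  unfolding V_def
 proof (rule continuous_open_preimage)
  show "continuous_on {z. z (al y) ~= 0} (%(z::nat => real) i. z i / z (al y))"
  by (rule continuous_on_ratios)
  show "open {z::nat => real. z (al y) ~= 0}" by (intro open_Collect_neq continuous_on_coord continuous_on_const)
  show "open (INT i:{..N}. {x::nat => real. abs (x i - y i / y (al y)) < rho y})"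
  by (intro open_INT ballI open_Collect_less continuous_intros) auto
 qed
 have cov: "?K <= \<Union>(V ` ?K)"
 proof
  fix y assume y: "y : ?K"
  hence "good y (t y)" using t by blast
  hence "y : V y" unfolding V_def al_def rho_def good_def by auto
  thus "y : \<Union>(V ` ?K)" using y by blast
 qed
 obtain D where D: "D <= ?K" "finite D" "?K <= \<Union>(V ` D)"
  by (rule compactE_image [OF compact_real_cone [OF Xclosed] oV cov]) blast
 obtain a where a: "a <= N" "p0 a ~= 0" using real_coneD(4) [OF p0] by blast
 define m where "m = (SUM y:D. snd (snd (t y))) + 1"
 let ?bp = "{b : grid N m. reval (lform N b) p0 = 0}"
 have "card ?bp <= card (({..N} - {a}) \<rightarrow>\<^sub>E {..m})"
 proof (rule card_inj_on_le)
  show "inj_on (%b. restrict b ({..N} - {a})) ?bp"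
  proof (rule inj_onI)
  fix b b' assume b: "b : ?bp" "b' : ?bp" and eq: "restrict b ({..N} - {a}) = restrict b' ({..N} - {a})"
  have off: "b k = b' k" if "k : {..N} - {a}" for k using fun_cong [OF eq, of k] that by simp
  have "(SUM k<=N. (real (b k) - real (b' k)) * p0 k) = 0" using b by (simp add: reval_lform left_diff_distrib sum_subtractf)
  moreover have "(SUM k<=N. (real (b k) - real (b' k)) * p0 k) = (SUM k<=N. if k = a then (real (b k) - real (b' k)) * p0 k else 0)"
  by (rule sum.cong) (use off in auto)
  ultimately have "b a = b' a" using a by simp
  thus "b = b'" by (intro PiE_ext [of b "{..N}" "%_. {..m}" b']) (use b off in auto)
  qed
  show "(%b. restrict b ({..N} - {a})) ` ?bp <= ({..N} - {a}) \<rightarrow>\<^sub>E {..m}" by (auto simp: PiE_def Pi_def)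
  show "finite (({..N} - {a}) \<rightarrow>\<^sub>E {..m})" by (intro finite_PiE) auto
 qed
 also have "... = (m + 1) ^ N" using a by (simp add: card_PiE)
 finally have bp: "card ?bp <= (m + 1) ^ N" .
 let ?bd = "%y. ?bad (al y) (%i. y i / y (al y)) (rho y) m"
 have "card (UN y:D. ?bd y) <= (SUM y:D. card (?bd y))" by (rule card_UN_le [OF D(2)])
 also have "... <= (SUM y:D. snd (snd (t y)) * (m + 1) ^ N)"
  using t D(1) unfolding good_def al_def rho_def by (intro sum_mono) blast
 also have "... = (m - 1) * (m + 1) ^ N" by (simp add: m_def sum_distrib_right)
 finally have bd: "card (UN y:D. ?bd y) <= (m - 1) * (m + 1) ^ N" .
 have "card (?bp Un (UN y:D. ?bd y)) <= (m + 1) ^ N + (m - 1) * (m + 1) ^ N"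
  using card_Un_le [of ?bp "UN y:D. ?bd y"] bp bd by linarith
 also have "... = m * (m + 1) ^ N" by (cases m) (simp_all add: m_def)
 also have "... < (m + 1) * (m + 1) ^ N" by simp
 also have "... = card (grid N m)" by (simp add: card_PiE)
 finally have lt: "card (?bp Un (UN y:D. ?bd y)) < card (grid N m)" .
 have "finite (grid N m)" by (intro finite_PiE) auto
 moreover have "?bp Un (UN y:D. ?bd y) <= grid N m" by (intro Un_least UN_least Collect_subset)
 ultimately have "finite (?bp Un (UN y:D. ?bd y))" by (rule rev_finite_subset)
 define U where "U = ?bp Un (UN y:D. ?bd y)"
 have "finite U" "card U < card (grid N m)" using `finite (?bp Un (UN y:D. ?bd y))` lt by (simp_all only: U_def)
 hence "~ grid N m <= U" using card_mono [of U "grid N m"] by linarith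
 then obtain b where b: "b : grid N m" "b ~: U" by blast
 have b2: "b ~: ?bp" using b(2) unfolding U_def by blast
 have b3: "b ~: ?bd y" if "y : D" for y using b(2) that unfolding U_def by blast
 show thesis
 proof (rule that [OF lform_forms])
  show "reval (lform N b) p0 ~= 0" using b(1) b2 by blast
  fix z assume z: "cone z"
  obtain z' where z': "cone z'" "nsq N z' = 1" "ver N z' = ver N z" "z = (%i. sqrt (nsq N z) * z' i)" by (rule ver_normalize [OF z])
  have "z' : \<Union>(V ` D)" using D(3) z'(1,2) by blast
  then obtain y where y: "y : D" "z' : V y" by blast
  obtain i where "i <= N" "z i ~= 0" using real_coneD(4) [OF z] by blast
  hence s: "sqrt (nsq N z) ~= 0" using nsq_pos [of i N z] by simp
  have zi: "z i = sqrt (nsq N z) * z' i" for i using fun_cong [OF z'(4)] .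
  have ra: "z i / z (al y) = z' i / z' (al y)" for i unfolding zi [of i] zi [of "al y"] using s by simp
  have al: "al y <= N" using t D(1) y(1) unfolding good_def al_def by blast
  have za: "z' (al y) ~= 0" using y(2) by (simp add: V_def)
  have "z (al y) ~= 0" unfolding zi [of "al y"] using za s by simp
  moreover have "regular (lform N b) (%i. z i / z (al y))"
  proof (rule ccontr)
  assume nr: "~ regular (lform N b) (%i. z i / z (al y))"
  have "cone (%i. (1 / z (al y)) * z i)" by (rule real_cone_scale [OF z]) (use `z (al y) ~= 0` in simp)
  hence "cone (%i. z i / z (al y))" by simp
  moreover have "ALL i<=N. abs (z i / z (al y) - y i / y (al y)) < rho y" unfolding ra using y(2) by (simp add: V_def)
  moreover have "z (al y) / z (al y) = 1" using `z (al y) ~= 0` by simp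
  ultimately have "b : ?bd y" using b(1) nr by blast
  thus False using b3 [OF y(1)] by (rule notE [rotated])
  qed
  ultimately show "EX a<=N. z a ~= 0 & regular (lform N b) (%i. z i / z a)" using al by blast
 qed
qed

end

section \<open>Chebyshev polynomials and their branches\<close>

text \<open>The homogeneous Chebyshev polynomial C^k T_k(B / C), over any ring so that it can be evaluated both
at forms and at numbers.\<close>

fun hcheb :: "nat => 'a::comm_ring_1 => 'a => 'a" where
 "hcheb 0 B C = 1"
| "hcheb (Suc 0) B C = B"
| "hcheb (Suc (Suc k)) B C = (B + B) * hcheb (Suc k) B C - C\<^sup>2 * hcheb k B C"

lemma hcheb_forms: "B : forms N e ==> C : forms N e ==> hcheb k B C : forms N (k * e)"
proof (induction k B C rule: hcheb.induct)
 case (3 k B C)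
 have "(B + B) * hcheb (Suc k) B C : forms N (e + Suc k * e)" by (rule forms_mult [OF forms_add [OF 3(3,3)] 3(1) [OF 3(3,4)]])
 moreover have "C\<^sup>2 * hcheb k B C : forms N (2 * e + k * e)" by (rule forms_mult [OF forms_power [OF 3(4)] 3(2) [OF 3(3,4)]])
 moreover have "e + Suc k * e = Suc (Suc k) * e" "2 * e + k * e = Suc (Suc k) * e" by simp_all
 ultimately show ?case by (simp only: hcheb.simps forms_diff)
qed (simp_all add: forms_1)

lemma reval_hcheb: "reval (hcheb k B C) x = hcheb k (reval B x) (reval C x)"
proof (induction k B C rule: hcheb.induct)
 case (3 k B C)
 show ?case by (simp only: hcheb.simps reval_diff reval_mult reval_add reval_power 3)
qed simp_all

lemma hcheb_0: "hcheb (Suc k) B 0 = 2 ^ k * (B::real) ^ Suc k"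
proof (induction k)
 case (Suc k)
 have "hcheb (Suc (Suc k)) B 0 = (B + B) * hcheb (Suc k) B 0" by simp
 also have "... = (B + B) * (2 ^ k * B ^ Suc k)" by (simp only: Suc)
 finally show ?case by simp
qed simp

lemma hcheb_cos: "hcheb k (cos t) 1 = cos (real k * t)"
proof (induction k "cos t" "1::real" rule: hcheb.induct)
 case (3 k)
 have "cos (real (Suc (Suc k)) * t) + cos (real k * t) = 2 * cos t * cos (real (Suc k) * t)"
  using cos_add [of "real (Suc k) * t" t] cos_diff [of "real (Suc k) * t" t] by (simp add: algebra_simps)
 thus ?case using 3 by simp
qed simp_all

lemma hcheb_ge_1: "abs t >= 1 ==> abs (hcheb k t (1::real)) >= 1"
proof -
 assume t: "abs t >= 1"
 have "abs (hcheb k t (1::real)) >= 1 & abs (hcheb (Suc k) t (1::real)) >= abs (hcheb k t 1)" for k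
 proof (induction k)
  case (Suc k)
  have "1 * abs (hcheb (Suc k) t 1) <= abs t * abs (hcheb (Suc k) t 1)" using t by (intro mult_right_mono) auto
  hence "2 * abs (hcheb (Suc k) t 1) <= abs ((t + t) * hcheb (Suc k) t 1)" by (simp add: abs_mult flip: mult_2)
  moreover have "hcheb (Suc (Suc k)) t 1 = (t + t) * hcheb (Suc k) t 1 - hcheb k t 1" by simp
  ultimately show ?case using Suc abs_triangle_ineq2 [of "(t + t) * hcheb (Suc k) t 1" "hcheb k t 1"] by linarith
 qed (use t in simp)
 thus ?thesis by blast
qed

text \<open>The k inverse branches of T_k on [-1,1], from T_k(cos a) = cos(k a). The alternation of arccos and
pi - arccos accounts for the k monotone pieces of alternating direction.\<close>

definition branch :: "nat => nat => real => real" where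
 "branch k kap x = cos ((real kap * pi + (if even kap then arccos x else pi - arccos x)) / real k)"

lemma branch_abs_le: "abs (branch k kap x) <= 1"
 by (simp add: branch_def)

lemma cos_nat_pi_add: "cos (real kap * pi + u) = (if even kap then cos u else - cos u)"
 by (simp add: cos_add)

lemma hcheb_branch:
 assumes k: "k >= 1" and x: "abs x <= 1" shows "hcheb k (branch k kap x) 1 = x"
proof -
 have "hcheb k (branch k kap x) 1 = cos (real kap * pi + (if even kap then arccos x else pi - arccos x))"
  unfolding branch_def hcheb_cos using k by simp
 thus ?thesis unfolding cos_nat_pi_add using x by (simp add: abs_le_iff)
qed

lemma branch_exists:
 assumes k: "k >= 1" and t: "abs t <= 1" and h: "abs (hcheb k t (1::real)) < 1"
 shows "EX kap<k. t = branch k kap (hcheb k t 1)"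
proof -
 define tht where "tht = arccos t"
 have tht: "0 <= tht" "tht <= pi" "cos tht = t" using t by (auto simp: tht_def abs_le_iff arccos_lbound arccos_ubound)
 have hk: "hcheb k t 1 = cos (real k * tht)" using hcheb_cos [of k tht] tht(3) by simp
 have "tht ~= pi"
 proof
  assume "tht = pi"
  thus False using h cos_nat_pi_add [of k 0] unfolding hk by (auto split: if_splits)
 qed
 hence lt: "real k * tht / pi < real k" using tht(2) k by (simp add: divide_less_eq)
 define kap where "kap = nat \<lfloor>real k * tht / pi\<rfloor>"
 have fl: "real kap <= real k * tht / pi" "real k * tht / pi < real kap + 1" using tht(1) unfolding kap_def by (simp_all add: of_nat_nat)
 define u where "u = real k * tht - real kap * pi"
 have u: "0 <= u" "u <= pi"
  using fl pi_gt_zero unfolding u_def by (simp_all add: pos_le_divide_eq pos_divide_less_eq distrib_right)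
 have arg: "real k * tht = real kap * pi + u" by (simp add: u_def)
 have "(if even kap then arccos (hcheb k t 1) else pi - arccos (hcheb k t 1)) = u"
  unfolding hk arg cos_nat_pi_add using u by (simp add: arccos_cos arccos_minus)
 hence "branch k kap (hcheb k t 1) = cos (real k * tht / real k)" unfolding branch_def arg by simp
 hence "t = branch k kap (hcheb k t 1)" using tht(3) k by simp
 moreover have "kap < k" using fl(1) lt by simp
 ultimately show ?thesis by blast
qed

lemma branch_inj:
 assumes k: "kap < k" "kap' < k" and x: "abs x < 1" and eq: "branch k kap x = branch k kap' x"
 shows "kap = kap'"
proof -
 define u where "u kap = (if even kap then arccos x else pi - arccos x)" for kap :: nat
 have u: "0 < u kap" "u kap < pi" for kap using arccos_lt_bounded [of x] x by (auto simp: u_def abs_less_iff)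
 have b: "0 <= (real kap * pi + u kap) / real k & (real kap * pi + u kap) / real k <= pi" if "kap < k" for kap
 proof -
  have "(real kap + 1) * pi <= real k * pi" using that by (intro mult_right_mono) auto
  hence "real kap * pi + u kap <= pi * real k" using u(2) [of kap] by (simp add: algebra_simps)
  thus ?thesis using u(1) [of kap] that by (simp add: pos_divide_le_eq)
 qed
 have "(real kap * pi + u kap) / real k = (real kap' * pi + u kap') / real k"
  using cos_inj_pi b [OF k(1)] b [OF k(2)] eq unfolding branch_def u_def by blast
 hence eq': "real kap * pi + u kap = real kap' * pi + u kap'" using k by simp
 have "~ i < j" if e: "real i * pi + u i = real j * pi + u j" for i j
 proof
  assume "i < j"
  hence "(real i + 1) * pi <= real j * pi" by (intro mult_right_mono) auto
  thus False using e u [of i] u [of j] by (simp add: algebra_simps)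
 qed
 thus ?thesis using eq' by (metis linorder_neqE_nat)
qed

lemma continuous_on_branch: "continuous_on {-1..1} (branch k kap)"
proof (cases "k = 0")
 case False
 thus ?thesis unfolding branch_def by (cases "even kap") (auto intro!: continuous_intros continuous_on_arccos')
qed (simp add: branch_def)

section \<open>Homology of the round spheres\<close>

text \<open>The radius i / n makes spheres of different dimensions disjoint and keeps them inside the open cube.
For i = 0 this is a single point.\<close>

definition round_sphere :: "nat => nat => rvec set" where
 "round_sphere n i = {x. (SUM j<=i. (x j)\<^sup>2) = (real i / real n)\<^sup>2 & (ALL j>i. x j = 0)}"

lemma round_sphere_coord:
 assumes "x : round_sphere n i" "i < n" shows "abs (x j) < 1"
proof (cases "j <= i")
 case True
 have "(x j)\<^sup>2 <= (SUM j<=i. (x j)\<^sup>2)" using True by (intro member_le_sum) auto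
 also have "... = (real i / real n)\<^sup>2" using assms(1) by (simp add: round_sphere_def)
 also have "... < 1\<^sup>2" using assms(2) by (intro power_strict_mono) auto
 finally have "(abs (x j))\<^sup>2 < 1\<^sup>2" by simp
 thus ?thesis by (rule power_less_imp_less_base) simp
qed (use assms in \<open>simp add: round_sphere_def\<close>)

lemma compact_round_sphere:
 assumes "i < n" shows "compact (round_sphere n i)"
proof -
 have "round_sphere n i = cbx n (%_. -1) (%_. 1) Int ({x. (SUM j<=i. (x j)\<^sup>2) = (real i / real n)\<^sup>2} Int (INT j:{i<..}. {x. x j = 0}))" (is "?L = ?R")
 proof (intro subset_antisym subsetI)
  fix x assume x: "x : ?L"
  have "abs (x j) <= 1" for j using round_sphere_coord [OF x assms, of j] by simp
  thus "x : ?R" using x assms by (auto simp: round_sphere_def cbx_def abs_le_iff minus_le_iff)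
 qed (auto simp: round_sphere_def)
 moreover have "closed ({x. (SUM j<=i. (x j)\<^sup>2) = (real i / real n)\<^sup>2} Int (INT j:{i<..}. {x :: nat => real. x j = 0}))"
  by (intro closed_Int closed_INT ballI closed_Collect_eq continuous_intros)
 ultimately show ?thesis by (simp add: compact_Int_closed compact_cbx)
qed

lemma nsphere_eq: "nsphere i = top_of_set {x. (SUM j<=i. (x j)\<^sup>2) = 1 & (ALL j>i. x j = 0)}"
 by (simp add: nsphere euclidean_product_topology)

lemma round_sphere_homeomorphic:
 assumes "1 <= i" "i < n" shows "top_of_set (round_sphere n i) homeomorphic_space nsphere i"
proof -
 define c where "c = real n / real i"
 have c: "c > 0" using assms by (simp add: c_def)
 have inv: "real i / real n = 1 / c" by (simp add: c_def)
 have s: "(SUM j<=i. (t * x j)\<^sup>2) = t\<^sup>2 * (SUM j<=i. (x j)\<^sup>2)" for t and x :: rvec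
  by (simp add: power_mult_distrib sum_distrib_left)
 have cont: "continuous_on S (%x j. t * x j)" for t and S :: "rvec set"
  by (intro continuous_on_coordinatewise_then_product continuous_intros)
 have "homeomorphic_maps (top_of_set (round_sphere n i)) (nsphere i) (%x j. c * x j) (%x j. 1 / c * x j)"
  unfolding homeomorphic_maps_def nsphere_eq
 proof (intro conjI ballI)
  have "(%j. c * x j) : {x. (SUM j<=i. (x j)\<^sup>2) = 1 & (ALL j>i. x j = 0)}" if "x : round_sphere n i" for x
  using that c unfolding round_sphere_def inv by (simp add: s power_divide)
  thus "continuous_map (top_of_set (round_sphere n i)) (top_of_set {x. (SUM j<=i. (x j)\<^sup>2) = 1 & (ALL j>i. x j = 0)}) (%x j. c * x j)"
  using cont by auto
  have "(%j. 1 / c * x j) : round_sphere n i" if "x : {x. (SUM j<=i. (x j)\<^sup>2) = 1 & (ALL j>i. x j = 0)}" for x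
  using that unfolding round_sphere_def inv mem_Collect_eq s by simp
  thus "continuous_map (top_of_set {x. (SUM j<=i. (x j)\<^sup>2) = 1 & (ALL j>i. x j = 0)}) (top_of_set (round_sphere n i)) (%x j. 1 / c * x j)"
  using cont [of _ "1 / c"] by (auto simp del: times_divide_eq_left)
 qed (use c in auto)
 thus ?thesis unfolding homeomorphic_space_def by blast
qed

lemma path_connected_nsphere:
 assumes "i >= 1" shows "path_connected_space (nsphere i)"
proof -
 let ?H = "%P. {x : topspace (nsphere i). P (x 0 :: real)}"
 have p1: "path_connectedin (nsphere i) (?H (%t. t >= 0))"
  using contractible_imp_path_connected_space [OF contractible_space_upper_hemisphere [of 0 i]]
  unfolding path_connectedin_def Collect_conj_eq Collect_mem_eq subtopology_restrict by simp
 have p2: "path_connectedin (nsphere i) (?H (%t. t <= 0))"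
  using contractible_imp_path_connected_space [OF contractible_space_lower_hemisphere [of 0 i]]
  unfolding path_connectedin_def Collect_conj_eq Collect_mem_eq subtopology_restrict by simp
 define e where "e = (%j::nat. if j = 1 then 1 else 0 :: real)"
 have "(SUM j<=i. (e j)\<^sup>2) = (SUM j<=i. if j = 1 then 1 else 0)" by (rule sum.cong) (auto simp: e_def)
 hence "e : topspace (nsphere i)" using assms by (auto simp: nsphere_eq e_def)
 hence "e : ?H (%t. t >= 0) Int ?H (%t. t <= 0)" by (simp add: e_def)
 hence "path_connectedin (nsphere i) (?H (%t. t >= 0) Un ?H (%t. t <= 0))"
  using path_connectedin_Un [OF p1 p2] by blast
 moreover have "?H (%t. t >= 0) Un ?H (%t. t <= 0) = topspace (nsphere i)" by auto
 ultimately show ?thesis by (simp add: path_connectedin_topspace)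
qed

lemma homology_nsphere:
 assumes i: "i >= 1" shows "hom01 p (nsphere i)" "homology_group (int i) (nsphere i) \<cong> integer_group"
proof -
 have r: "homology_group p (nsphere i) \<cong> integer_group" if "p = int i" for p
  using reduced_homology_group_nsphere [of i] un_reduced_homology_group [of p "nsphere i"] that i by simp
 thus "homology_group (int i) (nsphere i) \<cong> integer_group" by blast
 consider "p = 0" | "p ~= 0" "p ~= int i" | "p = int i" by blast
 thus "hom01 p (nsphere i)"
 proof cases
  case 1
  have "homology_group 0 (nsphere i) \<cong> integer_group"
  by (rule isomorphic_integer_zeroth_homology_group [OF path_connected_nsphere [OF i]]) (use in_topspace_nsphere in blast)
  thus ?thesis using 1 by (simp add: hom01_def)
 next
  case 2
  thus ?thesis using trivial_reduced_homology_group_nsphere [of p i] un_reduced_homology_group [of p "nsphere i"] by (simp add: hom01_def)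
 qed (use r in \<open>simp add: hom01_def\<close>)
qed

text \<open>The point for i = 0 is treated separately from the spheres of positive dimension.\<close>

lemma homology_sphere_like:
 assumes i: "i < n" and S: "top_of_set (round_sphere n i) homeomorphic_space T"
 shows "hom01 p T" "EX g:cycles2 i T. g ~: boundaries2 i T"
proof -
 have tr: "homology_group p T \<cong> integer_group" if "homology_group p Y \<cong> integer_group" "Y homeomorphic_space T" for p and Y :: "rvec topology"
  using homeomorphic_space_imp_isomorphic_homology_groups [of T Y p] that homeomorphic_space_sym iso_trans by blast
 have tt: "trivial_group (homology_group p T)" if "trivial_group (homology_group p Y)" "Y homeomorphic_space T" for p and Y :: "rvec topology"
  using isomorphic_group_triviality [OF homeomorphic_space_imp_isomorphic_homology_groups [OF that(2)] group_relative_homology_group group_relative_homology_group] that(1) by blast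
 have h: "hom01 p T" if "hom01 p Y" "Y homeomorphic_space T" for p and Y :: "rvec topology"
  using that tr tt unfolding hom01_def by blast
 have "hom01 p T & homology_group (int i) T \<cong> integer_group"
 proof (cases "i = 0")
  case True
  let ?Y = "top_of_set {%_::nat. 0::real}"
  have "round_sphere n i = {%_. 0}" by (auto simp: True round_sphere_def fun_eq_iff) (metis neq0_conv)
  hence Y: "?Y homeomorphic_space T" using S by simp
  have c: "contractible_space ?Y" by (simp add: contractible_space_top_of_set)
  have "homology_group 0 ?Y \<cong> integer_group"
  by (rule isomorphic_integer_zeroth_homology_group [OF contractible_imp_path_connected_space [OF c]]) simp
  thus ?thesis using h [OF hom01_contractible [OF c] Y] tr [OF _ Y] True by simp
 next
  case False
  hence Y: "nsphere i homeomorphic_space T"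
  using round_sphere_homeomorphic [of i n] i S homeomorphic_space_sym homeomorphic_space_trans by (metis less_one not_less)
  show ?thesis using h [OF homology_nsphere(1) Y] tr [OF homology_nsphere(2) Y] False by simp
 qed
 thus "hom01 p T" "EX g:cycles2 i T. g ~: boundaries2 i T" using integer_homology_nonbounding by blast+
qed

section \<open>Two sheets over a cube\<close>

text \<open>The quadratic part folds the first parameter, so that a level of w has two sheets. The quartic part
is negligible near q, but confines the zeros to a neighbourhood of q: it bounds all coordinates, and
its homogenisation has no real zero at infinity.\<close>

definition wfun :: "nat => nat => (nat => nat) => rvec => rvec => real" where
 "wfun N n J q x = (SUM j<n. (x (J j) - q (J j))\<^sup>2) + (SUM i<=N. (x i - q i) ^ 4)"

text \<open>The rescaled w is the coordinate 0, and the parameters 1, ..., n - 1 are rescaled by e. The values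
-1 and 1 of the coordinate 0 correspond to w = s^2 / 3 and w = 2 s^2 / 3.\<close>

definition tfun :: "nat => nat => (nat => nat) => rvec => real => real => rvec => nat => real" where
 "tfun N n J q s e x j = (if j = 0 then 6 / s\<^sup>2 * wfun N n J q x - 3 else (x (J j) - q (J j)) / e)"

lemma fourth_power_lipschitz:
 fixes u v b :: real
 assumes "abs u <= b" "abs v <= b" shows "abs (u ^ 4 - v ^ 4) <= 4 * b ^ 3 * abs (u - v)"
proof -
 have b: "b >= 0" using assms by linarith
 have "u ^ 4 - v ^ 4 = (u - v) * ((u + v) * (u\<^sup>2 + v\<^sup>2))" by (simp add: power2_eq_square power4_eq_xxxx algebra_simps)
 moreover have "abs ((u + v) * (u\<^sup>2 + v\<^sup>2)) <= (2 * b) * (2 * b\<^sup>2)"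
  unfolding abs_mult
 proof (rule mult_mono)
  show "abs (u + v) <= 2 * b" using assms by linarith
  have "u\<^sup>2 <= b\<^sup>2" "v\<^sup>2 <= b\<^sup>2" using power_mono [OF assms(1), of 2] power_mono [OF assms(2), of 2] by simp_all
  thus "abs (u\<^sup>2 + v\<^sup>2) <= 2 * b\<^sup>2" by simp
 qed (use b in auto)
 ultimately have "abs (u ^ 4 - v ^ 4) <= abs (u - v) * ((2 * b) * (2 * b\<^sup>2))" by (simp add: abs_mult mult_left_mono)
 also have "... = 4 * b ^ 3 * abs (u - v)" by (simp add: power2_eq_square power3_eq_cube)
 finally show ?thesis .
qed

lemma abs_lt_of_fourth:
 fixes u b :: real
 assumes "u ^ 4 < b ^ 4" "b >= 0" shows "abs u < b"
proof (rule power_less_imp_less_base [of _ 4])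
 show "abs u ^ 4 < b ^ 4" using assms(1) by (simp add: power_even_abs)
qed (rule assms(2))

context smooth_variety
begin

text \<open>On the cube the parameters 1, ..., n - 1 have size at most e, much smaller than s, and w lies between
s^2 / 3 and 2 s^2 / 3; so the parameter 0 is bounded away from 0, and its sign distinguishes the
sheets. The sheets are parametrised by solving w = const for the parameter 0, which is possible since
the quartic term is a small Lipschitz perturbation of the square.\<close>

lemma sheets:
 assumes q: "cone q" "q a = 1" and n1: "n >= 1" and L: "L : forms N m" "reval L q ~= 0"
 obtains J s e lift C where "!!j. j < n ==> J j <= N" "s > 0" "e > 0" "C > 0"
  "!!sig tau. ALL j<n. abs (tau j) <= 1 ==> cone (lift sig tau) & lift sig tau a = 1 &
  (ALL j<n. tfun N n J q s e (lift sig tau) j = tau j) & reval L (lift sig tau) ~= 0"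
  "!!x. cone x ==> x a = 1 ==> ALL j<n. abs (tfun N n J q s e x j) <= 1 ==> EX sig. x = lift sig (tfun N n J q s e x)"
  "!!sig tau tau'. ALL j<n. abs (tau j) <= 1 ==> ALL j<n. abs (tau' j) <= 1 ==>
  vdist N (lift sig tau) (lift sig tau') <= C * (SUM j<n. abs (tau j - tau' j))"
  "!!tau tau'. ALL j<n. abs (tau j) <= 1 ==> ALL j<n. abs (tau' j) <= 1 ==> lift True tau ~= lift False tau'"
proof -
 obtain F d J where fm: "is_frame F d a J" and th: "reval (jac N (fr F a J)) q ~= 0"
  using frame_exists [OF q(1), of a] q(2) by auto
 have JN: "J j <= N" if "j < n" for j using fm that by (simp add: is_frame_def)
 define f where "f = fr F a J"
 have ff: "f i : forms N (if i < codim then d i else 1)" if "i <= N" for i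
  unfolding f_def by (rule fr_forms [OF fm that])
 obtain rho1 K where r1: "rho1 > 0" "K > 0"
  "!!x y. cone x ==> cone y ==> x a = 1 ==> y a = 1 ==> near N q rho1 x ==> near N q rho1 y ==>
  vdist N x y <= K * (SUM i:{codim<..N}. abs (reval (f i) x - reval (f i) y))"
  "!!e z. 0 < e ==> e <= rho1 ==> (SUM i:{codim<..N}. abs (z i - reval (f i) q)) <= e / (6 * K) ==>
  EX x. cone x & x a = 1 & (near N q e x) & (ALL i:{codim<..N}. reval (f i) x = z i)"
 proof (rule local_coordinates [OF fm q th, of f "%i. if i < codim then d i else 1"])
  show "f i = fr F a J i" for i by (simp add: f_def)
  show "reval (jac N f) q ~= 0" using th by (simp add: f_def)
 qed (use ff in blast)+
 obtain rho2 where r2: "rho2 > 0" "!!x. near N q rho2 x ==> reval L x ~= 0"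
  by (rule nonzero_near [OF sdiff_reval [OF L(1)] L(2)]) blast
 have fJ: "reval (f (Suc codim + j)) x = x (J j)" for j x by (simp add: f_def fr_def)
 have sumJ: "(SUM i:{codim<..N}. h i) = (SUM j<n. h (Suc codim + j))" for h :: rvec
  by (rule sum.reindex_bij_witness [of _ "%j. Suc codim + j" "%i. i - Suc codim"]) (use codim_n in auto)
 define rho where "rho = min rho1 (min rho2 1)"
 have rho: "rho > 0" "rho <= rho1" "rho <= rho2" "rho <= 1" using r1(1) r2(1) by (auto simp: rho_def)
 define xi where "xi x j = x (J j) - q (J j)" for x :: rvec and j
 define box where "box x \<longleftrightarrow> cone x & x a = 1 & (near N q rho x)" for x
 have up: "near N q R x" if "box x" "rho <= R" for x R using that unfolding box_def by (meson less_le_trans)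
 have c1: "vdist N x y <= K * (SUM j<n. abs (xi x j - xi y j))" if "box x" "box y" for x y
  using r1(3) [OF _ _ _ _ up [OF that(1) rho(2)] up [OF that(2) rho(2)]] that
  unfolding box_def sumJ fJ by (simp add: xi_def)
 have c2: "EX x. box x & (ALL j<n. xi x j = z j)" if z: "(SUM j<n. abs (z j)) <= rho / (6 * K)" for z
 proof -
  have "EX x. cone x & x a = 1 & (near N q rho x) &
  (ALL i:{codim<..N}. reval (f i) x = z (i - Suc codim) + reval (f i) q)"
  by (rule r1(4) [OF rho(1,2)]) (use z in \<open>simp add: sumJ\<close>)
  then obtain x where x: "box x" "ALL i:{codim<..N}. reval (f i) x = z (i - Suc codim) + reval (f i) q"
  unfolding box_def by blast
  have "xi x j = z j" if "j < n" for j
  proof -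
  have "Suc codim + j : {codim<..N}" using that codim_n by auto
  hence "reval (f (Suc codim + j)) x = z j + reval (f (Suc codim + j)) q" using x(2) by fastforce
  thus ?thesis unfolding fJ by (simp add: xi_def)
  qed
  thus ?thesis using x(1) by blast
 qed
 have boxq: "box q" using q rho(1) by (simp add: box_def)
 define Kn where "Kn = K * real n"
 have Kn: "Kn > 0" using r1(2) n1 by (simp add: Kn_def)
 define Q where "Q = real (Suc N) * Kn ^ 4"
 define R4 where "R4 = 4 * Kn ^ 3 * K"
 have QR: "Q > 0" "R4 > 0" using Kn r1(2) by (simp_all add: Q_def R4_def)
 \<comment> \<open>s <= rho^2 confines w <= s^2 to the box; 1/(24 Q) and 1/(2 R4) control the quartic term and its Lipschitz constant.\<close>
 define s where "s = Min {1, rho\<^sup>2, rho / (6 * Kn), 1 / (24 * Q), 1 / (2 * R4)}"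
 have s0: "s > 0" and s1: "s <= 1" "s <= rho\<^sup>2" "s <= rho / (6 * Kn)" "s <= 1 / (24 * Q)" "s <= 1 / (2 * R4)"
 proof -
  have le: "s <= u" if "u : {1, rho\<^sup>2, rho / (6 * Kn), 1 / (24 * Q), 1 / (2 * R4)}" for u
  unfolding s_def by (rule Min_le [OF _ that]) simp
  show "s <= 1" "s <= rho\<^sup>2" "s <= rho / (6 * Kn)" "s <= 1 / (24 * Q)" "s <= 1 / (2 * R4)" by (rule le, simp)+
  show "s > 0" unfolding s_def using rho(1) Kn QR by (subst Min_gr_iff) simp_all
 qed
 have ss: "s\<^sup>2 <= s" using s0 s1(1) by (simp add: power2_eq_square mult_left_le)
 \<comment> \<open>The squares of the parameters 1, ..., n - 1 then add up to at most s^2/25.\<close>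
 define e where "e = s / (5 * real n)"
 have e0: "e > 0" and es: "e <= s" and ne: "real n * e\<^sup>2 <= s\<^sup>2 / 24"
 proof -
  show "e > 0" using s0 n1 by (simp add: e_def)
  have "s * 1 <= s * (5 * real n)" using s0 n1 by (intro mult_left_mono) auto
  thus "e <= s" using n1 by (simp add: e_def divide_le_eq)
  have "real n * e\<^sup>2 = s\<^sup>2 / (25 * real n)" using n1 by (simp add: e_def power_divide power2_eq_square)
  also have "... <= s\<^sup>2 / 24" using n1 by (intro divide_left_mono) auto
  finally show "real n * e\<^sup>2 <= s\<^sup>2 / 24" .
 qed
 have sR: "R4 * s ^ 3 <= s / 2"
 proof -
  have "R4 * s\<^sup>2 <= R4 * (1 / (2 * R4))" using ss s1(5) QR by (intro mult_left_mono) auto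
  hence "R4 * s\<^sup>2 * s <= 1 / 2 * s" using QR s0 by (intro mult_right_mono) auto
  thus ?thesis by (simp add: power3_eq_cube power2_eq_square)
 qed
 have sQ: "Q * s ^ 4 <= s\<^sup>2 / 24"
 proof -
  have "Q * s\<^sup>2 <= Q * (1 / (24 * Q))" using ss s1(4) QR by (intro mult_left_mono) auto
  hence "Q * s\<^sup>2 * s\<^sup>2 <= 1 / 24 * s\<^sup>2" using QR by (intro mult_right_mono) auto
  thus ?thesis by (simp add: power4_eq_xxxx power2_eq_square)
 qed
 define w where "w = wfun N n J q"
 define t where "t = tfun N n J q s e"
 define q4 where "q4 x = (SUM i<=N. (x i - q i) ^ 4)" for x :: rvec
 have wx: "w x = (SUM j<n. (xi x j)\<^sup>2) + q4 x" for x by (simp add: w_def wfun_def xi_def q4_def)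
 have q40: "q4 x >= 0" for x by (simp add: q4_def sum_nonneg)
 have split0: "(SUM j<n. h j) = h 0 + (SUM j:{1..<n}. h j)" for h :: rvec
  using sum.atLeast_Suc_lessThan [of 0 n h] n1 by (simp add: atLeast0LessThan)
 have t0: "t x 0 = 6 / s\<^sup>2 * w x - 3" and tj: "j ~= 0 ==> t x j = xi x j / e" for x j
  by (simp_all add: t_def tfun_def w_def xi_def)
 define sm where "sm x \<longleftrightarrow> box x & (ALL j<n. abs (xi x j) <= s)" for x
 have usm: "abs (x i - q i) <= Kn * s" if "sm x" "i <= N" for x i
 proof -
  have "abs (x i - q i) <= vdist N x q" by (rule coord_le_nrm [OF that(2)])
  also have "... <= K * (SUM j<n. abs (xi x j - xi q j))" using that(1) boxq by (intro c1) (simp_all add: sm_def)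
  also have "... <= K * (SUM j<n. s)" using that(1) r1(2) by (intro mult_left_mono sum_mono) (simp_all add: sm_def xi_def [of q])
  finally show ?thesis by (simp add: Kn_def mult_ac)
 qed
 have q4s: "q4 x <= s\<^sup>2 / 24" if "sm x" for x
 proof -
  have "q4 x <= (SUM i<=N. (Kn * s) ^ 4)" unfolding q4_def
  proof (rule sum_mono)
  fix i assume "i : {..N}"
  hence "abs (x i - q i) ^ 4 <= (Kn * s) ^ 4" using usm [OF that] by (intro power_mono) auto
  thus "(x i - q i) ^ 4 <= (Kn * s) ^ 4" by (simp add: power_even_abs)
  qed
  also have "... = Q * s ^ 4" by (simp add: Q_def power_mult_distrib mult_ac)
  finally show ?thesis using sQ by linarith
 qed
 have q4l: "abs (q4 x - q4 y) <= s / 2 * (SUM j<n. abs (xi x j - xi y j))" if "sm x" "sm y" for x y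
 proof -
  have "abs (q4 x - q4 y) <= (SUM i<=N. abs ((x i - q i) ^ 4 - (y i - q i) ^ 4))"
  unfolding q4_def sum_subtractf [symmetric] by (rule sum_abs)
  also have "... <= (SUM i<=N. 4 * (Kn * s) ^ 3 * abs (x i - y i))"
  proof (rule sum_mono)
  fix i assume "i : {..N}"
  hence i: "i <= N" by simp
  show "abs ((x i - q i) ^ 4 - (y i - q i) ^ 4) <= 4 * (Kn * s) ^ 3 * abs (x i - y i)"
  using fourth_power_lipschitz [OF usm [OF that(1) i] usm [OF that(2) i]] by simp
  qed
  also have "... = 4 * (Kn * s) ^ 3 * vdist N x y" by (simp add: nrm_def sum_distrib_left)
  also have "... <= 4 * (Kn * s) ^ 3 * (K * (SUM j<n. abs (xi x j - xi y j)))"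
  using c1 that Kn s0 by (intro mult_left_mono) (simp_all add: sm_def)
  also have "... = R4 * s ^ 3 * (SUM j<n. abs (xi x j - xi y j))" by (simp add: R4_def power_mult_distrib)
  also have "... <= s / 2 * (SUM j<n. abs (xi x j - xi y j))" using sR by (intro mult_right_mono sum_nonneg) auto
  finally show ?thesis .
 qed
 have region: "sm x & s / 2 <= abs (xi x 0)" if x: "cone x" "x a = 1" and tx: "ALL j<n. abs (t x j) <= 1" for x
 proof -
  have "abs (t x 0) <= 1" using tx n1 by simp
  hence "2 <= 6 / s\<^sup>2 * w x" "6 / s\<^sup>2 * w x <= 4" unfolding t0 by linarith+
  hence w: "s\<^sup>2 / 3 <= w x" "w x <= 2 / 3 * s\<^sup>2" using s0 by (simp_all add: field_simps)
  have xij: "(xi x j)\<^sup>2 <= w x" if "j < n" for j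
  using member_le_sum [of j "{..<n}" "%j. (xi x j)\<^sup>2"] that q40 [of x] unfolding wx by auto
  have xis: "abs (xi x j) <= s" if "j < n" for j
  proof (rule power2_le_imp_le)
  have "s\<^sup>2 >= 0" by simp
  thus "(abs (xi x j))\<^sup>2 <= s\<^sup>2" unfolding power2_abs using xij [OF that] w(2) by linarith
  qed (use s0 in simp)
  have "abs (x i - q i) < rho" if "i <= N" for i
  proof (rule abs_lt_of_fourth)
  have "(x i - q i) ^ 4 <= q4 x" unfolding q4_def using that by (intro member_le_sum) auto
  also have "... <= w x" unfolding wx by (simp add: sum_nonneg)
  also have "... < s\<^sup>2"
  proof -
  have "s\<^sup>2 > 0" using s0 by simp
  thus ?thesis using w(2) by linarith
  qed
  also have "... <= (rho\<^sup>2)\<^sup>2" using s1(2) s0 by (intro power_mono) auto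
  finally show "(x i - q i) ^ 4 < rho ^ 4" by simp
  qed (use rho(1) in simp)
  hence sm: "sm x" using x xis by (simp add: sm_def box_def)
  have "(SUM j:{1..<n}. (xi x j)\<^sup>2) <= (SUM j:{1..<n}. e\<^sup>2)"
  proof (rule sum_mono)
  fix j assume j: "j : {1..<n}"
  hence "abs (t x j) <= 1" using tx by simp
  hence "abs (xi x j) <= e" using tj [of j x] j e0 by (simp add: divide_le_eq)
  thus "(xi x j)\<^sup>2 <= e\<^sup>2" using power_mono [of "abs (xi x j)" e 2] by simp
  qed
  also have "... <= real n * e\<^sup>2" by (simp add: mult_right_mono)
  finally have "(SUM j:{1..<n}. (xi x j)\<^sup>2) <= s\<^sup>2 / 24" using ne by linarith
  hence "s\<^sup>2 / 4 <= (xi x 0)\<^sup>2" using w(1) q4s [OF sm] unfolding wx split0 by linarith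
  hence "(s / 2)\<^sup>2 <= (abs (xi x 0))\<^sup>2" by (simp add: power_divide)
  hence "s / 2 <= abs (xi x 0)" by (rule power2_le_imp_le) simp
  thus ?thesis using sm by blast
 qed
 define sg where "sg sig = (if sig then 1 else - 1 :: real)" for sig
 define C where "C = K * (6 * s)"
 have C: "C > 0" using r1(2) s0 by (simp add: C_def)
 have two: "vdist N x y <= C * (SUM j<n. abs (t x j - t y j))"
  if x: "cone x" "x a = 1" "ALL j<n. abs (t x j) <= 1" and y: "cone y" "y a = 1" "ALL j<n. abs (t y j) <= 1"
  and sgn: "sg sig * xi x 0 > 0" "sg sig * xi y 0 > 0" for x y sig
 proof -
  have sx: "sm x" "s / 2 <= abs (xi x 0)" and sy: "sm y" "s / 2 <= abs (xi y 0)" using region x y by blast+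
  define A where "A j = abs (xi x j - xi y j)" for j
  define S where "S = (SUM j:{1..<n}. A j)"
  define T where "T = (SUM j:{1..<n}. abs (t x j - t y j))"
  have T0: "T >= 0" by (simp add: T_def sum_nonneg)
  have "s <= abs (xi x 0 + xi y 0)" using sgn sx(2) sy(2) unfolding sg_def by (cases sig) auto
  hence "s * A 0 <= abs (xi x 0 + xi y 0) * A 0" by (intro mult_right_mono) (simp_all add: A_def)
  also have "... = abs ((xi x 0)\<^sup>2 - (xi y 0)\<^sup>2)" unfolding A_def abs_mult [symmetric] by (simp add: power2_eq_square algebra_simps)
  finally have 1: "s * A 0 <= abs ((xi x 0)\<^sup>2 - (xi y 0)\<^sup>2)" .
  have "abs ((SUM j:{1..<n}. (xi x j)\<^sup>2) - (SUM j:{1..<n}. (xi y j)\<^sup>2)) <= (SUM j:{1..<n}. abs ((xi x j)\<^sup>2 - (xi y j)\<^sup>2))"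
  unfolding sum_subtractf [symmetric] by (rule sum_abs)
  also have "... <= (SUM j:{1..<n}. 2 * s * A j)"
  proof (rule sum_mono)
  fix j assume "j : {1..<n}"
  hence "abs (xi x j) <= s" "abs (xi y j) <= s" using sx(1) sy(1) by (auto simp: sm_def)
  hence "abs (xi x j + xi y j) <= 2 * s" by linarith
  hence "abs (xi x j + xi y j) * A j <= 2 * s * A j" by (intro mult_right_mono) (simp_all add: A_def)
  moreover have "abs ((xi x j)\<^sup>2 - (xi y j)\<^sup>2) = abs (xi x j + xi y j) * A j"
  unfolding A_def abs_mult [symmetric] by (simp add: power2_eq_square algebra_simps)
  ultimately show "abs ((xi x j)\<^sup>2 - (xi y j)\<^sup>2) <= 2 * s * A j" by simp
  qed
  also have "... = 2 * s * S" by (simp add: S_def sum_distrib_left)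
  finally have 2: "abs ((SUM j:{1..<n}. (xi x j)\<^sup>2) - (SUM j:{1..<n}. (xi y j)\<^sup>2)) <= 2 * s * S" .
  have 3: "abs (q4 x - q4 y) <= s / 2 * (A 0 + S)"
  using q4l [OF sx(1) sy(1)] unfolding split0 S_def A_def .
  have "(xi x 0)\<^sup>2 - (xi y 0)\<^sup>2 = (w x - w y) - ((SUM j:{1..<n}. (xi x j)\<^sup>2) - (SUM j:{1..<n}. (xi y j)\<^sup>2)) - (q4 x - q4 y)"
  unfolding wx split0 by simp
  hence "s * A 0 <= abs (w x - w y) + 2 * s * S + s / 2 * (A 0 + S)" using 1 2 3 by linarith
  moreover have "w x - w y = s\<^sup>2 / 6 * (t x 0 - t y 0)" unfolding t0 using s0 by (simp add: field_simps)
  hence "abs (w x - w y) = abs (s\<^sup>2 / 6 * (t x 0 - t y 0))" by (rule arg_cong)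
  hence "abs (w x - w y) = s\<^sup>2 / 6 * abs (t x 0 - t y 0)" by (simp only: abs_mult) simp
  moreover have "A j = e * abs (t x j - t y j)" if "j : {1..<n}" for j
  proof -
  have "xi x j - xi y j = e * (t x j - t y j)" using tj [of j] that e0 by (simp add: field_simps)
  thus ?thesis using e0 by (simp add: A_def abs_mult)
  qed
  hence S: "S = e * T" by (simp add: S_def T_def sum_distrib_left)
  ultimately have "s / 2 * A 0 <= s\<^sup>2 / 6 * abs (t x 0 - t y 0) + 5 / 2 * s * (e * T)" by (simp add: algebra_simps)
  also have "... = s / 2 * (s / 3 * abs (t x 0 - t y 0) + 5 * (e * T))" by (simp add: power2_eq_square algebra_simps)
  finally have "A 0 <= s / 3 * abs (t x 0 - t y 0) + 5 * (e * T)" using s0 by simp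
  moreover have "e * T <= s * T" using es T0 by (intro mult_right_mono) auto
  moreover have "s / 3 * abs (t x 0 - t y 0) <= s * abs (t x 0 - t y 0)" using s0 by (intro mult_right_mono) auto
  moreover have "0 <= s * abs (t x 0 - t y 0)" using s0 by simp
  ultimately have "A 0 + S <= 6 * (s * abs (t x 0 - t y 0)) + 6 * (s * T)" unfolding S by linarith
  also have "... = 6 * s * (SUM j<n. abs (t x j - t y j))" unfolding split0 T_def by (simp add: algebra_simps)
  finally have "K * (A 0 + S) <= K * (6 * s * (SUM j<n. abs (t x j - t y j)))" using r1(2) by (intro mult_left_mono) auto
  moreover have "vdist N x y <= K * (A 0 + S)"
  using c1 [of x y] sx(1) sy(1) unfolding sm_def split0 S_def A_def by blast
  ultimately show ?thesis by (simp add: C_def mult.assoc)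
 qed
 define ok where "ok sig tau x \<longleftrightarrow> cone x & x a = 1 & (ALL j<n. t x j = tau j) & sg sig * xi x 0 > 0" for sig tau x
 have ex: "EX x. ok sig tau x" if tau: "ALL j<n. abs (tau j) <= 1" for sig tau
 proof -
  define z where "z c j = (if j = 0 then sg sig * c else e * tau j)" for c j
  have zs: "abs (z c j) <= s" if c: "c : {s/2..s}" and j: "j < n" for c j
  proof (cases "j = 0")
  case False
  have "abs (e * tau j) <= e * 1" unfolding abs_mult using tau j e0 by (intro mult_mono) auto
  thus ?thesis using False es by (simp add: z_def)
  qed (use c s0 in \<open>auto simp: z_def sg_def\<close>)
  have "EX x. box x & (ALL j<n. xi x j = z c j)" if c: "c : {s/2..s}" for c
  proof (rule c2)
  have "(SUM j<n. abs (z c j)) <= (SUM j<n. s)" using zs [OF c] by (intro sum_mono) auto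
  also have "... = real n * s" by simp
  also have "... <= real n * (rho / (6 * Kn))" using s1(3) by (intro mult_left_mono) auto
  also have "... = rho / (6 * K)" using n1 by (simp add: Kn_def)
  finally show "(SUM j<n. abs (z c j)) <= rho / (6 * K)" .
  qed
  then obtain X where X: "!!c. c : {s/2..s} ==> box (X c)" "!!c j. c : {s/2..s} ==> j < n ==> xi (X c) j = z c j"
  by metis
  have smX: "sm (X c)" if "c : {s/2..s}" for c using X [OF that] zs [OF that] by (simp add: sm_def)
  have wX: "w (X c) = c\<^sup>2 + (SUM j:{1..<n}. (e * tau j)\<^sup>2) + q4 (X c)" if c: "c : {s/2..s}" for c
  proof -
  have "(xi (X c) 0)\<^sup>2 = c\<^sup>2" using X(2) [OF c, of 0] n1 by (simp add: z_def sg_def)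
  moreover have "(SUM j:{1..<n}. (xi (X c) j)\<^sup>2) = (SUM j:{1..<n}. (e * tau j)\<^sup>2)"
  by (rule sum.cong) (use X(2) [OF c] in \<open>auto simp: z_def\<close>)
  ultimately show ?thesis unfolding wx split0 by simp
  qed
  have "(s / 2)-lipschitz_on {s/2..s} (%c. q4 (X c))"
  proof (rule lipschitz_onI)
  fix c c' assume c: "c : {s/2..s}" "c' : {s/2..s}"
  have "(SUM j:{1..<n}. abs (xi (X c) j - xi (X c') j)) = 0"
  using X(2) [OF c(1)] X(2) [OF c(2)] by (intro sum.neutral) (auto simp: z_def)
  moreover have "abs (xi (X c) 0 - xi (X c') 0) = abs (c - c')"
  using X(2) [OF c(1), of 0] X(2) [OF c(2), of 0] n1 by (auto simp: z_def sg_def)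
  ultimately show "dist (q4 (X c)) (q4 (X c')) <= s / 2 * dist c c'"
  using q4l [OF smX [OF c(1)] smX [OF c(2)]] unfolding split0 dist_real_def by simp
  qed (use s0 in simp)
  hence "continuous_on {s/2..s} (%c. q4 (X c))" by (rule lipschitz_on_continuous_on)
  hence "continuous_on {s/2..s} (%c. c\<^sup>2 + (SUM j:{1..<n}. (e * tau j)\<^sup>2) + q4 (X c))" by (intro continuous_intros)
  hence cw: "continuous_on {s/2..s} (%c. w (X c))" by (rule continuous_on_eq) (simp add: wX)
  have sl: "s / 2 : {s/2..s}" "s : {s/2..s}" using s0 by auto
  have tau0: "abs (tau 0) <= 1" using tau n1 by simp
  let ?y = "s\<^sup>2 / 6 * (tau 0 + 3)"
  have y: "s\<^sup>2 / 3 <= ?y" "?y <= s\<^sup>2"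
  proof -
  have "s\<^sup>2 / 6 * 2 <= ?y" using tau0 by (intro mult_left_mono) auto
  thus "s\<^sup>2 / 3 <= ?y" by simp
  have "?y <= s\<^sup>2 / 6 * 6" using tau0 by (intro mult_left_mono) auto
  thus "?y <= s\<^sup>2" by simp
  qed
  have "EX c>=s/2. c <= s & w (X c) = ?y"
  proof (rule IVT' [OF _ _ _ cw])
  have "(SUM j:{1..<n}. (e * tau j)\<^sup>2) <= (SUM j:{1..<n}. e\<^sup>2)"
  proof (rule sum_mono)
  fix j assume "j : {1..<n}"
  hence "abs (tau j) ^ 2 <= 1 ^ 2" using tau by (intro power_mono) auto
  thus "(e * tau j)\<^sup>2 <= e\<^sup>2" using e0 by (simp add: power_mult_distrib mult_left_le)
  qed
  also have "... <= real n * e\<^sup>2" by (simp add: mult_right_mono)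
  finally have "w (X (s / 2)) <= (s / 2)\<^sup>2 + s\<^sup>2 / 24 + s\<^sup>2 / 24" using ne q4s [OF smX [OF sl(1)]] unfolding wX [OF sl(1)] by linarith
  thus "w (X (s / 2)) <= ?y" using y(1) by (simp add: power_divide)
  have "s\<^sup>2 <= w (X s)" unfolding wX [OF sl(2)] using q40 [of "X s"] by (simp add: sum_nonneg)
  thus "?y <= w (X s)" using y(2) by linarith
  qed (use s0 in simp)
  then obtain c where c: "c : {s/2..s}" "w (X c) = ?y" by auto
  have "t (X c) j = tau j" if j: "j < n" for j
  proof (cases "j = 0")
  case True
  thus ?thesis unfolding True t0 c(2) using s0 by (simp add: field_simps)
  next
  case False
  thus ?thesis using tj [OF False] X(2) [OF c(1) j] e0 by (simp add: z_def)
  qed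
  moreover have "sg sig * xi (X c) 0 > 0" using X(2) [OF c(1), of 0] n1 c(1) s0 by (auto simp: z_def sg_def)
  ultimately have "ok sig tau (X c)" using X(1) [OF c(1)] by (simp add: ok_def box_def)
  thus ?thesis by blast
 qed
 define lift where "lift sig tau = (SOME x. ok sig tau x)" for sig tau
 have lift: "ok sig tau (lift sig tau)" if "ALL j<n. abs (tau j) <= 1" for sig tau
  unfolding lift_def using ex [OF that] by (rule someI_ex)
 have lc: "vdist N x y <= C * (SUM j<n. abs (tau j - tau' j))"
  if "ok sig tau x" "ok sig tau' y" "ALL j<n. abs (tau j) <= 1" "ALL j<n. abs (tau' j) <= 1" for sig tau tau' x y
  using two [of x y sig] that unfolding ok_def by simp
 show thesis
 proof (rule that [of J s e C lift])
  show "J j <= N" if "j < n" for j by (rule JN [OF that])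
  show "cone (lift sig tau) & lift sig tau a = 1 & (ALL j<n. tfun N n J q s e (lift sig tau) j = tau j) & reval L (lift sig tau) ~= 0"
  if tau: "ALL j<n. abs (tau j) <= 1" for sig tau
  proof -
  have o: "ok sig tau (lift sig tau)" by (rule lift [OF tau])
  hence "sm (lift sig tau)" using region [of "lift sig tau"] tau by (simp add: ok_def)
  hence "reval L (lift sig tau) ~= 0" using up [OF _ rho(3)] by (intro r2(2)) (simp add: sm_def)
  thus ?thesis using o by (simp add: ok_def t_def)
  qed
  show "EX sig. x = lift sig (tfun N n J q s e x)" if x: "cone x" "x a = 1" "ALL j<n. abs (tfun N n J q s e x j) <= 1" for x
  proof -
  have tx: "ALL j<n. abs (t x j) <= 1" using x(3) by (simp add: t_def)
  have "xi x 0 ~= 0" using region [OF x(1,2) tx] s0 by auto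
  hence "sg (xi x 0 > 0) * xi x 0 > 0" by (simp add: sg_def)
  hence o: "ok (xi x 0 > 0) (t x) x" using x(1,2) by (simp add: ok_def)
  have "nrm N (%i. x i - lift (xi x 0 > 0) (t x) i) <= 0"
  using lc [OF o lift [OF tx] tx tx] by simp
  hence "x i = lift (xi x 0 > 0) (t x) i" for i
  using coord_le_nrm [of i N "%i. x i - lift (xi x 0 > 0) (t x) i"] real_coneD(3) [OF x(1), of i]
  real_coneD(3) [of N X "lift (xi x 0 > 0) (t x)" i] lift [OF tx, of "xi x 0 > 0"] unfolding ok_def by (cases "i <= N") auto
  thus ?thesis unfolding t_def [symmetric] by blast
  qed
  show "vdist N (lift sig tau) (lift sig tau') <= C * (SUM j<n. abs (tau j - tau' j))"
  if "ALL j<n. abs (tau j) <= 1" "ALL j<n. abs (tau' j) <= 1" for sig tau tau'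
  by (rule lc [OF lift [OF that(1)] lift [OF that(2)] that])
  show "lift True tau ~= lift False tau'" if "ALL j<n. abs (tau j) <= 1" "ALL j<n. abs (tau' j) <= 1" for tau tau'
  using lift [OF that(1), of True] lift [OF that(2), of False] unfolding ok_def sg_def by auto
 qed (rule s0 e0 C)+
qed

end

section \<open>A hypersurface made of spheres\<close>

definition shifted :: "rvec => nat => nat => rpoly" where
 "shifted q a i = Xv i - single 0 (q i) * Xv a"

definition tform :: "nat => nat => (nat => nat) => rvec => nat => real => real => nat => nat => rpoly" where
 "tform N n J q a s e k j = (if j = 0
  then hcheb k (single 0 (6 / s\<^sup>2) * ((SUM j<n. shifted q a (J j) ^ 2 * Xv a ^ 2) + (SUM i<=N. shifted q a i ^ 4))
  - single 0 3 * Xv a ^ 4) (Xv a ^ 4)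
  else Xv a ^ (3 * k) * hcheb k (single 0 (1 / e) * shifted q a (J j)) (Xv a))"

text \<open>The product over i of sums of squares, each of which vanishes exactly where the Chebyshev images lie
on the i-th round sphere. All t_j are homogenised to degree 4, so every factor has degree 16 k.\<close>

definition sphere_form :: "nat => nat => (nat => nat) => rvec => nat => real => real => nat => rpoly" where
 "sphere_form N n J q a s e k = (PROD i<n.
  ((SUM j<=i. tform N n J q a s e k j ^ 2) - single 0 ((real i / real n)\<^sup>2) * Xv a ^ (8 * k)) ^ 2
  + Xv a ^ (8 * k) * (SUM j:{i<..<n}. tform N n J q a s e k j ^ 2))"

lemma sphere_form_forms:
 assumes a: "a <= N" and J: "!!j. j < n ==> J j <= N"
 shows "sphere_form N n J q a s e k : forms N (16 * n * k)"
proof -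
 have X: "Xv a ^ m : forms N m" for m using forms_power [OF forms_Xv [OF a], of m] by simp
 have sh: "shifted q a i : forms N 1" if "i <= N" for i
  unfolding shifted_def using that a by (intro forms_diff forms_scale forms_Xv)
 have t: "tform N n J q a s e k j : forms N (4 * k)" if "j < n" for j
 proof (cases "j = 0")
  case True
  have "shifted q a (J j) ^ 2 * Xv a ^ 2 : forms N 4" if "j < n" for j
  using forms_mult [OF forms_power [OF sh [OF J [OF that]], of 2] X [of 2]] by simp
  moreover have "shifted q a i ^ 4 : forms N 4" if "i <= N" for i using forms_power [OF sh [OF that], of 4] by simp
  ultimately have "hcheb k (single 0 (6 / s\<^sup>2) * ((SUM j<n. shifted q a (J j) ^ 2 * Xv a ^ 2) + (SUM i<=N. shifted q a i ^ 4))
  - single 0 3 * Xv a ^ 4) (Xv a ^ 4) : forms N (k * 4)"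
  by (intro hcheb_forms forms_diff forms_scale forms_add forms_sum X) auto
  thus ?thesis unfolding True tform_def by (simp only: refl if_True mult.commute [of k 4])
 next
  case False
  have "Xv a ^ (3 * k) * hcheb k (single 0 (1 / e) * shifted q a (J j)) (Xv a) : forms N (3 * k + k * 1)"
  using that a J by (intro forms_mult X hcheb_forms forms_scale sh forms_Xv)
  thus ?thesis using False by (simp add: tform_def)
 qed
 have t2: "tform N n J q a s e k j ^ 2 : forms N (8 * k)" if "j < n" for j
  using forms_power [OF t [OF that], of 2] by simp
 have "((SUM j<=i. tform N n J q a s e k j ^ 2) - single 0 ((real i / real n)\<^sup>2) * Xv a ^ (8 * k)) ^ 2
  + Xv a ^ (8 * k) * (SUM j:{i<..<n}. tform N n J q a s e k j ^ 2) : forms N (16 * k)" if i: "i < n" for i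
 proof (rule forms_add)
  have "((SUM j<=i. tform N n J q a s e k j ^ 2) - single 0 ((real i / real n)\<^sup>2) * Xv a ^ (8 * k)) ^ 2 : forms N (2 * (8 * k))"
  using i by (intro forms_power forms_diff forms_sum forms_scale X t2) auto
  thus "((SUM j<=i. tform N n J q a s e k j ^ 2) - single 0 ((real i / real n)\<^sup>2) * Xv a ^ (8 * k)) ^ 2 : forms N (16 * k)" by simp
  have "Xv a ^ (8 * k) * (SUM j:{i<..<n}. tform N n J q a s e k j ^ 2) : forms N (8 * k + 8 * k)"
  by (intro forms_mult X forms_sum t2) auto
  thus "Xv a ^ (8 * k) * (SUM j:{i<..<n}. tform N n J q a s e k j ^ 2) : forms N (16 * k)" by simp
 qed
 hence "sphere_form N n J q a s e k : forms N (SUM i<n. 16 * k)" unfolding sphere_form_def by (intro forms_prod) auto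
 thus ?thesis by (simp add: mult_ac)
qed

definition cheb_image :: "nat => nat => rvec => nat => real" where
 "cheb_image n k tau = (%j. if j < n then hcheb k (tau j) 1 else 0)"

lemma reval_shifted: "reval (shifted q a i) x = x i - q i * x a"
 by (simp only: shifted_def reval_diff reval_mult reval_const reval_Xv)

lemma reval_tform_affine:
 assumes "x a = 1" shows "reval (tform N n J q a s e k j) x = hcheb k (tfun N n J q s e x j) 1"
proof (cases "j = 0")
 case True
 thus ?thesis
  by (simp only: tform_def tfun_def wfun_def refl if_True reval_hcheb reval_diff reval_add reval_mult reval_const reval_sum
  reval_power reval_shifted reval_Xv assms power_one mult_1_right)
next
 case False
 thus ?thesis
  by (simp add: tform_def tfun_def reval_hcheb reval_mult reval_power reval_shifted assms)
qed

lemma sphere_form_zero_affine: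
 assumes "x a = 1"
 shows "reval (sphere_form N n J q a s e k) x = 0 \<longleftrightarrow> (EX i<n. cheb_image n k (tfun N n J q s e x) : round_sphere n i)"
proof -
 let ?h = "%j. hcheb k (tfun N n J q s e x j) 1"
 have "reval (sphere_form N n J q a s e k) x =
  (PROD i<n. ((SUM j<=i. (?h j)\<^sup>2) - (real i / real n)\<^sup>2)\<^sup>2 + (SUM j:{i<..<n}. (?h j)\<^sup>2))"
  by (simp only: sphere_form_def reval_prod reval_add reval_power reval_diff reval_sum reval_mult reval_const reval_Xv
  reval_tform_affine [of x a, OF assms] assms power_one mult_1_right mult_1_left)
 hence "reval (sphere_form N n J q a s e k) x = 0 \<longleftrightarrow>
  (EX i<n. ((SUM j<=i. (?h j)\<^sup>2) - (real i / real n)\<^sup>2)\<^sup>2 + (SUM j:{i<..<n}. (?h j)\<^sup>2) = 0)" by auto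
 also have "... \<longleftrightarrow> (EX i<n. cheb_image n k (tfun N n J q s e x) : round_sphere n i)"
 proof (intro ex_cong1 conj_cong refl)
  fix i assume i: "i < n"
  have "(SUM j<=i. (cheb_image n k (tfun N n J q s e x) j)\<^sup>2) = (SUM j<=i. (?h j)\<^sup>2)"
  by (rule sum.cong) (use i in \<open>auto simp: cheb_image_def\<close>)
  moreover have "(ALL j>i. cheb_image n k (tfun N n J q s e x) j = 0) \<longleftrightarrow> (SUM j:{i<..<n}. (?h j)\<^sup>2) = 0"
  by (subst sum_nonneg_eq_0_iff) (auto simp: cheb_image_def)
  moreover have "((SUM j<=i. (?h j)\<^sup>2) - (real i / real n)\<^sup>2)\<^sup>2 + (SUM j:{i<..<n}. (?h j)\<^sup>2) = 0 \<longleftrightarrow>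
  (SUM j<=i. (?h j)\<^sup>2) = (real i / real n)\<^sup>2 & (SUM j:{i<..<n}. (?h j)\<^sup>2) = 0"
  by (subst add_nonneg_eq_0_iff) (auto simp: sum_nonneg)
  ultimately show "((SUM j<=i. (?h j)\<^sup>2) - (real i / real n)\<^sup>2)\<^sup>2 + (SUM j:{i<..<n}. (?h j)\<^sup>2) = 0 \<longleftrightarrow>
  cheb_image n k (tfun N n J q s e x) : round_sphere n i" by (simp only: round_sphere_def mem_Collect_eq)
 qed
 finally show ?thesis .
qed

text \<open>On the hyperplane x a = 0 the radius and the last summand disappear, as they carry powers of x a, and
the form t_0 becomes a power of a positive multiple of the sum of fourth powers.\<close>

lemma sphere_form_nonzero_at_infinity:
 assumes k: "k >= 1" and s: "s > 0" and xa: "x a = 0" and b: "b <= N" "x b ~= 0"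
 shows "reval (sphere_form N n J q a s e k) x ~= 0"
proof -
 obtain k' where k': "k = Suc k'" using k by (cases k) auto
 have "(SUM i<=N. x i ^ 4) > 0" by (rule sum_pos2 [of _ b]) (use b in auto)
 hence B: "6 / s\<^sup>2 * (SUM i<=N. x i ^ 4) ~= 0" using s by simp
 have "reval (tform N n J q a s e k 0) x = hcheb k (6 / s\<^sup>2 * (SUM i<=N. x i ^ 4)) 0"
  by (simp add: tform_def reval_hcheb reval_diff reval_add reval_mult reval_sum reval_power reval_shifted xa del: times_divide_eq_left)
 hence t0: "reval (tform N n J q a s e k 0) x ~= 0" unfolding k' hcheb_0 using B by simp
 have "reval (((SUM j<=i. tform N n J q a s e k j ^ 2) - single 0 ((real i / real n)\<^sup>2) * Xv a ^ (8 * k)) ^ 2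
  + Xv a ^ (8 * k) * (SUM j:{i<..<n}. tform N n J q a s e k j ^ 2)) x ~= 0" for i
 proof -
  have "(SUM j<=i. (reval (tform N n J q a s e k j) x)\<^sup>2) > 0" by (rule sum_pos2 [of _ 0]) (use t0 in auto)
  thus ?thesis using k by (simp add: reval_add reval_power reval_diff reval_sum reval_mult xa power_0_left)
 qed
 thus ?thesis unfolding sphere_form_def reval_prod by simp
qed

lemma round_sphere_disjoint:
 assumes "x : round_sphere n i" "x : round_sphere n i'" "i < n" "i' < n" shows "i = i'"
proof -
 have "~ i < j" if x: "x : round_sphere n i" "x : round_sphere n j" "j < n" for i j
 proof
  assume ij: "i < j"
  have "(SUM l<=j. (x l)\<^sup>2) = (SUM l<=i. (x l)\<^sup>2)"
  by (rule sum.mono_neutral_right) (use ij x(1) in \<open>auto simp: round_sphere_def\<close>)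
  hence "(real j / real n)\<^sup>2 = (real i / real n)\<^sup>2" using x by (simp add: round_sphere_def)
  thus False using ij x(3) by (simp add: power_divide)
 qed
 thus ?thesis using assms by (metis linorder_neqE_nat)
qed

text \<open>A copy of the i-th sphere is given by a sheet sig and a choice kap of one Chebyshev branch in each of
the n coordinates.\<close>

theorem (in smooth_variety) sphere_hypersurface:
 assumes q: "cone q" "q a = 1" and n1: "n >= 1" and L: "L : forms N m" "reval L q ~= 0" and k: "k >= 1"
 shows "EX G:forms N (16 * n * k). EX S :: bool \<times> nat \<times> (nat => nat) => (nat => rvec) set.
  let I = UNIV \<times> {..<n} \<times> ({..<n} \<rightarrow>\<^sub>E {..<k}) in
  reval G q ~= 0 & section_locus G = (UN io:I. S io) & (ALL io:I. compact (S io) & S io Int section_locus L = {} &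
  top_of_set (round_sphere n (fst (snd io))) homeomorphic_space top_of_set (S io)) &
  (ALL io:I. ALL io':I. io ~= io' --> S io Int S io' = {})"
proof -
 obtain J s e lift C where J: "!!j. j < n ==> J j <= N" and se: "s > 0" "e > 0" "C > 0"
  and lift0: "!!sig tau. ALL j<n. abs (tau j) <= 1 ==> cone (lift sig tau) & lift sig tau a = 1 &
  (ALL j<n. tfun N n J q s e (lift sig tau) j = tau j) & reval L (lift sig tau) ~= 0"
  and sheet: "!!x. cone x ==> x a = 1 ==> ALL j<n. abs (tfun N n J q s e x j) <= 1 ==> EX sig. x = lift sig (tfun N n J q s e x)"
  and lip: "!!sig tau tau'. ALL j<n. abs (tau j) <= 1 ==> ALL j<n. abs (tau' j) <= 1 ==>
  vdist N (lift sig tau) (lift sig tau') <= C * (SUM j<n. abs (tau j - tau' j))"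
  and pm: "!!tau tau'. ALL j<n. abs (tau j) <= 1 ==> ALL j<n. abs (tau' j) <= 1 ==> lift True tau ~= lift False tau'"
  by (rule sheets [OF q n1 L]) blast
 define t where "t = tfun N n J q s e"
 have lift: "cone (lift sig tau)" "lift sig tau a = 1" "!!j. j < n ==> t (lift sig tau) j = tau j" "reval L (lift sig tau) ~= 0"
  if "ALL j<n. abs (tau j) <= 1" for sig tau using lift0 [OF that] by (simp_all add: t_def)
 define G where "G = sphere_form N n J q a s e k"
 have aN: "a <= N" using real_coneD(3) [OF q(1), of a] q(2) by (metis not_le zero_neq_one)
 have Gf: "G : forms N (16 * n * k)" unfolding G_def by (rule sphere_form_forms [OF aN J])
 define br where "br kap x = (%j. if j < n then branch k (kap j) (x j) else 0)" for kap :: "nat => nat" and x :: rvec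
 have brc: "ALL j<n. abs (br kap x j) <= 1" for kap x by (simp add: br_def branch_abs_le)
 have chb: "cheb_image n k (br kap x) = x" if x: "x : round_sphere n i" "i < n" for kap x i
 proof
  fix j
  show "cheb_image n k (br kap x) j = x j"
  using hcheb_branch [OF k, of "x j" "kap j"] round_sphere_coord [OF x, of j] x
  by (cases "j < n") (auto simp: cheb_image_def br_def round_sphere_def)
 qed
 define g where "g sig kap x = ver N (lift sig (br kap x))" for sig kap x
 define S where "S io = g (fst io) (snd (snd io)) ` round_sphere n (fst (snd io))" for io :: "bool \<times> nat \<times> (nat => nat)"
 have ti: "cheb_image n k (t (lift sig (br kap x))) = x" if x: "x : round_sphere n i" "i < n" for sig kap x i
  using chb [OF x, of kap] lift(3) [OF brc] by (simp add: cheb_image_def cong: if_cong)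
 have vinj: "x = y" if xy: "cone x" "x a = 1" "cone y" "y a = 1" "ver N x = ver N y" for x y
  using ver_eq_imp_proportional(2) [OF xy(5) _ aN real_coneD(4) [OF xy(3)]] xy(2,4) by (simp add: fun_eq_iff)
 have same: "i = i' & x = x' & sig = sig' & (ALL j<n. branch k (kap j) (x j) = branch k (kap' j) (x j))"
  if x: "x : round_sphere n i" "i < n" and x': "x' : round_sphere n i'" "i' < n" and eq: "g sig kap x = g sig' kap' x'"
  for x x' i i' sig sig' kap kap'
 proof -
  have l: "lift sig (br kap x) = lift sig' (br kap' x')"
  using eq unfolding g_def by (intro vinj lift(1,2) brc)
  hence xx: "x = x'" using ti [OF x] ti [OF x'] by metis
  hence "i = i'" using round_sphere_disjoint x x' by blast
  moreover have "sig = sig'" using l pm [OF brc brc] by (metis (full_types))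
  moreover have "br kap x j = br kap' x' j" if "j < n" for j using lift(3) [OF brc that] l by metis
  ultimately show ?thesis using xx by (auto simp: br_def)
 qed
 have gcont: "continuous_on (round_sphere n i) (g sig kap)" if i: "i < n" for i sig kap
 proof -
  have "continuous_on {tau::nat => real. ALL j<n. abs (tau j) <= 1} (lift sig)"
  proof (rule continuous_on_coordinatewise_then_product)
  fix l show "continuous_on {tau::nat => real. ALL j<n. abs (tau j) <= 1} (%tau. lift sig tau l)"
  proof (rule lipschitz_continuous_on [of _ _ C n])
  fix tau tau' assume tau: "tau : {tau::nat => real. ALL j<n. abs (tau j) <= 1}" "tau' : {tau::nat => real. ALL j<n. abs (tau j) <= 1}"
  have "abs (lift sig tau l - lift sig tau' l) <= vdist N (lift sig tau) (lift sig tau')"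
  using coord_le_nrm [of l N "%i. lift sig tau i - lift sig tau' i"] real_coneD(3) [OF lift(1), of tau l sig]
  real_coneD(3) [OF lift(1), of tau' l sig] tau by (cases "l <= N") auto
  also have "... <= C * (SUM j<n. abs (tau j - tau' j))" using tau by (intro lip) auto
  also have "... <= C * nrm n (%j. tau j - tau' j)" unfolding nrm_def using se(3) by (intro mult_left_mono sum_mono2) auto
  finally show "abs (lift sig tau l - lift sig tau' l) <= C * nrm n (%j. tau j - tau' j)" .
  qed
  qed
  moreover have "continuous_on (round_sphere n i) (br kap)"
  proof (rule continuous_on_coordinatewise_then_product)
  fix j
  have "continuous_on (round_sphere n i) (%x. branch k (kap j) (x j))"
  proof (rule continuous_on_compose2 [OF continuous_on_branch continuous_on_coord])
  show "(%x. x j) ` round_sphere n i <= {-1..1}" 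
  proof (intro subsetI, elim imageE)
  fix y x assume "y = x j" "x : round_sphere n i"
  hence "abs y < 1" using round_sphere_coord [OF _ i] by blast
  thus "y : {-1..1}" by auto
  qed
  qed
  thus "continuous_on (round_sphere n i) (%x. br kap x j)" by (cases "j < n") (simp_all add: br_def)
  qed
  ultimately have "continuous_on (round_sphere n i) (%x. lift sig (br kap x))"
  by (rule continuous_on_compose2) (use brc in auto)
  thus ?thesis unfolding g_def
  proof (rule continuous_on_compose2 [OF continuous_on_ver])
  have "nsq N (lift sig (br kap x)) ~= 0" for x using nsq_pos [OF aN, of "lift sig (br kap x)"] lift(2) [OF brc] by simp
  thus "(%x. lift sig (br kap x)) ` round_sphere n i <= {y. nsq N y ~= 0}" by blast
  qed
 qed
 let ?I = "(UNIV :: bool set) \<times> {..<n} \<times> ({..<n} \<rightarrow>\<^sub>E {..<k})"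
 have cover: "section_locus G = (UN io:?I. S io)"
 proof (intro subset_antisym subsetI)
  fix v assume "v : section_locus G"
  then obtain y where y: "v = ver N y" "cone y" "reval G y = 0" by blast
  have ya: "y a ~= 0"
  proof
  assume "y a = 0"
  moreover obtain b where "b <= N" "y b ~= 0" using real_coneD(4) [OF y(2)] by blast
  ultimately have "reval G y ~= 0" unfolding G_def by (intro sphere_form_nonzero_at_infinity [OF k se(1)])
  thus False using y(3) by simp
  qed
  define x where "x = (%i. (1 / y a) * y i)"
  have x: "cone x" "x a = 1" "ver N x = v" "reval G x = 0"
  using real_cone_scale [OF y(2), of "1 / y a"] ya ver_scale [of "1 / y a" N y] reval_scale [OF Gf, of "1 / y a" y] y(1,3)
  by (simp_all add: x_def)
  obtain i where i: "i < n" "cheb_image n k (t x) : round_sphere n i"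
  using x(4) unfolding G_def sphere_form_zero_affine [of x a, OF x(2)] t_def by blast
  define u where "u = cheb_image n k (t x)"
  have uj: "u j = hcheb k (t x j) 1" if "j < n" for j using that by (simp add: u_def cheb_image_def)
  have u1: "abs (u j) < 1" for j using round_sphere_coord i unfolding u_def by blast
  have t1: "abs (t x j) <= 1" if "j < n" for j
  proof (rule ccontr)
  assume "~ abs (t x j) <= 1"
  hence "abs (hcheb k (t x j) 1) >= 1" by (intro hcheb_ge_1) simp
  thus False using u1 [of j] uj [OF that] by simp
  qed
  obtain sig where sig: "x = lift sig (t x)" using sheet [OF x(1,2)] t1 unfolding t_def by blast
  have "EX kap<k. t x j = branch k kap (u j)" if "j < n" for j
  using branch_exists [OF k t1 [OF that]] u1 [of j] uj [OF that] by simp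
  then obtain kap0 where kap0: "!!j. j < n ==> kap0 j < k & t x j = branch k (kap0 j) (u j)" by metis
  define kap where "kap = restrict kap0 {..<n}"
  have kapI: "kap : {..<n} \<rightarrow>\<^sub>E {..<k}" using kap0 by (auto simp: kap_def)
  have tb: "t x j = br kap u j" if "j < n" for j using kap0 [OF that] that by (simp add: br_def kap_def)
  have "nrm N (%i. lift sig (t x) i - lift sig (br kap u) i) <= 0"
  using lip [of "t x" "br kap u" sig] t1 brc tb by simp
  hence "lift sig (t x) i = lift sig (br kap u) i" for i
  using coord_le_nrm [of i N "%i. lift sig (t x) i - lift sig (br kap u) i"] real_coneD(3) [OF x(1), of i] sig
  real_coneD(3) [OF lift(1) [OF brc], of i sig kap u] by (cases "i <= N") auto
  hence "x = lift sig (br kap u)" using sig by (simp add: fun_eq_iff)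
  hence "v = g sig kap u" using x(3) by (simp add: g_def)
  hence "v : S (sig, i, kap)" using i(2) by (simp add: S_def u_def)
  thus "v : (UN io:?I. S io)" using i(1) kapI by blast
 next
  fix v assume "v : (UN io:?I. S io)"
  then obtain sig i kap x where v: "i < n" "x : round_sphere n i" "v = g sig kap x" by (auto simp: S_def)
  have "reval G (lift sig (br kap x)) = 0"
  unfolding G_def sphere_form_zero_affine [of "lift sig (br kap x)" a, OF lift(2) [OF brc]] t_def [symmetric] ti [OF v(2,1)] using v by blast
  thus "v : section_locus G" unfolding v(3) g_def using lift(1) [OF brc] by blast
 qed
 have piece: "compact (S io) & S io Int section_locus L = {} &
  top_of_set (round_sphere n (fst (snd io))) homeomorphic_space top_of_set (S io)" if ioI: "io : ?I" for io
 proof -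
  obtain sig i kap where io: "io = (sig, i, kap)" "i < n" using ioI by auto
  have c: "compact (round_sphere n i)" by (rule compact_round_sphere [OF io(2)])
  have Sio: "S io = g sig kap ` round_sphere n i" by (simp add: S_def io)
  have "homeomorphic_map (top_of_set (round_sphere n i)) (top_of_set (S io)) (g sig kap)"
  proof (rule continuous_imp_homeomorphic_map)
  show "continuous_map (top_of_set (round_sphere n i)) (top_of_set (S io)) (g sig kap)" using gcont [OF io(2)] Sio by auto
  show "compact_space (top_of_set (round_sphere n i))" using c by (simp add: compact_space_subtopology)
  show "Hausdorff_space (top_of_set (S io))" by (simp add: Hausdorff_space_subtopology)
  show "g sig kap ` topspace (top_of_set (round_sphere n i)) = topspace (top_of_set (S io))" by (simp add: Sio)
  show "inj_on (g sig kap) (topspace (top_of_set (round_sphere n i)))"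
  unfolding topspace_euclidean_subtopology by (rule inj_onI) (use same io(2) in blast)
  qed
  hence hs: "top_of_set (round_sphere n i) homeomorphic_space top_of_set (S io)"
  by (rule homeomorphic_map_imp_homeomorphic_space)
  have av: "S io Int section_locus L = {}"
  proof (rule equals0I)
  fix v assume "v : S io Int section_locus L"
  then obtain x y where v: "v = ver N (lift sig (br kap x))" "v = ver N y" "cone y" "reval L y = 0"
  unfolding Sio g_def by blast
  have eq: "ver N (lift sig (br kap x)) = ver N y" using v(1,2) by simp
  have la: "lift sig (br kap x) a ~= 0" unfolding lift(2) [OF brc] by simp
  note pr = ver_eq_imp_proportional [OF eq la aN real_coneD(4) [OF v(3)]]
  have "y = (%i. y a * lift sig (br kap x) i)"
  proof
  fix i show "y i = y a * lift sig (br kap x) i" using pr(2) [of i] unfolding lift(2) [OF brc] div_by_1 .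
  qed
  hence "reval L y = reval L (%i. y a * lift sig (br kap x) i)" by (rule arg_cong)
  also have "... = y a ^ m * reval L (lift sig (br kap x))" by (rule reval_scale [OF L(1)])
  finally have "reval L y = y a ^ m * reval L (lift sig (br kap x))" .
  thus False using v(4) pr(1) lift(4) [OF brc] by simp
  qed
  have "compact (S io)" unfolding Sio by (rule compact_continuous_image [OF gcont [OF io(2)] c])
  thus ?thesis using av hs unfolding io(1) fst_conv snd_conv by blast
 qed
 have disj: "S io Int S io' = {}" if io: "io : ?I" "io' : ?I" "io ~= io'" for io io'
 proof (rule equals0I)
  fix v assume v: "v : S io Int S io'"
  obtain sig i kap where 1: "io = (sig, i, kap)" "i < n" "kap : {..<n} \<rightarrow>\<^sub>E {..<k}" using io(1) by auto
  obtain sig' i' kap' where 2: "io' = (sig', i', kap')" "i' < n" "kap' : {..<n} \<rightarrow>\<^sub>E {..<k}" using io(2) by auto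
  obtain x x' where x: "x : round_sphere n i" "x' : round_sphere n i'" "g sig kap x = g sig' kap' x'"
  using v by (auto simp: S_def 1(1) 2(1))
  have e: "i = i'" "sig = sig'" "ALL j<n. branch k (kap j) (x j) = branch k (kap' j) (x j)"
  using same [OF x(1) 1(2) x(2) 2(2) x(3)] by auto
  have "kap = kap'"
  proof (rule PiE_ext [OF 1(3) 2(3)])
  fix j assume j: "j : {..<n}"
  hence "kap j < k" "kap' j < k" using 1(3) 2(3) by auto
  thus "kap j = kap' j" using e(3) j round_sphere_coord [OF x(1) 1(2)] by (intro branch_inj [of _ k _ "x j"]) auto
  qed
  thus False using e(1,2) 1(1) 2(1) io(3) by simp
 qed
 show ?thesis
  unfolding Let_def
 proof (intro bexI [of _ G] exI [of _ S] conjI)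
  show "reval G q ~= 0"
  proof
  assume "reval G q = 0"
  then obtain i where i: "i < n" "cheb_image n k (t q) : round_sphere n i"
  unfolding G_def sphere_form_zero_affine [of q a, OF q(2)] t_def by blast
  have "t q 0 = - 3" by (simp add: t_def tfun_def wfun_def)
  thus False using round_sphere_coord [OF i(2,1), of 0] hcheb_ge_1 [of "-3" k] n1 by (simp add: cheb_image_def)
  qed
  show "ALL io:?I. compact (S io) & S io Int section_locus L = {} &
  top_of_set (round_sphere n (fst (snd io))) homeomorphic_space top_of_set (S io)" by (rule ballI) (rule piece)
  show "ALL io:?I. ALL io':?I. io ~= io' --> S io Int S io' = {}" by (intro ballI impI) (rule disj)
 qed (rule cover Gf)+
qed

section \<open>Betti numbers of the constructed divisors\<close>

text \<open>The homeomorphism transports the decomposition into V and the spheres to T; V only has to have finite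
homology, and each sphere of dimension i carries a non-bounding cycle of degree i.\<close>

lemma betti2_ge_sphere_pieces:
 fixes T :: "'a topology" and M V :: "(nat => rvec) set" and S :: "'i => (nat => rvec) set"
  and dg :: "'i => nat"
 assumes h: "homeomorphic_map T (top_of_set M) h" and M: "M = V Un (UN io:I. S io)" and fI: "finite I"
  and V: "compact V" "finq i (top_of_set V) V V"
  and S: "!!io. io : I ==> compact (S io)" "!!io. io : I ==> S io Int V = {}"
  "!!io io'. io : I ==> io' : I ==> io ~= io' ==> S io Int S io' = {}"
  and sph: "!!io. io : I ==> dg io < n"
  "!!io. io : I ==> top_of_set (round_sphere n (dg io)) homeomorphic_space top_of_set (S io)"
 shows "card {io:I. dg io = i} <= betti2 i T"
proof -
 obtain g where hg: "homeomorphic_maps T (top_of_set M) h g" using h by (auto simp: homeomorphic_map_maps)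
 have ch: "continuous_map T (top_of_set M) h" and cg: "continuous_map (top_of_set M) T g"
  and gh: "!!x. x : topspace T ==> g (h x) = x" and hgv: "!!v. v : M ==> h (g v) = v"
  using hg by (auto simp: homeomorphic_maps_def)
 have hM: "h x : M" if "x : topspace T" for x using ch that by (auto simp: continuous_map_def)
 define R where "R io = {x : topspace T. h x : (case io of None => V | Some io => S io)}" for io
 let ?I = "insert None (Some ` I)"
 have sub: "homeomorphic_map (subtop T {x : topspace T. h x : A}) (top_of_set A) h" if A: "A <= M" for A
 proof -
  have "homeomorphic_map (subtop T {x : topspace T. h x : A}) (subtop (top_of_set M) A) h"
  proof (rule homeomorphic_map_subtopologies [OF h])
  have "h ` topspace T = M" using homeomorphic_imp_surjective_map [OF h] by simp
  thus "h ` (topspace T Int {x : topspace T. h x : A}) = topspace (top_of_set M) Int A" using A by auto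
  qed
  moreover have "subtop (top_of_set M) A = top_of_set A" using A by (simp add: subtopology_subtopology Int_absorb1)
  ultimately show ?thesis by simp
 qed
 have hs: "top_of_set (round_sphere n (dg io)) homeomorphic_space subtop T (R (Some io))" if io: "io : I" for io
 proof -
  have "S io <= M" using M io by blast
  hence "subtop T (R (Some io)) homeomorphic_space top_of_set (S io)"
  unfolding R_def option.case by (rule homeomorphic_map_imp_homeomorphic_space [OF sub])
  thus ?thesis using sph(2) [OF io] homeomorphic_space_sym homeomorphic_space_trans by blast
 qed
 interpret pieces T ?I R
 proof
  show "finite ?I" using fI by simp
  show "closedin T (R io)" if "io : ?I" for io
  proof -
  define A where "A = (case io of None => V | Some io => S io)"
  have "compact A" "A <= M" using that V(1) S(1) M by (auto simp: A_def)
  hence "closedin (top_of_set M) A" by (intro closed_subset compact_imp_closed)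
  thus ?thesis unfolding R_def A_def [symmetric] by (rule closedin_continuous_map_preimage [OF ch])
  qed
  show "R io Int R io' = {}" if "io : ?I" "io' : ?I" "io ~= io'" for io io'
  using that S(2,3) unfolding R_def by (fastforce split: option.splits)
  show "topspace T = (UN io:?I. R io)" using hM unfolding M by (auto simp: R_def)
 qed
 have "card (Some ` {io:I. dg io = i}) <= betti2 i T"
 proof (rule betti2_ge_pieces)
  fix io assume "io : ?I"
  then consider "io = None" | io' where "io' : I" "io = Some io'" by blast
  thus "finq i T (R io) (R io)"
  proof cases
  case 1
  have VM: "V <= M" using M by blast
  have RV: "R None = {x : topspace T. h x : V}" by (simp add: R_def)
  have tV: "subtop (top_of_set V) V = top_of_set V" by (simp add: subtopology_subtopology)
  have "finq i T (R None) (R None)"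
  proof (rule finq_transport [OF V(2)])
  show "continuous_map (subtop T (R None)) (subtop (top_of_set V) V) h"
  unfolding RV tV by (rule homeomorphic_imp_continuous_map [OF sub [OF VM]])
  have "continuous_map (top_of_set V) T g" using continuous_map_from_subtopology_mono [OF cg VM] .
  moreover have "g v : R None" if "v : V" for v
  using that VM hgv cg by (auto simp: RV continuous_map_def)
  ultimately show "continuous_map (subtop (top_of_set V) V) (subtop T (R None)) g"
  unfolding tV continuous_map_in_subtopology by auto
  qed (use gh in blast)
  thus ?thesis using 1 by simp
  next
  case 2
  have "finq i T (R (Some io')) (R (Some io'))"
  by (rule hom01_finq [OF homology_sphere_like(1) [OF sph(1) [OF 2(1)] hs [OF 2(1)]] order_refl])
  thus ?thesis using 2(2) by simp
  qed
 next
  show "Some ` {io:I. dg io = i} <= ?I" by blast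
  fix io assume "io : Some ` {io:I. dg io = i}"
  then obtain io' where io': "io' : I" "dg io' = i" "io = Some io'" by blast
  show "EX g:cycles2 i (subtop T (R io)). g ~: boundaries2 i (subtop T (R io))"
  using homology_sphere_like(2) [OF sph(1) [OF io'(1)] hs [OF io'(1)]] unfolding io'(2,3) .
 qed
 thus ?thesis by (simp add: card_image)
qed

theorem theorem1p1:
  fixes N n :: nat and X :: "point set" and D :: divisor
  assumes "real_variety N X"
    and "variety_dim N X = n"
    and "real_divisor N X D"
    and "very_ample N X D"
  shows "\<exists>c::real. c > 0 \<and> (\<exists>m0::nat. \<forall>m\<ge>m0. \<exists>Z \<in> linear_system N X (multiple m D).
    \<forall>i<n. real (betti2 i (subtopology (proj_topology N) (real_locus (support N X Z))))
       \<ge> c * real m ^ n)"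
proof -
 obtain r phi a E where emb: "real_embedding N X r phi" and hyp: "hyperplane_pullback N X r phi a E" and DE: "lin_equiv N X D E"
  using assms(4) unfolding very_ample_def by blast
 have irr: "real_irreducible N X" and ne: "real_locus X ~= {}" using assms(1) by (simp_all add: real_variety_def)
 interpret embedded N r X phi using irr emb by unfold_locales
 interpret Y: smooth_variety r n "phi ` X" by (rule smooth_image [OF assms(1,2)])
 have divisor: "EX Z:linear_system N X (multiple m D). support N X Z = {P : X. vanishes_at G (phi P)}"
  if G: "G : forms r m" "m >= 1" and y: "Y.cone y" "reval G y ~= 0" for G m y
 proof -
  obtain P where P: "P : X" "proj_point (cx y) = phi P" using real_coneD(2) [OF y(1)] by blast
  have "~ vanishes_at G (phi P)" unfolding P(2) [symmetric] vanishes_at_proj_point [OF G(1)] using y(2) by (simp add: peval_cx)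
  then obtain Z where "Z : linear_system N X (multiple m D)" "support N X Z = {P : X. vanishes_at G (phi P)}"
  by (rule linear_system_form [OF hyp DE assms(3) G P(1)])
  thus ?thesis by blast
 qed
 \<comment> \<open>The zero form has the whole of X as its zero set, so that the model also yields a real point of Y.\<close>
 obtain q0 where q0: "Y.cone q0"
 proof -
  obtain h where "homeomorphic_map (subtop (proj_topology N) (real_locus {P : X. vanishes_at 0 (phi P)})) (top_of_set (Y.section_locus 0)) h"
  using real_locus_homeomorphic [OF forms_0] by blast
  hence "h ` topspace (subtop (proj_topology N) (real_locus {P : X. vanishes_at 0 (phi P)})) = Y.section_locus 0"
  by (simp only: homeomorphic_imp_surjective_map topspace_euclidean_subtopology)
  moreover have "real_locus {P : X. vanishes_at 0 (phi P)} = real_locus X" by (simp add: vanishes_at_def)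
  moreover have "topspace (subtop (proj_topology N) (real_locus X)) = real_locus X"
  using Xsub by (auto simp: topspace_proj_topology real_locus_def)
  ultimately have "Y.section_locus 0 ~= {}" using ne by auto
  thus thesis using that by blast
 qed
 obtain b where b: "b <= r" "q0 b ~= 0" using real_coneD(4) [OF q0] by blast
 define q where "q = (%i. (1 / q0 b) * q0 i)"
 have q: "Y.cone q" "q b = 1" using real_cone_scale [OF q0, of "1 / q0 b"] b(2) by (simp_all add: q_def)
 show ?thesis
 proof (cases "n = 0")
  case True
  show ?thesis
  proof (intro exI [of _ 1] conjI allI impI)
  fix m :: nat assume m: "1 <= m"
  have "Xv b ^ m : forms r (m * 1)" by (rule forms_power [OF forms_Xv [OF b(1)]])
  moreover have "reval (Xv b ^ m) q ~= 0" using q(2) by (simp add: reval_power)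
  ultimately obtain Z where "Z : linear_system N X (multiple m D)" using divisor [of "Xv b ^ m" m q] m q(1) by auto
  thus "EX Z:linear_system N X (multiple m D). ALL i<n. real (betti2 i (subtop (proj_topology N) (real_locus (support N X Z)))) >= 1 * real m ^ n"
  using True by auto
  qed simp
 next
  case False
  hence n1: "n >= 1" by simp
  obtain L where L: "L : forms r 1" "reval L q ~= 0" and reg: "!!y. Y.cone y ==> EX a<=r. y a ~= 0 & Y.regular L (%i. y i / y a)"
  by (rule Y.exists_regular_section [OF q(1)]) blast
  define D0 where "D0 = 16 * n"
  have D0: "D0 >= 1" using n1 by (simp add: D0_def)
  show ?thesis
  proof (intro exI [of _ "1 / (2 * real D0) ^ n"] exI [of _ "D0 + 1"] conjI allI impI)
  show "1 / (2 * real D0) ^ n > 0" using D0 by simp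
  fix m assume m: "D0 + 1 <= m"
  \<comment> \<open>With m - 1 in place of m the exponent d of L is positive, so that L always divides H.\<close>
  define k where "k = (m - 1) div D0"
  define d where "d = m - D0 * k"
  have "D0 * k <= m - 1" unfolding k_def by (rule times_div_less_eq_dividend)
  hence d: "m = d + D0 * k" "d >= 1" using m unfolding d_def by linarith+
  have k: "k >= 1" using div_le_mono [of D0 "m - 1" D0] m D0 unfolding k_def by simp
  have "m - 1 < D0 * (k + 1)" unfolding k_def using dividend_less_times_div [of D0 "m - 1"] D0 by simp
  hence "m <= D0 * (k + 1)" by linarith
  also have "... <= 2 * D0 * k" using k by simp
  finally have "real m <= real (2 * D0 * k)" by (simp only: of_nat_le_iff)
  hence "real m <= 2 * real D0 * real k" by simp
  hence km: "1 / (2 * real D0) ^ n * real m ^ n <= real (k ^ n)"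
  using power_mono [of "real m / (2 * real D0)" "real k" n] D0 by (simp add: power_divide divide_le_eq mult_ac)
  define PE where "PE = ({..<n} \<rightarrow>\<^sub>E {..<k})"
  have PE: "finite PE" "card PE = k ^ n" unfolding PE_def by (auto simp: card_PiE intro: finite_PiE)
  obtain G and S :: "bool \<times> nat \<times> (nat => nat) => (nat => rvec) set" where G: "G : forms r (16 * n * k)" "reval G q ~= 0"
  and S: "Y.section_locus G = (UN io:UNIV \<times> {..<n} \<times> PE. S io)"
  "ALL io:UNIV \<times> {..<n} \<times> PE. compact (S io) & S io Int Y.section_locus L = {} &
  top_of_set (round_sphere n (fst (snd io))) homeomorphic_space top_of_set (S io)"
  "ALL io:UNIV \<times> {..<n} \<times> PE. ALL io':UNIV \<times> {..<n} \<times> PE. io ~= io' --> S io Int S io' = {}"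
  using Y.sphere_hypersurface [OF q n1 L k, unfolded Let_def, folded PE_def] by (elim bexE exE conjE) (rule that)
  let ?I = "(UNIV :: bool set) \<times> {..<n} \<times> PE"
  have fI: "finite ?I" by (intro finite_cartesian_product PE) auto
  define H where "H = L ^ d * G"
  have "H : forms r (d * 1 + 16 * n * k)" unfolding H_def by (intro forms_mult forms_power L(1) G(1))
  hence Hf: "H : forms r m" using d(1) by (simp add: D0_def)
  have "reval H q ~= 0" using L(2) G(2) by (simp add: H_def reval_mult reval_power)
  then obtain Z where Z: "Z : linear_system N X (multiple m D)" "support N X Z = {P : X. vanishes_at H (phi P)}"
  using divisor [OF Hf _ q(1)] m by auto
  obtain h where h: "homeomorphic_map (subtop (proj_topology N) (real_locus (support N X Z))) (top_of_set (Y.section_locus H)) h"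
  using real_locus_homeomorphic [OF Hf] unfolding Z(2) by blast
  have "Y.section_locus H = Y.section_locus L Un Y.section_locus G"
  using d(2) unfolding H_def by (auto simp: reval_mult reval_power)
  hence M: "Y.section_locus H = Y.section_locus L Un (UN io:?I. S io)" unfolding S(1) .
  have "1 / (2 * real D0) ^ n * real m ^ n <= real (betti2 i (subtop (proj_topology N) (real_locus (support N X Z))))" if i: "i < n" for i
  proof -
  have "card {io:?I. fst (snd io) = i} <= betti2 i (subtop (proj_topology N) (real_locus (support N X Z)))"
  proof (rule betti2_ge_sphere_pieces [OF h M fI Y.compact_section_locus [OF L(1)] Y.regular_section_finq [OF L(1) reg]])
  show "fst (snd io) < n" if "io : ?I" for io using that by auto
  show "compact (S io)" if "io : ?I" for io using bspec [OF S(2) that] by (rule conjunct1)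
  show "S io Int Y.section_locus L = {}" if "io : ?I" for io
  using bspec [OF S(2) that] by (rule conjunct1 [OF conjunct2])
  show "top_of_set (round_sphere n (fst (snd io))) homeomorphic_space top_of_set (S io)" if "io : ?I" for io
  using bspec [OF S(2) that] by (rule conjunct2 [OF conjunct2])
  show "S io Int S io' = {}" if "io : ?I" "io' : ?I" "io ~= io'" for io io'
  using bspec [OF bspec [OF S(3) that(1)] that(2)] that(3) by (rule mp)
  qed
  moreover have "{io:?I. fst (snd io) = i} = UNIV \<times> {i} \<times> PE" using i by auto
  hence "card {io:?I. fst (snd io) = i} = 2 * k ^ n" by (simp add: card_cartesian_product PE)
  ultimately have "k ^ n <= betti2 i (subtop (proj_topology N) (real_locus (support N X Z)))" by linarith
  thus ?thesis using km of_nat_mono order_trans by blast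
  qed
  thus "EX Z:linear_system N X (multiple m D). ALL i<n.
  real (betti2 i (subtop (proj_topology N) (real_locus (support N X Z)))) >= 1 / (2 * real D0) ^ n * real m ^ n"
  using Z(1) by blast
  qed
 qed
qed

end
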